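(* Let $\mathcal{H}$ be a quasitriangular Hopf algebra over $k$ with universal R-matrix $\mathcal{R}$, let $\mathcal{U}$ be a Hopf algebra containing $\mathcal{H}$ as a Hopf subalgebra, and let $\mathcal{L}$ be an $\mathcal{H}$-commutative module algebra. Let $\mathcal{F}=\mathcal{F}_1\otimes\mathcal{F}_2\otimes\mathcal{F}_3\in\mathcal{U}\otimes\mathcal{U}\otimes\mathcal{L}$ be a universal dynamical cocycle over the $\mathcal{H}$-base algebra $\mathcal{L}_-$ (that is, $\mathcal{L}$ with the coaction $\delta^-(\lambda)=\mathcal{R}_2\otimes\mathcal{R}_1\triangleright\lambda$). Then the element $$\Psi:=(\mathcal{F}_1\otimes\mathcal{F}_3\otimes\mathcal{R}_1)\otimes_{\mathcal{L}}(\mathcal{F}_2\mathcal{R}_2\otimes1\otimes1)\in\bigl(\mathcal{U}\otimes(\mathcal{L}_+\rtimes\mathcal{H})\bigr)\otimes_{\mathcal{L}}\bigl(\mathcal{U}\otimes(\mathcal{L}_+\rtimes\mathcal{H})\bigr)$$ is a twisting cocycle of the tensor product $\mathcal{L}$-bialgebroid $\mathcal{U}\otimes(\mathcal{L}_+\rtimes\mathcal{H})$.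
   Context: $k$ is a field of characteristic zero (or a ring of formal power series over such a field); algebras are associative unital $k$-algebras, $\otimes=\otimes_k$. Hopf algebras have invertible antipode $\gamma$. $\mathcal{R}=\mathcal{R}_1\otimes\mathcal{R}_2$ satisfies $(\Delta\otimes\mathrm{id})(\mathcal{R})=\mathcal{R}_{13}\mathcal{R}_{23}$, $(\mathrm{id}\otimes\Delta)(\mathcal{R})=\mathcal{R}_{13}\mathcal{R}_{12}$, $\mathcal{R}\Delta(h)=\Delta^{op}(h)\mathcal{R}$. A left $\mathcal{H}$-module algebra $\mathcal{L}$ is $\mathcal{H}$-commutative if $\lambda\mu=(\mathcal{R}_2\triangleright\mu)(\mathcal{R}_1\triangleright\lambda)$ for all $\lambda,\mu$. **Universal dynamical cocycle.** Let $\mathcal{L}$ carry an $\mathcal{H}$-coaction $\delta(\lambda)=\lambda^{(1)}\otimes\lambda^{[2]}\in\mathcal{H}\otimes\mathcal{L}$ (here $\delta=\delta^-$). A universal dynamical cocycle over $\mathcal{L}$ is an invertible element $\mathcal{F}\in\mathcal{U}\otimes\mathcal{U}\otimes\mathcal{L}$ such that - $h^{(1)}\mathcal{F}_1\otimes h^{(2)}\mathcal{F}_2\otimes h^{(3)}\triangleright\mathcal{F}_3=\mathcal{F}_1h^{(1)}\otimes\mathcal{F}_2h^{(2)}\otimes\mathcal{F}_3$ for all $h\in\mathcal{H}$; - $(\Delta\otimes\mathrm{id})(\mathcal{F})\,(\mathcal{F}_1\otimes\mathcal{F}_2\otimes\mathcal{F}_3^{(1)}\otimes\mathcal{F}_3^{[2]})=(\mathrm{id}\otimes\Delta\otimes\mathrm{id})(\mathcal{F})\,(1\otimes\mathcal{F})$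 in $\mathcal{U}\otimes\mathcal{U}\otimes\mathcal{U}\otimes\mathcal{L}$, where $(\Delta\otimes\mathrm{id})(\mathcal{F})=\mathcal{F}_1^{(1)}\otimes\mathcal{F}_1^{(2)}\otimes\mathcal{F}_2\otimes\mathcal{F}_3$; - $(\varepsilon\otimes\mathrm{id}\otimes\mathrm{id})(\mathcal{F})=1\otimes1=(\mathrm{id}\otimes\varepsilon\otimes\mathrm{id})(\mathcal{F})$ in $\mathcal{U}\otimes\mathcal{L}$. **Bialgebroids.** An $\mathcal{L}$-bialgebroid is an algebra $B$ with an algebra homomorphism $s:\mathcal{L}\to B$ and an algebra anti-homomorphism $t:\mathcal{L}\to B$ with commuting images, so that $B$ is an $\mathcal{L}$-bimodule by $\lambda\cdot a=s(\lambda)a$, $a\cdot\lambda=t(\lambda)a$ (so $t(\lambda)a\otimes_{\mathcal{L}}b=a\otimes_{\mathcal{L}}s(\lambda)b$); a coassociative bimodule map $\Delta:B\to B\otimes_{\mathcal{L}}B$ which is an algebra homomorphism into $\{z: z(t(\lambda)\otimes1)=z(1\otimes s(\lambda))\ \forall\lambda\}$; and a bimodule map $\varepsilon:B\to\mathcal{L}$ with $\varepsilon(1)=1$, $\varepsilon(a\,s(\varepsilon(b)))=\varepsilon(ab)=\varepsilon(a\,t(\varepsilon(b)))$ and the counit axioms with respect to $\Delta$. **The bialgebroid $\mathcal{U}\otimes(\mathcal{L}_+\rtimes\mathcal{H})$.** The algebra $\mathcal{L}\rtimes\mathcal{H}$ is the smash product, $(\lambda\otimes f)(\mu\otimes g)=\lambda(f^{(1)}\triangleright\mu)\otimes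 f^{(2)}g$, and $\mathcal{U}\otimes(\mathcal{L}_+\rtimes\mathcal{H})$ is the tensor product algebra with $s(\lambda)=1\otimes\lambda\otimes1$, $t(\lambda)=1\otimes\mathcal{R}_2\triangleright\lambda\otimes\mathcal{R}_1$, $\Delta(u\otimes\lambda\otimes h)=(u^{(1)}\otimes\lambda\otimes h^{(1)})\otimes_{\mathcal{L}}(u^{(2)}\otimes1\otimes h^{(2)})$, $\varepsilon(u\otimes\lambda\otimes h)=\varepsilon(u)\lambda\varepsilon(h)$. **Twisting cocycle.** An element $\Psi=\Psi_1\otimes_{\mathcal{L}}\Psi_2\in B\otimes_{\mathcal{L}}B$ is a twisting cocycle of the $\mathcal{L}$-bialgebroid $B$ if $\Delta(\Psi_1)\Psi\otimes_{\mathcal{L}}\Psi_2=\Psi_1\otimes_{\mathcal{L}}\Delta(\Psi_2)\Psi$ in $B\otimes_{\mathcal{L}}B\otimes_{\mathcal{L}}B$ and $(\varepsilon\otimes_{\mathcal{L}}\mathrm{id})(\Psi)=1=(\mathrm{id}\otimes_{\mathcal{L}}\varepsilon)(\Psi)$ in $B$. *)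

theory Defs
  imports "HOL-Algebra.Algebra" "HOL-Algebra.Free_Abelian_Groups"
begin

section \<open>The base ring and algebras over it\<close>

definition char_zero_field :: "'k ring \<Rightarrow> bool" where
  "char_zero_field F \<longleftrightarrow> field F \<and> (\<forall>n::nat. n > 0 \<longrightarrow> add_pow F n \<one>\<^bsub>F\<^esub> \<noteq> \<zero>\<^bsub>F\<^esub>)"

definition power_series_ring :: "'k ring \<Rightarrow> (nat \<Rightarrow> 'k) ring" where
  "power_series_ring F =
     \<lparr>carrier = {f. \<forall>n. f n \<in> carrier F},
      monoid.mult = (\<lambda>f g n. \<Oplus>\<^bsub>F\<^esub>i\<in>{..n}. f i \<otimes>\<^bsub>F\<^esub> g (n - i)),
      one = (\<lambda>n. if n = 0 then \<one>\<^bsub>F\<^esub> else \<zero>\<^bsub>F\<^esub>),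
      ring.zero = (\<lambda>n. \<zero>\<^bsub>F\<^esub>),
      add = (\<lambda>f g n. f n \<oplus>\<^bsub>F\<^esub> g n)\<rparr>"

text \<open>The coefficient field of a power series ring embeds into it as the constant series, so
  quantifying over fields with the same underlying type as \<open>K\<close> loses no generality.\<close>

definition base_ring :: "'k ring \<Rightarrow> bool" where
  "base_ring K \<longleftrightarrow> cring K \<and>
     (char_zero_field K \<or> (\<exists>F::'k ring. char_zero_field F \<and> K \<simeq> power_series_ring F))"

text \<open>The library locale \<open>algebra\<close> is about commutative algebras; here algebras are associative
  and unital.\<close>

definition assoc_algebra :: "'k ring \<Rightarrow> ('k, 'a, 'm) module_scheme \<Rightarrow> bool" where
  "assoc_algebra K A \<longleftrightarrow> module K A \<and> ring A \<and>
     (\<forall>c\<in>carrier K. \<forall>x\<in>carrier A. \<forall>y\<in>carrier A.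
        (c \<odot>\<^bsub>A\<^esub> x) \<otimes>\<^bsub>A\<^esub> y = c \<odot>\<^bsub>A\<^esub> (x \<otimes>\<^bsub>A\<^esub> y) \<and>
        x \<otimes>\<^bsub>A\<^esub> (c \<odot>\<^bsub>A\<^esub> y) = c \<odot>\<^bsub>A\<^esub> (x \<otimes>\<^bsub>A\<^esub> y))"

definition alg_hom ::
  "'k ring \<Rightarrow> ('k, 'a, 'm) module_scheme \<Rightarrow> ('k, 'b, 'n) module_scheme \<Rightarrow> ('a \<Rightarrow> 'b) set" where
  "alg_hom K A B = {f \<in> ring_hom A B.
     \<forall>c\<in>carrier K. \<forall>x\<in>carrier A. f (c \<odot>\<^bsub>A\<^esub> x) = c \<odot>\<^bsub>B\<^esub> f x}"

definition alg_antihom ::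
  "'k ring \<Rightarrow> ('k, 'a, 'm) module_scheme \<Rightarrow> ('k, 'b, 'n) module_scheme \<Rightarrow> ('a \<Rightarrow> 'b) set" where
  "alg_antihom K A B = {f \<in> carrier A \<rightarrow> carrier B.
     (\<forall>x\<in>carrier A. \<forall>y\<in>carrier A. f (x \<otimes>\<^bsub>A\<^esub> y) = f y \<otimes>\<^bsub>B\<^esub> f x \<and>
                                  f (x \<oplus>\<^bsub>A\<^esub> y) = f x \<oplus>\<^bsub>B\<^esub> f y) \<and>
     f \<one>\<^bsub>A\<^esub> = \<one>\<^bsub>B\<^esub> \<and>
     (\<forall>c\<in>carrier K. \<forall>x\<in>carrier A. f (c \<odot>\<^bsub>A\<^esub> x) = c \<odot>\<^bsub>B\<^esub> f x)}"


section \<open>Tensor products\<close>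

type_synonym ('a, 'b) tensor = "('a \<times> 'b \<Rightarrow>\<^sub>0 int) set"

text \<open>The tensor product of \<open>A\<close> (with right action \<open>ra\<close> of \<open>S\<close>) and \<open>B\<close> (with left action
  \<open>smult B\<close> of \<open>S\<close>) is the free abelian group on \<open>A \<times> B\<close> modulo biadditivity and the
  balancing relation \<open>(a \<cdot> s, b) ~ (a, s \<cdot> b)\<close>.\<close>

definition tensor_rels ::
  "'s set \<Rightarrow> ('a \<Rightarrow> 's \<Rightarrow> 'a) \<Rightarrow> ('s, 'a, 'm) module_scheme \<Rightarrow> ('s, 'b, 'n) module_scheme
     \<Rightarrow> ('a \<times> 'b \<Rightarrow>\<^sub>0 int) set" where
  "tensor_rels S ra A B =
     {frag_of (a \<oplus>\<^bsub>A\<^esub> a', b) - frag_of (a, b) - frag_of (a', b) | a a' b.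
        a \<in> carrier A \<and> a' \<in> carrier A \<and> b \<in> carrier B} \<union>
     {frag_of (a, b \<oplus>\<^bsub>B\<^esub> b') - frag_of (a, b) - frag_of (a, b') | a b b'.
        a \<in> carrier A \<and> b \<in> carrier B \<and> b' \<in> carrier B} \<union>
     {frag_of (ra a s, b) - frag_of (a, s \<odot>\<^bsub>B\<^esub> b) | a s b.
        a \<in> carrier A \<and> s \<in> S \<and> b \<in> carrier B}"

definition tensor_group ::
  "'s set \<Rightarrow> ('a \<Rightarrow> 's \<Rightarrow> 'a) \<Rightarrow> ('s, 'a, 'm) module_scheme \<Rightarrow> ('s, 'b, 'n) module_scheme
     \<Rightarrow> ('a, 'b) tensor monoid" where
  "tensor_group S ra A B =
     (let G = free_Abelian_group (carrier A \<times> carrier B)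
      in G Mod (generate G (tensor_rels S ra A B)))"

text \<open>\<open>tens T a b\<close> is the pure tensor \<open>a \<otimes> b\<close>, the unique class in \<open>T\<close> containing the generator
  \<open>(a, b)\<close>.\<close>

definition tens :: "(('a, 'b) tensor, 'm) partial_object_scheme \<Rightarrow> 'a \<Rightarrow> 'b \<Rightarrow> ('a, 'b) tensor"
  where "tens T a b = (THE z. z \<in> carrier T \<and> frag_of (a, b) \<in> z)"

text \<open>\<open>tlift G z \<phi>\<close> is the value at the tensor \<open>z\<close> of the additive map into the abelian group \<open>G\<close>
  sending \<open>a \<otimes> b\<close> to \<open>\<phi> a b\<close>, for \<open>\<phi>\<close> biadditive and balanced: every representative
  \<open>\<Sum> n\<^sub>i (a\<^sub>i, b\<^sub>i)\<close> of \<open>z\<close> yields \<open>\<Sum> n\<^sub>i \<phi> a\<^sub>i b\<^sub>i\<close>. An expression in Sweedler notation such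
  as \<open>\<phi> (z\<^sub>1, z\<^sub>2)\<close> is thus rendered \<open>tlift G z (\<lambda>x1 x2. \<phi> x1 x2)\<close>; sums over several tensors,
  or over the legs of an iterated tensor, are nested. The value is meaningful only for balanced
  \<open>\<phi>\<close>.\<close>

definition tlift :: "('c, 'm) ring_scheme \<Rightarrow> ('a, 'b) tensor \<Rightarrow> ('a \<Rightarrow> 'b \<Rightarrow> 'c) \<Rightarrow> 'c" where
  "tlift G z \<phi> = (THE c. \<forall>r\<in>z.
     c = (\<Oplus>\<^bsub>G\<^esub>p\<in>Poly_Mapping.keys r. add_pow G (Poly_Mapping.lookup r p) (\<phi> (fst p) (snd p))))"

text \<open>The multiplication below is the componentwise one, \<open>(a \<otimes> b)(a' \<otimes> b') = aa' \<otimes> bb'\<close>. Over a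
  commutative base it is defined everywhere. For the tensor square of a bialgebroid the product
  \<open>x y\<close> is meaningful when \<open>x\<close> lies in the Takeuchi product; to this end the sum over
  \<open>y = a' \<otimes> b'\<close> has to be the outer one, since right multiplication by a fixed pure
  representative is always balanced in \<open>x\<close>. The scalars act through the left factor.\<close>

definition tensor_product ::
  "'s set \<Rightarrow> ('a \<Rightarrow> 's \<Rightarrow> 'a) \<Rightarrow> ('s, 'a, 'm) module_scheme \<Rightarrow> ('s, 'b, 'n) module_scheme
     \<Rightarrow> ('s, ('a, 'b) tensor) module" where
  "tensor_product S ra A B =
     (let G = tensor_group S ra A B;
          T = \<lparr>carrier = carrier G, monoid.mult = undefined, one = tens G \<one>\<^bsub>A\<^esub> \<one>\<^bsub>B\<^esub>,
               ring.zero = \<one>\<^bsub>G\<^esub>, add = monoid.mult G\<rparr>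
      in \<lparr>carrier = carrier G,
          monoid.mult = (\<lambda>x y. tlift T y (\<lambda>a' b'. tlift T x (\<lambda>a b.
                    tens T (a \<otimes>\<^bsub>A\<^esub> a') (b \<otimes>\<^bsub>B\<^esub> b')))),
          one = tens G \<one>\<^bsub>A\<^esub> \<one>\<^bsub>B\<^esub>,
          ring.zero = \<one>\<^bsub>G\<^esub>,
          add = monoid.mult G,
          smult = (\<lambda>s x. tlift T x (\<lambda>a b. tens T (s \<odot>\<^bsub>A\<^esub> a) b))\<rparr>)"

abbreviation ktensor ::
  "'k ring \<Rightarrow> ('k, 'a, 'm) module_scheme \<Rightarrow> ('k, 'b, 'n) module_scheme
     \<Rightarrow> ('k, ('a, 'b) tensor) module" where
  "ktensor K A B \<equiv> tensor_product (carrier K) (\<lambda>a c. c \<odot>\<^bsub>A\<^esub> a) A B"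


section \<open>Quasitriangular Hopf algebras\<close>

text \<open>Iterated tensor products are always bracketed to the right, \<open>A \<otimes> (B \<otimes> C)\<close>.\<close>

record ('k, 'a) hopf = "('k, 'a) module" +
  comult :: "'a \<Rightarrow> ('a, 'a) tensor"
  counit :: "'a \<Rightarrow> 'k"
  antipode :: "'a \<Rightarrow> 'a"

definition hopf_algebra :: "'k ring \<Rightarrow> ('k, 'a) hopf \<Rightarrow> bool" where
  "hopf_algebra K H \<longleftrightarrow>
     (let HH = ktensor K H H; HHH = ktensor K H HH in
       assoc_algebra K H \<and>
       comult H \<in> alg_hom K H HH \<and>
       counit H \<in> ring_hom H K \<and>
       (\<forall>c\<in>carrier K. \<forall>h\<in>carrier H. counit H (c \<odot>\<^bsub>H\<^esub> h) = c \<otimes>\<^bsub>K\<^esub> counit H h) \<and>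
       (\<forall>h\<in>carrier H.
          tlift HHH (comult H h) (\<lambda>h1 h2. tlift HHH (comult H h1) (\<lambda>h11 h12.
            tens HHH h11 (tens HH h12 h2))) =
          tlift HHH (comult H h) (\<lambda>h1 h2. tens HHH h1 (comult H h2))) \<and>
       (\<forall>h\<in>carrier H.
          tlift H (comult H h) (\<lambda>h1 h2. counit H h1 \<odot>\<^bsub>H\<^esub> h2) = h \<and>
          tlift H (comult H h) (\<lambda>h1 h2. counit H h2 \<odot>\<^bsub>H\<^esub> h1) = h) \<and>
       bij_betw (antipode H) (carrier H) (carrier H) \<and>
       (\<forall>g\<in>carrier H. \<forall>h\<in>carrier H.
          antipode H (g \<oplus>\<^bsub>H\<^esub> h) = antipode H g \<oplus>\<^bsub>H\<^esub> antipode H h) \<and>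
       (\<forall>c\<in>carrier K. \<forall>h\<in>carrier H. antipode H (c \<odot>\<^bsub>H\<^esub> h) = c \<odot>\<^bsub>H\<^esub> antipode H h) \<and>
       (\<forall>h\<in>carrier H.
          tlift H (comult H h) (\<lambda>h1 h2. antipode H h1 \<otimes>\<^bsub>H\<^esub> h2) = counit H h \<odot>\<^bsub>H\<^esub> \<one>\<^bsub>H\<^esub> \<and>
          tlift H (comult H h) (\<lambda>h1 h2. h1 \<otimes>\<^bsub>H\<^esub> antipode H h2) = counit H h \<odot>\<^bsub>H\<^esub> \<one>\<^bsub>H\<^esub>))"

text \<open>\<open>H\<close> carries its own tensor square, so its comultiplication is compared with that of \<open>U\<close>
  along the canonical map \<open>H \<otimes> H \<rightarrow> U \<otimes> U\<close>.\<close>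

definition hopf_subalgebra :: "'k ring \<Rightarrow> ('k, 'a) hopf \<Rightarrow> ('k, 'a) hopf \<Rightarrow> bool" where
  "hopf_subalgebra K H U \<longleftrightarrow>
     (let UU = ktensor K U U in
       hopf_algebra K H \<and> hopf_algebra K U \<and>
       carrier H \<subseteq> carrier U \<and>
       (\<lambda>h. h) \<in> alg_hom K H U \<and>
       (\<forall>h\<in>carrier H.
          tlift UU (comult H h) (\<lambda>h1 h2. tens UU h1 h2) = comult U h \<and>
          counit H h = counit U h \<and>
          antipode H h = antipode U h))"

definition quasitriangular :: "'k ring \<Rightarrow> ('k, 'a) hopf \<Rightarrow> ('a, 'a) tensor \<Rightarrow> bool" where
  "quasitriangular K H R \<longleftrightarrow>
     (let HH = ktensor K H H; HHH = ktensor K H HH;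
          R12 = tlift HHH R (\<lambda>r1 r2. tens HHH r1 (tens HH r2 \<one>\<^bsub>H\<^esub>));
          R13 = tlift HHH R (\<lambda>r1 r2. tens HHH r1 (tens HH \<one>\<^bsub>H\<^esub> r2));
          R23 = tlift HHH R (\<lambda>r1 r2. tens HHH \<one>\<^bsub>H\<^esub> (tens HH r1 r2))
      in hopf_algebra K H \<and> R \<in> Units HH \<and>
         tlift HHH R (\<lambda>r1 r2. tlift HHH (comult H r1) (\<lambda>a b. tens HHH a (tens HH b r2))) =
           R13 \<otimes>\<^bsub>HHH\<^esub> R23 \<and>
         tlift HHH R (\<lambda>r1 r2. tens HHH r1 (comult H r2)) = R13 \<otimes>\<^bsub>HHH\<^esub> R12 \<and>
         (\<forall>h\<in>carrier H.
            R \<otimes>\<^bsub>HH\<^esub> comult H h = tlift HH (comult H h) (\<lambda>h1 h2. tens HH h2 h1) \<otimes>\<^bsub>HH\<^esub> R))"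


section \<open>Module algebras and universal dynamical cocycles\<close>

definition module_algebra ::
  "'k ring \<Rightarrow> ('k, 'a) hopf \<Rightarrow> ('a \<Rightarrow> 'l \<Rightarrow> 'l) \<Rightarrow> ('k, 'l) module \<Rightarrow> bool" where
  "module_algebra K H act L \<longleftrightarrow>
     assoc_algebra K L \<and>
     (\<forall>h\<in>carrier H. \<forall>l\<in>carrier L. act h l \<in> carrier L) \<and>
     (\<forall>g\<in>carrier H. \<forall>h\<in>carrier H. \<forall>l\<in>carrier L.
        act (g \<oplus>\<^bsub>H\<^esub> h) l = act g l \<oplus>\<^bsub>L\<^esub> act h l \<and>
        act (g \<otimes>\<^bsub>H\<^esub> h) l = act g (act h l)) \<and>
     (\<forall>l\<in>carrier L. act \<one>\<^bsub>H\<^esub> l = l) \<and>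
     (\<forall>c\<in>carrier K. \<forall>h\<in>carrier H. \<forall>l\<in>carrier L.
        act (c \<odot>\<^bsub>H\<^esub> h) l = c \<odot>\<^bsub>L\<^esub> act h l \<and> act h (c \<odot>\<^bsub>L\<^esub> l) = c \<odot>\<^bsub>L\<^esub> act h l) \<and>
     (\<forall>h\<in>carrier H. \<forall>l\<in>carrier L. \<forall>m\<in>carrier L.
        act h (l \<oplus>\<^bsub>L\<^esub> m) = act h l \<oplus>\<^bsub>L\<^esub> act h m \<and>
        act h (l \<otimes>\<^bsub>L\<^esub> m) = tlift L (comult H h) (\<lambda>h1 h2. act h1 l \<otimes>\<^bsub>L\<^esub> act h2 m)) \<and>
     (\<forall>h\<in>carrier H. act h \<one>\<^bsub>L\<^esub> = counit H h \<odot>\<^bsub>L\<^esub> \<one>\<^bsub>L\<^esub>)"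

definition H_commutative ::
  "('a, 'a) tensor \<Rightarrow> ('a \<Rightarrow> 'l \<Rightarrow> 'l) \<Rightarrow> ('k, 'l) module \<Rightarrow> bool" where
  "H_commutative R act L \<longleftrightarrow>
     (\<forall>l\<in>carrier L. \<forall>m\<in>carrier L.
        l \<otimes>\<^bsub>L\<^esub> m = tlift L R (\<lambda>r1 r2. act r2 m \<otimes>\<^bsub>L\<^esub> act r1 l))"

definition coaction_minus ::
  "'k ring \<Rightarrow> ('k, 'a) hopf \<Rightarrow> ('a, 'a) tensor \<Rightarrow> ('a \<Rightarrow> 'l \<Rightarrow> 'l) \<Rightarrow> ('k, 'l) module
     \<Rightarrow> 'l \<Rightarrow> ('a, 'l) tensor" where
  "coaction_minus K H R act L l =
     (let HL = ktensor K H L in tlift HL R (\<lambda>r1 r2. tens HL r2 (act r1 l)))"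

definition universal_dynamical_cocycle ::
  "'k ring \<Rightarrow> ('k, 'a) hopf \<Rightarrow> ('k, 'a) hopf \<Rightarrow> ('a \<Rightarrow> 'l \<Rightarrow> 'l) \<Rightarrow> ('k, 'l) module
     \<Rightarrow> ('l \<Rightarrow> ('a, 'l) tensor) \<Rightarrow> ('a, ('a, 'l) tensor) tensor \<Rightarrow> bool" where
  "universal_dynamical_cocycle K H U act L \<delta> F \<longleftrightarrow>
     (let UL = ktensor K U L; UUL = ktensor K U UL; UUUL = ktensor K U UUL in
       F \<in> Units UUL \<and>
       (\<forall>h\<in>carrier H.
          tlift UUL (comult H h) (\<lambda>h1 h'. tlift UUL (comult H h') (\<lambda>h2 h3.
            tlift UUL F (\<lambda>f1 g. tlift UUL g (\<lambda>f2 f3.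
              tens UUL (h1 \<otimes>\<^bsub>U\<^esub> f1) (tens UL (h2 \<otimes>\<^bsub>U\<^esub> f2) (act h3 f3)))))) =
          tlift UUL (comult H h) (\<lambda>h1 h2.
            tlift UUL F (\<lambda>f1 g. tlift UUL g (\<lambda>f2 f3.
              tens UUL (f1 \<otimes>\<^bsub>U\<^esub> h1) (tens UL (f2 \<otimes>\<^bsub>U\<^esub> h2) f3))))) \<and>
       tlift UUUL F (\<lambda>f1 g. tlift UUUL (comult U f1) (\<lambda>a b. tens UUUL a (tens UUL b g)))
         \<otimes>\<^bsub>UUUL\<^esub>
       tlift UUUL F (\<lambda>f1 g. tlift UUUL g (\<lambda>f2 f3. tlift UUUL (\<delta> f3) (\<lambda>h l.
         tens UUUL f1 (tens UUL f2 (tens UL h l))))) =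
       tlift UUUL F (\<lambda>f1 g. tlift UUUL g (\<lambda>f2 f3. tlift UUUL (comult U f2) (\<lambda>a b.
         tens UUUL f1 (tens UUL a (tens UL b f3)))))
         \<otimes>\<^bsub>UUUL\<^esub>
       tens UUUL \<one>\<^bsub>U\<^esub> F \<and>
       tlift UL F (\<lambda>f1 g. counit U f1 \<odot>\<^bsub>UL\<^esub> g) = \<one>\<^bsub>UL\<^esub> \<and>
       tlift UL F (\<lambda>f1 g. tlift UL g (\<lambda>f2 f3. tens UL f1 (counit U f2 \<odot>\<^bsub>L\<^esub> f3))) = \<one>\<^bsub>UL\<^esub>)"


section \<open>Bialgebroids and twisting cocycles\<close>

record ('k, 'l, 'b) bgd = "('k, 'b) module" +
  src :: "'l \<Rightarrow> 'b"
  tgt :: "'l \<Rightarrow> 'b"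
  bcomult :: "'b \<Rightarrow> ('b, 'b) tensor"
  bcounit :: "'b \<Rightarrow> 'l"

definition left_mod :: "('k, 'l, 'b) bgd \<Rightarrow> ('l, 'b) module" where
  "left_mod B = \<lparr>carrier = carrier B, monoid.mult = monoid.mult B, one = \<one>\<^bsub>B\<^esub>, ring.zero = \<zero>\<^bsub>B\<^esub>,
                 add = add B, smult = (\<lambda>l b. src B l \<otimes>\<^bsub>B\<^esub> b)\<rparr>"

text \<open>\<open>ltensor L B M\<close> is \<open>B \<otimes>\<^sub>L M\<close>, with \<open>t(l) a \<otimes> m = a \<otimes> l \<cdot> m\<close>, as a left \<open>L\<close>-module.\<close>

definition ltensor ::
  "('k, 'l) module \<Rightarrow> ('k, 'l, 'b) bgd \<Rightarrow> ('l, 'm) module \<Rightarrow> ('l, ('b, 'm) tensor) module" where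
  "ltensor L B M = tensor_product (carrier L) (\<lambda>a l. tgt B l \<otimes>\<^bsub>B\<^esub> a) (left_mod B) M"

abbreviation ltensor2 ::
  "('k, 'l) module \<Rightarrow> ('k, 'l, 'b) bgd \<Rightarrow> ('l, ('b, 'b) tensor) module" where
  "ltensor2 L B \<equiv> ltensor L B (left_mod B)"

abbreviation ltensor3 ::
  "('k, 'l) module \<Rightarrow> ('k, 'l, 'b) bgd \<Rightarrow> ('l, ('b, ('b, 'b) tensor) tensor) module" where
  "ltensor3 L B \<equiv> ltensor L B (ltensor2 L B)"

definition bialgebroid :: "'k ring \<Rightarrow> ('k, 'l) module \<Rightarrow> ('k, 'l, 'b) bgd \<Rightarrow> bool" where
  "bialgebroid K L B \<longleftrightarrow>
     (let s = src B; t = tgt B; BB = ltensor2 L B; BBB = ltensor3 L B in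
       assoc_algebra K L \<and> assoc_algebra K B \<and>
       s \<in> alg_hom K L B \<and> t \<in> alg_antihom K L B \<and>
       (\<forall>l\<in>carrier L. \<forall>m\<in>carrier L. s l \<otimes>\<^bsub>B\<^esub> t m = t m \<otimes>\<^bsub>B\<^esub> s l) \<and>
       bcomult B \<in> carrier B \<rightarrow> carrier BB \<and>
       (\<forall>a\<in>carrier B. \<forall>b\<in>carrier B.
          bcomult B (a \<oplus>\<^bsub>B\<^esub> b) = bcomult B a \<oplus>\<^bsub>BB\<^esub> bcomult B b) \<and>
       (\<forall>l\<in>carrier L. \<forall>a\<in>carrier B.
          bcomult B (s l \<otimes>\<^bsub>B\<^esub> a) =
            tlift BB (bcomult B a) (\<lambda>a1 a2. tens BB (s l \<otimes>\<^bsub>B\<^esub> a1) a2) \<and>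
          bcomult B (t l \<otimes>\<^bsub>B\<^esub> a) =
            tlift BB (bcomult B a) (\<lambda>a1 a2. tens BB a1 (t l \<otimes>\<^bsub>B\<^esub> a2))) \<and>
       (\<forall>a\<in>carrier B.
          tlift BBB (bcomult B a) (\<lambda>a1 a2. tlift BBB (bcomult B a1) (\<lambda>a11 a12.
            tens BBB a11 (tens BB a12 a2))) =
          tlift BBB (bcomult B a) (\<lambda>a1 a2. tens BBB a1 (bcomult B a2))) \<and>
       (\<forall>a\<in>carrier B. \<forall>l\<in>carrier L.
          tlift BB (bcomult B a) (\<lambda>a1 a2. tens BB (a1 \<otimes>\<^bsub>B\<^esub> t l) a2) =
          tlift BB (bcomult B a) (\<lambda>a1 a2. tens BB a1 (a2 \<otimes>\<^bsub>B\<^esub> s l))) \<and>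
       bcomult B \<one>\<^bsub>B\<^esub> = \<one>\<^bsub>BB\<^esub> \<and>
       (\<forall>a\<in>carrier B. \<forall>b\<in>carrier B.
          bcomult B (a \<otimes>\<^bsub>B\<^esub> b) = bcomult B a \<otimes>\<^bsub>BB\<^esub> bcomult B b) \<and>
       bcounit B \<in> carrier B \<rightarrow> carrier L \<and>
       (\<forall>a\<in>carrier B. \<forall>b\<in>carrier B.
          bcounit B (a \<oplus>\<^bsub>B\<^esub> b) = bcounit B a \<oplus>\<^bsub>L\<^esub> bcounit B b) \<and>
       (\<forall>l\<in>carrier L. \<forall>a\<in>carrier B.
          bcounit B (s l \<otimes>\<^bsub>B\<^esub> a) = l \<otimes>\<^bsub>L\<^esub> bcounit B a \<and>
          bcounit B (t l \<otimes>\<^bsub>B\<^esub> a) = bcounit B a \<otimes>\<^bsub>L\<^esub> l) \<and>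
       bcounit B \<one>\<^bsub>B\<^esub> = \<one>\<^bsub>L\<^esub> \<and>
       (\<forall>a\<in>carrier B. \<forall>b\<in>carrier B.
          bcounit B (a \<otimes>\<^bsub>B\<^esub> s (bcounit B b)) = bcounit B (a \<otimes>\<^bsub>B\<^esub> b) \<and>
          bcounit B (a \<otimes>\<^bsub>B\<^esub> t (bcounit B b)) = bcounit B (a \<otimes>\<^bsub>B\<^esub> b)) \<and>
       (\<forall>a\<in>carrier B.
          tlift B (bcomult B a) (\<lambda>a1 a2. s (bcounit B a1) \<otimes>\<^bsub>B\<^esub> a2) = a \<and>
          tlift B (bcomult B a) (\<lambda>a1 a2. t (bcounit B a2) \<otimes>\<^bsub>B\<^esub> a1) = a))"

text \<open>In the counit conditions \<open>L \<otimes>\<^sub>L B\<close> and \<open>B \<otimes>\<^sub>L L\<close> are identified with \<open>B\<close>, i.e.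
  \<open>l \<otimes> b\<close> with \<open>s(l) b\<close> and \<open>b \<otimes> l\<close> with \<open>t(l) b\<close>.\<close>

definition twisting_cocycle ::
  "'k ring \<Rightarrow> ('k, 'l) module \<Rightarrow> ('k, 'l, 'b) bgd \<Rightarrow> ('b, 'b) tensor \<Rightarrow> bool" where
  "twisting_cocycle K L B \<Psi> \<longleftrightarrow>
     (let BB = ltensor2 L B; BBB = ltensor3 L B in
       bialgebroid K L B \<and>
       \<Psi> \<in> carrier BB \<and>
       tlift BBB \<Psi> (\<lambda>p1 p2. tlift BBB (bcomult B p1 \<otimes>\<^bsub>BB\<^esub> \<Psi>) (\<lambda>q1 q2.
         tens BBB q1 (tens BB q2 p2))) =
       tlift BBB \<Psi> (\<lambda>p1 p2. tens BBB p1 (bcomult B p2 \<otimes>\<^bsub>BB\<^esub> \<Psi>)) \<and>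
       tlift B \<Psi> (\<lambda>p1 p2. src B (bcounit B p1) \<otimes>\<^bsub>B\<^esub> p2) = \<one>\<^bsub>B\<^esub> \<and>
       tlift B \<Psi> (\<lambda>p1 p2. tgt B (bcounit B p2) \<otimes>\<^bsub>B\<^esub> p1) = \<one>\<^bsub>B\<^esub>)"


section \<open>The bialgebroid \<open>U \<otimes> (L\<^sub>+ \<rtimes> H)\<close>\<close>

definition smash_product ::
  "'k ring \<Rightarrow> ('k, 'a) hopf \<Rightarrow> ('a \<Rightarrow> 'l \<Rightarrow> 'l) \<Rightarrow> ('k, 'l) module
     \<Rightarrow> ('k, ('l, 'a) tensor) module" where
  "smash_product K H act L =
     (let LH = ktensor K L H in
       LH \<lparr>monoid.mult := (\<lambda>x y. tlift LH x (\<lambda>l f. tlift LH y (\<lambda>m g. tlift LH (comult H f) (\<lambda>f1 f2.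
              tens LH (l \<otimes>\<^bsub>L\<^esub> act f1 m) (f2 \<otimes>\<^bsub>H\<^esub> g)))))\<rparr>)"

text \<open>The target of the comultiplication, \<open>B \<otimes>\<^sub>L B\<close>, depends only on the algebra structure, the
  source and the target map, which are therefore fixed first.\<close>

definition tensor_smash_bialgebroid ::
  "'k ring \<Rightarrow> ('k, 'a) hopf \<Rightarrow> ('a, 'a) tensor \<Rightarrow> ('k, 'a) hopf \<Rightarrow> ('a \<Rightarrow> 'l \<Rightarrow> 'l)
     \<Rightarrow> ('k, 'l) module \<Rightarrow> ('k, 'l, ('a, ('l, 'a) tensor) tensor) bgd" where
  "tensor_smash_bialgebroid K H R U act L =
     (let LH = smash_product K H act L;
          A = ktensor K U LH;
          B0 = module.extend A
                 \<lparr>src = (\<lambda>l. tens A \<one>\<^bsub>U\<^esub> (tens LH l \<one>\<^bsub>H\<^esub>)),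
                  tgt = (\<lambda>l. tlift A R (\<lambda>r1 r2. tens A \<one>\<^bsub>U\<^esub> (tens LH (act r2 l) r1))),
                  bcomult = undefined,
                  bcounit = undefined\<rparr>;
          BB = ltensor2 L B0
      in B0 \<lparr>bcomult := (\<lambda>b. tlift BB b (\<lambda>u x. tlift BB x (\<lambda>l h.
                 tlift BB (comult U u) (\<lambda>u1 u2. tlift BB (comult H h) (\<lambda>h1 h2.
                   tens BB (tens A u1 (tens LH l h1)) (tens A u2 (tens LH \<one>\<^bsub>L\<^esub> h2))))))),
             bcounit := (\<lambda>b. tlift L b (\<lambda>u x. tlift L x (\<lambda>l h.
                 counit U u \<odot>\<^bsub>L\<^esub> (counit H h \<odot>\<^bsub>L\<^esub> l))))\<rparr>)"

end

theory Submission
  imports Defs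
begin

text \<open>Both sides of the cocycle identity for \<open>\<Psi>\<close> are values of one six-linear map
  \<open>x \<otimes> y \<otimes> z \<otimes> \<lambda> \<otimes> p \<otimes> q \<mapsto> (x \<otimes> \<lambda> \<otimes> p) \<otimes>\<^sub>L (y \<otimes> 1 \<otimes> q) \<otimes>\<^sub>L (z \<otimes> 1 \<otimes> 1)\<close> on expressions in two
  copies of \<open>\<F>\<close> and several copies of \<open>\<R>\<close>. On the left, the product in the smash product lets
  \<open>\<R>\<^sub>1\<close> act on the inner \<open>\<F>\<^sub>3\<close>, and two applications of
  \<open>(\<Delta> \<otimes> id)(\<R>) = \<R>\<^sub>1\<^sub>3 \<R>\<^sub>2\<^sub>3\<close> turn this action into the coaction \<open>\<delta>\<^sup>-\<close>, so that the left-hand side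
  of the dynamical cocycle equation appears. On the right, the inner \<open>\<F>\<^sub>3\<close> is carried across
  \<open>\<otimes>\<^sub>L\<close> by the target map at the price of a further copy of \<open>\<R>\<close>; this copy is absorbed by
  \<open>(id \<otimes> \<Delta>)(\<R>) = \<R>\<^sub>1\<^sub>3 \<R>\<^sub>1\<^sub>2\<close>, equivariance of \<open>\<F>\<close> removes the action on \<open>\<F>\<^sub>3\<close>, and the
  right-hand side of the dynamical cocycle equation appears. The counit conditions
  reduce to \<open>(\<epsilon> \<otimes> id)(\<R>) = 1 = (id \<otimes> \<epsilon>)(\<R>)\<close> and the normalisation of \<open>\<F>\<close>.\<close>

section \<open>Tensor products of abelian groups over a set of scalars\<close>

text \<open>The obstacle is well-definedness. \<open>tlift\<close> denotes something only for
  balanced maps, and the nested sums of a Sweedler computation are balanced for reasons that have to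
  be argued each time. Computations are therefore carried out with finite sums over a fixed
  decomposition, which are additive and interchangeable unconditionally; \<open>tlift\<close> is
  converted on entry and restored at the end. Over the noncommutative \<open>L\<close> no
  decomposition is fixed: there a map is proved balanced once, and linear maps are compared on pure
  tensors. Axioms that are equations between tensors are used by applying an arbitrary multilinear
  map to both sides. A twisting cocycle presupposes a bialgebroid, so the bialgebroid axioms have to
  be established too. \<H>-commutativity and a hexagon identity make the target map multiply the
  \<open>L\<close>-leg from the right, hence commute with the source map, which multiplies it from
  the left. The relation \<R> \<Delta>(h) = \<open>\<Delta>\<^sup>o\<^sup>p\<close>(h) \<R> is
  exactly what puts the values of the comultiplication into the Takeuchi product, and this in turn
  gives a meaning to the product \<Delta>(a) \<Psi> in the cocycle equation.\<close>

definition frag_eval :: "('c, 'm) ring_scheme \<Rightarrow> ('a \<Rightarrow> 'b \<Rightarrow> 'c) \<Rightarrow> ('a \<times> 'b \<Rightarrow>\<^sub>0 int) \<Rightarrow> 'c" where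
  "frag_eval G \<phi> r =
     (\<Oplus>\<^bsub>G\<^esub>p\<in>Poly_Mapping.keys r. add_pow G (Poly_Mapping.lookup r p) (\<phi> (fst p) (snd p)))"

context abelian_group
begin

text \<open>Indices outside the support carry the coefficient 0 and contribute nothing; elements
  with different supports can thus be compared over a common index set.\<close>

lemma frag_eval_superset:
  assumes "finite Y" "Poly_Mapping.keys r \<subseteq> Y" "\<And>p. p \<in> Y \<Longrightarrow> \<phi> (fst p) (snd p) \<in> carrier G"
  shows "frag_eval G \<phi> r = (\<Oplus>p\<in>Y. add_pow G (Poly_Mapping.lookup r p) (\<phi> (fst p) (snd p)))"
  unfolding frag_eval_def
  by (rule add.finprod_mono_neutral_cong_left)
     (use assms in \<open>auto simp: in_keys_iff add_pow_def[of _ "0 :: int"]\<close>)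

lemma frag_eval_closed:
  assumes "\<And>p. p \<in> Poly_Mapping.keys r \<Longrightarrow> \<phi> (fst p) (snd p) \<in> carrier G"
  shows "frag_eval G \<phi> r \<in> carrier G"
  unfolding frag_eval_def using assms by (intro add.finprod_closed) auto

lemma frag_eval_frag_of:
  assumes "\<phi> a b \<in> carrier G"
  shows "frag_eval G \<phi> (frag_of (a, b)) = \<phi> a b"
  using assms add.finprod_singleton[of "(a,b)" "{(a,b)}" "\<lambda>p. \<phi> a b"]
  by (simp add: frag_eval_def)

text \<open>Coefficients may cancel, so the support of \<open>r + r'\<close> can be smaller than the
  union of the supports. All three sums are extended to that union.\<close>

lemma frag_eval_add:
  assumes "\<And>p. p \<in> Poly_Mapping.keys r \<union> Poly_Mapping.keys r' \<Longrightarrow> \<phi> (fst p) (snd p) \<in> carrier G"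
  shows "frag_eval G \<phi> (r + r') = frag_eval G \<phi> r \<oplus> frag_eval G \<phi> r'"
proof -
  let ?Y = "Poly_Mapping.keys r \<union> Poly_Mapping.keys r'"
  have Y: "finite ?Y" by simp
  have "frag_eval G \<phi> (r + r') =
     (\<Oplus>p\<in>?Y. add_pow G (Poly_Mapping.lookup (r + r') p) (\<phi> (fst p) (snd p)))"
    by (rule frag_eval_superset) (use assms keys_add[of r r'] in auto)
  also have "\<dots> = (\<Oplus>p\<in>?Y. add_pow G (Poly_Mapping.lookup r p) (\<phi> (fst p) (snd p)) \<oplus>
                     add_pow G (Poly_Mapping.lookup r' p) (\<phi> (fst p) (snd p)))"
    by (rule add.finprod_cong')
       (use assms in \<open>auto simp: lookup_add add.int_pow_mult\<close>)
  also have "\<dots> = (\<Oplus>p\<in>?Y. add_pow G (Poly_Mapping.lookup r p) (\<phi> (fst p) (snd p))) \<oplus>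
                 (\<Oplus>p\<in>?Y. add_pow G (Poly_Mapping.lookup r' p) (\<phi> (fst p) (snd p)))"
    by (rule add.finprod_multf) (use assms in auto)
  also have "\<dots> = frag_eval G \<phi> r \<oplus> frag_eval G \<phi> r'"
    using frag_eval_superset[OF Y, of r \<phi>] frag_eval_superset[OF Y, of r' \<phi>] assms by simp
  finally show ?thesis .
qed

lemma frag_eval_zero: "frag_eval G \<phi> 0 = \<zero>"
  by (simp add: frag_eval_def)

lemma frag_eval_minus:
  assumes "\<And>p. p \<in> Poly_Mapping.keys r \<Longrightarrow> \<phi> (fst p) (snd p) \<in> carrier G"
  shows "frag_eval G \<phi> (- r) = \<ominus> frag_eval G \<phi> r"
proof -
  have "frag_eval G \<phi> (- r + r) = frag_eval G \<phi> (- r) \<oplus> frag_eval G \<phi> r"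
    by (rule frag_eval_add) (use assms in auto)
  then show ?thesis
    using frag_eval_closed[of r \<phi>] frag_eval_closed[of "- r" \<phi>] assms
    by (simp add: frag_eval_zero minus_equality)
qed

lemma frag_eval_diff:
  assumes "\<And>p. p \<in> Poly_Mapping.keys r \<union> Poly_Mapping.keys r' \<Longrightarrow> \<phi> (fst p) (snd p) \<in> carrier G"
  shows "frag_eval G \<phi> (r - r') = frag_eval G \<phi> r \<ominus> frag_eval G \<phi> r'"
proof -
  have "frag_eval G \<phi> (r + - r') = frag_eval G \<phi> r \<oplus> frag_eval G \<phi> (- r')"
    by (rule frag_eval_add) (use assms in auto)
  then show ?thesis using assms by (simp add: frag_eval_minus a_minus_def)
qed

end

text \<open>The three equational clauses mirror the three families of generators in
  \<open>tensor_rels\<close>; with the closure clause they are what makes the evaluation on the free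
  group vanish on the relations.\<close>

definition balanced ::
  "'s set \<Rightarrow> ('a \<Rightarrow> 's \<Rightarrow> 'a) \<Rightarrow> ('s, 'a, 'm) module_scheme \<Rightarrow> ('s, 'b, 'n) module_scheme
     \<Rightarrow> ('c, 'p) ring_scheme \<Rightarrow> ('a \<Rightarrow> 'b \<Rightarrow> 'c) \<Rightarrow> bool" where
  "balanced S ra A B G \<phi> \<longleftrightarrow>
     (\<forall>a\<in>carrier A. \<forall>b\<in>carrier B. \<phi> a b \<in> carrier G) \<and>
     (\<forall>a\<in>carrier A. \<forall>a'\<in>carrier A. \<forall>b\<in>carrier B. \<phi> (a \<oplus>\<^bsub>A\<^esub> a') b = \<phi> a b \<oplus>\<^bsub>G\<^esub> \<phi> a' b) \<and>
     (\<forall>a\<in>carrier A. \<forall>b\<in>carrier B. \<forall>b'\<in>carrier B. \<phi> a (b \<oplus>\<^bsub>B\<^esub> b') = \<phi> a b \<oplus>\<^bsub>G\<^esub> \<phi> a b') \<and>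
     (\<forall>a\<in>carrier A. \<forall>s\<in>S. \<forall>b\<in>carrier B. \<phi> (ra a s) b = \<phi> a (s \<odot>\<^bsub>B\<^esub> b))"

text \<open>Only closure of the two actions is assumed, no module axioms, so that \<open>S\<close>
  may be the carrier of the noncommutative \<open>L\<close> as well as that of
  \<open>K\<close>.\<close>

locale tensor_pair =
  fixes S :: "'s set" and ra :: "'a \<Rightarrow> 's \<Rightarrow> 'a"
    and A :: "('s, 'a, 'm) module_scheme" and B :: "('s, 'b, 'n) module_scheme"
  assumes abelian_A: "abelian_group A" and abelian_B: "abelian_group B"
    and ra_closed: "\<And>a s. a \<in> carrier A \<Longrightarrow> s \<in> S \<Longrightarrow> ra a s \<in> carrier A"
    and sm_closed: "\<And>b s. b \<in> carrier B \<Longrightarrow> s \<in> S \<Longrightarrow> s \<odot>\<^bsub>B\<^esub> b \<in> carrier B"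
begin

sublocale A: abelian_group A by (rule abelian_A)
sublocale B: abelian_group B by (rule abelian_B)

abbreviation "F \<equiv> free_Abelian_group (carrier A \<times> carrier B)"
abbreviation "N \<equiv> generate F (tensor_rels S ra A B)"
abbreviation "T \<equiv> tensor_product S ra A B"

sublocale F: comm_group F by (rule abelian_free_Abelian_group)

lemma F_diff: "x \<in> carrier F \<Longrightarrow> y \<in> carrier F \<Longrightarrow> x - y \<in> carrier F"
  using keys_diff[of x y] by auto

lemma rels_subset: "tensor_rels S ra A B \<subseteq> carrier F"
  unfolding tensor_rels_def
  by (intro Un_least subsetI; clarsimp simp del: carrier_free_Abelian_group_iff)
     (auto intro!: F_diff simp: ra_closed sm_closed simp del: carrier_free_Abelian_group_iff)

lemma N_normal: "N \<lhd> F"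
  using F.generate_is_subgroup[OF rels_subset] F.normal_iff_subgroup by blast

lemma N_subgroup: "subgroup N F"
  using F.generate_is_subgroup[OF rels_subset] .

lemma tensor_group_eq: "tensor_group S ra A B = F Mod N"
  by (simp add: tensor_group_def Let_def)

lemma T_carrier: "carrier T = rcosets\<^bsub>F\<^esub> N"
  by (simp add: tensor_product_def tensor_group_eq Let_def FactGroup_def)

lemma T_add: "x \<oplus>\<^bsub>T\<^esub> y = x <#>\<^bsub>F\<^esub> y"
  by (simp add: tensor_product_def tensor_group_eq Let_def FactGroup_def)

lemma T_zero: "\<zero>\<^bsub>T\<^esub> = N"
  by (simp add: tensor_product_def tensor_group_eq Let_def FactGroup_def)

abbreviation cl :: "('a \<times> 'b \<Rightarrow>\<^sub>0 int) \<Rightarrow> ('a, 'b) tensor" where "cl r \<equiv> N #>\<^bsub>F\<^esub> r"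

lemma cl_in_T: "r \<in> carrier F \<Longrightarrow> cl r \<in> carrier T"
  unfolding T_carrier by (rule F.rcosetsI) (use N_subgroup subgroup.subset in blast)

lemma T_cases: "z \<in> carrier T \<Longrightarrow> (\<And>r. r \<in> carrier F \<Longrightarrow> z = cl r \<Longrightarrow> P) \<Longrightarrow> P"
  unfolding T_carrier RCOSETS_def by blast

lemma cl_add: "r \<in> carrier F \<Longrightarrow> r' \<in> carrier F \<Longrightarrow> cl r \<oplus>\<^bsub>T\<^esub> cl r' = cl (r + r')"
  unfolding T_add using normal.rcos_sum[OF N_normal, of r r'] by simp

lemma cl_eqI:
  assumes "r \<in> carrier F" "r' \<in> carrier F" "r - r' \<in> N"
  shows "cl r = cl r'"
proof -
  have "r \<in> cl r'"
    using assms by (auto simp: r_coset_def intro!: bexI[of _ "r - r'"])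
  then show ?thesis
    using F.repr_independence[OF _ assms(2) N_subgroup] by metis
qed

lemma in_cl: "r \<in> carrier F \<Longrightarrow> r \<in> cl r"
  using F.rcos_self[OF _ N_subgroup] .

lemma in_cl_eq: "r' \<in> cl r \<Longrightarrow> r \<in> carrier F \<Longrightarrow> cl r' = cl r"
  using F.repr_independence[OF _ _ N_subgroup] by metis

lemma tens_eq:
  assumes "a \<in> carrier A" "b \<in> carrier B"
  shows "tens T a b = cl (frag_of (a, b))"
  unfolding tens_def
proof (rule the_equality)
  show "cl (frag_of (a, b)) \<in> carrier T \<and> frag_of (a, b) \<in> cl (frag_of (a, b))"
    using assms by (auto intro!: cl_in_T in_cl)
next
  fix z assume z: "z \<in> carrier T \<and> frag_of (a, b) \<in> z"
  then obtain r where "r \<in> carrier F" "z = cl r" using T_cases by blast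
  then show "z = cl (frag_of (a, b))" using z in_cl_eq by metis
qed

lemma T_comm_group: "comm_group (add_monoid T)"
proof -
  have 1: "group (F Mod N)" by (rule normal.factorgroup_is_group[OF N_normal])
  have g: "comm_group (F Mod N)"
    by (rule F.abelian_FactGroup[OF N_subgroup])
  have e: "carrier (F Mod N) = carrier T" "monoid.mult (F Mod N) = add T" "\<one>\<^bsub>F Mod N\<^esub> = \<zero>\<^bsub>T\<^esub>"
    by (simp_all add: tensor_product_def tensor_group_eq Let_def)
  interpret q: comm_group "F Mod N" by (rule g)
  show ?thesis
    by (rule comm_groupI)
       (use q.m_closed q.m_assoc q.m_comm q.l_one q.one_closed q.l_inv_ex e in \<open>auto\<close>)
qed

lemma T_abelian: "abelian_group T"
  using T_comm_group by (simp add: abelian_group_def abelian_monoid_def abelian_group_axioms_def comm_group.axioms)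

sublocale T: abelian_group T by (rule T_abelian)

lemma N_incl: "r \<in> tensor_rels S ra A B \<Longrightarrow> r \<in> N"
  by (rule generate.incl)

lemma tens_closed: "a \<in> carrier A \<Longrightarrow> b \<in> carrier B \<Longrightarrow> tens T a b \<in> carrier T"
  by (simp add: tens_eq cl_in_T)

lemma tens_add_left:
  assumes "a \<in> carrier A" "a' \<in> carrier A" "b \<in> carrier B"
  shows "tens T (a \<oplus>\<^bsub>A\<^esub> a') b = tens T a b \<oplus>\<^bsub>T\<^esub> tens T a' b"
proof -
  have "frag_of (a \<oplus>\<^bsub>A\<^esub> a', b) - (frag_of (a, b) + frag_of (a', b)) \<in> N"
    by (rule N_incl) (use assms in \<open>auto simp: tensor_rels_def diff_diff_add[symmetric]\<close>)
  then show ?thesis using assms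
    by (simp add: tens_eq cl_add del: mult_free_Abelian_group)
       (rule cl_eqI, auto dest: subsetD[OF keys_add])
qed

lemma tens_add_right:
  assumes "a \<in> carrier A" "b' \<in> carrier B" "b \<in> carrier B"
  shows "tens T a (b \<oplus>\<^bsub>B\<^esub> b') = tens T a b \<oplus>\<^bsub>T\<^esub> tens T a b'"
proof -
  have "frag_of (a, b \<oplus>\<^bsub>B\<^esub> b') - (frag_of (a, b) + frag_of (a, b')) \<in> N"
    by (rule N_incl) (use assms in \<open>auto simp: tensor_rels_def diff_diff_add[symmetric]\<close>)
  then show ?thesis using assms
    by (simp add: tens_eq cl_add del: mult_free_Abelian_group)
       (rule cl_eqI, auto dest: subsetD[OF keys_add])
qed

lemma tens_balanced:
  assumes "a \<in> carrier A" "s \<in> S" "b \<in> carrier B"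
  shows "tens T (ra a s) b = tens T a (s \<odot>\<^bsub>B\<^esub> b)"
proof -
  have "frag_of (ra a s, b) - frag_of (a, s \<odot>\<^bsub>B\<^esub> b) \<in> N"
    by (rule N_incl) (use assms in \<open>auto simp: tensor_rels_def\<close>)
  then show ?thesis using assms
    by (simp add: tens_eq ra_closed sm_closed)
       (rule cl_eqI, auto simp: ra_closed sm_closed)
qed

context
  fixes G :: "('c, 'p) ring_scheme" and \<phi> :: "'a \<Rightarrow> 'b \<Rightarrow> 'c"
  assumes G: "abelian_group G" and bal: "balanced S ra A B G \<phi>"
begin

interpretation G: abelian_group G by (rule G)

lemma \<phi>_closed: "p \<in> carrier A \<times> carrier B \<Longrightarrow> \<phi> (fst p) (snd p) \<in> carrier G"
  using bal by (auto simp: balanced_def)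

lemma frag_eval_hom: "frag_eval G \<phi> \<in> hom F (add_monoid G)"
  by (rule homI) (auto intro!: G.frag_eval_closed G.frag_eval_add \<phi>_closed simp: subset_iff)

lemma frag_eval_rels:
  assumes "r \<in> tensor_rels S ra A B"
  shows "frag_eval G \<phi> r = \<zero>\<^bsub>G\<^esub>"
proof -
  have cl: "\<phi> a b \<in> carrier G" if "a \<in> carrier A" "b \<in> carrier B" for a b
    using bal that by (auto simp: balanced_def)
  have e: "frag_eval G \<phi> (frag_of (a, b)) = \<phi> a b" if "a \<in> carrier A" "b \<in> carrier B" for a b
    using cl that by (simp add: G.frag_eval_frag_of)
  have d: "frag_eval G \<phi> (x - y) = frag_eval G \<phi> x \<ominus>\<^bsub>G\<^esub> frag_eval G \<phi> y"
    if "x \<in> carrier F" "y \<in> carrier F" for x y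
    by (rule G.frag_eval_diff) (use that \<phi>_closed in \<open>auto simp: subset_iff\<close>)
  have m: "x - y \<in> carrier F" if "x \<in> carrier F" "y \<in> carrier F" for x y
    using that keys_diff[of x y] by auto
  have g: "x \<oplus>\<^bsub>G\<^esub> y \<ominus>\<^bsub>G\<^esub> x \<ominus>\<^bsub>G\<^esub> y = \<zero>\<^bsub>G\<^esub>" "x \<ominus>\<^bsub>G\<^esub> x = \<zero>\<^bsub>G\<^esub>" if "x \<in> carrier G" "y \<in> carrier G" for x y
  proof -
    have "x \<oplus>\<^bsub>G\<^esub> y \<ominus>\<^bsub>G\<^esub> x = y" using that by (metis G.add.inv_closed G.a_assoc G.a_comm G.r_neg1 a_minus_def)
    then show "x \<oplus>\<^bsub>G\<^esub> y \<ominus>\<^bsub>G\<^esub> x \<ominus>\<^bsub>G\<^esub> y = \<zero>\<^bsub>G\<^esub>" "x \<ominus>\<^bsub>G\<^esub> x = \<zero>\<^bsub>G\<^esub>"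
      using that by (simp_all add: a_minus_def G.r_neg)
  qed
  show ?thesis
    using assms bal unfolding tensor_rels_def
    by (auto simp: d e m cl g balanced_def ra_closed sm_closed simp del: carrier_free_Abelian_group_iff
        intro!: g(2) cl)
qed

text \<open>The kernel of the evaluation homomorphism is a subgroup containing the relations, hence
  contains the subgroup they generate.\<close>

lemma frag_eval_N:
  assumes "r \<in> N"
  shows "frag_eval G \<phi> r = \<zero>\<^bsub>G\<^esub>"
proof -
  interpret h: group_hom F "add_monoid G" "frag_eval G \<phi>"
    using frag_eval_hom by (simp add: group_hom_def group_hom_axioms_def G.a_group)
  have "N \<subseteq> kernel F (add_monoid G) (frag_eval G \<phi>)"
  proof (rule F.generate_subgroup_incl)
    show "tensor_rels S ra A B \<subseteq> kernel F (add_monoid G) (frag_eval G \<phi>)"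
      using rels_subset frag_eval_rels by (force simp: kernel_def)
  qed (rule h.subgroup_kernel)
  then show ?thesis using assms by (auto simp: kernel_def)
qed

lemma frag_eval_cl:
  assumes "r \<in> carrier F" "r' \<in> cl r"
  shows "frag_eval G \<phi> r' = frag_eval G \<phi> r"
proof -
  obtain n where n: "n \<in> N" "r' = n + r" using assms(2) by (auto simp: r_coset_def)
  have "n \<in> carrier F" using n N_subgroup subgroup.subset by blast
  then have "frag_eval G \<phi> r' = frag_eval G \<phi> n \<oplus>\<^bsub>G\<^esub> frag_eval G \<phi> r"
    unfolding n using assms(1) by (intro G.frag_eval_add) (use \<phi>_closed in auto)
  then show ?thesis
    using frag_eval_N[OF n(1)] G.frag_eval_closed[of r \<phi>] assms(1) \<phi>_closed by (auto simp: subset_iff)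
qed

text \<open>All representatives of the class give the same value and the class is nonempty, so the
  definite description in \<open>tlift\<close> has exactly one solution.\<close>

lemma tlift_cl:
  assumes "r \<in> carrier F"
  shows "tlift G (cl r) \<phi> = frag_eval G \<phi> r"
  unfolding tlift_def frag_eval_def[symmetric]
proof (rule the_equality)
  show "\<forall>ra\<in>cl r. frag_eval G \<phi> r = frag_eval G \<phi> ra"
    using frag_eval_cl[OF assms] by simp
next
  fix c assume "\<forall>ra\<in>cl r. c = frag_eval G \<phi> ra"
  then show "c = frag_eval G \<phi> r" using in_cl[OF assms] by blast
qed

lemma tlift_tens:
  assumes "a \<in> carrier A" "b \<in> carrier B"
  shows "tlift G (tens T a b) \<phi> = \<phi> a b"
  using assms \<phi>_closed[of "(a, b)"] by (simp add: tens_eq tlift_cl G.frag_eval_frag_of)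

lemma tlift_closed:
  assumes "z \<in> carrier T"
  shows "tlift G z \<phi> \<in> carrier G"
  using assms by (auto elim!: T_cases simp: tlift_cl subset_iff intro!: G.frag_eval_closed \<phi>_closed)

lemma tlift_add:
  assumes "z \<in> carrier T" "w \<in> carrier T"
  shows "tlift G (z \<oplus>\<^bsub>T\<^esub> w) \<phi> = tlift G z \<phi> \<oplus>\<^bsub>G\<^esub> tlift G w \<phi>"
proof -
  obtain r where r: "r \<in> carrier F" "z = cl r" using assms(1) T_cases by blast
  obtain r' where r': "r' \<in> carrier F" "w = cl r'" using assms(2) T_cases by blast
  have "r + r' \<in> carrier F" using r r' F.m_closed[of r r'] by simp
  then show ?thesis
    using r r' by (simp add: cl_add tlift_cl del: carrier_free_Abelian_group_iff)
       (rule G.frag_eval_add, auto intro!: \<phi>_closed)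
qed

end

text \<open>Representatives are integer combinations, yet no clause for negatives is required: the
  sign is absorbed by the left factor, -(a \<otimes> b) = (-a) \<otimes> b, and zero is 0 \<otimes>
  0.\<close>

lemma tensor_induct [consumes 1, case_names tens add]:
  assumes z: "z \<in> carrier T"
    and t: "\<And>a b. a \<in> carrier A \<Longrightarrow> b \<in> carrier B \<Longrightarrow> P (tens T a b)"
    and s: "\<And>x y. x \<in> carrier T \<Longrightarrow> y \<in> carrier T \<Longrightarrow> P x \<Longrightarrow> P y \<Longrightarrow> P (x \<oplus>\<^bsub>T\<^esub> y)"
  shows "P z"
proof -
  have tz: "tens T \<zero>\<^bsub>A\<^esub> b = \<zero>\<^bsub>T\<^esub>" if "b \<in> carrier B" for b
    using tens_add_left[of "\<zero>\<^bsub>A\<^esub>" "\<zero>\<^bsub>A\<^esub>" b] that tens_closed[of "\<zero>\<^bsub>A\<^esub>" b] by simp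
  have tn: "tens T (\<ominus>\<^bsub>A\<^esub> a) b = \<ominus>\<^bsub>T\<^esub> tens T a b" if "a \<in> carrier A" "b \<in> carrier B" for a b
    using tens_add_left[of "\<ominus>\<^bsub>A\<^esub> a" a b] that tens_closed tz
    by (simp add: A.l_neg T.minus_equality)
  have P0: "P \<zero>\<^bsub>T\<^esub>" using t[of "\<zero>\<^bsub>A\<^esub>" "\<zero>\<^bsub>B\<^esub>"] by (simp add: tz)
  have c0: "cl 0 = \<zero>\<^bsub>T\<^esub>" using F.coset_mult_one[of N] N_subgroup subgroup.subset
    unfolding T_zero by (metis one_free_Abelian_group)
  have cm: "cl (- r) = \<ominus>\<^bsub>T\<^esub> cl r" if "r \<in> carrier F" for r
    using cl_add[of "-r" r] that cl_in_T c0
    by (simp add: T.minus_equality)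
  \<comment> \<open>Induction on the free abelian group proceeds through differences, while
    \<open>P\<close> is only known to be stable under sums; the claim is therefore strengthened to
    include the negative.\<close>
  have "P (cl r) \<and> P (\<ominus>\<^bsub>T\<^esub> cl r)" if "Poly_Mapping.keys r \<subseteq> carrier A \<times> carrier B" for r
    using that
  proof (induction r rule: free_Abelian_group_induct[consumes 1, case_names 1 2 3])
    case 1
    show ?case using T.add.inv_one P0 by (simp add: c0 a_inv_def del: T.add.inv_one)
  next
    case (2 x y)
    have m: "- y \<in> carrier F" "- x \<in> carrier F" using 2 by auto
    have e1: "cl (x - y) = cl x \<oplus>\<^bsub>T\<^esub> (\<ominus>\<^bsub>T\<^esub> cl y)"
      using cl_add[of x "- y"] cm[of y] 2 by simp
    have e2: "\<ominus>\<^bsub>T\<^esub> cl (x - y) = (\<ominus>\<^bsub>T\<^esub> cl x) \<oplus>\<^bsub>T\<^esub> cl y"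
      using cl_in_T[of x] cl_in_T[of y] 2 by (simp add: e1 T.minus_add)
    show ?case unfolding e2 unfolding e1 using 2 cl_in_T by (auto intro!: s)
  next
    case (3 a)
    then obtain a1 b1 where a: "a = (a1, b1)" "a1 \<in> carrier A" "b1 \<in> carrier B" by auto
    show ?case using t[of a1 b1] t[of "\<ominus>\<^bsub>A\<^esub> a1" b1] a
      by (simp add: tn) (simp add: tens_eq)
  qed
  then show ?thesis using T_cases[OF z] by force
qed

end

section \<open>Linear maps and Sweedler sums\<close>

definition lin :: "'k ring \<Rightarrow> ('k, 'a, 'm) module_scheme \<Rightarrow> ('k, 'b, 'n) module_scheme \<Rightarrow> ('a \<Rightarrow> 'b) \<Rightarrow> bool"
  where "lin K A G f \<longleftrightarrow> (\<forall>x\<in>carrier A. f x \<in> carrier G) \<and>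
    (\<forall>x\<in>carrier A. \<forall>y\<in>carrier A. f (x \<oplus>\<^bsub>A\<^esub> y) = f x \<oplus>\<^bsub>G\<^esub> f y) \<and>
    (\<forall>c\<in>carrier K. \<forall>x\<in>carrier A. f (c \<odot>\<^bsub>A\<^esub> x) = c \<odot>\<^bsub>G\<^esub> f x)"

definition bilin :: "'k ring \<Rightarrow> ('k, 'a, 'm) module_scheme \<Rightarrow> ('k, 'b, 'n) module_scheme
    \<Rightarrow> ('k, 'c, 'p) module_scheme \<Rightarrow> ('a \<Rightarrow> 'b \<Rightarrow> 'c) \<Rightarrow> bool"
  where "bilin K A B G \<phi> \<longleftrightarrow> (\<forall>a\<in>carrier A. lin K B G (\<phi> a)) \<and> (\<forall>b\<in>carrier B. lin K A G (\<lambda>a. \<phi> a b))"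

lemma linI:
  assumes "\<And>x. x \<in> carrier A \<Longrightarrow> f x \<in> carrier G"
    "\<And>x y. x \<in> carrier A \<Longrightarrow> y \<in> carrier A \<Longrightarrow> f (x \<oplus>\<^bsub>A\<^esub> y) = f x \<oplus>\<^bsub>G\<^esub> f y"
    "\<And>c x. c \<in> carrier K \<Longrightarrow> x \<in> carrier A \<Longrightarrow> f (c \<odot>\<^bsub>A\<^esub> x) = c \<odot>\<^bsub>G\<^esub> f x"
  shows "lin K A G f"
  using assms by (simp add: lin_def)

lemma linD:
  assumes "lin K A G f"
  shows "x \<in> carrier A \<Longrightarrow> f x \<in> carrier G"
    "x \<in> carrier A \<Longrightarrow> y \<in> carrier A \<Longrightarrow> f (x \<oplus>\<^bsub>A\<^esub> y) = f x \<oplus>\<^bsub>G\<^esub> f y"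
    "c \<in> carrier K \<Longrightarrow> x \<in> carrier A \<Longrightarrow> f (c \<odot>\<^bsub>A\<^esub> x) = c \<odot>\<^bsub>G\<^esub> f x"
  using assms by (simp_all add: lin_def)

lemma lin_ident: "lin K A A (\<lambda>x. x)"
  by (simp add: lin_def)

text \<open>The module hypothesis on \<open>A\<close> keeps sums and multiples inside the carrier,
  so agreement there is enough. This is how linearity passes from \<open>sw\<close> to
  \<open>tlift\<close>.\<close>

lemma lin_cong:
  assumes "module K A" "\<And>x. x \<in> carrier A \<Longrightarrow> f x = g x"
  shows "lin K A G f = lin K A G g"
proof -
  interpret module K A by (rule assms)
  show ?thesis using assms(2) unfolding lin_def by simp
qed

lemma lin_comp: "lin K A G f \<Longrightarrow> lin K Y A g \<Longrightarrow> lin K Y G (\<lambda>x. f (g x))"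
  by (simp add: lin_def)

lemma bilinI:
  assumes "\<And>a. a \<in> carrier A \<Longrightarrow> lin K B G (\<lambda>b. \<phi> a b)" "\<And>b. b \<in> carrier B \<Longrightarrow> lin K A G (\<lambda>a. \<phi> a b)"
  shows "bilin K A B G \<phi>"
  using assms by (simp add: bilin_def)

lemma bilinD:
  assumes "bilin K A B G \<phi>"
  shows "a \<in> carrier A \<Longrightarrow> lin K B G (\<phi> a)" "b \<in> carrier B \<Longrightarrow> lin K A G (\<lambda>a. \<phi> a b)"
   "a \<in> carrier A \<Longrightarrow> b \<in> carrier B \<Longrightarrow> \<phi> a b \<in> carrier G"
  using assms by (simp_all add: bilin_def lin_def)

lemma bilin_comp_l: "bilin K A B G \<phi> \<Longrightarrow> lin K Y A f \<Longrightarrow> b \<in> carrier B \<Longrightarrow> lin K Y G (\<lambda>x. \<phi> (f x) b)"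
  by (simp add: bilin_def lin_def)

lemma bilin_comp_r: "bilin K A B G \<phi> \<Longrightarrow> lin K Y B f \<Longrightarrow> a \<in> carrier A \<Longrightarrow> lin K Y G (\<lambda>x. \<phi> a (f x))"
  by (simp add: bilin_def lin_def)

lemma lin_smult:
  assumes "module K G" "lin K Y G f" "c \<in> carrier K"
  shows "lin K Y G (\<lambda>x. c \<odot>\<^bsub>G\<^esub> f x)"
proof -
  interpret module K G by (rule assms)
  show ?thesis using assms(2,3)
    by (auto simp: lin_def smult_r_distr smult_assoc1[symmetric] R.m_comm)
qed

lemma lin_zero:
  assumes "module K A" "module K G" "lin K A G f"
  shows "f \<zero>\<^bsub>A\<^esub> = \<zero>\<^bsub>G\<^esub>"
proof -
  interpret A: module K A by (rule assms)
  interpret G: module K G by (rule assms)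
  have "f \<zero>\<^bsub>A\<^esub> = f \<zero>\<^bsub>A\<^esub> \<oplus>\<^bsub>G\<^esub> f \<zero>\<^bsub>A\<^esub>"
    using linD(2)[OF assms(3), of "\<zero>\<^bsub>A\<^esub>" "\<zero>\<^bsub>A\<^esub>"] by simp
  then show ?thesis using linD(1)[OF assms(3), of "\<zero>\<^bsub>A\<^esub>"]
    by (metis A.M.zero_closed G.M.add.r_cancel_one')
qed

text \<open>Lists instead of finite index sets, because a decomposition into pure tensors may repeat
  a pair.\<close>

primrec lsum :: "('c, 'm) ring_scheme \<Rightarrow> 'c list \<Rightarrow> 'c" where
  "lsum G [] = \<zero>\<^bsub>G\<^esub>"
| "lsum G (x # xs) = x \<oplus>\<^bsub>G\<^esub> lsum G xs"

lemma (in abelian_monoid) lsum_closed: "set xs \<subseteq> carrier G \<Longrightarrow> lsum G xs \<in> carrier G"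
  by (induction xs) auto

lemma (in abelian_monoid) lsum_append:
  "set xs \<subseteq> carrier G \<Longrightarrow> set ys \<subseteq> carrier G \<Longrightarrow> lsum G (xs @ ys) = lsum G xs \<oplus> lsum G ys"
  by (induction xs) (auto simp: lsum_closed a_assoc)

lemma (in abelian_monoid) lsum_add:
  "(\<And>p. p \<in> set ps \<Longrightarrow> f p \<in> carrier G \<and> g p \<in> carrier G) \<Longrightarrow>
   lsum G (map (\<lambda>p. f p \<oplus> g p) ps) = lsum G (map f ps) \<oplus> lsum G (map g ps)"
proof (induction ps)
  case (Cons p ps)
  have "lsum G (map f ps) \<in> carrier G" "lsum G (map g ps) \<in> carrier G"
    using Cons.prems by (auto intro!: lsum_closed)
  then show ?case using Cons by (simp add: a_ac)
qed auto

lemma (in abelian_monoid) lsum_zero: "lsum G (map (\<lambda>p. \<zero>) ps) = \<zero>"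
  by (induction ps) auto

lemma (in abelian_monoid) lsum_swap:
  assumes "\<And>p q. p \<in> set ps \<Longrightarrow> q \<in> set qs \<Longrightarrow> f p q \<in> carrier G"
  shows "lsum G (map (\<lambda>p. lsum G (map (f p) qs)) ps) = lsum G (map (\<lambda>q. lsum G (map (\<lambda>p. f p q) ps)) qs)"
  using assms
proof (induction ps)
  case Nil
  then show ?case by (simp add: lsum_zero)
next
  case (Cons p ps)
  have "lsum G (map (\<lambda>q. f p q \<oplus> lsum G (map (\<lambda>p. f p q) ps)) qs) =
     lsum G (map (f p) qs) \<oplus> lsum G (map (\<lambda>q. lsum G (map (\<lambda>p. f p q) ps)) qs)"
    by (rule lsum_add) (use Cons.prems in \<open>auto intro!: lsum_closed\<close>)
  then show ?case using Cons by simp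
qed

lemma lsum_hom:
  assumes "module K G" "module K G'" "lin K G G' f" "set xs \<subseteq> carrier G"
  shows "f (lsum G xs) = lsum G' (map f xs)"
proof -
  interpret G: module K G by (rule assms)
  show ?thesis using assms(4)
    by (induction xs) (auto simp: lin_zero[OF assms(1-3)] linD[OF assms(3)] G.lsum_closed)
qed

text \<open>Membership of the pairs in the carriers is demanded for every \<open>z\<close>, even
  outside the tensor product; sums over \<open>tdec\<close> are then closed and may be rewritten
  termwise without any condition on \<open>z\<close>.\<close>

definition tdec :: "'k ring \<Rightarrow> ('k, 'a, 'm) module_scheme \<Rightarrow> ('k, 'b, 'n) module_scheme
    \<Rightarrow> ('a, 'b) tensor \<Rightarrow> ('a \<times> 'b) list" where
  "tdec K A B z = (SOME ps. set ps \<subseteq> carrier A \<times> carrier B \<and>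
      (z \<in> carrier (ktensor K A B) \<longrightarrow>
         z = lsum (ktensor K A B) (map (\<lambda>p. tens (ktensor K A B) (fst p) (snd p)) ps)))"

text \<open>\<open>sw K A B G z \<phi>\<close> is \<open>tlift G z \<phi>\<close> evaluated on a fixed decomposition of \<open>z\<close> into pure
  tensors. Unlike \<open>tlift\<close> it is meaningful, additive and interchangeable with other such sums
  for arbitrary \<open>\<phi>\<close>.\<close>

definition sw :: "'k ring \<Rightarrow> ('k, 'a, 'm) module_scheme \<Rightarrow> ('k, 'b, 'n) module_scheme
    \<Rightarrow> ('c, 'p) ring_scheme \<Rightarrow> ('a, 'b) tensor \<Rightarrow> ('a \<Rightarrow> 'b \<Rightarrow> 'c) \<Rightarrow> 'c" where
  "sw K A B G z \<phi> = lsum G (map (\<lambda>p. \<phi> (fst p) (snd p)) (tdec K A B z))"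

text \<open>\<open>tlift\<close> reads only the additive structure of its target, and
  \<open>tens\<close> below only the carrier. Records that differ in multiplication or scalars, such
  as a smash product and the underlying tensor product, share both operations.\<close>

lemma tlift_same:
  assumes "carrier G = carrier G'" "add G = add G'" "\<zero>\<^bsub>G\<^esub> = \<zero>\<^bsub>G'\<^esub>"
  shows "tlift G = tlift G'"
proof -
  have p: "add_pow G n x = add_pow G' n x" for n :: int and x
    using assms by (simp add: add_pow_def int_pow_def nat_pow_def m_inv_def Let_def)
  have s: "finsum G f Y = finsum G' f Y" for f and Y :: "('x \<times> 'y) set"
    using assms by (simp add: finsum_def finprod_def)
  show ?thesis
    by (intro ext) (simp add: tlift_def p s)
qed

lemma tens_same: "carrier T = carrier T' \<Longrightarrow> tens T = tens T'"
  by (intro ext) (simp add: tens_def)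

lemma tensor_product_smult:
  "c \<odot>\<^bsub>tensor_product S ra A B\<^esub> z = tlift (tensor_product S ra A B) z
     (\<lambda>a b. tens (tensor_product S ra A B) (c \<odot>\<^bsub>A\<^esub> a) b)"
proof -
  let ?G = "tensor_group S ra A B"
  let ?T = "\<lparr>carrier = carrier ?G, monoid.mult = undefined, one = tens ?G \<one>\<^bsub>A\<^esub> \<one>\<^bsub>B\<^esub>,
               ring.zero = \<one>\<^bsub>?G\<^esub>, add = monoid.mult ?G\<rparr>"
  have 1: "tlift ?T = tlift (tensor_product S ra A B)"
    by (rule tlift_same) (simp_all add: tensor_product_def Let_def)
  have 2: "tens ?T = tens (tensor_product S ra A B)"
    by (rule tens_same) (simp add: tensor_product_def Let_def)
  have "c \<odot>\<^bsub>tensor_product S ra A B\<^esub> z = tlift ?T z (\<lambda>a b. tens ?T (c \<odot>\<^bsub>A\<^esub> a) b)"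
    by (simp add: tensor_product_def Let_def)
  then show ?thesis unfolding 1 2 .
qed

lemma tensor_product_mult:
  "x \<otimes>\<^bsub>tensor_product S ra A B\<^esub> y = tlift (tensor_product S ra A B) y (\<lambda>a' b'.
     tlift (tensor_product S ra A B) x (\<lambda>a b.
       tens (tensor_product S ra A B) (a \<otimes>\<^bsub>A\<^esub> a') (b \<otimes>\<^bsub>B\<^esub> b')))"
proof -
  let ?G = "tensor_group S ra A B"
  let ?T = "\<lparr>carrier = carrier ?G, monoid.mult = undefined, one = tens ?G \<one>\<^bsub>A\<^esub> \<one>\<^bsub>B\<^esub>,
               ring.zero = \<one>\<^bsub>?G\<^esub>, add = monoid.mult ?G\<rparr>"
  have 1: "tlift ?T = tlift (tensor_product S ra A B)"
    by (rule tlift_same) (simp_all add: tensor_product_def Let_def)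
  have 2: "tens ?T = tens (tensor_product S ra A B)"
    by (rule tens_same) (simp add: tensor_product_def Let_def)
  have "x \<otimes>\<^bsub>tensor_product S ra A B\<^esub> y = tlift ?T y (\<lambda>a' b'. tlift ?T x (\<lambda>a b.
       tens ?T (a \<otimes>\<^bsub>A\<^esub> a') (b \<otimes>\<^bsub>B\<^esub> b')))"
    by (simp add: tensor_product_def Let_def)
  then show ?thesis unfolding 1 2 .
qed

lemma tensor_product_one:
  "\<one>\<^bsub>tensor_product S ra A B\<^esub> = tens (tensor_product S ra A B) \<one>\<^bsub>A\<^esub> \<one>\<^bsub>B\<^esub>"
proof -
  have "tens (tensor_group S ra A B) = tens (tensor_product S ra A B)"
    by (rule tens_same) (simp add: tensor_product_def Let_def)
  then show ?thesis by (simp add: tensor_product_def Let_def)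
qed

locale ktensor_pair =
  fixes K :: "'k ring" and A :: "('k, 'a, 'm) module_scheme" and B :: "('k, 'b, 'n) module_scheme"
  assumes module_A: "module K A" and module_B: "module K B"
begin

sublocale A: module K A by (rule module_A)
sublocale B: module K B by (rule module_B)

sublocale tensor_pair "carrier K" "\<lambda>a c. c \<odot>\<^bsub>A\<^esub> a" A B
  by (unfold_locales) auto

lemma balanced_bilin:
  assumes "bilin K A B G \<phi>"
  shows "balanced (carrier K) (\<lambda>a c. c \<odot>\<^bsub>A\<^esub> a) A B G \<phi>"
  using assms by (auto simp: balanced_def bilin_def lin_def)

lemma smult_T_balanced:
  assumes "c \<in> carrier K"
  shows "balanced (carrier K) (\<lambda>a c. c \<odot>\<^bsub>A\<^esub> a) A B T (\<lambda>a b. tens T (c \<odot>\<^bsub>A\<^esub> a) b)"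
  using assms by (auto simp: balanced_def tens_closed tens_add_left tens_add_right A.smult_r_distr
    tens_balanced[symmetric] A.smult_assoc1[symmetric] A.R.m_comm)

lemma smult_tens:
  assumes "c \<in> carrier K" "a \<in> carrier A" "b \<in> carrier B"
  shows "c \<odot>\<^bsub>T\<^esub> tens T a b = tens T (c \<odot>\<^bsub>A\<^esub> a) b"
  unfolding tensor_product_smult by (rule tlift_tens[OF T_abelian smult_T_balanced[OF assms(1)] assms(2,3)])

lemma smult_T_closed: "c \<in> carrier K \<Longrightarrow> z \<in> carrier T \<Longrightarrow> c \<odot>\<^bsub>T\<^esub> z \<in> carrier T"
  unfolding tensor_product_smult by (rule tlift_closed[OF T_abelian smult_T_balanced])

lemma smult_T_add: "c \<in> carrier K \<Longrightarrow> z \<in> carrier T \<Longrightarrow> w \<in> carrier T \<Longrightarrow>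
   c \<odot>\<^bsub>T\<^esub> (z \<oplus>\<^bsub>T\<^esub> w) = c \<odot>\<^bsub>T\<^esub> z \<oplus>\<^bsub>T\<^esub> c \<odot>\<^bsub>T\<^esub> w"
  unfolding tensor_product_smult by (rule tlift_add[OF T_abelian smult_T_balanced])

lemma module_T: "module K T"
proof (rule moduleI)
  fix a b x assume ab: "a \<in> carrier K" "b \<in> carrier K" and x: "x \<in> carrier T"
  show "(a \<oplus>\<^bsub>K\<^esub> b) \<odot>\<^bsub>T\<^esub> x = a \<odot>\<^bsub>T\<^esub> x \<oplus>\<^bsub>T\<^esub> b \<odot>\<^bsub>T\<^esub> x"
    using x
  proof (induction x rule: tensor_induct)
    case (tens u v)
    then show ?case using ab by (simp add: smult_tens A.smult_l_distr tens_add_left)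
  next
    case (add x y)
    then show ?case using ab by (simp add: smult_T_add smult_T_closed T.a_ac)
  qed
  show "(a \<otimes>\<^bsub>K\<^esub> b) \<odot>\<^bsub>T\<^esub> x = a \<odot>\<^bsub>T\<^esub> (b \<odot>\<^bsub>T\<^esub> x)"
    using x
  proof (induction x rule: tensor_induct)
    case (tens u v)
    then show ?case using ab by (simp add: smult_tens A.smult_assoc1)
  next
    case (add x y)
    then show ?case using ab by (simp add: smult_T_add smult_T_closed)
  qed
next
  fix x assume "x \<in> carrier T"
  then show "\<one>\<^bsub>K\<^esub> \<odot>\<^bsub>T\<^esub> x = x"
  proof (induction x rule: tensor_induct)
    case (tens u v)
    then show ?case by (simp add: smult_tens)
  next
    case (add x y)
    then show ?case by (simp add: smult_T_add)
  qed
qed (use A.R.cring_axioms T_abelian smult_T_closed smult_T_add in \<open>auto simp: A.R.is_cring\<close>)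

lemma bilin_tens: "bilin K A B T (tens T)"
  by (auto simp: bilin_def lin_def tens_closed tens_add_left tens_add_right smult_tens tens_balanced)

lemma tdec_ex: "\<exists>ps. set ps \<subseteq> carrier A \<times> carrier B \<and> (z \<in> carrier T \<longrightarrow>
         z = lsum T (map (\<lambda>p. tens T (fst p) (snd p)) ps))"
proof (cases "z \<in> carrier T")
  case True
  then show ?thesis
  proof (induction z rule: tensor_induct)
    case (tens a b)
    then show ?case by (intro exI[of _ "[(a, b)]"]) (simp add: tens_closed)
  next
    case (add x y)
    then obtain ps qs where "set ps \<subseteq> carrier A \<times> carrier B" "x = lsum T (map (\<lambda>p. tens T (fst p) (snd p)) ps)"
      "set qs \<subseteq> carrier A \<times> carrier B" "y = lsum T (map (\<lambda>p. tens T (fst p) (snd p)) qs)" by blast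
    then show ?case
      by (intro exI[of _ "ps @ qs"]) (auto simp: subset_iff tens_closed intro!: T.lsum_append[symmetric])
  qed
next
  case False
  then show ?thesis by (intro exI[of _ "[]"]) simp
qed

lemma tdec: "set (tdec K A B z) \<subseteq> carrier A \<times> carrier B"
   "z \<in> carrier T \<Longrightarrow> lsum T (map (\<lambda>p. tens T (fst p) (snd p)) (tdec K A B z)) = z"
  using someI_ex[OF tdec_ex[of z]] unfolding tdec_def[symmetric] by auto

lemma sw_cong:
  "(\<And>a b. a \<in> carrier A \<Longrightarrow> b \<in> carrier B \<Longrightarrow> \<phi> a b = \<psi> a b) \<Longrightarrow> sw K A B G z \<phi> = sw K A B G z \<psi>"
  unfolding sw_def using tdec(1)[of z] by (auto intro!: arg_cong[where f = "lsum G"] simp: subset_iff)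

lemma sw_closed:
  assumes "module K G" "\<And>a b. a \<in> carrier A \<Longrightarrow> b \<in> carrier B \<Longrightarrow> \<phi> a b \<in> carrier G"
  shows "sw K A B G z \<phi> \<in> carrier G"
proof -
  interpret G: module K G by (rule assms)
  show ?thesis unfolding sw_def using tdec(1)[of z] assms(2) by (auto intro!: G.lsum_closed simp: subset_iff)
qed

lemma sw_hom:
  assumes "module K G" "module K G'" "lin K G G' f"
    "\<And>a b. a \<in> carrier A \<Longrightarrow> b \<in> carrier B \<Longrightarrow> \<phi> a b \<in> carrier G"
  shows "f (sw K A B G z \<phi>) = sw K A B G' z (\<lambda>a b. f (\<phi> a b))"
  unfolding sw_def using tdec(1)[of z] assms(4)
  by (subst lsum_hom[OF assms(1-3)]) (auto simp: comp_def subset_iff)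

text \<open>For balanced maps \<open>tlift\<close> is additive and has the expected value on pure
  tensors, so it can be evaluated on the chosen decomposition. This is the bridge between the
  notation of the statement and the calculus of the proof.\<close>

lemma tlift_sw:
  assumes G: "module K G" and b: "bilin K A B G \<phi>" and z: "z \<in> carrier T"
  shows "tlift G z \<phi> = sw K A B G z \<phi>"
proof -
  interpret G: module K G by (rule assms)
  have bal: "balanced (carrier K) (\<lambda>a c. c \<odot>\<^bsub>A\<^esub> a) A B G \<phi>" by (rule balanced_bilin[OF b])
  note lift = G.abelian_group_axioms bal
  have l: "tlift G (lsum T xs) \<phi> = lsum G (map (\<lambda>z. tlift G z \<phi>) xs)" if "set xs \<subseteq> carrier T" for xs
    using that
  proof (induction xs)
    case Nil
    show ?case using tlift_add[OF lift, of "\<zero>\<^bsub>T\<^esub>" "\<zero>\<^bsub>T\<^esub>"] tlift_closed[OF lift, of "\<zero>\<^bsub>T\<^esub>"] by simp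
  next
    case (Cons x xs)
    then show ?case by (simp add: tlift_add[OF lift] T.lsum_closed)
  qed
  have "tlift G z \<phi> = tlift G (lsum T (map (\<lambda>p. tens T (fst p) (snd p)) (tdec K A B z))) \<phi>"
    using tdec(2)[OF z] by simp
  also have "\<dots> = sw K A B G z \<phi>"
    unfolding sw_def using tdec(1)[of z]
    by (subst l) (auto simp: subset_iff tens_closed tlift_tens[OF lift] intro!: arg_cong[where f = "lsum G"])
  finally show ?thesis .
qed

lemma lin_tlift:
  assumes G: "module K G" and b: "bilin K A B G \<phi>"
  shows "lin K T G (\<lambda>z. tlift G z \<phi>)"
proof (rule linI)
  interpret G: module K G by (rule assms)
  have bal: "balanced (carrier K) (\<lambda>a c. c \<odot>\<^bsub>A\<^esub> a) A B G \<phi>" by (rule balanced_bilin[OF b])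
  note lift = G.abelian_group_axioms bal
  fix x y assume x: "x \<in> carrier T"
  then show "tlift G x \<phi> \<in> carrier G" by (rule tlift_closed[OF lift])
  show "y \<in> carrier T \<Longrightarrow> tlift G (x \<oplus>\<^bsub>T\<^esub> y) \<phi> = tlift G x \<phi> \<oplus>\<^bsub>G\<^esub> tlift G y \<phi>"
    using x by (rule tlift_add[OF lift])
  show "tlift G (c \<odot>\<^bsub>T\<^esub> x) \<phi> = c \<odot>\<^bsub>G\<^esub> tlift G x \<phi>" if c: "c \<in> carrier K" for c
    using x
  proof (induction x rule: tensor_induct)
    case (tens a b)
    then show ?case using c linD(3)[OF bilinD(2)[OF assms(2) tens(2)] c tens(1)] by (simp add: smult_tens tlift_tens[OF lift])
  next
    case (add x y)
    then show ?case using c tlift_closed[OF lift, of x] tlift_closed[OF lift, of y]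
      by (simp add: tlift_add[OF lift] smult_T_add smult_T_closed G.smult_r_distr)
  qed
qed

text \<open>Linearity in the tensor itself needs \<open>\<phi>\<close> bilinear: the decompositions
  chosen for \<open>z\<close>, \<open>w\<close> and their sum are unrelated, and only the equality
  with \<open>tlift\<close> connects them.\<close>

lemma lin_sw_arg:
  assumes "module K G" "bilin K A B G \<phi>" "lin K Y T f"
  shows "lin K Y G (\<lambda>x. sw K A B G (f x) \<phi>)"
proof -
  have "lin K T G (\<lambda>z. sw K A B G z \<phi>)"
    using lin_tlift[OF assms(1,2)] by (subst lin_cong[OF module_T tlift_sw[OF assms(1,2), symmetric]])
  then show ?thesis using assms(3) by (rule lin_comp)
qed

lemma sw_tens:
  assumes "module K G" "bilin K A B G \<phi>" "a \<in> carrier A" "b \<in> carrier B"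
  shows "sw K A B G (tens T a b) \<phi> = \<phi> a b"
proof -
  interpret G: module K G by (rule assms)
  show ?thesis
  using tlift_sw[OF assms(1,2), symmetric, of "tens T a b"] assms tens_closed
     tlift_tens[OF G.abelian_group_axioms balanced_bilin[OF assms(2)]] by simp
qed

lemma sw_tensor: "z \<in> carrier T \<Longrightarrow> sw K A B T z (tens T) = z"
  using tdec(2)[of z] by (simp add: sw_def)

text \<open>A parameter of the summand, by contrast, passes through the sum termwise, and nothing is
  asked about how \<open>\<phi> x a b\<close> depends on \<open>a\<close> and
  \<open>b\<close>.\<close>

lemma lin_sw:
  assumes "module K G" "module K Y" "\<And>a b. a \<in> carrier A \<Longrightarrow> b \<in> carrier B \<Longrightarrow> lin K Y G (\<lambda>x. \<phi> x a b)"
  shows "lin K Y G (\<lambda>x. sw K A B G z (\<phi> x))"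
proof -
  interpret G: module K G by (rule assms)
  interpret Y: module K Y by (rule assms)
  have cl: "\<phi> x a b \<in> carrier G" if "x \<in> carrier Y" "a \<in> carrier A" "b \<in> carrier B" for x a b
    using assms(3) that by (simp add: lin_def)
  show ?thesis
  proof (rule linI)
    fix x assume x: "x \<in> carrier Y"
    show "sw K A B G z (\<phi> x) \<in> carrier G" using x by (auto intro!: sw_closed assms cl)
    fix y assume y: "y \<in> carrier Y"
    have "sw K A B G z (\<phi> (x \<oplus>\<^bsub>Y\<^esub> y)) = sw K A B G z (\<lambda>a b. \<phi> x a b \<oplus>\<^bsub>G\<^esub> \<phi> y a b)"
      using x y assms(3) by (intro sw_cong) (simp add: lin_def)
    also have "\<dots> = sw K A B G z (\<phi> x) \<oplus>\<^bsub>G\<^esub> sw K A B G z (\<phi> y)"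
      unfolding sw_def using tdec(1)[of z] x y cl by (subst G.lsum_add) (auto simp: subset_iff)
    finally show "sw K A B G z (\<phi> (x \<oplus>\<^bsub>Y\<^esub> y)) = sw K A B G z (\<phi> x) \<oplus>\<^bsub>G\<^esub> sw K A B G z (\<phi> y)" .
  next
    fix c x assume c: "c \<in> carrier K" and x: "x \<in> carrier Y"
    have "sw K A B G z (\<phi> (c \<odot>\<^bsub>Y\<^esub> x)) = sw K A B G z (\<lambda>a b. c \<odot>\<^bsub>G\<^esub> \<phi> x a b)"
      using x c assms(3) by (intro sw_cong) (simp add: lin_def)
    also have "\<dots> = c \<odot>\<^bsub>G\<^esub> sw K A B G z (\<phi> x)"
      using sw_hom[OF assms(1) assms(1) lin_smult[OF assms(1) lin_ident c], of "\<phi> x" z] x cl by simp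
    finally show "sw K A B G z (\<phi> (c \<odot>\<^bsub>Y\<^esub> x)) = c \<odot>\<^bsub>G\<^esub> sw K A B G z (\<phi> x)" .
  qed
qed

lemma ktensor_ext:
  assumes "module K G" "lin K T G f" "lin K T G g"
    "\<And>a b. a \<in> carrier A \<Longrightarrow> b \<in> carrier B \<Longrightarrow> f (tens T a b) = g (tens T a b)" "z \<in> carrier T"
  shows "f z = g z"
  using assms(5)
proof (induction z rule: tensor_induct)
  case (add x y)
  then show ?case using assms(2,3) by (simp add: lin_def)
qed (use assms in auto)

end

lemma sw_swap:
  assumes "ktensor_pair K A B" "ktensor_pair K A' B'" "module K G"
    "\<And>a b c d. a \<in> carrier A \<Longrightarrow> b \<in> carrier B \<Longrightarrow> c \<in> carrier A' \<Longrightarrow> d \<in> carrier B' \<Longrightarrow> \<phi> a b c d \<in> carrier G"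
  shows "sw K A B G z (\<lambda>a b. sw K A' B' G w (\<lambda>c d. \<phi> a b c d)) =
         sw K A' B' G w (\<lambda>c d. sw K A B G z (\<lambda>a b. \<phi> a b c d))"
proof -
  interpret p: ktensor_pair K A B by fact
  interpret q: ktensor_pair K A' B' by fact
  interpret G: module K G by fact
  show ?thesis unfolding sw_def
    by (rule G.lsum_swap) (use p.tdec(1)[of z] q.tdec(1)[of w] assms(4) in \<open>auto simp: subset_iff\<close>)
qed

section \<open>Associative algebras\<close>

lemma assoc_algebra_module: "assoc_algebra K A \<Longrightarrow> module K A"
  by (simp add: assoc_algebra_def)

lemma assoc_algebra_ring: "assoc_algebra K A \<Longrightarrow> ring A"
  by (simp add: assoc_algebra_def)

lemma bilin_mult:
  assumes "assoc_algebra K A"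
  shows "bilin K A A A (\<lambda>x y. x \<otimes>\<^bsub>A\<^esub> y)"
proof -
  interpret ring A using assms by (rule assoc_algebra_ring)
  show ?thesis using assms by (auto simp: bilin_def lin_def assoc_algebra_def l_distr r_distr)
qed

lemmas lin_mult_l = bilin_comp_l[OF bilin_mult]
lemmas lin_mult_r = bilin_comp_r[OF bilin_mult]

lemma assoc_algebraI:
  assumes "module K A" "bilin K A A A (\<lambda>x y. x \<otimes>\<^bsub>A\<^esub> y)" "\<one>\<^bsub>A\<^esub> \<in> carrier A"
    "\<And>x. x \<in> carrier A \<Longrightarrow> \<one>\<^bsub>A\<^esub> \<otimes>\<^bsub>A\<^esub> x = x" "\<And>x. x \<in> carrier A \<Longrightarrow> x \<otimes>\<^bsub>A\<^esub> \<one>\<^bsub>A\<^esub> = x"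
    "\<And>x y z. x \<in> carrier A \<Longrightarrow> y \<in> carrier A \<Longrightarrow> z \<in> carrier A \<Longrightarrow>
       (x \<otimes>\<^bsub>A\<^esub> y) \<otimes>\<^bsub>A\<^esub> z = x \<otimes>\<^bsub>A\<^esub> (y \<otimes>\<^bsub>A\<^esub> z)"
  shows "assoc_algebra K A"
proof -
  interpret module K A by fact
  note b = bilinD[OF assms(2)]
  have "ring A"
  proof (rule ringI[OF abelian_group_axioms])
    show "monoid A" by (rule monoidI) (use assms(3-6) b(3) in auto)
    fix x y z assume "x \<in> carrier A" "y \<in> carrier A" "z \<in> carrier A"
    then show "(x \<oplus>\<^bsub>A\<^esub> y) \<otimes>\<^bsub>A\<^esub> z = x \<otimes>\<^bsub>A\<^esub> z \<oplus>\<^bsub>A\<^esub> y \<otimes>\<^bsub>A\<^esub> z"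
      "z \<otimes>\<^bsub>A\<^esub> (x \<oplus>\<^bsub>A\<^esub> y) = z \<otimes>\<^bsub>A\<^esub> x \<oplus>\<^bsub>A\<^esub> z \<otimes>\<^bsub>A\<^esub> y"
      using linD(2)[OF b(1)] linD(2)[OF b(2)] by blast+
  qed
  then show ?thesis using assms(1) linD(3)[OF b(1)] linD(3)[OF b(2)]
    unfolding assoc_algebra_def by blast
qed

locale ktensor_algebra_pair =
  fixes K :: "'k ring" and A :: "('k, 'a, 'm) module_scheme" and B :: "('k, 'b, 'n) module_scheme"
  assumes alg_A: "assoc_algebra K A" and alg_B: "assoc_algebra K B"
begin

sublocale ktensor_pair K A B
  by (rule ktensor_pair.intro[OF assoc_algebra_module[OF alg_A] assoc_algebra_module[OF alg_B]])

sublocale RA: ring A by (rule assoc_algebra_ring[OF alg_A])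
sublocale RB: ring B by (rule assoc_algebra_ring[OF alg_B])

lemma mult_bilin_l:
  assumes "a' \<in> carrier A" "b' \<in> carrier B"
  shows "bilin K A B T (\<lambda>a b. tens T (a \<otimes>\<^bsub>A\<^esub> a') (b \<otimes>\<^bsub>B\<^esub> b'))"
  using assms by (intro bilinI bilin_comp_l[OF bilin_tens] bilin_comp_r[OF bilin_tens]
     lin_mult_l[OF alg_A] lin_mult_l[OF alg_B] lin_ident) auto

lemma mult_bilin_r:
  assumes "x \<in> carrier T"
  shows "bilin K A B T (\<lambda>a' b'. tlift T x (\<lambda>a b. tens T (a \<otimes>\<^bsub>A\<^esub> a') (b \<otimes>\<^bsub>B\<^esub> b')))"
proof (rule bilinI)
  fix a' assume a': "a' \<in> carrier A"
  have "lin K B T (\<lambda>b'. sw K A B T x (\<lambda>a b. tens T (a \<otimes>\<^bsub>A\<^esub> a') (b \<otimes>\<^bsub>B\<^esub> b')))"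
    using a' by (intro lin_sw module_T module_B bilin_comp_r[OF bilin_tens] lin_mult_r[OF alg_B] lin_ident) auto
  then show "lin K B T (\<lambda>b'. tlift T x (\<lambda>a b. tens T (a \<otimes>\<^bsub>A\<^esub> a') (b \<otimes>\<^bsub>B\<^esub> b')))"
    by (subst lin_cong[OF module_B tlift_sw[OF module_T mult_bilin_l[OF a'] assms]])
next
  fix b' assume b': "b' \<in> carrier B"
  have "lin K A T (\<lambda>a'. sw K A B T x (\<lambda>a b. tens T (a \<otimes>\<^bsub>A\<^esub> a') (b \<otimes>\<^bsub>B\<^esub> b')))"
    using b' by (intro lin_sw module_T module_A bilin_comp_l[OF bilin_tens] lin_mult_r[OF alg_A] lin_ident) auto
  then show "lin K A T (\<lambda>a'. tlift T x (\<lambda>a b. tens T (a \<otimes>\<^bsub>A\<^esub> a') (b \<otimes>\<^bsub>B\<^esub> b')))"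
    by (subst lin_cong[OF module_A tlift_sw[OF module_T mult_bilin_l[OF _ b'] assms]])
qed

lemma mult_tens_r:
  assumes "x \<in> carrier T" "a' \<in> carrier A" "b' \<in> carrier B"
  shows "x \<otimes>\<^bsub>T\<^esub> tens T a' b' = tlift T x (\<lambda>a b. tens T (a \<otimes>\<^bsub>A\<^esub> a') (b \<otimes>\<^bsub>B\<^esub> b'))"
  unfolding tensor_product_mult
  by (rule tlift_tens[OF T_abelian balanced_bilin[OF mult_bilin_r[OF assms(1)]] assms(2,3)])

lemma mult_tens:
  assumes "a \<in> carrier A" "b \<in> carrier B" "a' \<in> carrier A" "b' \<in> carrier B"
  shows "tens T a b \<otimes>\<^bsub>T\<^esub> tens T a' b' = tens T (a \<otimes>\<^bsub>A\<^esub> a') (b \<otimes>\<^bsub>B\<^esub> b')"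
  using assms by (simp add: mult_tens_r tens_closed tlift_tens[OF T_abelian balanced_bilin[OF mult_bilin_l]])

text \<open>Linearity in \<open>y\<close> is that of the outer sum of the product. For linearity in
  \<open>x\<close> the outer sum is evaluated on a decomposition of \<open>y\<close>, each of whose
  terms is right multiplication by a pure tensor.\<close>

lemma bilin_mult_T: "bilin K T T T (\<lambda>x y. x \<otimes>\<^bsub>T\<^esub> y)"
proof (rule bilinI)
  fix x assume x: "x \<in> carrier T"
  show "lin K T T (\<lambda>y. x \<otimes>\<^bsub>T\<^esub> y)"
    unfolding tensor_product_mult using lin_tlift[OF module_T mult_bilin_r[OF x]] .
next
  fix y assume y: "y \<in> carrier T"
  have l: "lin K T T (\<lambda>x. x \<otimes>\<^bsub>T\<^esub> tens T a' b')" if "a' \<in> carrier A" "b' \<in> carrier B" for a' b'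
    using lin_tlift[OF module_T mult_bilin_l[OF that]] that
    by (subst lin_cong[OF module_T mult_tens_r]) auto
  have s: "x \<otimes>\<^bsub>T\<^esub> y = sw K A B T y (\<lambda>a' b'. x \<otimes>\<^bsub>T\<^esub> tens T a' b')" if x: "x \<in> carrier T" for x
    unfolding tensor_product_mult[of _ _ _ _ x y] tlift_sw[OF module_T mult_bilin_r[OF x] y]
    using x by (intro sw_cong) (simp add: mult_tens_r)
  show "lin K T T (\<lambda>x. x \<otimes>\<^bsub>T\<^esub> y)"
    by (subst lin_cong[OF module_T s], assumption) (intro lin_sw module_T l)
qed

text \<open>Both sides of each law are linear in every argument, so the laws are checked on pure
  tensors, one argument after the other.\<close>

lemma alg_T: "assoc_algebra K T"
proof (rule assoc_algebraI[OF module_T bilin_mult_T])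
  note cl = bilinD(3)[OF bilin_mult_T]
  note lin1 = bilin_comp_l[OF bilin_mult_T] and lin2 = bilin_comp_r[OF bilin_mult_T]
  show one: "\<one>\<^bsub>T\<^esub> \<in> carrier T" by (simp add: tensor_product_one tens_closed)
  show "\<one>\<^bsub>T\<^esub> \<otimes>\<^bsub>T\<^esub> x = x" if "x \<in> carrier T" for x
    using module_T lin2[OF lin_ident one] lin_ident _ that
    by (rule ktensor_ext) (simp add: tensor_product_one mult_tens)
  show "x \<otimes>\<^bsub>T\<^esub> \<one>\<^bsub>T\<^esub> = x" if "x \<in> carrier T" for x
    using module_T lin1[OF lin_ident one] lin_ident _ that
    by (rule ktensor_ext) (simp add: tensor_product_one mult_tens)
  fix x y z assume x: "x \<in> carrier T" and y: "y \<in> carrier T" and z: "z \<in> carrier T"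
  show "(x \<otimes>\<^bsub>T\<^esub> y) \<otimes>\<^bsub>T\<^esub> z = x \<otimes>\<^bsub>T\<^esub> (y \<otimes>\<^bsub>T\<^esub> z)"
  proof (rule ktensor_ext[OF module_T _ _ _ x])
    show "lin K T T (\<lambda>x. (x \<otimes>\<^bsub>T\<^esub> y) \<otimes>\<^bsub>T\<^esub> z)" "lin K T T (\<lambda>x. x \<otimes>\<^bsub>T\<^esub> (y \<otimes>\<^bsub>T\<^esub> z))"
      by (intro lin1 lin2 lin_ident y z cl)+
    fix a b assume ab: "a \<in> carrier A" "b \<in> carrier B"
    then have t1: "tens T a b \<in> carrier T" by (rule tens_closed)
    show "(tens T a b \<otimes>\<^bsub>T\<^esub> y) \<otimes>\<^bsub>T\<^esub> z = tens T a b \<otimes>\<^bsub>T\<^esub> (y \<otimes>\<^bsub>T\<^esub> z)"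
    proof (rule ktensor_ext[OF module_T _ _ _ y])
      show "lin K T T (\<lambda>y. (tens T a b \<otimes>\<^bsub>T\<^esub> y) \<otimes>\<^bsub>T\<^esub> z)" "lin K T T (\<lambda>y. tens T a b \<otimes>\<^bsub>T\<^esub> (y \<otimes>\<^bsub>T\<^esub> z))"
        by (intro lin1 lin2 lin_ident t1 z cl)+
      fix a' b' assume ab': "a' \<in> carrier A" "b' \<in> carrier B"
      then have t2: "tens T a' b' \<in> carrier T" by (rule tens_closed)
      show "(tens T a b \<otimes>\<^bsub>T\<^esub> tens T a' b') \<otimes>\<^bsub>T\<^esub> z = tens T a b \<otimes>\<^bsub>T\<^esub> (tens T a' b' \<otimes>\<^bsub>T\<^esub> z)"
        by (rule ktensor_ext[OF module_T _ _ _ z])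
           ((intro lin1 lin2 lin_ident t1 t2 cl)+,
            use ab ab' in \<open>simp add: mult_tens RA.m_assoc RB.m_assoc\<close>)
    qed
  qed
qed

end

section \<open>Rewriting rules for Sweedler sums\<close>

definition trilin :: "'k ring \<Rightarrow> ('k, 'a, 'm) module_scheme \<Rightarrow> ('k, 'b, 'n) module_scheme
    \<Rightarrow> ('k, 'c, 'p) module_scheme \<Rightarrow> ('k, 'd, 'q) module_scheme \<Rightarrow> ('a \<Rightarrow> 'b \<Rightarrow> 'c \<Rightarrow> 'd) \<Rightarrow> bool"
  where "trilin K A B C G \<phi> \<longleftrightarrow> (\<forall>a\<in>carrier A. bilin K B C G (\<phi> a)) \<and>
    (\<forall>b\<in>carrier B. \<forall>c\<in>carrier C. lin K A G (\<lambda>a. \<phi> a b c))"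

text \<open>Each argument is precomposed with an arbitrary linear map, so that linearity of deeply
  nested expressions is found by backward chaining on their syntax.\<close>

lemma trilinD:
  assumes "trilin K A B C G \<phi>"
  shows "a \<in> carrier A \<Longrightarrow> b \<in> carrier B \<Longrightarrow> c \<in> carrier C \<Longrightarrow> \<phi> a b c \<in> carrier G"
   "lin K Y A f \<Longrightarrow> b \<in> carrier B \<Longrightarrow> c \<in> carrier C \<Longrightarrow> lin K Y G (\<lambda>x. \<phi> (f x) b c)"
   "lin K Y B g \<Longrightarrow> a \<in> carrier A \<Longrightarrow> c \<in> carrier C \<Longrightarrow> lin K Y G (\<lambda>x. \<phi> a (g x) c)"
   "lin K Y C h \<Longrightarrow> a \<in> carrier A \<Longrightarrow> b \<in> carrier B \<Longrightarrow> lin K Y G (\<lambda>x. \<phi> a b (h x))"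
  using assms by (simp_all add: trilin_def bilin_def lin_def)

context
  fixes K :: "'k ring" and A :: "('k, 'a, 'm) module_scheme" and B :: "('k, 'b, 'n) module_scheme"
  assumes AB: "module K A" "module K B"
begin

interpretation ktensor_pair K A B by (rule ktensor_pair.intro) (rule AB)+

lemmas module_ktensor = module_T
lemmas ktensor_tens_closed = tens_closed
lemmas lin_tens_l = bilin_comp_l[OF bilin_tens]
lemmas lin_tens_r = bilin_comp_r[OF bilin_tens]
lemmas ktensor_sw_closed = sw_closed
lemmas ktensor_sw_tens = sw_tens
lemmas ktensor_lin_sw = lin_sw
lemmas ktensor_lin_sw_arg = lin_sw_arg
lemmas ktensor_tlift_sw = tlift_sw
lemmas ktensor_sw_hom = sw_hom
lemmas ktensor_sw_cong = sw_cong
lemmas ktensor_sw_tensor = sw_tensor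
lemmas ktensor_linext = ktensor_ext

end

lemma ktensor_sw_swap:
  assumes "module K A" "module K B" "module K A'" "module K B'" "module K G"
    "\<And>a b c d. a \<in> carrier A \<Longrightarrow> b \<in> carrier B \<Longrightarrow> c \<in> carrier A' \<Longrightarrow> d \<in> carrier B' \<Longrightarrow> \<phi> a b c d \<in> carrier G"
  shows "sw K A B G z (\<lambda>a b. sw K A' B' G w (\<lambda>c d. \<phi> a b c d)) =
         sw K A' B' G w (\<lambda>c d. sw K A B G z (\<lambda>a b. \<phi> a b c d))"
  using assms by (intro sw_swap ktensor_pair.intro)

lemma alg_ktensor: "assoc_algebra K A \<Longrightarrow> assoc_algebra K B \<Longrightarrow> assoc_algebra K (ktensor K A B)"
  by (rule ktensor_algebra_pair.alg_T[OF ktensor_algebra_pair.intro])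

lemma ktensor_mult_tens:
  assumes "assoc_algebra K A" "assoc_algebra K B" "a \<in> carrier A" "b \<in> carrier B" "a' \<in> carrier A" "b' \<in> carrier B"
  shows "tens (ktensor K A B) a b \<otimes>\<^bsub>ktensor K A B\<^esub> tens (ktensor K A B) a' b' =
    tens (ktensor K A B) (a \<otimes>\<^bsub>A\<^esub> a') (b \<otimes>\<^bsub>B\<^esub> b')"
  using assms by (intro ktensor_algebra_pair.mult_tens ktensor_algebra_pair.intro)

lemma alg_closed:
  assumes "assoc_algebra K A"
  shows "x \<in> carrier A \<Longrightarrow> y \<in> carrier A \<Longrightarrow> x \<otimes>\<^bsub>A\<^esub> y \<in> carrier A" "\<one>\<^bsub>A\<^esub> \<in> carrier A"
    "x \<in> carrier A \<Longrightarrow> \<one>\<^bsub>A\<^esub> \<otimes>\<^bsub>A\<^esub> x = x" "x \<in> carrier A \<Longrightarrow> x \<otimes>\<^bsub>A\<^esub> \<one>\<^bsub>A\<^esub> = x"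
    "x \<in> carrier A \<Longrightarrow> y \<in> carrier A \<Longrightarrow> z \<in> carrier A \<Longrightarrow>
       (x \<otimes>\<^bsub>A\<^esub> y) \<otimes>\<^bsub>A\<^esub> z = x \<otimes>\<^bsub>A\<^esub> (y \<otimes>\<^bsub>A\<^esub> z)"
proof -
  interpret ring A by (rule assoc_algebra_ring[OF assms])
  show "x \<in> carrier A \<Longrightarrow> y \<in> carrier A \<Longrightarrow> x \<otimes>\<^bsub>A\<^esub> y \<in> carrier A" "\<one>\<^bsub>A\<^esub> \<in> carrier A"
    "x \<in> carrier A \<Longrightarrow> \<one>\<^bsub>A\<^esub> \<otimes>\<^bsub>A\<^esub> x = x" "x \<in> carrier A \<Longrightarrow> x \<otimes>\<^bsub>A\<^esub> \<one>\<^bsub>A\<^esub> = x"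
    "x \<in> carrier A \<Longrightarrow> y \<in> carrier A \<Longrightarrow> z \<in> carrier A \<Longrightarrow>
       (x \<otimes>\<^bsub>A\<^esub> y) \<otimes>\<^bsub>A\<^esub> z = x \<otimes>\<^bsub>A\<^esub> (y \<otimes>\<^bsub>A\<^esub> z)"
    by (simp_all add: m_assoc)
qed

lemma module_smult_closed: "module K A \<Longrightarrow> c \<in> carrier K \<Longrightarrow> x \<in> carrier A \<Longrightarrow> c \<odot>\<^bsub>A\<^esub> x \<in> carrier A"
  by (rule module.smult_closed)

lemma ktensor_mult_sw_l:
  assumes "assoc_algebra K G" "module K A" "module K B" "y \<in> carrier G"
    "\<And>a b. a \<in> carrier A \<Longrightarrow> b \<in> carrier B \<Longrightarrow> \<phi> a b \<in> carrier G"
  shows "sw K A B G z \<phi> \<otimes>\<^bsub>G\<^esub> y = sw K A B G z (\<lambda>a b. \<phi> a b \<otimes>\<^bsub>G\<^esub> y)"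
  by (rule ktensor_sw_hom[OF assms(2,3) _ _ lin_mult_l[OF assms(1) lin_ident assms(4)]])
     (simp_all add: assms assoc_algebra_module)

lemma ktensor_mult_sw_r:
  assumes "assoc_algebra K G" "module K A" "module K B" "y \<in> carrier G"
    "\<And>a b. a \<in> carrier A \<Longrightarrow> b \<in> carrier B \<Longrightarrow> \<phi> a b \<in> carrier G"
  shows "y \<otimes>\<^bsub>G\<^esub> sw K A B G z \<phi> = sw K A B G z (\<lambda>a b. y \<otimes>\<^bsub>G\<^esub> \<phi> a b)"
  by (rule ktensor_sw_hom[OF assms(2,3) _ _ lin_mult_r[OF assms(1) lin_ident assms(4)]])
     (simp_all add: assms assoc_algebra_module)

lemma ktensor_one: "\<one>\<^bsub>ktensor K A B\<^esub> = tens (ktensor K A B) \<one>\<^bsub>A\<^esub> \<one>\<^bsub>B\<^esub>"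
  by (rule tensor_product_one)

lemmas closure_rules = assoc_algebra_module module_ktensor ktensor_tens_closed ktensor_sw_closed alg_ktensor
lemmas lin_rules = lin_ident lin_tens_l lin_tens_r ktensor_lin_sw ktensor_lin_sw_arg lin_mult_l lin_mult_r
  lin_smult bilin_def
lemmas eval_rules = ktensor_sw_tens ktensor_mult_tens alg_closed(3,4) ktensor_mult_sw_l ktensor_mult_sw_r ktensor_one

section \<open>Sweedler sums over threefold tensors and multilinear evaluation\<close>

definition sw3 :: "'k ring \<Rightarrow> ('k, 'a, 'm) module_scheme \<Rightarrow> ('k, 'b, 'n) module_scheme
    \<Rightarrow> ('k, 'c, 'p) module_scheme \<Rightarrow> ('d, 'q) ring_scheme \<Rightarrow> ('a, ('b, 'c) tensor) tensor \<Rightarrow> ('a \<Rightarrow> 'b \<Rightarrow> 'c \<Rightarrow> 'd) \<Rightarrow> 'd"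
  where "sw3 K A B C G z \<phi> = sw K A (ktensor K B C) G z (\<lambda>a w. sw K B C G w (\<phi> a))"

context
  fixes K :: "'k ring" and A :: "('k, 'a, 'm) module_scheme" and B :: "('k, 'b, 'n) module_scheme"
    and C :: "('k, 'c, 'p) module_scheme" and G :: "('k, 'd, 'q) module_scheme"
  assumes ABC [simp]: "module K A" "module K B" "module K C" "module K G"
begin

declare closure_rules [simp]

lemma sw3_cong: "(\<And>a b c. a \<in> carrier A \<Longrightarrow> b \<in> carrier B \<Longrightarrow> c \<in> carrier C \<Longrightarrow> \<phi> a b c = \<psi> a b c) \<Longrightarrow>
  sw3 K A B C G z \<phi> = sw3 K A B C G z \<psi>"
  by (simp add: sw3_def cong: ktensor_sw_cong)

lemma sw3_closed: "(\<And>a b c. a \<in> carrier A \<Longrightarrow> b \<in> carrier B \<Longrightarrow> c \<in> carrier C \<Longrightarrow> \<phi> a b c \<in> carrier G) \<Longrightarrow>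
  sw3 K A B C G z \<phi> \<in> carrier G"
  by (simp add: sw3_def)

lemma sw3_tens:
  assumes "trilin K A B C G \<phi>" "a \<in> carrier A" "b \<in> carrier B" "c \<in> carrier C"
  shows "sw3 K A B C G (tens (ktensor K A (ktensor K B C)) a (tens (ktensor K B C) b c)) \<phi> = \<phi> a b c"
  using assms(2-) by (simp add: sw3_def eval_rules lin_rules trilinD[OF assms(1)])

lemma lin_sw3:
  assumes "module K Y" "\<And>a b c. a \<in> carrier A \<Longrightarrow> b \<in> carrier B \<Longrightarrow> c \<in> carrier C \<Longrightarrow> lin K Y G (\<lambda>x. \<phi> x a b c)"
  shows "lin K Y G (\<lambda>x. sw3 K A B C G z (\<phi> x))"
  using assms unfolding sw3_def by (simp add: lin_rules)

lemma lin_sw3_arg: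
  assumes "trilin K A B C G \<phi>" "lin K Y (ktensor K A (ktensor K B C)) f"
  shows "lin K Y G (\<lambda>x. sw3 K A B C G (f x) \<phi>)"
  using assms(2-) unfolding sw3_def by (simp add: lin_rules trilinD[OF assms(1)])

lemma sw3_hom:
  assumes "module K G'" "lin K G G' f"
    "\<And>a b c. a \<in> carrier A \<Longrightarrow> b \<in> carrier B \<Longrightarrow> c \<in> carrier C \<Longrightarrow> \<phi> a b c \<in> carrier G"
  shows "f (sw3 K A B C G z \<phi>) = sw3 K A B C G' z (\<lambda>a b c. f (\<phi> a b c))"
  using assms by (simp add: sw3_def ktensor_sw_hom[where f = f and G' = G'] cong: ktensor_sw_cong)

text \<open>The outer conversion needs the inner value to be bilinear. That is known for
  \<open>sw\<close> and is carried over to \<open>tlift\<close>, the two being equal on the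
  carriers.\<close>

lemma tlift_sw3:
  assumes "trilin K A B C G \<phi>" "z \<in> carrier (ktensor K A (ktensor K B C))"
  shows "tlift G z (\<lambda>a w. tlift G w (\<phi> a)) = sw3 K A B C G z \<phi>"
proof -
  note t = trilinD[OF assms(1)]
  have e: "tlift G w (\<phi> a) = sw K B C G w (\<phi> a)" if "a \<in> carrier A" "w \<in> carrier (ktensor K B C)" for a w
    using that by (intro ktensor_tlift_sw) (simp_all add: lin_rules t)
  have "lin K A G (\<lambda>a. tlift G w (\<phi> a)) = lin K A G (\<lambda>a. sw K B C G w (\<phi> a))" if "w \<in> carrier (ktensor K B C)" for w
    using that by (intro lin_cong) (simp_all add: e)
  moreover have "lin K (ktensor K B C) G (\<lambda>w. tlift G w (\<phi> a)) = lin K (ktensor K B C) G (\<lambda>w. sw K B C G w (\<phi> a))" if "a \<in> carrier A" for a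
    using that by (intro lin_cong) (simp_all add: e)
  ultimately have b: "bilin K A (ktensor K B C) G (\<lambda>a w. tlift G w (\<phi> a))"
    by (simp add: lin_rules t)
  have "tlift G z (\<lambda>a w. tlift G w (\<phi> a)) = sw K A (ktensor K B C) G z (\<lambda>a w. tlift G w (\<phi> a))"
    by (rule ktensor_tlift_sw) (use b assms(2) in simp_all)
  also have "\<dots> = sw3 K A B C G z \<phi>"
    unfolding sw3_def by (rule ktensor_sw_cong) (simp_all add: e)
  finally show ?thesis .
qed

lemma sw_sw3_swap:
  assumes "module K A'" "module K B'"
    "\<And>a b c d e. a \<in> carrier A \<Longrightarrow> b \<in> carrier B \<Longrightarrow> c \<in> carrier C \<Longrightarrow> d \<in> carrier A' \<Longrightarrow> e \<in> carrier B' \<Longrightarrow> \<phi> a b c d e \<in> carrier G"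
  shows "sw K A' B' G w (\<lambda>d e. sw3 K A B C G z (\<lambda>a b c. \<phi> a b c d e)) =
         sw3 K A B C G z (\<lambda>a b c. sw K A' B' G w (\<lambda>d e. \<phi> a b c d e))"
proof -
  have "sw K A' B' G w (\<lambda>d e. sw3 K A B C G z (\<lambda>a b c. \<phi> a b c d e)) =
     sw K A (ktensor K B C) G z (\<lambda>a v. sw K A' B' G w (\<lambda>d e. sw K B C G v (\<lambda>b c. \<phi> a b c d e)))"
    unfolding sw3_def by (rule ktensor_sw_swap) (simp_all add: assms)
  also have "\<dots> = sw K A (ktensor K B C) G z (\<lambda>a v. sw K B C G v (\<lambda>b c. sw K A' B' G w (\<lambda>d e. \<phi> a b c d e)))"
    by (intro ktensor_sw_cong ktensor_sw_swap) (simp_all add: assms)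
  finally show ?thesis unfolding sw3_def .
qed

end

lemma sw3_tensor:
  assumes "module K A" "module K B" "module K C" "z \<in> carrier (ktensor K A (ktensor K B C))"
  shows "sw3 K A B C (ktensor K A (ktensor K B C)) z
    (\<lambda>a b c. tens (ktensor K A (ktensor K B C)) a (tens (ktensor K B C) b c)) = z"
proof -
  let ?T = "ktensor K A (ktensor K B C)"
  have "sw3 K A B C ?T z (\<lambda>a b c. tens ?T a (tens (ktensor K B C) b c)) =
    sw K A (ktensor K B C) ?T z (\<lambda>a w. tens ?T a (sw K B C (ktensor K B C) w (tens (ktensor K B C))))"
    unfolding sw3_def
  proof (rule ktensor_sw_cong)
    fix a w assume a: "a \<in> carrier A"
    have l: "lin K (ktensor K B C) ?T (tens ?T a)"
      using lin_tens_r[OF assms(1) _ lin_ident a, of "ktensor K B C"] assms(2,3) by (simp only: module_ktensor)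
    show "sw K B C ?T w (\<lambda>b c. tens ?T a (tens (ktensor K B C) b c)) =
      tens ?T a (sw K B C (ktensor K B C) w (tens (ktensor K B C)))"
      by (rule ktensor_sw_hom[where f = "tens ?T a" and G = "ktensor K B C" and G' = ?T, symmetric])
        (simp_all add: assms closure_rules l)
  qed (simp_all add: assms closure_rules)
  also have "\<dots> = sw K A (ktensor K B C) ?T z (tens ?T)"
    by (rule ktensor_sw_cong) (simp_all add: assms closure_rules ktensor_sw_tensor)
  also have "\<dots> = z"
    by (rule ktensor_sw_tensor[OF assms(1) module_ktensor[OF assms(2,3)] assms(4)])
  finally show ?thesis .
qed

lemma sw3_mult_l:
  assumes "assoc_algebra K G" "module K A" "module K B" "module K C" "y \<in> carrier G"
    "\<And>a b c. a \<in> carrier A \<Longrightarrow> b \<in> carrier B \<Longrightarrow> c \<in> carrier C \<Longrightarrow> \<phi> a b c \<in> carrier G"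
  shows "sw3 K A B C G z \<phi> \<otimes>\<^bsub>G\<^esub> y = sw3 K A B C G z (\<lambda>a b c. \<phi> a b c \<otimes>\<^bsub>G\<^esub> y)"
  by (rule sw3_hom[OF assms(2-4) _ _ lin_mult_l[OF assms(1) lin_ident assms(5)]])
     (simp_all add: assms assoc_algebra_module)

lemma sw3_mult_r:
  assumes "assoc_algebra K G" "module K A" "module K B" "module K C" "y \<in> carrier G"
    "\<And>a b c. a \<in> carrier A \<Longrightarrow> b \<in> carrier B \<Longrightarrow> c \<in> carrier C \<Longrightarrow> \<phi> a b c \<in> carrier G"
  shows "y \<otimes>\<^bsub>G\<^esub> sw3 K A B C G z \<phi> = sw3 K A B C G z (\<lambda>a b c. y \<otimes>\<^bsub>G\<^esub> \<phi> a b c)"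
  by (rule sw3_hom[OF assms(2-4) _ _ lin_mult_r[OF assms(1) lin_ident assms(5)]])
     (simp_all add: assms assoc_algebra_module)

definition quadlin :: "'k ring \<Rightarrow> ('k, 'a, 'm) module_scheme \<Rightarrow> ('k, 'b, 'n) module_scheme
    \<Rightarrow> ('k, 'c, 'p) module_scheme \<Rightarrow> ('k, 'd, 'q) module_scheme \<Rightarrow> ('k, 'e, 'r) module_scheme
    \<Rightarrow> ('a \<Rightarrow> 'b \<Rightarrow> 'c \<Rightarrow> 'd \<Rightarrow> 'e) \<Rightarrow> bool"
  where "quadlin K A B C D G \<phi> \<longleftrightarrow> (\<forall>a\<in>carrier A. trilin K B C D G (\<phi> a)) \<and>
    (\<forall>b\<in>carrier B. \<forall>c\<in>carrier C. \<forall>d\<in>carrier D. lin K A G (\<lambda>a. \<phi> a b c d))"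

lemma quadlinD:
  assumes "quadlin K A B C D G \<phi>"
  shows "a \<in> carrier A \<Longrightarrow> b \<in> carrier B \<Longrightarrow> c \<in> carrier C \<Longrightarrow> d \<in> carrier D \<Longrightarrow> \<phi> a b c d \<in> carrier G"
   "lin K Y A f1 \<Longrightarrow> b \<in> carrier B \<Longrightarrow> c \<in> carrier C \<Longrightarrow> d \<in> carrier D \<Longrightarrow> lin K Y G (\<lambda>x. \<phi> (f1 x) b c d)"
   "lin K Y B f2 \<Longrightarrow> a \<in> carrier A \<Longrightarrow> c \<in> carrier C \<Longrightarrow> d \<in> carrier D \<Longrightarrow> lin K Y G (\<lambda>x. \<phi> a (f2 x) c d)"
   "lin K Y C f3 \<Longrightarrow> a \<in> carrier A \<Longrightarrow> b \<in> carrier B \<Longrightarrow> d \<in> carrier D \<Longrightarrow> lin K Y G (\<lambda>x. \<phi> a b (f3 x) d)"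
   "lin K Y D f4 \<Longrightarrow> a \<in> carrier A \<Longrightarrow> b \<in> carrier B \<Longrightarrow> c \<in> carrier C \<Longrightarrow> lin K Y G (\<lambda>x. \<phi> a b c (f4 x))"
  using assms by (simp_all add: quadlin_def trilin_def bilin_def lin_def)

text \<open>The universal property in the form in which the axioms are used: an equation between
  tensors is mapped through \<open>\<Phi>\<close>, which yields the Sweedler identity for every
  bilinear \<open>\<phi>\<close> and so a rule that applies inside larger expressions.\<close>

lemma bilin_eval:
  assumes "module K A" "module K B" "module K G" "bilin K A B G \<phi>"
  obtains \<Phi> where "lin K (ktensor K A B) G \<Phi>"
    "\<And>a b. a \<in> carrier A \<Longrightarrow> b \<in> carrier B \<Longrightarrow> \<Phi> (tens (ktensor K A B) a b) = \<phi> a b"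
proof
  show "lin K (ktensor K A B) G (\<lambda>z. sw K A B G z \<phi>)"
    using assms by (intro ktensor_lin_sw_arg lin_ident)
qed (simp add: assms ktensor_sw_tens)

lemma trilin_eval:
  assumes "module K A" "module K B" "module K C" "module K G" "trilin K A B C G \<phi>"
  obtains \<Phi> where "lin K (ktensor K A (ktensor K B C)) G \<Phi>"
    "\<And>a b c. a \<in> carrier A \<Longrightarrow> b \<in> carrier B \<Longrightarrow> c \<in> carrier C \<Longrightarrow>
      \<Phi> (tens (ktensor K A (ktensor K B C)) a (tens (ktensor K B C) b c)) = \<phi> a b c"
proof
  show "lin K (ktensor K A (ktensor K B C)) G (\<lambda>z. sw3 K A B C G z \<phi>)"
    using assms by (intro lin_sw3_arg lin_ident)
qed (simp add: assms sw3_tens)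

lemma quadlin_eval:
  assumes "module K A" "module K B" "module K C" "module K D" "module K G" "quadlin K A B C D G \<phi>"
  obtains \<Phi> where "lin K (ktensor K A (ktensor K B (ktensor K C D))) G \<Phi>"
    "\<And>a b c d. a \<in> carrier A \<Longrightarrow> b \<in> carrier B \<Longrightarrow> c \<in> carrier C \<Longrightarrow> d \<in> carrier D \<Longrightarrow>
      \<Phi> (tens (ktensor K A (ktensor K B (ktensor K C D))) a
          (tens (ktensor K B (ktensor K C D)) b (tens (ktensor K C D) c d))) = \<phi> a b c d"
proof -
  have "trilin K A B (ktensor K C D) G (\<lambda>a b w. sw K C D G w (\<phi> a b))"
    unfolding trilin_def by (simp add: assms(1-5) quadlinD[OF assms(6)] lin_rules closure_rules)
  from trilin_eval[OF assms(1,2) module_ktensor[OF assms(3,4)] assms(5) this]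
  obtain \<Phi> where \<Phi>: "lin K (ktensor K A (ktensor K B (ktensor K C D))) G \<Phi>"
    "\<And>a b w. a \<in> carrier A \<Longrightarrow> b \<in> carrier B \<Longrightarrow> w \<in> carrier (ktensor K C D) \<Longrightarrow>
      \<Phi> (tens (ktensor K A (ktensor K B (ktensor K C D))) a (tens (ktensor K B (ktensor K C D)) b w)) =
        sw K C D G w (\<phi> a b)"
    by blast
  show thesis
    by (rule that[OF \<Phi>(1)]) (simp add: \<Phi>(2) assms(1-5) closure_rules eval_rules lin_rules quadlinD[OF assms(6)])
qed

section \<open>Sweedler calculus in Hopf algebras\<close>

locale hopf =
  fixes K :: "'k ring" and H :: "('k, 'a) hopf"
  assumes hopf: "hopf_algebra K H"
begin

abbreviation "HH \<equiv> ktensor K H H"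
abbreviation "HHH \<equiv> ktensor K H HH"

lemma alg [simp]: "assoc_algebra K H"
  and comult_alg_hom: "comult H \<in> alg_hom K H HH"
  and counit_ring_hom: "counit H \<in> ring_hom H K"
  and counit_smult: "\<And>c h. c \<in> carrier K \<Longrightarrow> h \<in> carrier H \<Longrightarrow> counit H (c \<odot>\<^bsub>H\<^esub> h) = c \<otimes>\<^bsub>K\<^esub> counit H h"
  and coassoc_axiom: "\<And>h. h \<in> carrier H \<Longrightarrow>
          tlift HHH (comult H h) (\<lambda>h1 h2. tlift HHH (comult H h1) (\<lambda>h11 h12.
            tens HHH h11 (tens HH h12 h2))) =
          tlift HHH (comult H h) (\<lambda>h1 h2. tens HHH h1 (comult H h2))"
  and counit_axiom: "\<And>h. h \<in> carrier H \<Longrightarrow> tlift H (comult H h) (\<lambda>h1 h2. counit H h1 \<odot>\<^bsub>H\<^esub> h2) = h"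
     "\<And>h. h \<in> carrier H \<Longrightarrow> tlift H (comult H h) (\<lambda>h1 h2. counit H h2 \<odot>\<^bsub>H\<^esub> h1) = h"
  using hopf unfolding hopf_algebra_def Let_def by blast+

lemma mod [simp]: "module K H"
  by (rule assoc_algebra_module[OF alg])

declare closure_rules [simp] alg_closed(1,2)[where K = K, simp] alg_closed(3,4)[where K = K, simp]
  module_smult_closed[where K = K, simp] lin_rules [simp]

lemma comult_in [simp]: "h \<in> carrier H \<Longrightarrow> comult H h \<in> carrier HH"
  using comult_alg_hom by (auto simp: alg_hom_def ring_hom_def)

lemma lin_comult_H: "lin K H HH (comult H)"
  using comult_alg_hom by (auto simp: alg_hom_def ring_hom_def lin_def)

lemmas lin_comult [simp] = lin_comp[OF lin_comult_H]

lemma counit_in [simp]: "h \<in> carrier H \<Longrightarrow> counit H h \<in> carrier K"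
  using counit_ring_hom by (auto simp: ring_hom_def)

lemma counit_mult: "g \<in> carrier H \<Longrightarrow> h \<in> carrier H \<Longrightarrow> counit H (g \<otimes>\<^bsub>H\<^esub> h) = counit H g \<otimes>\<^bsub>K\<^esub> counit H h"
  and counit_one: "counit H \<one>\<^bsub>H\<^esub> = \<one>\<^bsub>K\<^esub>"
  using counit_ring_hom by (auto simp: ring_hom_def)

text \<open>\<open>K\<close> is a ring and not a module record, so linearity of \<epsilon> is
  expressed through its values acting as scalars on a fixed vector.\<close>

lemma lin_counit [simp]:
  assumes "module K G" "g \<in> carrier G" "lin K Y H f"
  shows "lin K Y G (\<lambda>x. counit H (f x) \<odot>\<^bsub>G\<^esub> g)"
proof -
  interpret G: module K G by fact
  have "lin K H G (\<lambda>x. counit H x \<odot>\<^bsub>G\<^esub> g)"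
    using counit_ring_hom assms(2) counit_smult
    by (auto simp: lin_def ring_hom_def G.smult_l_distr G.smult_assoc1)
  then show ?thesis using assms(3) by (rule lin_comp)
qed

lemma tlift_comult: "h \<in> carrier H \<Longrightarrow> module K G \<Longrightarrow> bilin K H H G \<phi> \<Longrightarrow>
    tlift G (comult H h) \<phi> = sw K H H G (comult H h) \<phi>"
  by (intro ktensor_tlift_sw mod comult_in)

lemma comult_mult:
  assumes gh [simp]: "g \<in> carrier H" "h \<in> carrier H" and G [simp]: "module K G" and \<phi>: "bilin K H H G \<phi>"
  shows "sw K H H G (comult H (g \<otimes>\<^bsub>H\<^esub> h)) \<phi> =
    sw K H H G (comult H g) (\<lambda>g1 g2. sw K H H G (comult H h) (\<lambda>h1 h2. \<phi> (g1 \<otimes>\<^bsub>H\<^esub> h1) (g2 \<otimes>\<^bsub>H\<^esub> h2)))"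
proof -
  obtain \<Phi> where \<Phi>: "lin K HH G \<Phi>" "\<And>a b. a \<in> carrier H \<Longrightarrow> b \<in> carrier H \<Longrightarrow> \<Phi> (tens HH a b) = \<phi> a b"
    using bilin_eval[OF mod mod G \<phi>] by blast
  have s: "sw K H H G z \<phi> = \<Phi> z" if z: "z \<in> carrier HH" for z
  proof -
    have "\<Phi> z = \<Phi> (sw K H H HH z (tens HH))" using z by (simp add: ktensor_sw_tensor)
    also have "\<dots> = sw K H H G z (\<lambda>a b. \<Phi> (tens HH a b))"
      by (rule ktensor_sw_hom) (simp_all add: \<Phi>(1))
    also have "\<dots> = sw K H H G z \<phi>" by (rule ktensor_sw_cong) (simp_all add: \<Phi>(2))
    finally show ?thesis by simp
  qed
  have "comult H (g \<otimes>\<^bsub>H\<^esub> h) = comult H g \<otimes>\<^bsub>HH\<^esub> comult H h"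
    using comult_alg_hom gh by (auto simp: alg_hom_def ring_hom_def)
  also have "\<dots> = sw K H H HH (comult H g) (tens HH) \<otimes>\<^bsub>HH\<^esub> sw K H H HH (comult H h) (tens HH)"
    by (simp add: ktensor_sw_tensor)
  also have "\<dots> = sw K H H HH (comult H g) (\<lambda>g1 g2. tens HH g1 g2 \<otimes>\<^bsub>HH\<^esub> sw K H H HH (comult H h) (tens HH))"
    by (rule ktensor_mult_sw_l) simp_all
  also have "\<dots> = sw K H H HH (comult H g) (\<lambda>g1 g2. sw K H H HH (comult H h) (\<lambda>h1 h2.
      tens HH (g1 \<otimes>\<^bsub>H\<^esub> h1) (g2 \<otimes>\<^bsub>H\<^esub> h2)))"
    by (simp add: ktensor_mult_sw_r ktensor_mult_tens cong: ktensor_sw_cong)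
  finally have "\<Phi> (comult H (g \<otimes>\<^bsub>H\<^esub> h)) = \<Phi> (sw K H H HH (comult H g) (\<lambda>g1 g2. sw K H H HH (comult H h) (\<lambda>h1 h2.
      tens HH (g1 \<otimes>\<^bsub>H\<^esub> h1) (g2 \<otimes>\<^bsub>H\<^esub> h2))))" by (rule arg_cong)
  then have "\<Phi> (comult H (g \<otimes>\<^bsub>H\<^esub> h)) =
    sw K H H G (comult H g) (\<lambda>g1 g2. sw K H H G (comult H h) (\<lambda>h1 h2. \<phi> (g1 \<otimes>\<^bsub>H\<^esub> h1) (g2 \<otimes>\<^bsub>H\<^esub> h2)))"
    by (simp add: ktensor_sw_hom[where f = \<Phi> and G = HH and G' = G] \<Phi> cong: ktensor_sw_cong)
  moreover have "sw K H H G (comult H (g \<otimes>\<^bsub>H\<^esub> h)) \<phi> = \<Phi> (comult H (g \<otimes>\<^bsub>H\<^esub> h))" by (rule s) simp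
  ultimately show ?thesis by (rule trans[rotated])
qed

lemma comult_one:
  assumes G [simp]: "module K G" and \<phi>: "bilin K H H G \<phi>"
  shows "sw K H H G (comult H \<one>\<^bsub>H\<^esub>) \<phi> = \<phi> \<one>\<^bsub>H\<^esub> \<one>\<^bsub>H\<^esub>"
proof -
  have "comult H \<one>\<^bsub>H\<^esub> = tens HH \<one>\<^bsub>H\<^esub> \<one>\<^bsub>H\<^esub>"
    using comult_alg_hom by (auto simp: alg_hom_def ring_hom_def ktensor_one)
  then show ?thesis using \<phi> by (simp add: ktensor_sw_tens del: bilin_def)
qed

lemma coassoc:
  assumes h [simp]: "h \<in> carrier H" and G [simp]: "module K G" and \<phi>: "trilin K H H H G \<phi>"
  shows "sw K H H G (comult H h) (\<lambda>a b. sw K H H G (comult H a) (\<lambda>a1 a2. \<phi> a1 a2 b)) =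
    sw K H H G (comult H h) (\<lambda>a b. sw K H H G (comult H b) (\<lambda>b1 b2. \<phi> a b1 b2))"
proof -
  obtain \<Phi> where \<Phi>: "lin K HHH G \<Phi>" "\<And>a b c. a \<in> carrier H \<Longrightarrow> b \<in> carrier H \<Longrightarrow> c \<in> carrier H \<Longrightarrow>
      \<Phi> (tens HHH a (tens HH b c)) = \<phi> a b c"
    using trilin_eval[OF mod mod mod G \<phi>] by blast
  have 1: "tlift HHH (comult H h) (\<lambda>h1 h2. tlift HHH (comult H h1) (\<lambda>h11 h12. tens HHH h11 (tens HH h12 h2))) =
     sw K H H HHH (comult H h) (\<lambda>h1 h2. sw K H H HHH (comult H h1) (\<lambda>h11 h12. tens HHH h11 (tens HH h12 h2)))"
  proof -
    have e: "tlift HHH (comult H h1) (\<lambda>h11 h12. tens HHH h11 (tens HH h12 h2)) =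
       sw K H H HHH (comult H h1) (\<lambda>h11 h12. tens HHH h11 (tens HH h12 h2))" if "h1 \<in> carrier H" "h2 \<in> carrier H" for h1 h2
      using that by (intro tlift_comult) simp_all
    \<comment> \<open>The linearity rules speak about \<open>sw\<close>; the inner
      \<open>tlift\<close> inherits bilinearity through equality on the carriers.\<close>
    have b: "bilin K H H HHH (\<lambda>h1 h2. tlift HHH (comult H h1) (\<lambda>h11 h12. tens HHH h11 (tens HH h12 h2))) =
      bilin K H H HHH (\<lambda>h1 h2. sw K H H HHH (comult H h1) (\<lambda>h11 h12. tens HHH h11 (tens HH h12 h2)))"
      unfolding bilin_def by (intro arg_cong2[where f = "(\<and>)"] ball_cong refl lin_cong mod e)
    show ?thesis by (subst tlift_comult) (simp_all only: h b mod, simp_all add: e cong: ktensor_sw_cong)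
  qed
  have 2: "tlift HHH (comult H h) (\<lambda>h1 h2. tens HHH h1 (comult H h2)) =
     sw K H H HHH (comult H h) (\<lambda>h1 h2. sw K H H HHH (comult H h2) (\<lambda>b1 b2. tens HHH h1 (tens HH b1 b2)))"
  proof -
    have "tlift HHH (comult H h) (\<lambda>h1 h2. tens HHH h1 (comult H h2)) =
        sw K H H HHH (comult H h) (\<lambda>h1 h2. tens HHH h1 (sw K H H HH (comult H h2) (tens HH)))"
      by (simp add: tlift_comult ktensor_sw_tensor cong: ktensor_sw_cong)
    also have "\<dots> = sw K H H HHH (comult H h) (\<lambda>h1 h2. sw K H H HHH (comult H h2) (\<lambda>b1 b2. tens HHH h1 (tens HH b1 b2)))"
      by (simp add: ktensor_sw_hom[where f = "tens HHH a" and G = HH and G' = HHH for a] cong: ktensor_sw_cong)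
    finally show ?thesis .
  qed
  have "\<Phi> (sw K H H HHH (comult H h) (\<lambda>h1 h2. sw K H H HHH (comult H h1) (\<lambda>h11 h12. tens HHH h11 (tens HH h12 h2)))) =
    \<Phi> (sw K H H HHH (comult H h) (\<lambda>h1 h2. sw K H H HHH (comult H h2) (\<lambda>b1 b2. tens HHH h1 (tens HH b1 b2))))"
    using coassoc_axiom[OF h] unfolding 1 2 by simp
  then show ?thesis
    by (simp add: ktensor_sw_hom[where f = \<Phi> and G = HHH and G' = G] \<Phi> cong: ktensor_sw_cong)
qed

lemma counit_left:
  assumes h [simp]: "h \<in> carrier H" and G [simp]: "module K G" and \<phi> [simp]: "lin K H G \<phi>"
  shows "sw K H H G (comult H h) (\<lambda>a b. counit H a \<odot>\<^bsub>G\<^esub> \<phi> b) = \<phi> h"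
proof -
  have "\<phi> h = \<phi> (sw K H H H (comult H h) (\<lambda>a b. counit H a \<odot>\<^bsub>H\<^esub> b))"
    using counit_axiom(1)[OF h] by (simp add: tlift_comult)
  also have "\<dots> = sw K H H G (comult H h) (\<lambda>a b. counit H a \<odot>\<^bsub>G\<^esub> \<phi> b)"
    by (simp add: ktensor_sw_hom[where f = \<phi> and G = H and G' = G] linD(3)[OF \<phi>] cong: ktensor_sw_cong)
  finally show ?thesis by simp
qed

lemma counit_right:
  assumes h [simp]: "h \<in> carrier H" and G [simp]: "module K G" and \<phi> [simp]: "lin K H G \<phi>"
  shows "sw K H H G (comult H h) (\<lambda>a b. counit H b \<odot>\<^bsub>G\<^esub> \<phi> a) = \<phi> h"
proof -
  have "\<phi> h = \<phi> (sw K H H H (comult H h) (\<lambda>a b. counit H b \<odot>\<^bsub>H\<^esub> a))"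
    using counit_axiom(2)[OF h] by (simp add: tlift_comult)
  also have "\<dots> = sw K H H G (comult H h) (\<lambda>a b. counit H b \<odot>\<^bsub>G\<^esub> \<phi> a)"
    by (simp add: ktensor_sw_hom[where f = \<phi> and G = H and G' = G] linD(3)[OF \<phi>] cong: ktensor_sw_cong)
  finally show ?thesis by simp
qed

end

lemma bilin_cong:
  assumes "module K A" "module K B" "\<And>a b. a \<in> carrier A \<Longrightarrow> b \<in> carrier B \<Longrightarrow> \<phi> a b = \<psi> a b"
  shows "bilin K A B G \<phi> = bilin K A B G \<psi>"
  unfolding bilin_def using assms(3)
  by (intro arg_cong2[where f = "(\<and>)"] ball_cong refl lin_cong assms(1,2)) auto

text \<open>Converts a sum together with its body. Only the converted body \<open>\<psi>\<close> has
  to be shown bilinear, so nested occurrences of \<open>tlift\<close> can be translated in a single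
  pass.\<close>

lemma tlift_sw_cong:
  assumes "module K A" "module K B" "module K G" "z \<in> carrier (ktensor K A B)"
    "\<And>a b. a \<in> carrier A \<Longrightarrow> b \<in> carrier B \<Longrightarrow> \<phi> a b = \<psi> a b" "bilin K A B G \<psi>"
  shows "tlift G z \<phi> = sw K A B G z \<psi>"
proof -
  have "bilin K A B G \<phi>" using bilin_cong[OF assms(1,2), of \<phi> \<psi> G] assms(5,6) by simp
  then have "tlift G z \<phi> = sw K A B G z \<phi>" by (rule ktensor_tlift_sw[OF assms(1-3) _ assms(4)])
  also have "\<dots> = sw K A B G z \<psi>" by (rule ktensor_sw_cong[OF assms(1,2,5)])
  finally show ?thesis .
qed

lemma alg_smult:
  assumes "assoc_algebra K A" "c \<in> carrier K" "x \<in> carrier A" "y \<in> carrier A"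
  shows "(c \<odot>\<^bsub>A\<^esub> x) \<otimes>\<^bsub>A\<^esub> y = c \<odot>\<^bsub>A\<^esub> (x \<otimes>\<^bsub>A\<^esub> y)" "x \<otimes>\<^bsub>A\<^esub> (c \<odot>\<^bsub>A\<^esub> y) = c \<odot>\<^bsub>A\<^esub> (x \<otimes>\<^bsub>A\<^esub> y)"
  using assms by (simp_all add: assoc_algebra_def)

lemma tens_smult:
  assumes "module K A" "module K B" "c \<in> carrier K" "a \<in> carrier A" "b \<in> carrier B"
  shows "tens (ktensor K A B) (c \<odot>\<^bsub>A\<^esub> a) b = c \<odot>\<^bsub>ktensor K A B\<^esub> tens (ktensor K A B) a b"
    "tens (ktensor K A B) a (c \<odot>\<^bsub>B\<^esub> b) = c \<odot>\<^bsub>ktensor K A B\<^esub> tens (ktensor K A B) a b"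
  using linD(3)[OF lin_tens_l[OF assms(1,2) lin_ident assms(5)] assms(3,4)]
    linD(3)[OF lin_tens_r[OF assms(1,2) lin_ident assms(4)] assms(3,5)] by simp_all

section \<open>Quasitriangular structure, module algebra and dynamical cocycle\<close>

locale quasitriangular_hopf = hopf +
  fixes R :: "('b, 'b) tensor"
  assumes qt: "quasitriangular K H R"
begin

lemma R_in [simp]: "R \<in> carrier HH"
  using qt by (simp add: quasitriangular_def Let_def Units_def)

lemma R_unit: "\<exists>R'\<in>carrier HH. R' \<otimes>\<^bsub>HH\<^esub> R = \<one>\<^bsub>HH\<^esub> \<and> R \<otimes>\<^bsub>HH\<^esub> R' = \<one>\<^bsub>HH\<^esub>"
  using qt by (simp add: quasitriangular_def Let_def Units_def)

lemma tlift_R: "module K G \<Longrightarrow> bilin K H H G \<phi> \<Longrightarrow> tlift G R \<phi> = sw K H H G R \<phi>"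
  by (rule ktensor_tlift_sw) simp_all

lemma hexagon_left:
  assumes G [simp]: "module K G" and \<phi>: "trilin K H H H G \<phi>"
  shows "sw K H H G R (\<lambda>r r'. sw K H H G (comult H r) (\<lambda>a b. \<phi> a b r')) =
    sw K H H G R (\<lambda>r r'. sw K H H G R (\<lambda>s s'. \<phi> r s (r' \<otimes>\<^bsub>H\<^esub> s')))"
proof -
  obtain \<Phi> where \<Phi>: "lin K HHH G \<Phi>" "\<And>a b c. a \<in> carrier H \<Longrightarrow> b \<in> carrier H \<Longrightarrow> c \<in> carrier H \<Longrightarrow>
      \<Phi> (tens HHH a (tens HH b c)) = \<phi> a b c"
    using trilin_eval[OF mod mod mod G \<phi>] by blast
  have 1: "tlift HHH R (\<lambda>r r'. tlift HHH (comult H r) (\<lambda>a b. tens HHH a (tens HH b r'))) =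
    sw K H H HHH R (\<lambda>r r'. sw K H H HHH (comult H r) (\<lambda>a b. tens HHH a (tens HH b r')))"
    by (rule tlift_sw_cong) (simp_all add: tlift_comult)
  have 2: "tlift HHH R (\<lambda>r1 r2. tens HHH r1 (tens HH \<one>\<^bsub>H\<^esub> r2)) = sw K H H HHH R (\<lambda>r1 r2. tens HHH r1 (tens HH \<one>\<^bsub>H\<^esub> r2))"
    "tlift HHH R (\<lambda>r1 r2. tens HHH \<one>\<^bsub>H\<^esub> (tens HH r1 r2)) = sw K H H HHH R (\<lambda>r1 r2. tens HHH \<one>\<^bsub>H\<^esub> (tens HH r1 r2))"
    by (simp_all add: tlift_R)
  have "sw K H H HHH R (\<lambda>r r'. sw K H H HHH (comult H r) (\<lambda>a b. tens HHH a (tens HH b r'))) =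
    sw K H H HHH R (\<lambda>r1 r2. tens HHH r1 (tens HH \<one>\<^bsub>H\<^esub> r2)) \<otimes>\<^bsub>HHH\<^esub>
    sw K H H HHH R (\<lambda>r1 r2. tens HHH \<one>\<^bsub>H\<^esub> (tens HH r1 r2))"
    unfolding 1[symmetric] 2[symmetric] using qt by (simp add: quasitriangular_def Let_def)
  also have "\<dots> = sw K H H HHH R (\<lambda>r1 r2. tens HHH r1 (tens HH \<one>\<^bsub>H\<^esub> r2) \<otimes>\<^bsub>HHH\<^esub>
    sw K H H HHH R (\<lambda>r1 r2. tens HHH \<one>\<^bsub>H\<^esub> (tens HH r1 r2)))"
    by (rule ktensor_mult_sw_l) simp_all
  also have "\<dots> = sw K H H HHH R (\<lambda>r r'. sw K H H HHH R (\<lambda>s s'. tens HHH r (tens HH s (r' \<otimes>\<^bsub>H\<^esub> s'))))"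
    by (simp add: ktensor_mult_sw_r ktensor_mult_tens cong: ktensor_sw_cong)
  finally have "\<Phi> (sw K H H HHH R (\<lambda>r r'. sw K H H HHH (comult H r) (\<lambda>a b. tens HHH a (tens HH b r')))) =
    \<Phi> (sw K H H HHH R (\<lambda>r r'. sw K H H HHH R (\<lambda>s s'. tens HHH r (tens HH s (r' \<otimes>\<^bsub>H\<^esub> s')))))"
    by (rule arg_cong)
  then show ?thesis
    by (simp add: ktensor_sw_hom[where f = \<Phi> and G = HHH and G' = G] \<Phi> cong: ktensor_sw_cong)
qed

text \<open>The product \<open>R13 R12\<close> is (r \<otimes> 1 \<otimes> r')(s \<otimes> s'
  \<otimes> 1): the copy that stands second feeds the middle leg, so \<open>s'\<close> precedes
  \<open>r'\<close>. This reversal is responsible later for the target map being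
  anti-multiplicative.\<close>

lemma hexagon_right:
  assumes G [simp]: "module K G" and \<phi>: "trilin K H H H G \<phi>"
  shows "sw K H H G R (\<lambda>r r'. sw K H H G (comult H r') (\<lambda>a b. \<phi> r a b)) =
    sw K H H G R (\<lambda>r r'. sw K H H G R (\<lambda>s s'. \<phi> (r \<otimes>\<^bsub>H\<^esub> s) s' r'))"
proof -
  obtain \<Phi> where \<Phi>: "lin K HHH G \<Phi>" "\<And>a b c. a \<in> carrier H \<Longrightarrow> b \<in> carrier H \<Longrightarrow> c \<in> carrier H \<Longrightarrow>
      \<Phi> (tens HHH a (tens HH b c)) = \<phi> a b c"
    using trilin_eval[OF mod mod mod G \<phi>] by blast
  have 0: "tens HHH r (comult H r') = sw K H H HHH (comult H r') (\<lambda>a b. tens HHH r (tens HH a b))"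
    if [simp]: "r \<in> carrier H" "r' \<in> carrier H" for r r'
  proof -
    have "tens HHH r (comult H r') = tens HHH r (sw K H H HH (comult H r') (tens HH))"
      by (simp add: ktensor_sw_tensor)
    also have "\<dots> = sw K H H HHH (comult H r') (\<lambda>a b. tens HHH r (tens HH a b))"
      by (simp add: ktensor_sw_hom[where f = "tens HHH r" and G = HH and G' = HHH])
    finally show ?thesis .
  qed
  have 1: "tlift HHH R (\<lambda>r r'. tens HHH r (comult H r')) =
    sw K H H HHH R (\<lambda>r r'. sw K H H HHH (comult H r') (\<lambda>a b. tens HHH r (tens HH a b)))"
    by (rule tlift_sw_cong) (simp_all add: 0)
  have 2: "tlift HHH R (\<lambda>r1 r2. tens HHH r1 (tens HH \<one>\<^bsub>H\<^esub> r2)) = sw K H H HHH R (\<lambda>r1 r2. tens HHH r1 (tens HH \<one>\<^bsub>H\<^esub> r2))"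
    "tlift HHH R (\<lambda>r1 r2. tens HHH r1 (tens HH r2 \<one>\<^bsub>H\<^esub>)) = sw K H H HHH R (\<lambda>r1 r2. tens HHH r1 (tens HH r2 \<one>\<^bsub>H\<^esub>))"
    by (simp_all add: tlift_R)
  have "sw K H H HHH R (\<lambda>r r'. sw K H H HHH (comult H r') (\<lambda>a b. tens HHH r (tens HH a b))) =
    sw K H H HHH R (\<lambda>r1 r2. tens HHH r1 (tens HH \<one>\<^bsub>H\<^esub> r2)) \<otimes>\<^bsub>HHH\<^esub>
    sw K H H HHH R (\<lambda>r1 r2. tens HHH r1 (tens HH r2 \<one>\<^bsub>H\<^esub>))"
    unfolding 1[symmetric] 2[symmetric] using qt by (simp add: quasitriangular_def Let_def)
  also have "\<dots> = sw K H H HHH R (\<lambda>r1 r2. tens HHH r1 (tens HH \<one>\<^bsub>H\<^esub> r2) \<otimes>\<^bsub>HHH\<^esub>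
    sw K H H HHH R (\<lambda>r1 r2. tens HHH r1 (tens HH r2 \<one>\<^bsub>H\<^esub>)))"
    by (rule ktensor_mult_sw_l) simp_all
  also have "\<dots> = sw K H H HHH R (\<lambda>r r'. sw K H H HHH R (\<lambda>s s'. tens HHH (r \<otimes>\<^bsub>H\<^esub> s) (tens HH s' r')))"
    by (simp add: ktensor_mult_sw_r ktensor_mult_tens cong: ktensor_sw_cong)
  finally have "\<Phi> (sw K H H HHH R (\<lambda>r r'. sw K H H HHH (comult H r') (\<lambda>a b. tens HHH r (tens HH a b)))) =
    \<Phi> (sw K H H HHH R (\<lambda>r r'. sw K H H HHH R (\<lambda>s s'. tens HHH (r \<otimes>\<^bsub>H\<^esub> s) (tens HH s' r'))))"
    by (rule arg_cong)
  then show ?thesis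
    by (simp add: ktensor_sw_hom[where f = \<Phi> and G = HHH and G' = G] \<Phi> cong: ktensor_sw_cong)
qed

text \<open>Quasi-cocommutativity for arbitrary bilinear maps. The sum over \<open>R\<close> is kept
  outermost on both sides, so that the rule changes only the innermost products.\<close>

lemma R_comult:
  assumes h [simp]: "h \<in> carrier H" and G [simp]: "module K G" and \<phi>: "bilin K H H G \<phi>"
  shows "sw K H H G R (\<lambda>r r'. sw K H H G (comult H h) (\<lambda>h1 h2. \<phi> (r \<otimes>\<^bsub>H\<^esub> h1) (r' \<otimes>\<^bsub>H\<^esub> h2))) =
    sw K H H G R (\<lambda>r r'. sw K H H G (comult H h) (\<lambda>h1 h2. \<phi> (h2 \<otimes>\<^bsub>H\<^esub> r) (h1 \<otimes>\<^bsub>H\<^esub> r')))"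
proof -
  obtain \<Phi> where \<Phi>: "lin K HH G \<Phi>" "\<And>a b. a \<in> carrier H \<Longrightarrow> b \<in> carrier H \<Longrightarrow> \<Phi> (tens HH a b) = \<phi> a b"
    using bilin_eval[OF mod mod G \<phi>] by blast
  have cl: "\<phi> a b \<in> carrier G" if "a \<in> carrier H" "b \<in> carrier H" for a b
    using bilinD(3)[OF \<phi> that] .
  have 1: "R \<otimes>\<^bsub>HH\<^esub> comult H h = sw K H H HH R (\<lambda>r r'. sw K H H HH (comult H h) (\<lambda>h1 h2. tens HH (r \<otimes>\<^bsub>H\<^esub> h1) (r' \<otimes>\<^bsub>H\<^esub> h2)))"
  proof -
    have "R \<otimes>\<^bsub>HH\<^esub> comult H h = sw K H H HH R (tens HH) \<otimes>\<^bsub>HH\<^esub> sw K H H HH (comult H h) (tens HH)"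
      by (simp add: ktensor_sw_tensor)
    also have "\<dots> = sw K H H HH R (\<lambda>r r'. tens HH r r' \<otimes>\<^bsub>HH\<^esub> sw K H H HH (comult H h) (tens HH))"
      by (rule ktensor_mult_sw_l) simp_all
    also have "\<dots> = sw K H H HH R (\<lambda>r r'. sw K H H HH (comult H h) (\<lambda>h1 h2. tens HH (r \<otimes>\<^bsub>H\<^esub> h1) (r' \<otimes>\<^bsub>H\<^esub> h2)))"
      by (simp add: ktensor_mult_sw_r ktensor_mult_tens cong: ktensor_sw_cong)
    finally show ?thesis .
  qed
  have 2: "tlift HH (comult H h) (\<lambda>h1 h2. tens HH h2 h1) \<otimes>\<^bsub>HH\<^esub> R =
     sw K H H HH (comult H h) (\<lambda>h1 h2. sw K H H HH R (\<lambda>r r'. tens HH (h2 \<otimes>\<^bsub>H\<^esub> r) (h1 \<otimes>\<^bsub>H\<^esub> r')))"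
  proof -
    have "tlift HH (comult H h) (\<lambda>h1 h2. tens HH h2 h1) \<otimes>\<^bsub>HH\<^esub> R =
      sw K H H HH (comult H h) (\<lambda>h1 h2. tens HH h2 h1) \<otimes>\<^bsub>HH\<^esub> sw K H H HH R (tens HH)"
      by (simp add: ktensor_sw_tensor tlift_comult)
    also have "\<dots> = sw K H H HH (comult H h) (\<lambda>h1 h2. tens HH h2 h1 \<otimes>\<^bsub>HH\<^esub> sw K H H HH R (tens HH))"
      by (rule ktensor_mult_sw_l) simp_all
    also have "\<dots> = sw K H H HH (comult H h) (\<lambda>h1 h2. sw K H H HH R (\<lambda>r r'. tens HH (h2 \<otimes>\<^bsub>H\<^esub> r) (h1 \<otimes>\<^bsub>H\<^esub> r')))"
      by (simp add: ktensor_mult_sw_r ktensor_mult_tens cong: ktensor_sw_cong)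
    finally show ?thesis .
  qed
  have "R \<otimes>\<^bsub>HH\<^esub> comult H h = tlift HH (comult H h) (\<lambda>h1 h2. tens HH h2 h1) \<otimes>\<^bsub>HH\<^esub> R"
    using qt by (simp add: quasitriangular_def Let_def)
  then have "\<Phi> (R \<otimes>\<^bsub>HH\<^esub> comult H h) = \<Phi> (tlift HH (comult H h) (\<lambda>h1 h2. tens HH h2 h1) \<otimes>\<^bsub>HH\<^esub> R)"
    by (rule arg_cong)
  then have "sw K H H G R (\<lambda>r r'. sw K H H G (comult H h) (\<lambda>h1 h2. \<phi> (r \<otimes>\<^bsub>H\<^esub> h1) (r' \<otimes>\<^bsub>H\<^esub> h2))) =
    sw K H H G (comult H h) (\<lambda>h1 h2. sw K H H G R (\<lambda>r r'. \<phi> (h2 \<otimes>\<^bsub>H\<^esub> r) (h1 \<otimes>\<^bsub>H\<^esub> r')))"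
    unfolding 1 2 by (simp add: ktensor_sw_hom[where f = \<Phi> and G = HH and G' = G] \<Phi> cong: ktensor_sw_cong)
  moreover have "sw K H H G (comult H h) (\<lambda>h1 h2. sw K H H G R (\<lambda>r r'. \<phi> (h2 \<otimes>\<^bsub>H\<^esub> r) (h1 \<otimes>\<^bsub>H\<^esub> r'))) =
    sw K H H G R (\<lambda>r r'. sw K H H G (comult H h) (\<lambda>h1 h2. \<phi> (h2 \<otimes>\<^bsub>H\<^esub> r) (h1 \<otimes>\<^bsub>H\<^esub> r')))"
    by (rule ktensor_sw_swap) (simp_all add: cl)
  ultimately show ?thesis by (rule trans)
qed

text \<open>Applying \<open>\<epsilon>\<close> to the first leg of the hexagon identity gives \<open>\<R> = (1 \<otimes> e) \<R>\<close> with
  \<open>e = (\<epsilon> \<otimes> id)(\<R>)\<close>, and \<open>\<R>\<close> is invertible.\<close>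

lemma counit_R_left:
  assumes G [simp]: "module K G" and \<phi> [simp]: "lin K H G \<phi>"
  shows "sw K H H G R (\<lambda>r r'. counit H r \<odot>\<^bsub>G\<^esub> \<phi> r') = \<phi> \<one>\<^bsub>H\<^esub>"
proof -
  define e where "e = sw K H H H R (\<lambda>r r'. counit H r \<odot>\<^bsub>H\<^esub> r')"
  have e [simp]: "e \<in> carrier H" by (simp add: e_def)
  have "R = sw K H H HH R (\<lambda>r r'. tens HH r r')" by (simp add: ktensor_sw_tensor)
  also have "\<dots> = sw K H H HH R (\<lambda>r r'. sw K H H HH (comult H r) (\<lambda>a b. counit H a \<odot>\<^bsub>HH\<^esub> tens HH b r'))"
    by (simp add: counit_left cong: ktensor_sw_cong)
  also have "\<dots> = sw K H H HH R (\<lambda>r r'. sw K H H HH R (\<lambda>s s'. counit H r \<odot>\<^bsub>HH\<^esub> tens HH s (r' \<otimes>\<^bsub>H\<^esub> s')))"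
    by (rule hexagon_left[where \<phi> = "\<lambda>a b c. counit H a \<odot>\<^bsub>HH\<^esub> tens HH b c"]) (simp_all add: trilin_def)
  also have "\<dots> = sw K H H HH R (\<lambda>r r'. sw K H H HH R (\<lambda>s s'. tens HH \<one>\<^bsub>H\<^esub> (counit H r \<odot>\<^bsub>H\<^esub> r') \<otimes>\<^bsub>HH\<^esub> tens HH s s'))"
  proof -
    have "counit H r \<odot>\<^bsub>HH\<^esub> tens HH s (r' \<otimes>\<^bsub>H\<^esub> s') = tens HH \<one>\<^bsub>H\<^esub> (counit H r \<odot>\<^bsub>H\<^esub> r') \<otimes>\<^bsub>HH\<^esub> tens HH s s'"
      if "r \<in> carrier H" "r' \<in> carrier H" "s \<in> carrier H" "s' \<in> carrier H" for r r' s s'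
      using that by (simp add: ktensor_mult_tens tens_smult alg_smult[where K = K])
    then show ?thesis by (simp cong: ktensor_sw_cong)
  qed
  also have "\<dots> = sw K H H HH R (\<lambda>r r'. tens HH \<one>\<^bsub>H\<^esub> (counit H r \<odot>\<^bsub>H\<^esub> r') \<otimes>\<^bsub>HH\<^esub> sw K H H HH R (tens HH))"
    by (simp add: ktensor_mult_sw_r cong: ktensor_sw_cong)
  also have "\<dots> = sw K H H HH R (\<lambda>r r'. tens HH \<one>\<^bsub>H\<^esub> (counit H r \<odot>\<^bsub>H\<^esub> r')) \<otimes>\<^bsub>HH\<^esub> sw K H H HH R (tens HH)"
    by (rule ktensor_mult_sw_l[symmetric]) simp_all
  also have "sw K H H HH R (\<lambda>r r'. tens HH \<one>\<^bsub>H\<^esub> (counit H r \<odot>\<^bsub>H\<^esub> r')) = tens HH \<one>\<^bsub>H\<^esub> e"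
    unfolding e_def by (simp add: ktensor_sw_hom[where f = "tens HH \<one>\<^bsub>H\<^esub>" and G = H and G' = HH])
  finally have R: "tens HH \<one>\<^bsub>H\<^esub> e \<otimes>\<^bsub>HH\<^esub> R = R" by (simp add: ktensor_sw_tensor)
  obtain R' where R': "R' \<in> carrier HH" "R \<otimes>\<^bsub>HH\<^esub> R' = \<one>\<^bsub>HH\<^esub>" using R_unit by blast
  have "tens HH \<one>\<^bsub>H\<^esub> e = tens HH \<one>\<^bsub>H\<^esub> e \<otimes>\<^bsub>HH\<^esub> (R \<otimes>\<^bsub>HH\<^esub> R')" by (simp add: R')
  also have "\<dots> = (tens HH \<one>\<^bsub>H\<^esub> e \<otimes>\<^bsub>HH\<^esub> R) \<otimes>\<^bsub>HH\<^esub> R'"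
    by (rule alg_closed(5)[where K = K, symmetric]) (simp_all add: R')
  also have "\<dots> = \<one>\<^bsub>HH\<^esub>" by (simp add: R R')
  finally have "sw K H H H (tens HH \<one>\<^bsub>H\<^esub> e) (\<lambda>a b. counit H a \<odot>\<^bsub>H\<^esub> b) = sw K H H H (tens HH \<one>\<^bsub>H\<^esub> \<one>\<^bsub>H\<^esub>) (\<lambda>a b. counit H a \<odot>\<^bsub>H\<^esub> b)"
    by (simp add: ktensor_one)
  then have "e = \<one>\<^bsub>H\<^esub>" using module.smult_one[OF mod] by (simp add: ktensor_sw_tens counit_one)
  have "sw K H H G R (\<lambda>r r'. counit H r \<odot>\<^bsub>G\<^esub> \<phi> r') = \<phi> e"
    unfolding e_def by (simp add: ktensor_sw_hom[where f = \<phi> and G = H and G' = G] linD(3)[OF \<phi>] cong: ktensor_sw_cong)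
  then show ?thesis using \<open>e = \<one>\<^bsub>H\<^esub>\<close> by simp
qed

text \<open>Applying \<epsilon> to the middle leg of the other hexagon identity leaves R = R (e
  \<otimes> 1) with e = (id \<otimes> \<epsilon>)(R). The factor stands on the right this time, so
  it is a left inverse of \<open>R\<close> that cancels.\<close>

lemma counit_R_right:
  assumes G [simp]: "module K G" and \<phi> [simp]: "lin K H G \<phi>"
  shows "sw K H H G R (\<lambda>r r'. counit H r' \<odot>\<^bsub>G\<^esub> \<phi> r) = \<phi> \<one>\<^bsub>H\<^esub>"
proof -
  define e where "e = sw K H H H R (\<lambda>r r'. counit H r' \<odot>\<^bsub>H\<^esub> r)"
  have e [simp]: "e \<in> carrier H" by (simp add: e_def)
  have "R = sw K H H HH R (\<lambda>r r'. tens HH r r')" by (simp add: ktensor_sw_tensor)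
  also have "\<dots> = sw K H H HH R (\<lambda>r r'. sw K H H HH (comult H r') (\<lambda>a b. counit H a \<odot>\<^bsub>HH\<^esub> tens HH r b))"
    by (simp add: counit_left cong: ktensor_sw_cong)
  also have "\<dots> = sw K H H HH R (\<lambda>r r'. sw K H H HH R (\<lambda>s s'. counit H s' \<odot>\<^bsub>HH\<^esub> tens HH (r \<otimes>\<^bsub>H\<^esub> s) r'))"
    by (rule hexagon_right[where \<phi> = "\<lambda>a b c. counit H b \<odot>\<^bsub>HH\<^esub> tens HH a c"]) (simp_all add: trilin_def)
  also have "\<dots> = sw K H H HH R (\<lambda>r r'. sw K H H HH R (\<lambda>s s'. tens HH r r' \<otimes>\<^bsub>HH\<^esub> tens HH (counit H s' \<odot>\<^bsub>H\<^esub> s) \<one>\<^bsub>H\<^esub>))"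
  proof -
    have "counit H s' \<odot>\<^bsub>HH\<^esub> tens HH (r \<otimes>\<^bsub>H\<^esub> s) r' = tens HH r r' \<otimes>\<^bsub>HH\<^esub> tens HH (counit H s' \<odot>\<^bsub>H\<^esub> s) \<one>\<^bsub>H\<^esub>"
      if "r \<in> carrier H" "r' \<in> carrier H" "s \<in> carrier H" "s' \<in> carrier H" for r r' s s'
      using that by (simp add: ktensor_mult_tens tens_smult alg_smult[where K = K])
    then show ?thesis by (simp cong: ktensor_sw_cong)
  qed
  also have "\<dots> = sw K H H HH R (\<lambda>r r'. tens HH r r' \<otimes>\<^bsub>HH\<^esub> sw K H H HH R (\<lambda>s s'. tens HH (counit H s' \<odot>\<^bsub>H\<^esub> s) \<one>\<^bsub>H\<^esub>))"
    by (simp add: ktensor_mult_sw_r cong: ktensor_sw_cong)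
  also have "\<dots> = sw K H H HH R (tens HH) \<otimes>\<^bsub>HH\<^esub> sw K H H HH R (\<lambda>s s'. tens HH (counit H s' \<odot>\<^bsub>H\<^esub> s) \<one>\<^bsub>H\<^esub>)"
    by (rule ktensor_mult_sw_l[symmetric]) simp_all
  also have "sw K H H HH R (\<lambda>s s'. tens HH (counit H s' \<odot>\<^bsub>H\<^esub> s) \<one>\<^bsub>H\<^esub>) = tens HH e \<one>\<^bsub>H\<^esub>"
    unfolding e_def by (simp add: ktensor_sw_hom[where f = "\<lambda>x. tens HH x \<one>\<^bsub>H\<^esub>" and G = H and G' = HH])
  finally have R: "R \<otimes>\<^bsub>HH\<^esub> tens HH e \<one>\<^bsub>H\<^esub> = R" by (simp add: ktensor_sw_tensor)
  obtain R' where R': "R' \<in> carrier HH" "R' \<otimes>\<^bsub>HH\<^esub> R = \<one>\<^bsub>HH\<^esub>" using R_unit by blast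
  have "tens HH e \<one>\<^bsub>H\<^esub> = (R' \<otimes>\<^bsub>HH\<^esub> R) \<otimes>\<^bsub>HH\<^esub> tens HH e \<one>\<^bsub>H\<^esub>" by (simp add: R')
  also have "\<dots> = R' \<otimes>\<^bsub>HH\<^esub> (R \<otimes>\<^bsub>HH\<^esub> tens HH e \<one>\<^bsub>H\<^esub>)"
    by (rule alg_closed(5)[where K = K]) (simp_all add: R')
  also have "\<dots> = \<one>\<^bsub>HH\<^esub>" by (simp add: R R')
  \<comment> \<open>Evaluating id \<otimes> \<epsilon> recovers \<open>e\<close> from e \<otimes> 1,
    so injectivity of the embedding into the tensor square is never an issue.\<close>
  finally have "sw K H H H (tens HH e \<one>\<^bsub>H\<^esub>) (\<lambda>a b. counit H b \<odot>\<^bsub>H\<^esub> a) = sw K H H H (tens HH \<one>\<^bsub>H\<^esub> \<one>\<^bsub>H\<^esub>) (\<lambda>a b. counit H b \<odot>\<^bsub>H\<^esub> a)"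
    by (simp add: ktensor_one)
  then have "e = \<one>\<^bsub>H\<^esub>" using module.smult_one[OF mod] by (simp add: ktensor_sw_tens counit_one)
  have "sw K H H G R (\<lambda>r r'. counit H r' \<odot>\<^bsub>G\<^esub> \<phi> r) = \<phi> e"
    unfolding e_def by (simp add: ktensor_sw_hom[where f = \<phi> and G = H and G' = G] linD(3)[OF \<phi>] cong: ktensor_sw_cong)
  then show ?thesis using \<open>e = \<one>\<^bsub>H\<^esub>\<close> by simp
qed

end

section \<open>The module algebra and the dynamical cocycle as rewriting rules\<close>

locale dynamical_data = quasitriangular_hopf K H R + Uh: hopf K U
  for K :: "'k ring" and H U :: "('k, 'u) hopf" and R :: "('u, 'u) tensor" +
  fixes L :: "('k, 'l) module" and act :: "'u \<Rightarrow> 'l \<Rightarrow> 'l" and F :: "('u, ('u, 'l) tensor) tensor"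
  assumes subalg: "hopf_subalgebra K H U"
    and modalg: "module_algebra K H act L"
    and Hcomm: "H_commutative R act L"
    and cocycle: "universal_dynamical_cocycle K H U act L (coaction_minus K H R act L) F"
begin

abbreviation "UU \<equiv> ktensor K U U"
abbreviation "UL \<equiv> ktensor K U L"
abbreviation "UUL \<equiv> ktensor K U UL"
abbreviation "UUUL \<equiv> ktensor K U UUL"
abbreviation "HL \<equiv> ktensor K H L"

lemma H_sub_U [simp]: "h \<in> carrier H \<Longrightarrow> h \<in> carrier U"
  using subalg by (auto simp: hopf_subalgebra_def Let_def)

lemma inclusion_hom: "(\<lambda>h. h) \<in> alg_hom K H U"
  using subalg by (auto simp: hopf_subalgebra_def Let_def)

lemma mult_H_U: "g \<in> carrier H \<Longrightarrow> h \<in> carrier H \<Longrightarrow> g \<otimes>\<^bsub>H\<^esub> h = g \<otimes>\<^bsub>U\<^esub> h"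
  and one_H_U: "\<one>\<^bsub>H\<^esub> = \<one>\<^bsub>U\<^esub>"
  using inclusion_hom by (auto simp: alg_hom_def ring_hom_def)

lemma lin_H_U [simp]: "lin K Y H f \<Longrightarrow> lin K Y U f"
  using inclusion_hom by (auto simp: alg_hom_def ring_hom_def lin_def)

lemma counit_H_U: "h \<in> carrier H \<Longrightarrow> counit U h = counit H h"
  using subalg by (auto simp: hopf_subalgebra_def Let_def)

text \<open>The two comultiplications of \<open>h\<close> lie in different tensor squares and are
  not equal as sets; the sums agree because the canonical map from the tensor square of
  \<open>H\<close> to that of \<open>U\<close> carries one to the other.\<close>

lemma comult_U_H:
  assumes h [simp]: "h \<in> carrier H" and G [simp]: "module K G" and \<phi>: "bilin K U U G \<phi>"
  shows "sw K U U G (comult U h) \<phi> = sw K H H G (comult H h) \<phi>"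
proof -
  have "tlift UU (comult H h) (tens UU) = comult U h"
    using subalg h by (auto simp: hopf_subalgebra_def Let_def)
  then have "comult U h = sw K H H UU (comult H h) (tens UU)"
    by (simp add: tlift_comult)
  then have "sw K U U G (comult U h) \<phi> = sw K U U G (sw K H H UU (comult H h) (tens UU)) \<phi>" by simp
  also have "\<dots> = sw K H H G (comult H h) (\<lambda>a b. sw K U U G (tens UU a b) \<phi>)"
    by (rule ktensor_sw_hom[where f = "\<lambda>x. sw K U U G x \<phi>" and G = UU and G' = G])
       (auto intro!: ktensor_lin_sw_arg \<phi> simp del: bilin_def)
  also have "\<dots> = sw K H H G (comult H h) \<phi>"
    by (rule ktensor_sw_cong) (simp_all add: ktensor_sw_tens[OF _ _ _ \<phi>])
  finally show ?thesis .
qed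

lemma algL [simp]: "assoc_algebra K L"
  and act_closed [simp]: "h \<in> carrier H \<Longrightarrow> l \<in> carrier L \<Longrightarrow> act h l \<in> carrier L"
  and act_mult: "g \<in> carrier H \<Longrightarrow> h \<in> carrier H \<Longrightarrow> l \<in> carrier L \<Longrightarrow> act (g \<otimes>\<^bsub>H\<^esub> h) l = act g (act h l)"
  and act_one: "l \<in> carrier L \<Longrightarrow> act \<one>\<^bsub>H\<^esub> l = l"
  and act_unit: "h \<in> carrier H \<Longrightarrow> act h \<one>\<^bsub>L\<^esub> = counit H h \<odot>\<^bsub>L\<^esub> \<one>\<^bsub>L\<^esub>"
  using modalg unfolding module_algebra_def by blast+

lemma modL [simp]: "module K L"
  by (rule assoc_algebra_module[OF algL])

lemma bilin_act: "bilin K H L L act"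
  using modalg unfolding module_algebra_def bilin_def lin_def by blast

lemmas lin_act [simp] = bilin_comp_l[OF bilin_act] bilin_comp_r[OF bilin_act]

lemma act_prod:
  assumes [simp]: "h \<in> carrier H" "l \<in> carrier L" "m \<in> carrier L"
  shows "act h (l \<otimes>\<^bsub>L\<^esub> m) = sw K H H L (comult H h) (\<lambda>h1 h2. act h1 l \<otimes>\<^bsub>L\<^esub> act h2 m)"
proof -
  have "act h (l \<otimes>\<^bsub>L\<^esub> m) = tlift L (comult H h) (\<lambda>h1 h2. act h1 l \<otimes>\<^bsub>L\<^esub> act h2 m)"
    using modalg assms unfolding module_algebra_def by blast
  then show ?thesis by (simp add: tlift_comult)
qed

lemma H_comm:
  assumes [simp]: "l \<in> carrier L" "m \<in> carrier L"
  shows "l \<otimes>\<^bsub>L\<^esub> m = sw K H H L R (\<lambda>r1 r2. act r2 m \<otimes>\<^bsub>L\<^esub> act r1 l)"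
proof -
  have "l \<otimes>\<^bsub>L\<^esub> m = tlift L R (\<lambda>r1 r2. act r2 m \<otimes>\<^bsub>L\<^esub> act r1 l)"
    using Hcomm assms unfolding H_commutative_def by blast
  then show ?thesis by (simp add: tlift_R)
qed

lemma coaction_eq:
  "l \<in> carrier L \<Longrightarrow> coaction_minus K H R act L l = sw K H H HL R (\<lambda>r1 r2. tens HL r2 (act r1 l))"
  by (simp add: coaction_minus_def Let_def tlift_R)

declare lin_sw3 [simp] lin_sw3_arg [simp] sw3_closed [simp]

lemma F_in [simp]: "F \<in> carrier UUL"
  using cocycle by (simp add: universal_dynamical_cocycle_def Let_def Units_def)

lemma F_equivariant:
  assumes h [simp]: "h \<in> carrier H" and G [simp]: "module K G" and \<phi>: "trilin K U U L G \<phi>"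
  shows "sw K H H G (comult H h) (\<lambda>h1 h'. sw K H H G (comult H h') (\<lambda>h2 h3.
            sw3 K U U L G F (\<lambda>f1 f2 f3. \<phi> (h1 \<otimes>\<^bsub>U\<^esub> f1) (h2 \<otimes>\<^bsub>U\<^esub> f2) (act h3 f3)))) =
         sw K H H G (comult H h) (\<lambda>h1 h2. sw3 K U U L G F (\<lambda>f1 f2 f3. \<phi> (f1 \<otimes>\<^bsub>U\<^esub> h1) (f2 \<otimes>\<^bsub>U\<^esub> h2) f3))"
proof -
  obtain \<Phi> where \<Phi>: "lin K UUL G \<Phi>" "\<And>a b c. a \<in> carrier U \<Longrightarrow> b \<in> carrier U \<Longrightarrow> c \<in> carrier L \<Longrightarrow>
      \<Phi> (tens UUL a (tens UL b c)) = \<phi> a b c"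
    using trilin_eval[OF Uh.mod Uh.mod modL G \<phi>] by blast
  have 1: "tlift UUL (comult H h) (\<lambda>h1 h'. tlift UUL (comult H h') (\<lambda>h2 h3.
            tlift UUL F (\<lambda>f1 g. tlift UUL g (\<lambda>f2 f3.
              tens UUL (h1 \<otimes>\<^bsub>U\<^esub> f1) (tens UL (h2 \<otimes>\<^bsub>U\<^esub> f2) (act h3 f3)))))) =
    sw K H H UUL (comult H h) (\<lambda>h1 h'. sw K H H UUL (comult H h') (\<lambda>h2 h3.
            sw3 K U U L UUL F (\<lambda>f1 f2 f3. tens UUL (h1 \<otimes>\<^bsub>U\<^esub> f1) (tens UL (h2 \<otimes>\<^bsub>U\<^esub> f2) (act h3 f3)))))"
    by (intro tlift_sw_cong tlift_sw3 mod Uh.mod modL) (simp_all add: trilin_def)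
  have 2: "tlift UUL (comult H h) (\<lambda>h1 h2.
            tlift UUL F (\<lambda>f1 g. tlift UUL g (\<lambda>f2 f3.
              tens UUL (f1 \<otimes>\<^bsub>U\<^esub> h1) (tens UL (f2 \<otimes>\<^bsub>U\<^esub> h2) f3)))) =
    sw K H H UUL (comult H h) (\<lambda>h1 h2.
            sw3 K U U L UUL F (\<lambda>f1 f2 f3. tens UUL (f1 \<otimes>\<^bsub>U\<^esub> h1) (tens UL (f2 \<otimes>\<^bsub>U\<^esub> h2) f3)))"
    by (intro tlift_sw_cong tlift_sw3 mod Uh.mod modL) (simp_all add: trilin_def)
  have "tlift UUL (comult H h) (\<lambda>h1 h'. tlift UUL (comult H h') (\<lambda>h2 h3.
            tlift UUL F (\<lambda>f1 g. tlift UUL g (\<lambda>f2 f3.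
              tens UUL (h1 \<otimes>\<^bsub>U\<^esub> f1) (tens UL (h2 \<otimes>\<^bsub>U\<^esub> f2) (act h3 f3)))))) =
      tlift UUL (comult H h) (\<lambda>h1 h2.
            tlift UUL F (\<lambda>f1 g. tlift UUL g (\<lambda>f2 f3.
              tens UUL (f1 \<otimes>\<^bsub>U\<^esub> h1) (tens UL (f2 \<otimes>\<^bsub>U\<^esub> h2) f3))))"
    using cocycle h unfolding universal_dynamical_cocycle_def Let_def by blast
  then have "\<Phi> (sw K H H UUL (comult H h) (\<lambda>h1 h'. sw K H H UUL (comult H h') (\<lambda>h2 h3.
            sw3 K U U L UUL F (\<lambda>f1 f2 f3. tens UUL (h1 \<otimes>\<^bsub>U\<^esub> f1) (tens UL (h2 \<otimes>\<^bsub>U\<^esub> f2) (act h3 f3)))))) =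
    \<Phi> (sw K H H UUL (comult H h) (\<lambda>h1 h2.
            sw3 K U U L UUL F (\<lambda>f1 f2 f3. tens UUL (f1 \<otimes>\<^bsub>U\<^esub> h1) (tens UL (f2 \<otimes>\<^bsub>U\<^esub> h2) f3))))"
    unfolding 1 2 by (rule arg_cong)
  then show ?thesis
    by (simp add: ktensor_sw_hom[where f = \<Phi> and G = UUL and G' = G] sw3_hom[where f = \<Phi> and G = UUL and G' = G]
       \<Phi> cong: ktensor_sw_cong sw3_cong)
qed

text \<open>The coaction \<delta>(g3) = r' \<otimes> (r \<triangleright> g3) is unfolded: the second
  leg of \<open>R\<close> multiplies the third leg in \<open>U\<close> from the right, and the first
  leg acts on the component in \<open>L\<close>.\<close>

lemma F_cocycle:
  assumes G [simp]: "module K G" and \<phi>: "quadlin K U U U L G \<phi>"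
  shows "sw3 K U U L G F (\<lambda>f1 f2 f3. sw K U U G (comult U f1) (\<lambda>a b. sw3 K U U L G F (\<lambda>g1 g2 g3.
            sw K H H G R (\<lambda>r r'. \<phi> (a \<otimes>\<^bsub>U\<^esub> g1) (b \<otimes>\<^bsub>U\<^esub> g2) (f2 \<otimes>\<^bsub>U\<^esub> r') (f3 \<otimes>\<^bsub>L\<^esub> act r g3))))) =
         sw3 K U U L G F (\<lambda>f1 f2 f3. sw K U U G (comult U f2) (\<lambda>a b. sw3 K U U L G F (\<lambda>g1 g2 g3.
            \<phi> f1 (a \<otimes>\<^bsub>U\<^esub> g1) (b \<otimes>\<^bsub>U\<^esub> g2) (f3 \<otimes>\<^bsub>L\<^esub> g3))))"
proof -
  let ?t = "\<lambda>a b c d. tens UUUL a (tens UUL b (tens UL c d))"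
  obtain \<Phi> where \<Phi>: "lin K UUUL G \<Phi>" "\<And>a b c d. a \<in> carrier U \<Longrightarrow> b \<in> carrier U \<Longrightarrow> c \<in> carrier U \<Longrightarrow>
      d \<in> carrier L \<Longrightarrow> \<Phi> (?t a b c d) = \<phi> a b c d"
    using quadlin_eval[OF Uh.mod Uh.mod Uh.mod modL G \<phi>] by blast
  have 1: "tlift UUUL F (\<lambda>f1 g. tlift UUUL (comult U f1) (\<lambda>a b. tens UUUL a (tens UUL b g))) =
    sw3 K U U L UUUL F (\<lambda>f1 f2 f3. sw K U U UUUL (comult U f1) (\<lambda>a b. ?t a b f2 f3))"
  proof -
    have "tlift UUUL F (\<lambda>f1 g. tlift UUUL (comult U f1) (\<lambda>a b. tens UUUL a (tens UUL b g))) =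
      sw K U UL UUUL F (\<lambda>f1 g. sw K U U UUUL (comult U f1) (\<lambda>a b. tens UUUL a (tens UUL b g)))"
      by (intro tlift_sw_cong Uh.mod modL) simp_all
    also have "\<dots> = sw K U UL UUUL F (\<lambda>f1 g. sw K U L UUUL g (\<lambda>f2 f3. sw K U U UUUL (comult U f1) (\<lambda>a b. ?t a b f2 f3)))"
    proof (rule ktensor_sw_cong)
      fix f1 g assume [simp]: "f1 \<in> carrier U" "g \<in> carrier UL"
      have "sw K U U UUUL (comult U f1) (\<lambda>a b. tens UUUL a (tens UUL b g)) =
        sw K U U UUUL (comult U f1) (\<lambda>a b. tens UUUL a (tens UUL b (sw K U L UL g (tens UL))))"
        by (simp add: ktensor_sw_tensor)
      also have "\<dots> = sw K U L UUUL g (\<lambda>f2 f3. sw K U U UUUL (comult U f1) (\<lambda>a b. ?t a b f2 f3))"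
        by (rule ktensor_sw_hom[where f = "\<lambda>g. sw K U U UUUL (comult U f1) (\<lambda>a b. tens UUUL a (tens UUL b g))"
            and G = UL and G' = UUUL]) simp_all
      finally show "sw K U U UUUL (comult U f1) (\<lambda>a b. tens UUUL a (tens UUL b g)) =
         sw K U L UUUL g (\<lambda>f2 f3. sw K U U UUUL (comult U f1) (\<lambda>a b. ?t a b f2 f3))" .
    qed simp_all
    finally show ?thesis unfolding sw3_def .
  qed
  have 2: "tlift UUUL F (\<lambda>f1 g. tlift UUUL g (\<lambda>f2 f3. tlift UUUL (coaction_minus K H R act L f3) (\<lambda>h l.
         tens UUUL f1 (tens UUL f2 (tens UL h l))))) =
     sw3 K U U L UUUL F (\<lambda>g1 g2 g3. sw K H H UUUL R (\<lambda>r r'. ?t g1 g2 r' (act r g3)))"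
  proof -
    have e: "tlift UUUL (coaction_minus K H R act L f3) (\<lambda>h l. ?t f1 f2 h l) =
        sw K H H UUUL R (\<lambda>r r'. ?t f1 f2 r' (act r f3))"
      if [simp]: "f1 \<in> carrier U" "f2 \<in> carrier U" "f3 \<in> carrier L" for f1 f2 f3
    proof -
      have "tlift UUUL (coaction_minus K H R act L f3) (\<lambda>h l. ?t f1 f2 h l) =
         sw K H L UUUL (coaction_minus K H R act L f3) (\<lambda>h l. ?t f1 f2 h l)"
        by (rule ktensor_tlift_sw) (simp_all add: coaction_eq)
      also have "\<dots> = sw K H L UUUL (sw K H H HL R (\<lambda>r1 r2. tens HL r2 (act r1 f3))) (\<lambda>h l. ?t f1 f2 h l)"
        by (simp add: coaction_eq)
      also have "\<dots> = sw K H H UUUL R (\<lambda>r r'. sw K H L UUUL (tens HL r' (act r f3)) (\<lambda>h l. ?t f1 f2 h l))"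
        by (rule ktensor_sw_hom[where f = "\<lambda>z. sw K H L UUUL z (\<lambda>h l. ?t f1 f2 h l)" and G = HL and G' = UUUL]) simp_all
      also have "\<dots> = sw K H H UUUL R (\<lambda>r r'. ?t f1 f2 r' (act r f3))"
        by (rule ktensor_sw_cong) (simp_all add: ktensor_sw_tens)
      finally show ?thesis .
    qed
    have "tlift UUUL F (\<lambda>f1 g. tlift UUUL g (\<lambda>f2 f3. tlift UUUL (coaction_minus K H R act L f3) (\<lambda>h l. ?t f1 f2 h l))) =
     sw K U UL UUUL F (\<lambda>f1 g. sw K U L UUUL g (\<lambda>f2 f3. sw K H H UUUL R (\<lambda>r r'. ?t f1 f2 r' (act r f3))))"
      by (intro tlift_sw_cong Uh.mod modL e) simp_all
    then show ?thesis unfolding sw3_def .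
  qed
  have 3: "tlift UUUL F (\<lambda>f1 g. tlift UUUL g (\<lambda>f2 f3. tlift UUUL (comult U f2) (\<lambda>a b.
         tens UUUL f1 (tens UUL a (tens UL b f3))))) =
     sw3 K U U L UUUL F (\<lambda>f1 f2 f3. sw K U U UUUL (comult U f2) (\<lambda>a b. ?t f1 a b f3))"
    unfolding sw3_def by (intro tlift_sw_cong Uh.mod modL) simp_all
  have 4: "tens UUUL \<one>\<^bsub>U\<^esub> F = sw3 K U U L UUUL F (\<lambda>g1 g2 g3. ?t \<one>\<^bsub>U\<^esub> g1 g2 g3)"
  proof -
    have "tens UUUL \<one>\<^bsub>U\<^esub> F = tens UUUL \<one>\<^bsub>U\<^esub> (sw3 K U U L UUL F (\<lambda>a b c. tens UUL a (tens UL b c)))"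
      by (simp add: sw3_tensor)
    also have "\<dots> = sw3 K U U L UUUL F (\<lambda>g1 g2 g3. ?t \<one>\<^bsub>U\<^esub> g1 g2 g3)"
      by (rule sw3_hom[where f = "tens UUUL \<one>\<^bsub>U\<^esub>" and G = UUL and G' = UUUL]) simp_all
    finally show ?thesis .
  qed
  have "sw3 K U U L UUUL F (\<lambda>f1 f2 f3. sw K U U UUUL (comult U f1) (\<lambda>a b. ?t a b f2 f3)) \<otimes>\<^bsub>UUUL\<^esub>
      sw3 K U U L UUUL F (\<lambda>g1 g2 g3. sw K H H UUUL R (\<lambda>r r'. ?t g1 g2 r' (act r g3))) =
    sw3 K U U L UUUL F (\<lambda>f1 f2 f3. sw K U U UUUL (comult U f2) (\<lambda>a b. ?t f1 a b f3)) \<otimes>\<^bsub>UUUL\<^esub>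
      sw3 K U U L UUUL F (\<lambda>g1 g2 g3. ?t \<one>\<^bsub>U\<^esub> g1 g2 g3)"
    using cocycle unfolding universal_dynamical_cocycle_def Let_def 1 2 3 4 by blast
  moreover have "sw3 K U U L UUUL F (\<lambda>f1 f2 f3. sw K U U UUUL (comult U f1) (\<lambda>a b. ?t a b f2 f3)) \<otimes>\<^bsub>UUUL\<^esub>
      sw3 K U U L UUUL F (\<lambda>g1 g2 g3. sw K H H UUUL R (\<lambda>r r'. ?t g1 g2 r' (act r g3))) =
    sw3 K U U L UUUL F (\<lambda>f1 f2 f3. sw K U U UUUL (comult U f1) (\<lambda>a b. sw3 K U U L UUUL F (\<lambda>g1 g2 g3.
        sw K H H UUUL R (\<lambda>r r'. ?t (a \<otimes>\<^bsub>U\<^esub> g1) (b \<otimes>\<^bsub>U\<^esub> g2) (f2 \<otimes>\<^bsub>U\<^esub> r') (f3 \<otimes>\<^bsub>L\<^esub> act r g3)))))"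
    by (subst sw3_mult_l, simp_all, subst sw3_cong[OF _ _ _ _ ktensor_mult_sw_l], simp_all,
        simp add: sw3_mult_r ktensor_mult_sw_r ktensor_mult_tens cong: ktensor_sw_cong sw3_cong)
  moreover have "sw3 K U U L UUUL F (\<lambda>f1 f2 f3. sw K U U UUUL (comult U f2) (\<lambda>a b. ?t f1 a b f3)) \<otimes>\<^bsub>UUUL\<^esub>
      sw3 K U U L UUUL F (\<lambda>g1 g2 g3. ?t \<one>\<^bsub>U\<^esub> g1 g2 g3) =
    sw3 K U U L UUUL F (\<lambda>f1 f2 f3. sw K U U UUUL (comult U f2) (\<lambda>a b. sw3 K U U L UUUL F (\<lambda>g1 g2 g3.
        ?t f1 (a \<otimes>\<^bsub>U\<^esub> g1) (b \<otimes>\<^bsub>U\<^esub> g2) (f3 \<otimes>\<^bsub>L\<^esub> g3))))"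
    by (subst sw3_mult_l, simp_all, subst sw3_cong[OF _ _ _ _ ktensor_mult_sw_l], simp_all,
        simp add: sw3_mult_r ktensor_mult_sw_r ktensor_mult_tens cong: ktensor_sw_cong sw3_cong)
  ultimately have "\<Phi> (sw3 K U U L UUUL F (\<lambda>f1 f2 f3. sw K U U UUUL (comult U f1) (\<lambda>a b. sw3 K U U L UUUL F (\<lambda>g1 g2 g3.
        sw K H H UUUL R (\<lambda>r r'. ?t (a \<otimes>\<^bsub>U\<^esub> g1) (b \<otimes>\<^bsub>U\<^esub> g2) (f2 \<otimes>\<^bsub>U\<^esub> r') (f3 \<otimes>\<^bsub>L\<^esub> act r g3)))))) =
      \<Phi> (sw3 K U U L UUUL F (\<lambda>f1 f2 f3. sw K U U UUUL (comult U f2) (\<lambda>a b. sw3 K U U L UUUL F (\<lambda>g1 g2 g3.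
        ?t f1 (a \<otimes>\<^bsub>U\<^esub> g1) (b \<otimes>\<^bsub>U\<^esub> g2) (f3 \<otimes>\<^bsub>L\<^esub> g3)))))"
    by presburger
  then show ?thesis
    by (simp add: ktensor_sw_hom[where f = \<Phi> and G = UUUL and G' = G] sw3_hom[where f = \<Phi> and G = UUUL and G' = G]
       \<Phi> cong: ktensor_sw_cong sw3_cong)
qed

lemma F_counit_left:
  assumes G [simp]: "module K G" and \<phi>: "bilin K U L G \<phi>"
  shows "sw3 K U U L G F (\<lambda>f1 f2 f3. counit U f1 \<odot>\<^bsub>G\<^esub> \<phi> f2 f3) = \<phi> \<one>\<^bsub>U\<^esub> \<one>\<^bsub>L\<^esub>"
proof -
  obtain \<Phi> where \<Phi>: "lin K UL G \<Phi>" "\<And>a b. a \<in> carrier U \<Longrightarrow> b \<in> carrier L \<Longrightarrow> \<Phi> (tens UL a b) = \<phi> a b"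
    using bilin_eval[OF Uh.mod modL G \<phi>] by blast
  have "tlift UL F (\<lambda>f1 g. counit U f1 \<odot>\<^bsub>UL\<^esub> g) = sw3 K U U L UL F (\<lambda>f1 f2 f3. counit U f1 \<odot>\<^bsub>UL\<^esub> tens UL f2 f3)"
  proof -
    have "tlift UL F (\<lambda>f1 g. counit U f1 \<odot>\<^bsub>UL\<^esub> g) = sw K U UL UL F (\<lambda>f1 g. counit U f1 \<odot>\<^bsub>UL\<^esub> sw K U L UL g (tens UL))"
      by (intro tlift_sw_cong Uh.mod modL) (simp_all add: ktensor_sw_tensor)
    also have "\<dots> = sw K U UL UL F (\<lambda>f1 g. sw K U L UL g (\<lambda>f2 f3. counit U f1 \<odot>\<^bsub>UL\<^esub> tens UL f2 f3))"
    proof (rule ktensor_sw_cong)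
      fix f1 g assume [simp]: "f1 \<in> carrier U"
      show "counit U f1 \<odot>\<^bsub>UL\<^esub> sw K U L UL g (tens UL) = sw K U L UL g (\<lambda>f2 f3. counit U f1 \<odot>\<^bsub>UL\<^esub> tens UL f2 f3)"
        by (rule ktensor_sw_hom[where f = "\<lambda>g. counit U f1 \<odot>\<^bsub>UL\<^esub> g" and G = UL and G' = UL]) simp_all
    qed simp_all
    finally show ?thesis unfolding sw3_def .
  qed
  then have "\<Phi> (sw3 K U U L UL F (\<lambda>f1 f2 f3. counit U f1 \<odot>\<^bsub>UL\<^esub> tens UL f2 f3)) = \<Phi> (tens UL \<one>\<^bsub>U\<^esub> \<one>\<^bsub>L\<^esub>)"
    using cocycle by (simp add: universal_dynamical_cocycle_def Let_def ktensor_one)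
  then show ?thesis
    by (simp add: sw3_hom[where f = \<Phi> and G = UL and G' = G] \<Phi> linD(3)[OF \<Phi>(1)] cong: sw3_cong)
qed

lemma F_counit_right:
  assumes G [simp]: "module K G" and \<phi>: "bilin K U L G \<phi>"
  shows "sw3 K U U L G F (\<lambda>f1 f2 f3. \<phi> f1 (counit U f2 \<odot>\<^bsub>L\<^esub> f3)) = \<phi> \<one>\<^bsub>U\<^esub> \<one>\<^bsub>L\<^esub>"
proof -
  obtain \<Phi> where \<Phi>: "lin K UL G \<Phi>" "\<And>a b. a \<in> carrier U \<Longrightarrow> b \<in> carrier L \<Longrightarrow> \<Phi> (tens UL a b) = \<phi> a b"
    using bilin_eval[OF Uh.mod modL G \<phi>] by blast
  have "tlift UL F (\<lambda>f1 g. tlift UL g (\<lambda>f2 f3. tens UL f1 (counit U f2 \<odot>\<^bsub>L\<^esub> f3))) =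
     sw3 K U U L UL F (\<lambda>f1 f2 f3. tens UL f1 (counit U f2 \<odot>\<^bsub>L\<^esub> f3))"
    unfolding sw3_def by (intro tlift_sw_cong Uh.mod modL) simp_all
  then have "\<Phi> (sw3 K U U L UL F (\<lambda>f1 f2 f3. tens UL f1 (counit U f2 \<odot>\<^bsub>L\<^esub> f3))) = \<Phi> (tens UL \<one>\<^bsub>U\<^esub> \<one>\<^bsub>L\<^esub>)"
    using cocycle by (simp add: universal_dynamical_cocycle_def Let_def ktensor_one)
  then show ?thesis
    by (simp add: sw3_hom[where f = \<Phi> and G = UL and G' = G] \<Phi> cong: sw3_cong)
qed

end

text \<open>Three arguments in \<open>U\<close>, one in \<open>L\<close>, and two in
  \<open>H\<close> for the smash product legs that survive in the first and second tensor factor. An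
  abstract map of this type separates the bookkeeping with \<open>F\<close> and \<open>R\<close>
  from tensor products over \<open>L\<close>.\<close>

definition hexlin where
  "hexlin K U L H G W \<longleftrightarrow>
    (\<forall>x\<in>carrier U. \<forall>y\<in>carrier U. \<forall>z\<in>carrier U. \<forall>l\<in>carrier L. \<forall>p\<in>carrier H. \<forall>q\<in>carrier H. W x y z l p q \<in> carrier G) \<and>
    (\<forall>y\<in>carrier U. \<forall>z\<in>carrier U. \<forall>l\<in>carrier L. \<forall>p\<in>carrier H. \<forall>q\<in>carrier H. lin K U G (\<lambda>v. W v y z l p q)) \<and>
    (\<forall>x\<in>carrier U. \<forall>z\<in>carrier U. \<forall>l\<in>carrier L. \<forall>p\<in>carrier H. \<forall>q\<in>carrier H. lin K U G (\<lambda>v. W x v z l p q)) \<and>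
    (\<forall>x\<in>carrier U. \<forall>y\<in>carrier U. \<forall>l\<in>carrier L. \<forall>p\<in>carrier H. \<forall>q\<in>carrier H. lin K U G (\<lambda>v. W x y v l p q)) \<and>
    (\<forall>x\<in>carrier U. \<forall>y\<in>carrier U. \<forall>z\<in>carrier U. \<forall>p\<in>carrier H. \<forall>q\<in>carrier H. lin K L G (\<lambda>v. W x y z v p q)) \<and>
    (\<forall>x\<in>carrier U. \<forall>y\<in>carrier U. \<forall>z\<in>carrier U. \<forall>l\<in>carrier L. \<forall>q\<in>carrier H. lin K H G (\<lambda>v. W x y z l v q)) \<and>
    (\<forall>x\<in>carrier U. \<forall>y\<in>carrier U. \<forall>z\<in>carrier U. \<forall>l\<in>carrier L. \<forall>p\<in>carrier H. lin K H G (\<lambda>v. W x y z l p v))"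

lemma hexlinD:
  assumes "hexlin K U L H G W"
  shows "x \<in> carrier U \<Longrightarrow> y \<in> carrier U \<Longrightarrow> z \<in> carrier U \<Longrightarrow> l \<in> carrier L \<Longrightarrow> p \<in> carrier H \<Longrightarrow> q \<in> carrier H \<Longrightarrow>
      W x y z l p q \<in> carrier G"
    "lin K Y U f \<Longrightarrow> y \<in> carrier U \<Longrightarrow> z \<in> carrier U \<Longrightarrow> l \<in> carrier L \<Longrightarrow> p \<in> carrier H \<Longrightarrow> q \<in> carrier H \<Longrightarrow>
      lin K Y G (\<lambda>v. W (f v) y z l p q)"
    "lin K Y U f \<Longrightarrow> x \<in> carrier U \<Longrightarrow> z \<in> carrier U \<Longrightarrow> l \<in> carrier L \<Longrightarrow> p \<in> carrier H \<Longrightarrow> q \<in> carrier H \<Longrightarrow>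
      lin K Y G (\<lambda>v. W x (f v) z l p q)"
    "lin K Y U f \<Longrightarrow> x \<in> carrier U \<Longrightarrow> y \<in> carrier U \<Longrightarrow> l \<in> carrier L \<Longrightarrow> p \<in> carrier H \<Longrightarrow> q \<in> carrier H \<Longrightarrow>
      lin K Y G (\<lambda>v. W x y (f v) l p q)"
    "lin K Y L f' \<Longrightarrow> x \<in> carrier U \<Longrightarrow> y \<in> carrier U \<Longrightarrow> z \<in> carrier U \<Longrightarrow> p \<in> carrier H \<Longrightarrow> q \<in> carrier H \<Longrightarrow>
      lin K Y G (\<lambda>v. W x y z (f' v) p q)"
    "lin K Y H f'' \<Longrightarrow> x \<in> carrier U \<Longrightarrow> y \<in> carrier U \<Longrightarrow> z \<in> carrier U \<Longrightarrow> l \<in> carrier L \<Longrightarrow> q \<in> carrier H \<Longrightarrow>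
      lin K Y G (\<lambda>v. W x y z l (f'' v) q)"
    "lin K Y H f'' \<Longrightarrow> x \<in> carrier U \<Longrightarrow> y \<in> carrier U \<Longrightarrow> z \<in> carrier U \<Longrightarrow> l \<in> carrier L \<Longrightarrow> p \<in> carrier H \<Longrightarrow>
      lin K Y G (\<lambda>v. W x y z l p (f'' v))"
  using assms by (simp_all add: hexlin_def lin_def)

section \<open>The six-linear identity behind the cocycle equation\<close>

context quasitriangular_hopf
begin

text \<open>Coassociativity moves the second splitting to the right leg; each splitting then
  detaches one copy of \<open>R\<close>, and the second legs of the three copies multiply in
  order.\<close>

lemma hexagon_left_iterated:
  assumes G [simp]: "module K G" and \<phi>: "quadlin K H H H H G \<phi>"
  shows "sw K H H G R (\<lambda>r r'. sw K H H G (comult H r) (\<lambda>h1 h2. sw K H H G (comult H h1) (\<lambda>k1 k2. \<phi> k1 k2 h2 r'))) =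
    sw K H H G R (\<lambda>p p'. sw K H H G R (\<lambda>r r'. sw K H H G R (\<lambda>t t'. \<phi> p r t (p' \<otimes>\<^bsub>H\<^esub> (r' \<otimes>\<^bsub>H\<^esub> t')))))"
proof -
  note q [simp] = quadlinD[OF \<phi>]
  have "sw K H H G R (\<lambda>r r'. sw K H H G (comult H r) (\<lambda>h1 h2. sw K H H G (comult H h1) (\<lambda>k1 k2. \<phi> k1 k2 h2 r'))) =
     sw K H H G R (\<lambda>r r'. sw K H H G (comult H r) (\<lambda>h1 h2. sw K H H G (comult H h2) (\<lambda>k1 k2. \<phi> h1 k1 k2 r')))"
    by (rule ktensor_sw_cong) (simp_all add: coassoc[where \<phi> = "\<lambda>a b c. \<phi> a b c r'" for r'] trilin_def)
  also have "\<dots> = sw K H H G R (\<lambda>p p'. sw K H H G R (\<lambda>r r'. sw K H H G (comult H r) (\<lambda>k1 k2. \<phi> p k1 k2 (p' \<otimes>\<^bsub>H\<^esub> r'))))"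
    by (rule hexagon_left[where \<phi> = "\<lambda>a b c. sw K H H G (comult H b) (\<lambda>k1 k2. \<phi> a k1 k2 c)"]) (simp_all add: trilin_def)
  also have "\<dots> = sw K H H G R (\<lambda>p p'. sw K H H G R (\<lambda>r r'. sw K H H G R (\<lambda>t t'. \<phi> p r t (p' \<otimes>\<^bsub>H\<^esub> (r' \<otimes>\<^bsub>H\<^esub> t')))))"
    by (rule ktensor_sw_cong)
       (simp_all add: hexagon_left[where \<phi> = "\<lambda>a b c. \<phi> p a b (p' \<otimes>\<^bsub>H\<^esub> c)" for p p'] trilin_def)
  finally show ?thesis .
qed

end

context dynamical_data
begin

lemma mult_U_in_H: "g \<in> carrier H \<Longrightarrow> h \<in> carrier H \<Longrightarrow> g \<otimes>\<^bsub>U\<^esub> h \<in> carrier H"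
  by (simp add: mult_H_U[symmetric])

context
  fixes G :: "('k, 'g, 'n) module_scheme" and W
  assumes G [simp]: "module K G" and W: "hexlin K U L H G W"
begin

lemmas W_simps = hexlinD[OF W]

text \<open>A normal form with four copies of \<open>R\<close>. The copies \<open>p\<close>,
  \<open>r\<close>, \<open>t\<close> share their second legs in the third argument, while
  \<open>s\<close> links the fifth argument with the second. It is the meeting point of the
  left-hand side of the cocycle equation for \<Psi> and the left-hand side of the one for
  \<open>F\<close>.\<close>

definition twist_sum where
  "twist_sum x y z l g = sw K H H G R (\<lambda>p p'. sw K H H G R (\<lambda>r r'. sw K H H G R (\<lambda>t t'. sw K H H G R (\<lambda>s s'.
     W x (y \<otimes>\<^bsub>U\<^esub> s') (z \<otimes>\<^bsub>U\<^esub> (p' \<otimes>\<^bsub>H\<^esub> (r' \<otimes>\<^bsub>H\<^esub> t'))) (l \<otimes>\<^bsub>L\<^esub> act p g) (r \<otimes>\<^bsub>H\<^esub> s) t))))"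

text \<open>The first leg of the outer \<R> is split twice, by the comultiplication of the
  bialgebroid and by the smash product; the iterated hexagon identity turns the three pieces into
  three copies.\<close>

lemma twist_sum_left:
  assumes [simp]: "x \<in> carrier U" "y \<in> carrier U" "z \<in> carrier U" "l \<in> carrier L" "g \<in> carrier L"
  shows "sw K H H G R (\<lambda>r r'. sw K H H G (comult H r) (\<lambda>h1 h2. sw K H H G R (\<lambda>s s'. sw K H H G (comult H h1) (\<lambda>k1 k2.
     W x (y \<otimes>\<^bsub>U\<^esub> s') (z \<otimes>\<^bsub>U\<^esub> r') (l \<otimes>\<^bsub>L\<^esub> act k1 g) (k2 \<otimes>\<^bsub>H\<^esub> s) h2)))) = twist_sum x y z l g"
proof -
  note [simp] = W_simps
  let ?\<phi> = "\<lambda>k1 k2 h2 r'. sw K H H G R (\<lambda>s s'. W x (y \<otimes>\<^bsub>U\<^esub> s') (z \<otimes>\<^bsub>U\<^esub> r') (l \<otimes>\<^bsub>L\<^esub> act k1 g) (k2 \<otimes>\<^bsub>H\<^esub> s) h2)"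
  have "sw K H H G R (\<lambda>r r'. sw K H H G (comult H r) (\<lambda>h1 h2. sw K H H G R (\<lambda>s s'. sw K H H G (comult H h1) (\<lambda>k1 k2.
     W x (y \<otimes>\<^bsub>U\<^esub> s') (z \<otimes>\<^bsub>U\<^esub> r') (l \<otimes>\<^bsub>L\<^esub> act k1 g) (k2 \<otimes>\<^bsub>H\<^esub> s) h2)))) =
    sw K H H G R (\<lambda>r r'. sw K H H G (comult H r) (\<lambda>h1 h2. sw K H H G (comult H h1) (\<lambda>k1 k2. ?\<phi> k1 k2 h2 r')))"
    by (intro ktensor_sw_cong ktensor_sw_swap) simp_all
  also have "\<dots> = sw K H H G R (\<lambda>p p'. sw K H H G R (\<lambda>r r'. sw K H H G R (\<lambda>t t'. ?\<phi> p r t (p' \<otimes>\<^bsub>H\<^esub> (r' \<otimes>\<^bsub>H\<^esub> t')))))"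
    by (rule hexagon_left_iterated[where \<phi> = ?\<phi>]) (simp_all add: trilin_def quadlin_def)
  finally show ?thesis unfolding twist_sum_def .
qed

text \<open>What remains of \<open>twist_sum\<close> when the copy of \<open>R\<close> that forms
  the coaction is stripped off. It is quadrilinear in its arguments and thus can serve as the test
  map in \<open>F_cocycle\<close>; a splitting of the second leg is kept in it so as to match the
  equivariance of \<open>F\<close>.\<close>

definition twist_core where
  "twist_core x y z m = sw K H H G R (\<lambda>r r'. sw K H H G (comult H r') (\<lambda>c d. sw K H H G R (\<lambda>s s'.
     W x (y \<otimes>\<^bsub>U\<^esub> c) (z \<otimes>\<^bsub>U\<^esub> (d \<otimes>\<^bsub>U\<^esub> s')) m r s)))"

text \<open>Splitting the second leg of \<open>R\<close> amounts to two copies by the second hexagon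
  identity, the core contains a third, and the coaction copy \<open>p\<close> is the fourth. Only an
  interchange of sums and reassociation of the products remain.\<close>

lemma twist_core_sum:
  assumes [simp]: "x \<in> carrier U" "y \<in> carrier U" "z \<in> carrier U" "l \<in> carrier L" "g \<in> carrier L"
  shows "sw K H H G R (\<lambda>p p'. twist_core x y (z \<otimes>\<^bsub>U\<^esub> p') (l \<otimes>\<^bsub>L\<^esub> act p g)) = twist_sum x y z l g"
proof -
  note [simp] = W_simps
  have "sw K H H G R (\<lambda>p p'. twist_core x y (z \<otimes>\<^bsub>U\<^esub> p') (l \<otimes>\<^bsub>L\<^esub> act p g)) =
    sw K H H G R (\<lambda>p p'. sw K H H G R (\<lambda>r r'. sw K H H G R (\<lambda>s s'. sw K H H G R (\<lambda>t t'.
     W x (y \<otimes>\<^bsub>U\<^esub> s') ((z \<otimes>\<^bsub>U\<^esub> p') \<otimes>\<^bsub>U\<^esub> (r' \<otimes>\<^bsub>U\<^esub> t')) (l \<otimes>\<^bsub>L\<^esub> act p g) (r \<otimes>\<^bsub>H\<^esub> s) t))))"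
    unfolding twist_core_def
    by (intro ktensor_sw_cong hexagon_right[where \<phi> = "\<lambda>r c d. sw K H H G R (\<lambda>s s'.
         W x (y \<otimes>\<^bsub>U\<^esub> c) ((z \<otimes>\<^bsub>U\<^esub> p') \<otimes>\<^bsub>U\<^esub> (d \<otimes>\<^bsub>U\<^esub> s')) (l \<otimes>\<^bsub>L\<^esub> act p g) r s)" for p p'])
       (simp_all add: trilin_def)
  also have "\<dots> = sw K H H G R (\<lambda>p p'. sw K H H G R (\<lambda>r r'. sw K H H G R (\<lambda>t t'. sw K H H G R (\<lambda>s s'.
     W x (y \<otimes>\<^bsub>U\<^esub> s') ((z \<otimes>\<^bsub>U\<^esub> p') \<otimes>\<^bsub>U\<^esub> (r' \<otimes>\<^bsub>U\<^esub> t')) (l \<otimes>\<^bsub>L\<^esub> act p g) (r \<otimes>\<^bsub>H\<^esub> s) t))))"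
    by (intro ktensor_sw_cong ktensor_sw_swap) simp_all
  also have "\<dots> = twist_sum x y z l g"
    unfolding twist_sum_def by (intro ktensor_sw_cong) (simp_all add: mult_H_U mult_U_in_H alg_closed(5)[where K = K])
  finally show ?thesis .
qed

text \<open>The left factors \<open>c\<close>, \<open>d\<close> come from the comultiplication of
  the second factor of \<Psi>, the copy \<open>p\<close> from the passage across the tensor product
  over \<open>L\<close>. Together they form the threefold coproduct of a single second leg, which is
  what equivariance can move from the left of \<open>F\<close> to its right.\<close>

lemma twist_sum_right:
  assumes [simp]: "x \<in> carrier U" "a \<in> carrier U" "b \<in> carrier U" "l \<in> carrier L"
  shows "sw K H H G R (\<lambda>r r'. sw K H H G (comult H r') (\<lambda>c d. sw3 K U U L G F (\<lambda>g1 g2 g3. sw K H H G R (\<lambda>s s'.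
      sw K H H G R (\<lambda>p p'. W x ((a \<otimes>\<^bsub>U\<^esub> c) \<otimes>\<^bsub>U\<^esub> g1) ((b \<otimes>\<^bsub>U\<^esub> d) \<otimes>\<^bsub>U\<^esub> (g2 \<otimes>\<^bsub>U\<^esub> s')) (l \<otimes>\<^bsub>L\<^esub> act p' g3) (p \<otimes>\<^bsub>H\<^esub> r) s))))) =
    sw3 K U U L G F (\<lambda>g1 g2 g3. twist_core x (a \<otimes>\<^bsub>U\<^esub> g1) (b \<otimes>\<^bsub>U\<^esub> g2) (l \<otimes>\<^bsub>L\<^esub> g3))"
proof -
  note [simp] = W_simps
  let ?W = "\<lambda>g1 g2 g3 c d p' q. sw K H H G R (\<lambda>s s'. W x ((a \<otimes>\<^bsub>U\<^esub> c) \<otimes>\<^bsub>U\<^esub> g1) ((b \<otimes>\<^bsub>U\<^esub> d) \<otimes>\<^bsub>U\<^esub> (g2 \<otimes>\<^bsub>U\<^esub> s')) (l \<otimes>\<^bsub>L\<^esub> act p' g3) q s)"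
  let ?V = "\<lambda>q c d p'. sw3 K U U L G F (\<lambda>g1 g2 g3. ?W g1 g2 g3 c d p' q)"
  have "sw K H H G R (\<lambda>r r'. sw K H H G (comult H r') (\<lambda>c d. sw3 K U U L G F (\<lambda>g1 g2 g3. sw K H H G R (\<lambda>s s'.
      sw K H H G R (\<lambda>p p'. W x ((a \<otimes>\<^bsub>U\<^esub> c) \<otimes>\<^bsub>U\<^esub> g1) ((b \<otimes>\<^bsub>U\<^esub> d) \<otimes>\<^bsub>U\<^esub> (g2 \<otimes>\<^bsub>U\<^esub> s')) (l \<otimes>\<^bsub>L\<^esub> act p' g3) (p \<otimes>\<^bsub>H\<^esub> r) s))))) =
    sw K H H G R (\<lambda>r r'. sw K H H G (comult H r') (\<lambda>c d. sw3 K U U L G F (\<lambda>g1 g2 g3. sw K H H G R (\<lambda>p p'.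
      ?W g1 g2 g3 c d p' (p \<otimes>\<^bsub>H\<^esub> r)))))"
    by (intro ktensor_sw_cong sw3_cong ktensor_sw_swap) simp_all
  also have "\<dots> = sw K H H G R (\<lambda>r r'. sw K H H G (comult H r') (\<lambda>c d. sw K H H G R (\<lambda>p p'. ?V (p \<otimes>\<^bsub>H\<^esub> r) c d p')))"
    by (intro ktensor_sw_cong sw_sw3_swap[symmetric]) simp_all
  also have "\<dots> = sw K H H G R (\<lambda>r r'. sw K H H G R (\<lambda>p p'. sw K H H G (comult H r') (\<lambda>c d. ?V (p \<otimes>\<^bsub>H\<^esub> r) c d p')))"
    by (intro ktensor_sw_cong ktensor_sw_swap) simp_all
  also have "\<dots> = sw K H H G R (\<lambda>p p'. sw K H H G R (\<lambda>r r'. sw K H H G (comult H r') (\<lambda>c d. ?V (p \<otimes>\<^bsub>H\<^esub> r) c d p')))"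
    by (rule ktensor_sw_swap) simp_all
  \<comment> \<open>The hexagon identity is read from right to left: the copies with product
    \<open>p r\<close> in the first leg merge into one copy whose second leg is split,
    \<open>r'\<close> and \<open>p'\<close> becoming its two parts.\<close>
  also have "\<dots> = sw K H H G R (\<lambda>r r'. sw K H H G (comult H r') (\<lambda>h1 h2. sw K H H G (comult H h1) (\<lambda>c d. ?V r c d h2)))"
    by (rule hexagon_right[where \<phi> = "\<lambda>q h1 h2. sw K H H G (comult H h1) (\<lambda>c d. ?V q c d h2)", symmetric]) (simp_all add: trilin_def)
  \<comment> \<open>Rebracketing puts the threefold coproduct into the form in which the
    equivariance axiom is stated, with the last part acting on the component of \<open>F\<close> in
    \<open>L\<close>.\<close>
  also have "\<dots> = sw K H H G R (\<lambda>r r'. sw K H H G (comult H r') (\<lambda>h1 h2. sw K H H G (comult H h2) (\<lambda>d e. ?V r h1 d e)))"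
    by (intro ktensor_sw_cong coassoc[where \<phi> = "?V r" for r]) (simp_all add: trilin_def)
  also have "\<dots> = sw K H H G R (\<lambda>r r'. sw K H H G (comult H r') (\<lambda>h1 h2. sw K H H G (comult H h2) (\<lambda>d e.
      sw3 K U U L G F (\<lambda>g1 g2 g3. sw K H H G R (\<lambda>s s'. W x (a \<otimes>\<^bsub>U\<^esub> (h1 \<otimes>\<^bsub>U\<^esub> g1)) (b \<otimes>\<^bsub>U\<^esub> ((d \<otimes>\<^bsub>U\<^esub> g2) \<otimes>\<^bsub>U\<^esub> s')) (l \<otimes>\<^bsub>L\<^esub> act e g3) r s)))))"
    by (intro ktensor_sw_cong sw3_cong) (simp_all add: alg_closed(5)[where K = K])
  also have "\<dots> = sw K H H G R (\<lambda>r r'. sw K H H G (comult H r') (\<lambda>c d.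
      sw3 K U U L G F (\<lambda>g1 g2 g3. sw K H H G R (\<lambda>s s'. W x (a \<otimes>\<^bsub>U\<^esub> (g1 \<otimes>\<^bsub>U\<^esub> c)) (b \<otimes>\<^bsub>U\<^esub> ((g2 \<otimes>\<^bsub>U\<^esub> d) \<otimes>\<^bsub>U\<^esub> s')) (l \<otimes>\<^bsub>L\<^esub> g3) r s))))"
    by (intro ktensor_sw_cong F_equivariant[where \<phi> = "\<lambda>y z m. sw K H H G R (\<lambda>s s'. W x (a \<otimes>\<^bsub>U\<^esub> y) (b \<otimes>\<^bsub>U\<^esub> (z \<otimes>\<^bsub>U\<^esub> s')) (l \<otimes>\<^bsub>L\<^esub> m) r s)" for r])
      (simp_all add: trilin_def)
  also have "\<dots> = sw K H H G R (\<lambda>r r'. sw K H H G (comult H r') (\<lambda>c d.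
      sw3 K U U L G F (\<lambda>g1 g2 g3. sw K H H G R (\<lambda>s s'. W x ((a \<otimes>\<^bsub>U\<^esub> g1) \<otimes>\<^bsub>U\<^esub> c) ((b \<otimes>\<^bsub>U\<^esub> g2) \<otimes>\<^bsub>U\<^esub> (d \<otimes>\<^bsub>U\<^esub> s')) (l \<otimes>\<^bsub>L\<^esub> g3) r s))))"
    by (intro ktensor_sw_cong sw3_cong) (simp_all add: alg_closed(5)[where K = K])
  also have "\<dots> = sw K H H G R (\<lambda>r r'. sw3 K U U L G F (\<lambda>g1 g2 g3. sw K H H G (comult H r') (\<lambda>c d.
      sw K H H G R (\<lambda>s s'. W x ((a \<otimes>\<^bsub>U\<^esub> g1) \<otimes>\<^bsub>U\<^esub> c) ((b \<otimes>\<^bsub>U\<^esub> g2) \<otimes>\<^bsub>U\<^esub> (d \<otimes>\<^bsub>U\<^esub> s')) (l \<otimes>\<^bsub>L\<^esub> g3) r s))))"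
    by (intro ktensor_sw_cong sw_sw3_swap) simp_all
  also have "\<dots> = sw3 K U U L G F (\<lambda>g1 g2 g3. twist_core x (a \<otimes>\<^bsub>U\<^esub> g1) (b \<otimes>\<^bsub>U\<^esub> g2) (l \<otimes>\<^bsub>L\<^esub> g3))"
    unfolding twist_core_def by (rule sw_sw3_swap) simp_all
  finally show ?thesis .
qed

text \<open>The dynamical cocycle equation is applied to \<open>twist_core\<close>, not to
  \<open>W\<close>: with \<open>W\<close> itself the additional copies of \<open>R\<close> on the
  two sides would not match. The reductions on either side serve to reach this common test
  map.\<close>

lemma twist_identity:
  "sw3 K U U L G F (\<lambda>f1 f2 f3. sw K H H G R (\<lambda>r r'. sw K U U G (comult U f1) (\<lambda>u1 u2. sw K H H G (comult H r) (\<lambda>h1 h2.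
     sw3 K U U L G F (\<lambda>g1 g2 g3. sw K H H G R (\<lambda>s s'. sw K H H G (comult H h1) (\<lambda>k1 k2.
       W (u1 \<otimes>\<^bsub>U\<^esub> g1) (u2 \<otimes>\<^bsub>U\<^esub> (g2 \<otimes>\<^bsub>U\<^esub> s')) (f2 \<otimes>\<^bsub>U\<^esub> r') (f3 \<otimes>\<^bsub>L\<^esub> act k1 g3) (k2 \<otimes>\<^bsub>H\<^esub> s) h2))))))) =
   sw3 K U U L G F (\<lambda>f1 f2 f3. sw K H H G R (\<lambda>r r'. sw K U U G (comult U (f2 \<otimes>\<^bsub>U\<^esub> r')) (\<lambda>v1 v2.
     sw3 K U U L G F (\<lambda>g1 g2 g3. sw K H H G R (\<lambda>s s'. sw K H H G R (\<lambda>p p'.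
       W f1 (v1 \<otimes>\<^bsub>U\<^esub> g1) (v2 \<otimes>\<^bsub>U\<^esub> (g2 \<otimes>\<^bsub>U\<^esub> s')) (f3 \<otimes>\<^bsub>L\<^esub> act p' g3) (p \<otimes>\<^bsub>H\<^esub> r) s))))))"
  (is "?lhs = ?rhs")
proof -
  note [simp] = W_simps
  have q: "quadlin K U U U L G twist_core"
    by (simp add: quadlin_def trilin_def twist_core_def[abs_def])
  have "?lhs = sw3 K U U L G F (\<lambda>f1 f2 f3. sw K U U G (comult U f1) (\<lambda>u1 u2. sw K H H G R (\<lambda>r r'. sw K H H G (comult H r) (\<lambda>h1 h2.
     sw3 K U U L G F (\<lambda>g1 g2 g3. sw K H H G R (\<lambda>s s'. sw K H H G (comult H h1) (\<lambda>k1 k2.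
       W (u1 \<otimes>\<^bsub>U\<^esub> g1) (u2 \<otimes>\<^bsub>U\<^esub> (g2 \<otimes>\<^bsub>U\<^esub> s')) (f2 \<otimes>\<^bsub>U\<^esub> r') (f3 \<otimes>\<^bsub>L\<^esub> act k1 g3) (k2 \<otimes>\<^bsub>H\<^esub> s) h2)))))))"
    by (intro sw3_cong ktensor_sw_swap) simp_all
  also have "\<dots> = sw3 K U U L G F (\<lambda>f1 f2 f3. sw K U U G (comult U f1) (\<lambda>u1 u2. sw K H H G R (\<lambda>r r'.
     sw3 K U U L G F (\<lambda>g1 g2 g3. sw K H H G (comult H r) (\<lambda>h1 h2. sw K H H G R (\<lambda>s s'. sw K H H G (comult H h1) (\<lambda>k1 k2.
       W (u1 \<otimes>\<^bsub>U\<^esub> g1) ((u2 \<otimes>\<^bsub>U\<^esub> g2) \<otimes>\<^bsub>U\<^esub> s') (f2 \<otimes>\<^bsub>U\<^esub> r') (f3 \<otimes>\<^bsub>L\<^esub> act k1 g3) (k2 \<otimes>\<^bsub>H\<^esub> s) h2)))))))"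
    by (simp add: sw_sw3_swap alg_closed(5)[where K = K] cong: ktensor_sw_cong sw3_cong)
  also have "\<dots> = sw3 K U U L G F (\<lambda>f1 f2 f3. sw K U U G (comult U f1) (\<lambda>u1 u2. sw3 K U U L G F (\<lambda>g1 g2 g3.
      sw K H H G R (\<lambda>r r'. sw K H H G (comult H r) (\<lambda>h1 h2. sw K H H G R (\<lambda>s s'. sw K H H G (comult H h1) (\<lambda>k1 k2.
       W (u1 \<otimes>\<^bsub>U\<^esub> g1) ((u2 \<otimes>\<^bsub>U\<^esub> g2) \<otimes>\<^bsub>U\<^esub> s') (f2 \<otimes>\<^bsub>U\<^esub> r') (f3 \<otimes>\<^bsub>L\<^esub> act k1 g3) (k2 \<otimes>\<^bsub>H\<^esub> s) h2)))))))"
    by (intro sw3_cong ktensor_sw_cong sw_sw3_swap) simp_all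
  also have "\<dots> = sw3 K U U L G F (\<lambda>f1 f2 f3. sw K U U G (comult U f1) (\<lambda>u1 u2. sw3 K U U L G F (\<lambda>g1 g2 g3.
      twist_sum (u1 \<otimes>\<^bsub>U\<^esub> g1) (u2 \<otimes>\<^bsub>U\<^esub> g2) f2 f3 g3)))"
    by (intro sw3_cong ktensor_sw_cong twist_sum_left) simp_all
  also have "\<dots> = sw3 K U U L G F (\<lambda>f1 f2 f3. sw K U U G (comult U f1) (\<lambda>u1 u2. sw3 K U U L G F (\<lambda>g1 g2 g3.
      sw K H H G R (\<lambda>p p'. twist_core (u1 \<otimes>\<^bsub>U\<^esub> g1) (u2 \<otimes>\<^bsub>U\<^esub> g2) (f2 \<otimes>\<^bsub>U\<^esub> p') (f3 \<otimes>\<^bsub>L\<^esub> act p g3)))))"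
    by (intro sw3_cong ktensor_sw_cong twist_core_sum[symmetric]) simp_all
  also have "\<dots> = sw3 K U U L G F (\<lambda>f1 f2 f3. sw K U U G (comult U f2) (\<lambda>a b. sw3 K U U L G F (\<lambda>g1 g2 g3.
            twist_core f1 (a \<otimes>\<^bsub>U\<^esub> g1) (b \<otimes>\<^bsub>U\<^esub> g2) (f3 \<otimes>\<^bsub>L\<^esub> g3))))"
    by (rule F_cocycle[OF G q])
  also have "\<dots> = sw3 K U U L G F (\<lambda>f1 f2 f3. sw K U U G (comult U f2) (\<lambda>a b. sw K H H G R (\<lambda>r r'. sw K H H G (comult H r') (\<lambda>c d. sw3 K U U L G F (\<lambda>g1 g2 g3. sw K H H G R (\<lambda>s s'.
      sw K H H G R (\<lambda>p p'. W f1 ((a \<otimes>\<^bsub>U\<^esub> c) \<otimes>\<^bsub>U\<^esub> g1) ((b \<otimes>\<^bsub>U\<^esub> d) \<otimes>\<^bsub>U\<^esub> (g2 \<otimes>\<^bsub>U\<^esub> s')) (f3 \<otimes>\<^bsub>L\<^esub> act p' g3) (p \<otimes>\<^bsub>H\<^esub> r) s)))))))"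
    by (intro sw3_cong ktensor_sw_cong twist_sum_right[symmetric]) simp_all
  also have "\<dots> = sw3 K U U L G F (\<lambda>f1 f2 f3. sw K H H G R (\<lambda>r r'. sw K U U G (comult U f2) (\<lambda>a b. sw K H H G (comult H r') (\<lambda>c d. sw3 K U U L G F (\<lambda>g1 g2 g3. sw K H H G R (\<lambda>s s'.
      sw K H H G R (\<lambda>p p'. W f1 ((a \<otimes>\<^bsub>U\<^esub> c) \<otimes>\<^bsub>U\<^esub> g1) ((b \<otimes>\<^bsub>U\<^esub> d) \<otimes>\<^bsub>U\<^esub> (g2 \<otimes>\<^bsub>U\<^esub> s')) (f3 \<otimes>\<^bsub>L\<^esub> act p' g3) (p \<otimes>\<^bsub>H\<^esub> r) s)))))))"
    by (intro sw3_cong ktensor_sw_swap) simp_all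
  also have "\<dots> = ?rhs"
  proof (intro sw3_cong ktensor_sw_cong)
    fix f1 f2 f3 r r' assume [simp]: "f1 \<in> carrier U" "f2 \<in> carrier U" "f3 \<in> carrier L" "r \<in> carrier H" "r' \<in> carrier H"
    let ?\<psi> = "\<lambda>v1 v2. sw3 K U U L G F (\<lambda>g1 g2 g3. sw K H H G R (\<lambda>s s'.
      sw K H H G R (\<lambda>p p'. W f1 (v1 \<otimes>\<^bsub>U\<^esub> g1) (v2 \<otimes>\<^bsub>U\<^esub> (g2 \<otimes>\<^bsub>U\<^esub> s')) (f3 \<otimes>\<^bsub>L\<^esub> act p' g3) (p \<otimes>\<^bsub>H\<^esub> r) s)))"
    \<comment> \<open>The coproduct of \<open>r'\<close> is reinterpreted in the tensor square of
      \<open>U\<close>, where multiplicativity of the comultiplication applies to the product of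
      \<open>f2\<close> and \<open>r'\<close>.\<close>
    have "sw K U U G (comult U f2) (\<lambda>a b. sw K H H G (comult H r') (\<lambda>c d. ?\<psi> (a \<otimes>\<^bsub>U\<^esub> c) (b \<otimes>\<^bsub>U\<^esub> d))) =
      sw K U U G (comult U f2) (\<lambda>a b. sw K U U G (comult U r') (\<lambda>c d. ?\<psi> (a \<otimes>\<^bsub>U\<^esub> c) (b \<otimes>\<^bsub>U\<^esub> d)))"
      by (intro ktensor_sw_cong comult_U_H[symmetric]) simp_all
    also have "\<dots> = sw K U U G (comult U (f2 \<otimes>\<^bsub>U\<^esub> r')) ?\<psi>"
      by (rule Uh.comult_mult[where \<phi> = ?\<psi>, symmetric]) simp_all
    finally show "sw K U U G (comult U f2) (\<lambda>a b. sw K H H G (comult H r') (\<lambda>c d. ?\<psi> (a \<otimes>\<^bsub>U\<^esub> c) (b \<otimes>\<^bsub>U\<^esub> d))) =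
      sw K U U G (comult U (f2 \<otimes>\<^bsub>U\<^esub> r')) ?\<psi>" .
  qed simp_all
  finally show ?thesis .
qed

end

end

section \<open>Tensor products over a noncommutative base\<close>

text \<open>Pullback of the action along c \<mapsto> c 1. It brings tensor products over
  \<open>L\<close> within reach of the calculus of \<open>K\<close>-linear maps.\<close>

definition restrict_scalars :: "('k, 'l) module \<Rightarrow> ('l, 'm) module \<Rightarrow> ('k, 'm) module" where
  "restrict_scalars L M = \<lparr>carrier = carrier M, monoid.mult = monoid.mult M, one = \<one>\<^bsub>M\<^esub>, ring.zero = \<zero>\<^bsub>M\<^esub>,
     add = add M, smult = (\<lambda>c m. (c \<odot>\<^bsub>L\<^esub> \<one>\<^bsub>L\<^esub>) \<odot>\<^bsub>M\<^esub> m)\<rparr>"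

lemma restrict_scalars_simps:
  "carrier (restrict_scalars L M) = carrier M" "add (restrict_scalars L M) = add M"
  "\<zero>\<^bsub>restrict_scalars L M\<^esub> = \<zero>\<^bsub>M\<^esub>" "c \<odot>\<^bsub>restrict_scalars L M\<^esub> m = (c \<odot>\<^bsub>L\<^esub> \<one>\<^bsub>L\<^esub>) \<odot>\<^bsub>M\<^esub> m"
  by (simp_all add: restrict_scalars_def)

text \<open>Equivalently, an algebra under the enveloping algebra
  \<open>L \<otimes> L\<^sup>o\<^sup>p\<close>: the part of a bialgebroid that is needed before a
  comultiplication can be given a target.\<close>

locale enveloping =
  fixes K :: "'k ring" and L :: "('k, 'l) module" and A :: "('k, 'b) module" and s t :: "'l \<Rightarrow> 'b"
  assumes alg_L [simp]: "assoc_algebra K L" and alg_A [simp]: "assoc_algebra K A"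
    and s_hom: "s \<in> alg_hom K L A" and t_anti: "t \<in> alg_antihom K L A"
    and s_t_commute: "\<And>l m. l \<in> carrier L \<Longrightarrow> m \<in> carrier L \<Longrightarrow> s l \<otimes>\<^bsub>A\<^esub> t m = t m \<otimes>\<^bsub>A\<^esub> s l"
begin

declare closure_rules [simp] alg_closed(1,2)[where K = K, simp] alg_closed(3,4)[where K = K, simp]
  module_smult_closed[where K = K, simp] lin_rules [simp]

lemma mod_A [simp]: "module K A" and mod_L [simp]: "module K L"
  by (simp_all add: assoc_algebra_module)

lemma s_closed [simp]: "l \<in> carrier L \<Longrightarrow> s l \<in> carrier A"
  and t_closed [simp]: "l \<in> carrier L \<Longrightarrow> t l \<in> carrier A"
  and s_mult: "l \<in> carrier L \<Longrightarrow> m \<in> carrier L \<Longrightarrow> s (l \<otimes>\<^bsub>L\<^esub> m) = s l \<otimes>\<^bsub>A\<^esub> s m"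
  and t_mult: "l \<in> carrier L \<Longrightarrow> m \<in> carrier L \<Longrightarrow> t (l \<otimes>\<^bsub>L\<^esub> m) = t m \<otimes>\<^bsub>A\<^esub> t l"
  and s_one: "s \<one>\<^bsub>L\<^esub> = \<one>\<^bsub>A\<^esub>" and t_one: "t \<one>\<^bsub>L\<^esub> = \<one>\<^bsub>A\<^esub>"
  using s_hom t_anti by (auto simp: alg_hom_def ring_hom_def alg_antihom_def)

lemma lin_s: "lin K L A s" and lin_t: "lin K L A t"
  using s_hom t_anti by (auto simp: alg_hom_def ring_hom_def alg_antihom_def lin_def)

lemmas lin_st [simp] = lin_comp[OF lin_s] lin_comp[OF lin_t]

lemma s_scalar: "c \<in> carrier K \<Longrightarrow> a \<in> carrier A \<Longrightarrow> s (c \<odot>\<^bsub>L\<^esub> \<one>\<^bsub>L\<^esub>) \<otimes>\<^bsub>A\<^esub> a = c \<odot>\<^bsub>A\<^esub> a"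
  and t_scalar: "c \<in> carrier K \<Longrightarrow> a \<in> carrier A \<Longrightarrow> t (c \<odot>\<^bsub>L\<^esub> \<one>\<^bsub>L\<^esub>) \<otimes>\<^bsub>A\<^esub> a = c \<odot>\<^bsub>A\<^esub> a"
  by (simp_all add: linD(3)[OF lin_s] linD(3)[OF lin_t] s_one t_one alg_smult[where K = K])

text \<open>Same module as \<open>left_mod\<close>, but built from the algebra and the source map
  alone, since the tensor square formed from it is the target in which the comultiplication is still
  to be constructed.\<close>

definition lm :: "('l, 'b) module" where
  "lm = \<lparr>carrier = carrier A, monoid.mult = monoid.mult A, one = \<one>\<^bsub>A\<^esub>, ring.zero = \<zero>\<^bsub>A\<^esub>,
                 add = add A, smult = (\<lambda>l b. s l \<otimes>\<^bsub>A\<^esub> b)\<rparr>"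

lemma lm_simps: "carrier lm = carrier A" "add lm = add A" "\<zero>\<^bsub>lm\<^esub> = \<zero>\<^bsub>A\<^esub>" "l \<odot>\<^bsub>lm\<^esub> a = s l \<otimes>\<^bsub>A\<^esub> a"
  "monoid.mult lm = monoid.mult A" "\<one>\<^bsub>lm\<^esub> = \<one>\<^bsub>A\<^esub>"
  by (simp_all add: lm_def)

end

lemma abelian_group_same:
  assumes "abelian_group M'" "carrier M = carrier M'" "add M = add M'" "\<zero>\<^bsub>M\<^esub> = \<zero>\<^bsub>M'\<^esub>"
  shows "abelian_group M"
proof -
  interpret abelian_group M' by fact
  show ?thesis
  proof (rule abelian_groupI)
    fix x y z assume "x \<in> carrier M" "y \<in> carrier M" "z \<in> carrier M"
    then have [simp]: "x \<in> carrier M'" "y \<in> carrier M'" "z \<in> carrier M'" by (simp_all add: assms)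
    show "x \<oplus>\<^bsub>M\<^esub> y \<in> carrier M" "x \<oplus>\<^bsub>M\<^esub> y \<oplus>\<^bsub>M\<^esub> z = x \<oplus>\<^bsub>M\<^esub> (y \<oplus>\<^bsub>M\<^esub> z)"
      by (simp_all add: assms a_assoc)
    show "x \<oplus>\<^bsub>M\<^esub> y = y \<oplus>\<^bsub>M\<^esub> x" unfolding assms by (rule a_comm) simp_all
    show "\<exists>y\<in>carrier M. y \<oplus>\<^bsub>M\<^esub> x = \<zero>\<^bsub>M\<^esub>"
      by (rule bexI[of _ "\<ominus>\<^bsub>M'\<^esub> x"]) (simp_all add: assms l_neg)
  qed (simp_all add: assms)
qed

text \<open>\<open>Mk\<close> is the \<open>L\<close>-module \<open>M\<close> viewed as a \<open>K\<close>-module along \<open>K \<rightarrow> L\<close>.\<close>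

locale base_tensor = enveloping K L A s t
  for K :: "'k ring" and L :: "('k, 'l) module" and A :: "('k, 'b) module" and s t :: "'l \<Rightarrow> 'b" +
  fixes M :: "('l, 'm) module" and Mk :: "('k, 'm, 'n) module_scheme"
  assumes mod_Mk [simp]: "module K Mk"
    and M_same: "carrier M = carrier Mk" "add M = add Mk" "\<zero>\<^bsub>M\<^esub> = \<zero>\<^bsub>Mk\<^esub>"
    and smult_M_closed: "\<And>l m. l \<in> carrier L \<Longrightarrow> m \<in> carrier Mk \<Longrightarrow> l \<odot>\<^bsub>M\<^esub> m \<in> carrier Mk"
    and smult_M_scalar: "\<And>c m. c \<in> carrier K \<Longrightarrow> m \<in> carrier Mk \<Longrightarrow> (c \<odot>\<^bsub>L\<^esub> \<one>\<^bsub>L\<^esub>) \<odot>\<^bsub>M\<^esub> m = c \<odot>\<^bsub>Mk\<^esub> m"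
begin

abbreviation "T \<equiv> tensor_product (carrier L) (\<lambda>a l. t l \<otimes>\<^bsub>A\<^esub> a) lm M"
abbreviation "Tk \<equiv> restrict_scalars L T"

lemma tensor_pair_T: "tensor_pair (carrier L) (\<lambda>a l. t l \<otimes>\<^bsub>A\<^esub> a) lm M"
proof (rule tensor_pair.intro)
  show "abelian_group lm"
    by (rule abelian_group_same[where M' = A]) (simp_all add: lm_simps ring.is_abelian_group[OF assoc_algebra_ring[OF alg_A]])
  show "abelian_group M"
    by (rule abelian_group_same[where M' = Mk]) (use mod_Mk in \<open>simp_all add: M_same module_def\<close>)
qed (simp_all add: lm_simps M_same smult_M_closed)

interpretation T: tensor_pair "carrier L" "\<lambda>a l. t l \<otimes>\<^bsub>A\<^esub> a" lm M
  by (rule tensor_pair_T)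

lemma T_closed: "a \<in> carrier A \<Longrightarrow> m \<in> carrier Mk \<Longrightarrow> tens T a m \<in> carrier T"
  using T.tens_closed by (simp add: lm_simps M_same)

lemma T_balance: "a \<in> carrier A \<Longrightarrow> l \<in> carrier L \<Longrightarrow> m \<in> carrier Mk \<Longrightarrow> tens T (t l \<otimes>\<^bsub>A\<^esub> a) m = tens T a (l \<odot>\<^bsub>M\<^esub> m)"
  using T.tens_balanced by (simp add: lm_simps M_same)

text \<open>Bilinearity over \<open>K\<close> is included besides balancing over \<open>L\<close>,
  so that the induced map on the tensor product is \<open>K\<close>-linear and not merely
  additive.\<close>

definition lbal where
  "lbal G \<phi> \<longleftrightarrow> bilin K A Mk G \<phi> \<and>
     (\<forall>l\<in>carrier L. \<forall>a\<in>carrier A. \<forall>m\<in>carrier Mk. \<phi> (t l \<otimes>\<^bsub>A\<^esub> a) m = \<phi> a (l \<odot>\<^bsub>M\<^esub> m))"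

lemma lbal_balanced: "lbal G \<phi> \<Longrightarrow> balanced (carrier L) (\<lambda>a l. t l \<otimes>\<^bsub>A\<^esub> a) lm M G \<phi>"
  unfolding lbal_def balanced_def bilin_def lin_def by (auto simp: lm_simps M_same)

lemma tlift_T_tens:
  assumes "module K G" "lbal G \<phi>" "a \<in> carrier A" "m \<in> carrier Mk"
  shows "tlift G (tens T a m) \<phi> = \<phi> a m"
proof -
  interpret G: module K G by fact
  show ?thesis using T.tlift_tens[OF G.abelian_group_axioms lbal_balanced[OF assms(2)]] assms(3,4)
    by (simp add: lm_simps M_same)
qed

lemma tlift_T_closed:
  assumes "module K G" "lbal G \<phi>" "z \<in> carrier T"
  shows "tlift G z \<phi> \<in> carrier G"
proof -
  interpret G: module K G by fact
  show ?thesis using T.tlift_closed[OF G.abelian_group_axioms lbal_balanced[OF assms(2)]] assms(3) by simp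
qed

lemma tlift_T_add:
  assumes "module K G" "lbal G \<phi>" "z \<in> carrier T" "w \<in> carrier T"
  shows "tlift G (z \<oplus>\<^bsub>T\<^esub> w) \<phi> = tlift G z \<phi> \<oplus>\<^bsub>G\<^esub> tlift G w \<phi>"
proof -
  interpret G: module K G by fact
  show ?thesis using T.tlift_add[OF G.abelian_group_axioms lbal_balanced[OF assms(2)]] assms(3,4) by simp
qed

lemma T_induct [consumes 1, case_names tens add]:
  assumes "z \<in> carrier T" "\<And>a b. a \<in> carrier A \<Longrightarrow> b \<in> carrier Mk \<Longrightarrow> P (tens T a b)"
    "\<And>x y. x \<in> carrier T \<Longrightarrow> y \<in> carrier T \<Longrightarrow> P x \<Longrightarrow> P y \<Longrightarrow> P (x \<oplus>\<^bsub>T\<^esub> y)"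
  shows "P z"
  using assms(1) by (rule T.tensor_induct) (simp_all add: assms(2,3) lm_simps M_same)

text \<open>The action through \<open>s\<close> respects a balancing relation formulated with
  \<open>t\<close> because the images of the two maps commute.\<close>

lemma smult_T_balanced:
  assumes [simp]: "l \<in> carrier L"
  shows "balanced (carrier L) (\<lambda>a l. t l \<otimes>\<^bsub>A\<^esub> a) lm M T (\<lambda>a m. tens T (l \<odot>\<^bsub>lm\<^esub> a) m)"
proof -
  have "tens T (s l \<otimes>\<^bsub>A\<^esub> (t l' \<otimes>\<^bsub>A\<^esub> a)) m = tens T (s l \<otimes>\<^bsub>A\<^esub> a) (l' \<odot>\<^bsub>M\<^esub> m)"
    if [simp]: "l' \<in> carrier L" "a \<in> carrier A" "m \<in> carrier Mk" for l' a m
  proof -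
    have "s l \<otimes>\<^bsub>A\<^esub> (t l' \<otimes>\<^bsub>A\<^esub> a) = t l' \<otimes>\<^bsub>A\<^esub> (s l \<otimes>\<^bsub>A\<^esub> a)"
      by (simp add: alg_closed(5)[where K = K, symmetric] s_t_commute)
    then show ?thesis by (simp add: T_balance)
  qed
  moreover have "s l \<otimes>\<^bsub>A\<^esub> (a \<oplus>\<^bsub>A\<^esub> a') = s l \<otimes>\<^bsub>A\<^esub> a \<oplus>\<^bsub>A\<^esub> s l \<otimes>\<^bsub>A\<^esub> a'" if "a \<in> carrier A" "a' \<in> carrier A" for a a'
    using that by (simp add: linD(2)[OF lin_mult_r[OF alg_A lin_ident]])
  ultimately show ?thesis
    using T.tens_add_left T.tens_add_right by (simp add: balanced_def lm_simps M_same T_closed)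
qed

lemma smult_T_tens: "l \<in> carrier L \<Longrightarrow> a \<in> carrier A \<Longrightarrow> m \<in> carrier Mk \<Longrightarrow> l \<odot>\<^bsub>T\<^esub> tens T a m = tens T (s l \<otimes>\<^bsub>A\<^esub> a) m"
  unfolding tensor_product_smult
  using T.tlift_tens[OF T.T_abelian smult_T_balanced] by (simp add: lm_simps M_same)

lemma smult_T_closed: "l \<in> carrier L \<Longrightarrow> z \<in> carrier T \<Longrightarrow> l \<odot>\<^bsub>T\<^esub> z \<in> carrier T"
  unfolding tensor_product_smult using T.tlift_closed[OF T.T_abelian smult_T_balanced] .

lemma smult_T_add: "l \<in> carrier L \<Longrightarrow> z \<in> carrier T \<Longrightarrow> w \<in> carrier T \<Longrightarrow>
   l \<odot>\<^bsub>T\<^esub> (z \<oplus>\<^bsub>T\<^esub> w) = l \<odot>\<^bsub>T\<^esub> z \<oplus>\<^bsub>T\<^esub> l \<odot>\<^bsub>T\<^esub> w"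
  unfolding tensor_product_smult using T.tlift_add[OF T.T_abelian smult_T_balanced] .

lemma Tk_simps: "carrier Tk = carrier T" "add Tk = add T" "\<zero>\<^bsub>Tk\<^esub> = \<zero>\<^bsub>T\<^esub>"
  by (simp_all add: restrict_scalars_simps)

lemma smult_Tk_tens: "c \<in> carrier K \<Longrightarrow> a \<in> carrier A \<Longrightarrow> m \<in> carrier Mk \<Longrightarrow> c \<odot>\<^bsub>Tk\<^esub> tens T a m = tens T (c \<odot>\<^bsub>A\<^esub> a) m"
  by (simp add: restrict_scalars_simps smult_T_tens s_scalar)

lemma smult_Tk_closed: "c \<in> carrier K \<Longrightarrow> z \<in> carrier T \<Longrightarrow> c \<odot>\<^bsub>Tk\<^esub> z \<in> carrier T"
  by (simp add: restrict_scalars_simps smult_T_closed)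

lemma smult_Tk_add: "c \<in> carrier K \<Longrightarrow> z \<in> carrier T \<Longrightarrow> w \<in> carrier T \<Longrightarrow>
   c \<odot>\<^bsub>Tk\<^esub> (z \<oplus>\<^bsub>T\<^esub> w) = c \<odot>\<^bsub>Tk\<^esub> z \<oplus>\<^bsub>T\<^esub> c \<odot>\<^bsub>Tk\<^esub> w"
  by (simp add: restrict_scalars_simps smult_T_add)

text \<open>\<open>module\<close> presupposes commutative scalars, so the module axioms are stated
  for the restriction to \<open>K\<close>; they are verified on pure tensors.\<close>

lemma mod_Tk [simp]: "module K Tk"
proof -
  interpret A: module K A by simp
  show ?thesis
  proof (rule moduleI)
    show "cring K" by (rule A.R.is_cring)
    show "abelian_group Tk" by (rule abelian_group_same[OF T.T_abelian]) (simp_all add: Tk_simps)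
    fix a b x assume ab: "a \<in> carrier K" "b \<in> carrier K" and "x \<in> carrier Tk"
    then have x: "x \<in> carrier T" by (simp add: Tk_simps)
    show "(a \<oplus>\<^bsub>K\<^esub> b) \<odot>\<^bsub>Tk\<^esub> x = a \<odot>\<^bsub>Tk\<^esub> x \<oplus>\<^bsub>Tk\<^esub> b \<odot>\<^bsub>Tk\<^esub> x"
      using x unfolding Tk_simps
    proof (induction x rule: T_induct)
      case (tens u v)
      then show ?case using ab T.tens_add_left by (simp add: smult_Tk_tens A.smult_l_distr lm_simps M_same)
    next
      case (add x y)
      then show ?case using ab by (simp add: smult_Tk_add smult_Tk_closed T.T.a_ac)
    qed
    show "(a \<otimes>\<^bsub>K\<^esub> b) \<odot>\<^bsub>Tk\<^esub> x = a \<odot>\<^bsub>Tk\<^esub> (b \<odot>\<^bsub>Tk\<^esub> x)"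
      using x
    proof (induction x rule: T_induct)
      case (tens u v)
      then show ?case using ab by (simp add: smult_Tk_tens A.smult_assoc1)
    next
      case (add x y)
      then show ?case using ab by (simp add: smult_Tk_add smult_Tk_closed)
    qed
  next
    fix x assume "x \<in> carrier Tk"
    then have "x \<in> carrier T" by (simp add: Tk_simps)
    then show "\<one>\<^bsub>K\<^esub> \<odot>\<^bsub>Tk\<^esub> x = x"
    proof (induction x rule: T_induct)
      case (tens u v)
      then show ?case by (simp add: smult_Tk_tens)
    next
      case (add x y)
      then show ?case by (simp add: smult_Tk_add)
    qed
  qed (simp_all add: Tk_simps smult_Tk_closed smult_Tk_add)
qed

text \<open>Homogeneity in the second argument is no generating relation of its own. It is the
  balancing relation at the scalar c 1, where \<open>t\<close> acts as multiplication by
  \<open>c\<close>.\<close>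

lemma bilin_T: "bilin K A Mk Tk (tens T)"
proof -
  have "tens T a (c \<odot>\<^bsub>Mk\<^esub> m) = c \<odot>\<^bsub>Tk\<^esub> tens T a m"
    if [simp]: "c \<in> carrier K" "a \<in> carrier A" "m \<in> carrier Mk" for a c m
    using T_balance[of a "c \<odot>\<^bsub>L\<^esub> \<one>\<^bsub>L\<^esub>" m] by (simp add: smult_M_scalar t_scalar smult_Tk_tens)
  then show ?thesis
    using T.tens_add_left T.tens_add_right
    by (simp add: bilin_def lin_def Tk_simps T_closed smult_Tk_tens lm_simps M_same)
qed

lemmas lin_T_l = bilin_comp_l[OF bilin_T]
lemmas lin_T_r = bilin_comp_r[OF bilin_T]

lemma lin_tlift_T:
  assumes "module K G" "lbal G \<phi>"
  shows "lin K Tk G (\<lambda>z. tlift G z \<phi>)"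
proof (rule linI)
  interpret G: module K G by fact
  fix x y assume "x \<in> carrier Tk"
  then have x: "x \<in> carrier T" by (simp add: Tk_simps)
  show "tlift G x \<phi> \<in> carrier G" using tlift_T_closed[OF assms x] .
  show "y \<in> carrier Tk \<Longrightarrow> tlift G (x \<oplus>\<^bsub>Tk\<^esub> y) \<phi> = tlift G x \<phi> \<oplus>\<^bsub>G\<^esub> tlift G y \<phi>"
    using tlift_T_add[OF assms x, of y] by (simp add: Tk_simps)
  show "tlift G (c \<odot>\<^bsub>Tk\<^esub> x) \<phi> = c \<odot>\<^bsub>G\<^esub> tlift G x \<phi>" if c: "c \<in> carrier K" for c
    using x
  proof (induction x rule: T_induct)
    case (tens a b)
    have "bilin K A Mk G \<phi>" using assms(2) by (simp add: lbal_def)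
    then have l: "lin K A G (\<lambda>a. \<phi> a b)" using tens(2) by (rule bilinD(2))
    show ?case using c tens linD(3)[OF l c tens(1)] by (simp add: smult_Tk_tens tlift_T_tens[OF assms])
  next
    case (add x y)
    then show ?case using c
      by (simp add: smult_Tk_add smult_Tk_closed tlift_T_add[OF assms] tlift_T_closed[OF assms] G.smult_r_distr)
  qed
qed

lemma T_ext:
  assumes "lin K Tk G f" "lin K Tk G g" "\<And>a m. a \<in> carrier A \<Longrightarrow> m \<in> carrier Mk \<Longrightarrow> f (tens T a m) = g (tens T a m)"
    "z \<in> carrier T"
  shows "f z = g z"
  using assms(4)
proof (induction z rule: T_induct)
  case (add x y)
  then show ?case using assms(1,2) by (simp add: lin_def Tk_simps)
qed (use assms in auto)

text \<open>The counterpart of \<open>lin_sw\<close> for tensors over \<open>L\<close>, which have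
  no fixed decomposition: linearity in a parameter spreads from pure tensors to all tensors because
  each \<open>f v\<close> is additive.\<close>

lemma lin_param:
  assumes mG: "module K G" and mY: "module K Y" and x: "x \<in> carrier T"
    and f: "\<And>v. v \<in> carrier Y \<Longrightarrow> lin K Tk G (f v)"
    and p: "\<And>a m. a \<in> carrier A \<Longrightarrow> m \<in> carrier Mk \<Longrightarrow> lin K Y G (\<lambda>v. f v (tens T a m))"
  shows "lin K Y G (\<lambda>v. f v x)"
  using x
proof (induction x rule: T_induct)
  case (tens a b)
  then show ?case by (rule p)
next
  case (add x y)
  interpret M: module K G by (rule mG)
  interpret Y: module K Y by (rule mY)
  interpret TT: module K Tk by (rule mod_Tk)
  show ?case
  proof (rule linI)
    fix v w c assume v: "v \<in> carrier Y"
    show "f v (x \<oplus>\<^bsub>T\<^esub> y) \<in> carrier G"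
      using linD(1)[OF f[OF v], of "x \<oplus>\<^bsub>T\<^esub> y"] TT.a_closed[of x y] add by (simp add: Tk_simps)
    have s: "f u (x \<oplus>\<^bsub>T\<^esub> y) = f u x \<oplus>\<^bsub>G\<^esub> f u y" if "u \<in> carrier Y" for u
      using linD(2)[OF f[OF that], of x y] add by (simp add: Tk_simps)
    have cl: "f u x \<in> carrier G" "f u y \<in> carrier G" if "u \<in> carrier Y" for u
      using linD(1)[OF f[OF that]] add by (simp_all add: Tk_simps)
    show "f (v \<oplus>\<^bsub>Y\<^esub> w) (x \<oplus>\<^bsub>T\<^esub> y) = f v (x \<oplus>\<^bsub>T\<^esub> y) \<oplus>\<^bsub>G\<^esub> f w (x \<oplus>\<^bsub>T\<^esub> y)" if w: "w \<in> carrier Y"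
      using v w cl linD(2)[OF add(3), of v w] linD(2)[OF add(4), of v w] by (simp add: s M.a_ac)
    show "f (c \<odot>\<^bsub>Y\<^esub> v) (x \<oplus>\<^bsub>T\<^esub> y) = c \<odot>\<^bsub>G\<^esub> f v (x \<oplus>\<^bsub>T\<^esub> y)" if c: "c \<in> carrier K"
      using v c cl linD(3)[OF add(3) c v] linD(3)[OF add(4) c v] by (simp add: s M.smult_r_distr)
  qed
qed

lemma lin_smult_T:
  assumes l [simp]: "l \<in> carrier L"
  shows "lin K Tk Tk (\<lambda>z. l \<odot>\<^bsub>T\<^esub> z)"
proof (rule linI)
  fix x y assume "x \<in> carrier Tk"
  then have x: "x \<in> carrier T" by (simp add: Tk_simps)
  show "l \<odot>\<^bsub>T\<^esub> x \<in> carrier Tk" using smult_T_closed[OF l x] by (simp add: Tk_simps)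
  show "y \<in> carrier Tk \<Longrightarrow> l \<odot>\<^bsub>T\<^esub> (x \<oplus>\<^bsub>Tk\<^esub> y) = l \<odot>\<^bsub>T\<^esub> x \<oplus>\<^bsub>Tk\<^esub> l \<odot>\<^bsub>T\<^esub> y"
    using smult_T_add[OF l x] by (simp add: Tk_simps)
  show "l \<odot>\<^bsub>T\<^esub> (c \<odot>\<^bsub>Tk\<^esub> x) = c \<odot>\<^bsub>Tk\<^esub> (l \<odot>\<^bsub>T\<^esub> x)" if c [simp]: "c \<in> carrier K" for c
    using x
  proof (induction x rule: T_induct)
    case (tens a b)
    then show ?case by (simp add: smult_T_tens smult_Tk_tens alg_smult[where K = K])
  next
    case (add x y)
    then show ?case by (simp add: smult_T_add smult_Tk_add smult_T_closed smult_Tk_closed)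
  qed
qed

end

section \<open>The tensor square and cube over the base, and the Takeuchi product\<close>

context enveloping
begin

lemma base_tensor_lm: "base_tensor K L A s t lm A"
  by (rule base_tensor.intro[OF enveloping_axioms base_tensor_axioms.intro]) (simp_all add: lm_simps s_scalar)

sublocale B2: base_tensor K L A s t lm A
  by (rule base_tensor_lm)

abbreviation "BB \<equiv> B2.T"
abbreviation "BBk \<equiv> B2.Tk"

sublocale B3: base_tensor K L A s t BB BBk
  by (rule base_tensor.intro[OF enveloping_axioms base_tensor_axioms.intro])
     (simp_all add: restrict_scalars_simps B2.smult_T_closed)

abbreviation "BBB \<equiv> B3.T"
abbreviation "BBBk \<equiv> B3.Tk"

text \<open>The inner sum of the product on the tensor square, isolated because it makes sense for
  every \<open>x\<close>: balancing multiplies from the left and does not interfere. A condition on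
  \<open>x\<close> arises only when the pair of multipliers varies.\<close>

definition rmul :: "'b \<Rightarrow> 'b \<Rightarrow> ('b, 'b) tensor \<Rightarrow> ('b, 'b) tensor" where
  "rmul a' b' x = tlift BBk x (\<lambda>a b. tens BB (a \<otimes>\<^bsub>A\<^esub> a') (b \<otimes>\<^bsub>A\<^esub> b'))"

lemma rmul_lbal:
  assumes "a' \<in> carrier A" "b' \<in> carrier A"
  shows "B2.lbal BBk (\<lambda>a b. tens BB (a \<otimes>\<^bsub>A\<^esub> a') (b \<otimes>\<^bsub>A\<^esub> b'))"
  using assms by (simp add: B2.lbal_def B2.lin_T_l B2.lin_T_r B2.T_balance lm_simps alg_closed(5)[where K = K])

lemma rmul_tens:
  assumes "a \<in> carrier A" "b \<in> carrier A" "a' \<in> carrier A" "b' \<in> carrier A"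
  shows "rmul a' b' (tens BB a b) = tens BB (a \<otimes>\<^bsub>A\<^esub> a') (b \<otimes>\<^bsub>A\<^esub> b')"
  unfolding rmul_def using assms by (simp add: B2.tlift_T_tens rmul_lbal)

lemma lin_rmul: "a' \<in> carrier A \<Longrightarrow> b' \<in> carrier A \<Longrightarrow> lin K BBk BBk (rmul a' b')"
  unfolding rmul_def[abs_def] by (rule B2.lin_tlift_T) (simp_all add: rmul_lbal)

lemma rmul_rmul:
  assumes [simp]: "a \<in> carrier A" "b \<in> carrier A" "a' \<in> carrier A" "b' \<in> carrier A" and x: "x \<in> carrier BB"
  shows "rmul a' b' (rmul a b x) = rmul (a \<otimes>\<^bsub>A\<^esub> a') (b \<otimes>\<^bsub>A\<^esub> b') x"
  by (rule B2.T_ext[OF _ _ _ x, where G = BBk])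
     (simp_all add: lin_comp[OF lin_rmul lin_rmul] lin_rmul rmul_tens alg_closed(5)[where K = K])

lemma bilin_rmul:
  assumes x: "x \<in> carrier BB"
  shows "bilin K A A BBk (\<lambda>a' b'. rmul a' b' x)"
proof -
  have "lin K A BBk (\<lambda>v. rmul c v (tens BB a b))" "lin K A BBk (\<lambda>v. rmul v c (tens BB a b))"
    if "a \<in> carrier A" "b \<in> carrier A" "c \<in> carrier A" for a b c
  proof -
    have "lin K A BBk (\<lambda>v. rmul c v (tens BB a b)) = lin K A BBk (\<lambda>v. tens BB (a \<otimes>\<^bsub>A\<^esub> c) (b \<otimes>\<^bsub>A\<^esub> v))"
      by (rule lin_cong) (simp_all add: rmul_tens that)
    then show "lin K A BBk (\<lambda>v. rmul c v (tens BB a b))" by (simp add: B2.lin_T_r that)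
    have "lin K A BBk (\<lambda>v. rmul v c (tens BB a b)) = lin K A BBk (\<lambda>v. tens BB (a \<otimes>\<^bsub>A\<^esub> v) (b \<otimes>\<^bsub>A\<^esub> c))"
      by (rule lin_cong) (simp_all add: rmul_tens that)
    then show "lin K A BBk (\<lambda>v. rmul v c (tens BB a b))" by (simp add: B2.lin_T_l that)
  qed
  note l = this
  show ?thesis
    by (rule bilinI; rule B2.lin_param) (simp_all add: lin_rmul l x)
qed

text \<open>The condition x (t(l) \<otimes> 1) = x (1 \<otimes> s(l)), written with
  \<open>rmul\<close> because the full product is not yet meaningful for a general
  \<open>x\<close>.\<close>

definition takeuchi :: "('b, 'b) tensor \<Rightarrow> bool" where
  "takeuchi x \<longleftrightarrow> x \<in> carrier BB \<and> (\<forall>l\<in>carrier L. rmul (t l) \<one>\<^bsub>A\<^esub> x = rmul \<one>\<^bsub>A\<^esub> (s l) x)"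

text \<open>Being in the Takeuchi product is what makes \<open>x y\<close> well defined in \<open>y \<in> B \<otimes>\<^sub>L B\<close>.\<close>

lemma takeuchi_lbal:
  assumes "takeuchi x"
  shows "B2.lbal BBk (\<lambda>a' b'. rmul a' b' x)"
proof -
  have x: "x \<in> carrier BB" using assms by (simp add: takeuchi_def)
  have "rmul (t l \<otimes>\<^bsub>A\<^esub> a) m x = rmul a (s l \<otimes>\<^bsub>A\<^esub> m) x"
    if [simp]: "l \<in> carrier L" "a \<in> carrier A" "m \<in> carrier A" for l a m
  proof -
    have "rmul (t l \<otimes>\<^bsub>A\<^esub> a) m x = rmul a m (rmul (t l) \<one>\<^bsub>A\<^esub> x)" using x by (simp add: rmul_rmul)
    also have "\<dots> = rmul a m (rmul \<one>\<^bsub>A\<^esub> (s l) x)" using assms by (simp add: takeuchi_def)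
    also have "\<dots> = rmul a (s l \<otimes>\<^bsub>A\<^esub> m) x" using x by (simp add: rmul_rmul)
    finally show ?thesis .
  qed
  then show ?thesis using bilin_rmul[OF x] by (simp only: B2.lbal_def lm_simps) simp
qed

lemma mult_BB: "x \<otimes>\<^bsub>BB\<^esub> y = tlift BBk y (\<lambda>a' b'. rmul a' b' x)"
proof -
  have e: "tlift BB z \<phi> = tlift BBk z \<phi>" for z :: "('b, 'b) tensor" and \<phi>
    by (simp add: tlift_same[of BB BBk] B2.Tk_simps)
  show ?thesis unfolding tensor_product_mult rmul_def by (simp add: lm_simps e)
qed

lemma mult_BB_tens:
  assumes "takeuchi x" "a' \<in> carrier A" "b' \<in> carrier A"
  shows "x \<otimes>\<^bsub>BB\<^esub> tens BB a' b' = rmul a' b' x"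
  unfolding mult_BB using assms by (simp add: B2.tlift_T_tens takeuchi_lbal)

lemma lin_mult_BB: "takeuchi x \<Longrightarrow> lin K BBk BBk (\<lambda>y. x \<otimes>\<^bsub>BB\<^esub> y)"
  using B2.lin_tlift_T[OF B2.mod_Tk takeuchi_lbal] by (simp add: mult_BB)

text \<open>The right action of \<open>L\<close> on the tensor square, inherited from the right
  factor; it is well defined because \<open>s\<close> and \<open>t\<close> commute.\<close>

definition tmul :: "'l \<Rightarrow> ('b, 'b) tensor \<Rightarrow> ('b, 'b) tensor" where
  "tmul l z = tlift BBk z (\<lambda>a b. tens BB a (t l \<otimes>\<^bsub>A\<^esub> b))"

lemma tmul_lbal:
  assumes [simp]: "l \<in> carrier L"
  shows "B2.lbal BBk (\<lambda>a b. tens BB a (t l \<otimes>\<^bsub>A\<^esub> b))"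
proof -
  have "tens BB (t l' \<otimes>\<^bsub>A\<^esub> a) (t l \<otimes>\<^bsub>A\<^esub> b) = tens BB a (t l \<otimes>\<^bsub>A\<^esub> (s l' \<otimes>\<^bsub>A\<^esub> b))"
    if [simp]: "l' \<in> carrier L" "a \<in> carrier A" "b \<in> carrier A" for l' a b
  proof -
    have "t l \<otimes>\<^bsub>A\<^esub> (s l' \<otimes>\<^bsub>A\<^esub> b) = s l' \<otimes>\<^bsub>A\<^esub> (t l \<otimes>\<^bsub>A\<^esub> b)"
      by (simp add: alg_closed(5)[where K = K, symmetric] s_t_commute)
    then show ?thesis by (simp add: B2.T_balance lm_simps)
  qed
  then show ?thesis by (simp add: B2.lbal_def B2.lin_T_l B2.lin_T_r lm_simps)
qed

lemma tmul_tens: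
  "l \<in> carrier L \<Longrightarrow> a \<in> carrier A \<Longrightarrow> b \<in> carrier A \<Longrightarrow> tmul l (tens BB a b) = tens BB a (t l \<otimes>\<^bsub>A\<^esub> b)"
  unfolding tmul_def by (simp add: B2.tlift_T_tens tmul_lbal)

lemma lin_tmul: "l \<in> carrier L \<Longrightarrow> lin K BBk BBk (tmul l)"
  unfolding tmul_def[abs_def] by (rule B2.lin_tlift_T) (simp_all add: tmul_lbal)

text \<open>The associativity map from (B \<otimes> B) \<otimes> B to B \<otimes> (B \<otimes> B)
  over \<open>L\<close> with its last argument held fixed, so that the cube bracketed to the left
  need not be constructed.\<close>

definition reassoc :: "'b \<Rightarrow> ('b, 'b) tensor \<Rightarrow> ('b, ('b, 'b) tensor) tensor" where
  "reassoc c z = tlift BBBk z (\<lambda>a b. tens BBB a (tens BB b c))"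

lemma reassoc_lbal:
  "c \<in> carrier A \<Longrightarrow> B2.lbal BBBk (\<lambda>a b. tens BBB a (tens BB b c))"
  by (simp add: B2.lbal_def B2.lin_T_l B2.lin_T_r B3.lin_T_l B3.lin_T_r B2.Tk_simps B2.T_closed
      B3.T_balance B2.smult_T_tens lm_simps)

lemma reassoc_tens:
  "a \<in> carrier A \<Longrightarrow> b \<in> carrier A \<Longrightarrow> c \<in> carrier A \<Longrightarrow> reassoc c (tens BB a b) = tens BBB a (tens BB b c)"
  unfolding reassoc_def by (simp add: B2.tlift_T_tens reassoc_lbal)

lemma lin_reassoc: "c \<in> carrier A \<Longrightarrow> lin K BBk BBBk (reassoc c)"
  unfolding reassoc_def[abs_def] by (rule B2.lin_tlift_T) (simp_all add: reassoc_lbal)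

lemma bilin_reassoc: "bilin K A BBk BBBk reassoc"
proof (rule bilinI)
  fix z assume "z \<in> carrier BBk"
  then have z: "z \<in> carrier BB" by (simp add: B2.Tk_simps)
  have l: "lin K A BBBk (\<lambda>c. reassoc c (tens BB a b))" if [simp]: "a \<in> carrier A" "b \<in> carrier A" for a b
  proof -
    have "lin K A BBBk (\<lambda>c. reassoc c (tens BB a b)) = lin K A BBBk (\<lambda>c. tens BBB a (tens BB b c))"
      by (rule lin_cong) (simp_all add: reassoc_tens)
    then show ?thesis by (simp add: B3.lin_T_r B2.lin_T_r)
  qed
  show "lin K A BBBk (\<lambda>c. reassoc c z)"
    by (rule B2.lin_param) (simp_all add: lin_reassoc l z)
qed (simp add: lin_reassoc)

text \<open>The right action on the square is exactly the action that balances against a third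
  factor; with this, nested sums over iterated coproducts become well defined.\<close>

lemma reassoc_tmul:
  assumes [simp]: "l \<in> carrier L" "c \<in> carrier A" and z: "z \<in> carrier BB"
  shows "reassoc c (tmul l z) = reassoc (s l \<otimes>\<^bsub>A\<^esub> c) z"
  by (rule B2.T_ext[OF _ _ _ z, where G = BBBk])
     (simp_all add: lin_comp[OF lin_reassoc lin_tmul] lin_reassoc tmul_tens reassoc_tens B2.T_balance lm_simps)

end

section \<open>The smash product and its source and target maps\<close>

lemma module_same:
  assumes "module K M'" "carrier M = carrier M'" "add M = add M'" "\<zero>\<^bsub>M\<^esub> = \<zero>\<^bsub>M'\<^esub>" "smult M = smult M'"
  shows "module K M"
proof -
  interpret module K M' by fact
  show ?thesis
  proof (rule moduleI)
    show "cring K" by (rule R.is_cring)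
    show "abelian_group M" by (rule abelian_group_same[OF M.abelian_group_axioms assms(2-4)])
  qed (simp_all add: assms smult_l_distr smult_r_distr smult_assoc1)
qed

lemma assoc_algebra_same:
  assumes "assoc_algebra K M'" "carrier M = carrier M'" "add M = add M'" "\<zero>\<^bsub>M\<^esub> = \<zero>\<^bsub>M'\<^esub>" "smult M = smult M'"
    "monoid.mult M = monoid.mult M'" "\<one>\<^bsub>M\<^esub> = \<one>\<^bsub>M'\<^esub>"
  shows "assoc_algebra K M"
proof -
  have "bilin K M M M (\<lambda>x y. x \<otimes>\<^bsub>M\<^esub> y)"
    using bilin_mult[OF assms(1)] by (simp add: bilin_def lin_def assms)
  then show ?thesis
    by (intro assoc_algebraI module_same[OF assoc_algebra_module[OF assms(1)]])
       (simp_all add: assms alg_closed[OF assms(1)])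
qed

context dynamical_data
begin

definition LH where "LH = smash_product K H act L"

text \<open>The smash product changes only the multiplication of the tensor product, so pure
  tensors, linear maps and sums are inherited unchanged.\<close>

lemma LH_simps: "carrier LH = carrier (ktensor K L H)" "add LH = add (ktensor K L H)"
  "\<zero>\<^bsub>LH\<^esub> = \<zero>\<^bsub>ktensor K L H\<^esub>" "smult LH = smult (ktensor K L H)" "\<one>\<^bsub>LH\<^esub> = \<one>\<^bsub>ktensor K L H\<^esub>"
  by (simp_all add: LH_def smash_product_def Let_def)

lemma tens_LH: "tens LH = tens (ktensor K L H)"
  by (rule tens_same) (simp add: LH_simps)

lemma tlift_LH: "tlift LH = tlift (ktensor K L H)"
  by (rule tlift_same) (simp_all add: LH_simps)

lemma mod_LH [simp]: "module K LH"
  by (rule module_same[of K "ktensor K L H"]) (simp_all add: LH_simps)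

lemma lin_LH: "lin K Y LH f = lin K Y (ktensor K L H) f" "lin K LH G g = lin K (ktensor K L H) G g"
  by (simp_all add: lin_def LH_simps)

lemma LH_closed [simp]: "l \<in> carrier L \<Longrightarrow> h \<in> carrier H \<Longrightarrow> tens LH l h \<in> carrier LH"
  by (simp add: LH_simps tens_LH)

lemma LH_one: "\<one>\<^bsub>LH\<^esub> = tens LH \<one>\<^bsub>L\<^esub> \<one>\<^bsub>H\<^esub>"
  by (simp add: LH_simps tens_LH ktensor_one)

lemma lin_tens_LH [simp]:
  "lin K Y L f \<Longrightarrow> h \<in> carrier H \<Longrightarrow> lin K Y LH (\<lambda>x. tens LH (f x) h)"
  "lin K Y H g \<Longrightarrow> l \<in> carrier L \<Longrightarrow> lin K Y LH (\<lambda>x. tens LH l (g x))"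
  unfolding tens_LH lin_LH by simp_all

lemma sw_LH_tens: "module K G \<Longrightarrow> bilin K L H G \<phi> \<Longrightarrow> l \<in> carrier L \<Longrightarrow> h \<in> carrier H \<Longrightarrow>
   sw K L H G (tens LH l h) \<phi> = \<phi> l h"
  unfolding tens_LH by (intro ktensor_sw_tens mod modL)

lemma lin_sw_LH [simp]: "module K G \<Longrightarrow> bilin K L H G \<phi> \<Longrightarrow> lin K Y LH f \<Longrightarrow> lin K Y G (\<lambda>x. sw K L H G (f x) \<phi>)"
  unfolding lin_LH by (intro ktensor_lin_sw_arg mod modL)

lemma tlift_LH_sw_cong:
  assumes "module K G" "z \<in> carrier LH"
    "\<And>a b. a \<in> carrier L \<Longrightarrow> b \<in> carrier H \<Longrightarrow> \<phi> a b = \<psi> a b" "bilin K L H G \<psi>"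
  shows "tlift G z \<phi> = sw K L H G z \<psi>"
  using assms by (intro tlift_sw_cong) (simp_all add: LH_simps)

lemma LH_ext:
  assumes "module K G" "lin K LH G f" "lin K LH G g"
    "\<And>l h. l \<in> carrier L \<Longrightarrow> h \<in> carrier H \<Longrightarrow> f (tens LH l h) = g (tens LH l h)" "z \<in> carrier LH"
  shows "f z = g z"
  using assms unfolding tens_LH lin_LH LH_simps by (intro ktensor_linext[of K L H G f g z]) simp_all

text \<open>The product in the form in which bilinearity follows from the linearity rules alone,
  before anything is known about \<open>LH\<close> as an algebra.\<close>

definition smash where
  "smash x y = sw K L H LH x (\<lambda>l f. sw K L H LH y (\<lambda>m g. sw K H H LH (comult H f) (\<lambda>f1 f2.
     tens LH (l \<otimes>\<^bsub>L\<^esub> act f1 m) (f2 \<otimes>\<^bsub>H\<^esub> g))))"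

lemma smash_mult:
  assumes [simp]: "x \<in> carrier LH" "y \<in> carrier LH"
  shows "x \<otimes>\<^bsub>LH\<^esub> y = smash x y"
proof -
  have "x \<otimes>\<^bsub>LH\<^esub> y = tlift LH x (\<lambda>l f. tlift LH y (\<lambda>m g. tlift LH (comult H f) (\<lambda>f1 f2.
     tens LH (l \<otimes>\<^bsub>L\<^esub> act f1 m) (f2 \<otimes>\<^bsub>H\<^esub> g))))"
    unfolding tlift_LH tens_LH by (simp add: LH_def smash_product_def Let_def)
  also have "\<dots> = smash x y"
    unfolding smash_def by (intro tlift_LH_sw_cong tlift_comult) simp_all
  finally show ?thesis .
qed

lemma bilin_smash: "bilin K LH LH LH smash"
  unfolding smash_def[abs_def] by simp

lemma smash_tens:
  assumes [simp]: "l \<in> carrier L" "f \<in> carrier H" "m \<in> carrier L" "g \<in> carrier H"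
  shows "smash (tens LH l f) (tens LH m g) = sw K H H LH (comult H f) (\<lambda>f1 f2.
     tens LH (l \<otimes>\<^bsub>L\<^esub> act f1 m) (f2 \<otimes>\<^bsub>H\<^esub> g))"
  unfolding smash_def by (simp add: sw_LH_tens)

text \<open>Multiplicativity of \<Delta> splits the middle product, the action of a product becomes
  a composite of actions, and the module algebra axiom reassembles them into one action on a product
  in \<open>L\<close>.\<close>

lemma smash_assoc_tens:
  assumes [simp]: "l \<in> carrier L" "f \<in> carrier H" "m \<in> carrier L" "g \<in> carrier H" "n \<in> carrier L" "h \<in> carrier H"
  shows "smash (smash (tens LH l f) (tens LH m g)) (tens LH n h) =
    smash (tens LH l f) (smash (tens LH m g) (tens LH n h))"
proof -
  note b = bilin_smash
  note [simp] = bilin_comp_l[OF b] bilin_comp_r[OF b] bilinD(3)[OF b]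
  have "smash (smash (tens LH l f) (tens LH m g)) (tens LH n h) =
    sw K H H LH (comult H f) (\<lambda>f1 f2. smash (tens LH (l \<otimes>\<^bsub>L\<^esub> act f1 m) (f2 \<otimes>\<^bsub>H\<^esub> g)) (tens LH n h))"
    unfolding smash_tens[OF assms(1-4)]
    by (rule ktensor_sw_hom[where f = "\<lambda>x. smash x (tens LH n h)" and G = LH and G' = LH]) simp_all
  also have "\<dots> = sw K H H LH (comult H f) (\<lambda>f1 f2. sw K H H LH (comult H (f2 \<otimes>\<^bsub>H\<^esub> g)) (\<lambda>a b.
      tens LH ((l \<otimes>\<^bsub>L\<^esub> act f1 m) \<otimes>\<^bsub>L\<^esub> act a n) (b \<otimes>\<^bsub>H\<^esub> h)))"
    by (simp add: smash_tens cong: ktensor_sw_cong)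
  also have "\<dots> = sw K H H LH (comult H f) (\<lambda>f1 f2. sw K H H LH (comult H f2) (\<lambda>c d. sw K H H LH (comult H g) (\<lambda>g1 g2.
      tens LH ((l \<otimes>\<^bsub>L\<^esub> act f1 m) \<otimes>\<^bsub>L\<^esub> act (c \<otimes>\<^bsub>H\<^esub> g1) n) ((d \<otimes>\<^bsub>H\<^esub> g2) \<otimes>\<^bsub>H\<^esub> h))))"
    by (intro ktensor_sw_cong comult_mult[where \<phi> = "\<lambda>a b. tens LH ((l \<otimes>\<^bsub>L\<^esub> act f1 m) \<otimes>\<^bsub>L\<^esub> act a n) (b \<otimes>\<^bsub>H\<^esub> h)" for f1]) simp_all
  also have "\<dots> = sw K H H LH (comult H f) (\<lambda>f1 f2. sw K H H LH (comult H g) (\<lambda>g1 g2. sw K H H LH (comult H f2) (\<lambda>c d.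
      tens LH (l \<otimes>\<^bsub>L\<^esub> (act f1 m \<otimes>\<^bsub>L\<^esub> act c (act g1 n))) (d \<otimes>\<^bsub>H\<^esub> (g2 \<otimes>\<^bsub>H\<^esub> h)))))"
    by (subst ktensor_sw_cong[OF mod mod ktensor_sw_swap]) (simp_all add: act_mult alg_closed(5)[where K = K] cong: ktensor_sw_cong)
  also have "\<dots> = sw K H H LH (comult H g) (\<lambda>g1 g2. sw K H H LH (comult H f) (\<lambda>f1 f2. sw K H H LH (comult H f2) (\<lambda>c d.
      tens LH (l \<otimes>\<^bsub>L\<^esub> (act f1 m \<otimes>\<^bsub>L\<^esub> act c (act g1 n))) (d \<otimes>\<^bsub>H\<^esub> (g2 \<otimes>\<^bsub>H\<^esub> h)))))"
    by (rule ktensor_sw_swap) simp_all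
  \<comment> \<open>Coassociativity gathers the two parts of \<open>f\<close> that act on
    \<open>m\<close> and on the image of \<open>n\<close> into the coproduct of a single element, as
    the action on a product requires.\<close>
  also have "\<dots> = sw K H H LH (comult H g) (\<lambda>g1 g2. sw K H H LH (comult H f) (\<lambda>f1 f2. sw K H H LH (comult H f1) (\<lambda>c d.
      tens LH (l \<otimes>\<^bsub>L\<^esub> (act c m \<otimes>\<^bsub>L\<^esub> act d (act g1 n))) (f2 \<otimes>\<^bsub>H\<^esub> (g2 \<otimes>\<^bsub>H\<^esub> h)))))"
    by (intro ktensor_sw_cong coassoc[where \<phi> = "\<lambda>a b c. tens LH (l \<otimes>\<^bsub>L\<^esub> (act a m \<otimes>\<^bsub>L\<^esub> act b (act g1 n))) (c \<otimes>\<^bsub>H\<^esub> (g2 \<otimes>\<^bsub>H\<^esub> h))" for g1 g2, symmetric])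
       (simp_all add: trilin_def)
  also have "\<dots> = sw K H H LH (comult H g) (\<lambda>g1 g2. sw K H H LH (comult H f) (\<lambda>f1 f2.
      tens LH (l \<otimes>\<^bsub>L\<^esub> act f1 (m \<otimes>\<^bsub>L\<^esub> act g1 n)) (f2 \<otimes>\<^bsub>H\<^esub> (g2 \<otimes>\<^bsub>H\<^esub> h))))"
  proof -
    have "tens LH (l \<otimes>\<^bsub>L\<^esub> act f1 (m \<otimes>\<^bsub>L\<^esub> act g1 n)) k = sw K H H LH (comult H f1) (\<lambda>c d.
        tens LH (l \<otimes>\<^bsub>L\<^esub> (act c m \<otimes>\<^bsub>L\<^esub> act d (act g1 n))) k)"
      if [simp]: "g1 \<in> carrier H" "f1 \<in> carrier H" "k \<in> carrier H" for g1 f1 k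
      unfolding act_prod[OF that(2) assms(3) act_closed[OF that(1) assms(5)]]
      by (rule ktensor_sw_hom[where f = "\<lambda>x. tens LH (l \<otimes>\<^bsub>L\<^esub> x) k" and G = L and G' = LH]) simp_all
    then show ?thesis by (simp cong: ktensor_sw_cong)
  qed
  also have "\<dots> = sw K H H LH (comult H g) (\<lambda>g1 g2. smash (tens LH l f) (tens LH (m \<otimes>\<^bsub>L\<^esub> act g1 n) (g2 \<otimes>\<^bsub>H\<^esub> h)))"
    by (simp add: smash_tens cong: ktensor_sw_cong)
  also have "\<dots> = smash (tens LH l f) (smash (tens LH m g) (tens LH n h))"
    unfolding smash_tens[OF assms(3-6)]
    by (rule ktensor_sw_hom[where f = "\<lambda>x. smash (tens LH l f) x" and G = LH and G' = LH, symmetric]) simp_all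
  finally show ?thesis .
qed

lemma smash_one_left:
  assumes [simp]: "m \<in> carrier L" "g \<in> carrier H"
  shows "smash (tens LH \<one>\<^bsub>L\<^esub> \<one>\<^bsub>H\<^esub>) (tens LH m g) = tens LH m g"
proof -
  have "sw K H H LH (comult H \<one>\<^bsub>H\<^esub>) (\<lambda>f1 f2. tens LH (\<one>\<^bsub>L\<^esub> \<otimes>\<^bsub>L\<^esub> act f1 m) (f2 \<otimes>\<^bsub>H\<^esub> g)) =
     tens LH (\<one>\<^bsub>L\<^esub> \<otimes>\<^bsub>L\<^esub> act \<one>\<^bsub>H\<^esub> m) (\<one>\<^bsub>H\<^esub> \<otimes>\<^bsub>H\<^esub> g)"
    by (rule comult_one) simp_all
  then show ?thesis by (simp add: smash_tens act_one)
qed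

text \<open>\<open>H\<close> acts on the unit of \<open>L\<close> through \<epsilon>, so the counit
  axiom removes the splitting of \<open>f\<close>.\<close>

lemma smash_one_right:
  assumes [simp]: "l \<in> carrier L" "f \<in> carrier H"
  shows "smash (tens LH l f) (tens LH \<one>\<^bsub>L\<^esub> \<one>\<^bsub>H\<^esub>) = tens LH l f"
proof -
  have "tens LH (l \<otimes>\<^bsub>L\<^esub> act f1 \<one>\<^bsub>L\<^esub>) (f2 \<otimes>\<^bsub>H\<^esub> \<one>\<^bsub>H\<^esub>) = counit H f1 \<odot>\<^bsub>LH\<^esub> tens LH l f2"
    if [simp]: "f1 \<in> carrier H" "f2 \<in> carrier H" for f1 f2
    using tens_smult[OF modL mod, of "counit H f1" l f2]
    by (simp add: act_unit alg_smult[where K = K] tens_LH LH_simps)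
  then have "smash (tens LH l f) (tens LH \<one>\<^bsub>L\<^esub> \<one>\<^bsub>H\<^esub>) = sw K H H LH (comult H f) (\<lambda>f1 f2. counit H f1 \<odot>\<^bsub>LH\<^esub> tens LH l f2)"
    by (simp add: smash_tens cong: ktensor_sw_cong)
  also have "\<dots> = tens LH l f"
    by (rule counit_left) simp_all
  finally show ?thesis .
qed

lemma alg_LH [simp]: "assoc_algebra K LH"
proof (rule assoc_algebraI)
  note b = bilin_smash
  note [simp] = bilin_comp_l[OF b] bilin_comp_r[OF b] bilinD(3)[OF b]
  show "\<one>\<^bsub>LH\<^esub> \<in> carrier LH" by (simp add: LH_one)
  have "smash \<one>\<^bsub>LH\<^esub> x = x" if "x \<in> carrier LH" for x
    by (rule LH_ext[where z = x and G = LH and f = "\<lambda>x. smash \<one>\<^bsub>LH\<^esub> x" and g = "\<lambda>x. x"])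
       (simp_all add: LH_one smash_one_left that)
  moreover have "smash x \<one>\<^bsub>LH\<^esub> = x" if "x \<in> carrier LH" for x
    by (rule LH_ext[where z = x and G = LH and f = "\<lambda>x. smash x \<one>\<^bsub>LH\<^esub>" and g = "\<lambda>x. x"])
       (simp_all add: LH_one smash_one_right that)
  ultimately
  show "\<one>\<^bsub>LH\<^esub> \<otimes>\<^bsub>LH\<^esub> x = x" "x \<otimes>\<^bsub>LH\<^esub> \<one>\<^bsub>LH\<^esub> = x" if "x \<in> carrier LH" for x
    using that \<open>\<one>\<^bsub>LH\<^esub> \<in> carrier LH\<close> by (simp_all add: smash_mult)
  show "bilin K LH LH LH (\<lambda>x y. x \<otimes>\<^bsub>LH\<^esub> y)"
  proof -
    have "bilin K LH LH LH (\<lambda>x y. x \<otimes>\<^bsub>LH\<^esub> y) = bilin K LH LH LH smash"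
      by (rule bilin_cong) (simp_all add: smash_mult)
    then show ?thesis using b by (rule iffD2)
  qed
  have "smash (smash x y) z = smash x (smash y z)"
    if x: "x \<in> carrier LH" and y: "y \<in> carrier LH" and z: "z \<in> carrier LH" for x y z
  proof (rule LH_ext[where z = x and G = LH])
    fix l f assume lf [simp]: "l \<in> carrier L" "f \<in> carrier H"
    show "smash (smash (tens LH l f) y) z = smash (tens LH l f) (smash y z)"
    proof (rule LH_ext[where z = y and G = LH])
      fix m g assume mg [simp]: "m \<in> carrier L" "g \<in> carrier H"
      show "smash (smash (tens LH l f) (tens LH m g)) z = smash (tens LH l f) (smash (tens LH m g) z)"
        by (rule LH_ext[where z = z and G = LH]) (simp_all add: z smash_assoc_tens)
    qed (simp_all add: y z)
  qed (simp_all add: x y z)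
  then show "(x \<otimes>\<^bsub>LH\<^esub> y) \<otimes>\<^bsub>LH\<^esub> z = x \<otimes>\<^bsub>LH\<^esub> (y \<otimes>\<^bsub>LH\<^esub> z)"
    if "x \<in> carrier LH" "y \<in> carrier LH" "z \<in> carrier LH" for x y z
    using that by (simp add: smash_mult)
qed simp

end

section \<open>Source and target maps\<close>

context dynamical_data
begin

abbreviation "BA \<equiv> ktensor K U LH"

definition bb where "bb u l h = tens BA u (tens LH l h)"

lemma bb_closed [simp]: "u \<in> carrier U \<Longrightarrow> l \<in> carrier L \<Longrightarrow> h \<in> carrier H \<Longrightarrow> bb u l h \<in> carrier BA"
  by (simp add: bb_def)

lemma lin_bb [simp]:
  "lin K Y U f \<Longrightarrow> l \<in> carrier L \<Longrightarrow> h \<in> carrier H \<Longrightarrow> lin K Y BA (\<lambda>x. bb (f x) l h)"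
  "lin K Y L f' \<Longrightarrow> u \<in> carrier U \<Longrightarrow> h \<in> carrier H \<Longrightarrow> lin K Y BA (\<lambda>x. bb u (f' x) h)"
  "lin K Y H f'' \<Longrightarrow> u \<in> carrier U \<Longrightarrow> l \<in> carrier L \<Longrightarrow> lin K Y BA (\<lambda>x. bb u l (f'' x))"
  unfolding bb_def by simp_all

lemma bb_ext:
  assumes "module K G" "lin K BA G f" "lin K BA G g"
    "\<And>u l h. u \<in> carrier U \<Longrightarrow> l \<in> carrier L \<Longrightarrow> h \<in> carrier H \<Longrightarrow> f (bb u l h) = g (bb u l h)" "z \<in> carrier BA"
  shows "f z = g z"
proof (rule ktensor_linext[OF Uh.mod mod_LH assms(1-3) _ assms(5)])
  fix u x assume u [simp]: "u \<in> carrier U" and x: "x \<in> carrier LH"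
  have l: "lin K LH BA (\<lambda>x. tens BA u x)" by simp
  show "f (tens BA u x) = g (tens BA u x)"
    by (rule LH_ext[OF assms(1) lin_comp[OF assms(2) l] lin_comp[OF assms(3) l] _ x])
       (use assms(4) in \<open>simp add: bb_def\<close>)
qed

definition bsw where
  "bsw G b \<phi> = sw K U LH G b (\<lambda>u x. sw K L H G x (\<phi> u))"

lemma bsw_bb:
  assumes [simp]: "module K G" and \<phi>: "trilin K U L H G \<phi>" and [simp]: "u \<in> carrier U" "l \<in> carrier L" "h \<in> carrier H"
  shows "bsw G (bb u l h) \<phi> = \<phi> u l h"
  unfolding bsw_def bb_def by (simp add: ktensor_sw_tens sw_LH_tens trilinD[OF \<phi>])

lemma lin_bsw:
  assumes [simp]: "module K G" and \<phi>: "trilin K U L H G \<phi>"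
  shows "lin K BA G (\<lambda>b. bsw G b \<phi>)"
  unfolding bsw_def by (simp add: trilinD[OF \<phi>])

lemma tlift_bsw:
  assumes [simp]: "module K G" and "trilin K U L H G \<psi>" and b: "b \<in> carrier BA"
    and e: "\<And>u l h. u \<in> carrier U \<Longrightarrow> l \<in> carrier L \<Longrightarrow> h \<in> carrier H \<Longrightarrow> \<phi> u l h = \<psi> u l h"
  shows "tlift G b (\<lambda>u x. tlift G x (\<phi> u)) = bsw G b \<psi>"
  unfolding bsw_def
proof (rule tlift_sw_cong)
  fix u x assume "u \<in> carrier U" "x \<in> carrier LH"
  then show "tlift G x (\<phi> u) = sw K L H G x (\<psi> u)"
    by (intro tlift_LH_sw_cong) (simp_all add: e trilinD[OF assms(2)])
qed (simp_all add: b trilinD[OF assms(2)])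

lemma bb_mult:
  assumes [simp]: "u \<in> carrier U" "l \<in> carrier L" "f \<in> carrier H" "v \<in> carrier U" "m \<in> carrier L" "g \<in> carrier H"
  shows "bb u l f \<otimes>\<^bsub>BA\<^esub> bb v m g = sw K H H BA (comult H f) (\<lambda>f1 f2. bb (u \<otimes>\<^bsub>U\<^esub> v) (l \<otimes>\<^bsub>L\<^esub> act f1 m) (f2 \<otimes>\<^bsub>H\<^esub> g))"
proof -
  have "bb u l f \<otimes>\<^bsub>BA\<^esub> bb v m g = tens BA (u \<otimes>\<^bsub>U\<^esub> v) (smash (tens LH l f) (tens LH m g))"
    by (simp add: bb_def ktensor_mult_tens smash_mult)
  also have "\<dots> = sw K H H BA (comult H f) (\<lambda>f1 f2. tens BA (u \<otimes>\<^bsub>U\<^esub> v) (tens LH (l \<otimes>\<^bsub>L\<^esub> act f1 m) (f2 \<otimes>\<^bsub>H\<^esub> g)))"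
    unfolding smash_tens[OF assms(2,3,5,6)]
    by (rule ktensor_sw_hom[where f = "\<lambda>x. tens BA (u \<otimes>\<^bsub>U\<^esub> v) x" and G = LH and G' = BA]) simp_all
  finally show ?thesis by (simp add: bb_def)
qed

lemma BA_one: "\<one>\<^bsub>BA\<^esub> = bb \<one>\<^bsub>U\<^esub> \<one>\<^bsub>L\<^esub> \<one>\<^bsub>H\<^esub>"
  by (simp add: bb_def ktensor_one LH_one)

lemma smult_bb: "c \<in> carrier K \<Longrightarrow> u \<in> carrier U \<Longrightarrow> l \<in> carrier L \<Longrightarrow> h \<in> carrier H \<Longrightarrow>
    c \<odot>\<^bsub>BA\<^esub> bb u l h = bb u (c \<odot>\<^bsub>L\<^esub> l) h"
  using linD(3)[OF lin_bb(2)[OF lin_ident]] by simp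

definition sB where "sB l = bb \<one>\<^bsub>U\<^esub> l \<one>\<^bsub>H\<^esub>"
definition tB where "tB l = sw K H H BA R (\<lambda>r r'. bb \<one>\<^bsub>U\<^esub> (act r' l) r)"

lemma sB_closed: "l \<in> carrier L \<Longrightarrow> sB l \<in> carrier BA" and tB_closed: "l \<in> carrier L \<Longrightarrow> tB l \<in> carrier BA"
  by (simp_all add: sB_def tB_def)

lemma lin_sB: "lin K L BA sB" and lin_tB: "lin K L BA tB"
  unfolding sB_def[abs_def] tB_def[abs_def] by simp_all

lemma sB_mult_bb:
  assumes [simp]: "l \<in> carrier L" "u \<in> carrier U" "m \<in> carrier L" "h \<in> carrier H"
  shows "sB l \<otimes>\<^bsub>BA\<^esub> bb u m h = bb u (l \<otimes>\<^bsub>L\<^esub> m) h"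
proof -
  have "sw K H H BA (comult H \<one>\<^bsub>H\<^esub>) (\<lambda>f1 f2. bb (\<one>\<^bsub>U\<^esub> \<otimes>\<^bsub>U\<^esub> u) (l \<otimes>\<^bsub>L\<^esub> act f1 m) (f2 \<otimes>\<^bsub>H\<^esub> h)) =
     bb (\<one>\<^bsub>U\<^esub> \<otimes>\<^bsub>U\<^esub> u) (l \<otimes>\<^bsub>L\<^esub> act \<one>\<^bsub>H\<^esub> m) (\<one>\<^bsub>H\<^esub> \<otimes>\<^bsub>H\<^esub> h)"
    by (rule comult_one) simp_all
  then show ?thesis by (simp add: sB_def bb_mult act_one)
qed

lemma bb_mult_sB:
  assumes [simp]: "l \<in> carrier L" "u \<in> carrier U" "m \<in> carrier L" "h \<in> carrier H"
  shows "bb u m h \<otimes>\<^bsub>BA\<^esub> sB l = sw K H H BA (comult H h) (\<lambda>a b. bb u (m \<otimes>\<^bsub>L\<^esub> act a l) b)"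
  by (simp add: sB_def bb_mult cong: ktensor_sw_cong)

text \<open>The heart of the structure: left multiplication by t(l) multiplies the
  \<open>L\<close>-leg from the right. The smash product splits the first leg of \<open>R\<close>,
  the hexagon identity makes a second copy of it, and \<H>-commutativity, read from right to left,
  uses this copy to exchange the two factors in \<open>L\<close>.\<close>

lemma tB_mult_bb:
  assumes [simp]: "l \<in> carrier L" "u \<in> carrier U" "m \<in> carrier L" "h \<in> carrier H"
  shows "tB l \<otimes>\<^bsub>BA\<^esub> bb u m h = sw K H H BA R (\<lambda>r r'. bb u (m \<otimes>\<^bsub>L\<^esub> act r' l) (r \<otimes>\<^bsub>H\<^esub> h))"
proof -
  have "tB l \<otimes>\<^bsub>BA\<^esub> bb u m h = sw K H H BA R (\<lambda>r r'. bb \<one>\<^bsub>U\<^esub> (act r' l) r \<otimes>\<^bsub>BA\<^esub> bb u m h)"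
    unfolding tB_def by (rule ktensor_mult_sw_l) simp_all
  also have "\<dots> = sw K H H BA R (\<lambda>r r'. sw K H H BA (comult H r) (\<lambda>a b. bb u (act r' l \<otimes>\<^bsub>L\<^esub> act a m) (b \<otimes>\<^bsub>H\<^esub> h)))"
    by (simp add: bb_mult cong: ktensor_sw_cong)
  also have "\<dots> = sw K H H BA R (\<lambda>r r'. sw K H H BA R (\<lambda>s s'. bb u (act (r' \<otimes>\<^bsub>H\<^esub> s') l \<otimes>\<^bsub>L\<^esub> act r m) (s \<otimes>\<^bsub>H\<^esub> h)))"
    by (rule hexagon_left[where \<phi> = "\<lambda>a b r'. bb u (act r' l \<otimes>\<^bsub>L\<^esub> act a m) (b \<otimes>\<^bsub>H\<^esub> h)"]) (simp_all add: trilin_def)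
  also have "\<dots> = sw K H H BA R (\<lambda>s s'. sw K H H BA R (\<lambda>r r'. bb u (act (r' \<otimes>\<^bsub>H\<^esub> s') l \<otimes>\<^bsub>L\<^esub> act r m) (s \<otimes>\<^bsub>H\<^esub> h)))"
    by (rule ktensor_sw_swap) simp_all
  also have "\<dots> = sw K H H BA R (\<lambda>s s'. bb u (sw K H H L R (\<lambda>r r'. act r' (act s' l) \<otimes>\<^bsub>L\<^esub> act r m)) (s \<otimes>\<^bsub>H\<^esub> h))"
  proof (rule ktensor_sw_cong)
    fix s s' assume [simp]: "s \<in> carrier H" "s' \<in> carrier H"
    have "bb u (sw K H H L R (\<lambda>r r'. act r' (act s' l) \<otimes>\<^bsub>L\<^esub> act r m)) (s \<otimes>\<^bsub>H\<^esub> h) =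
       sw K H H BA R (\<lambda>r r'. bb u (act r' (act s' l) \<otimes>\<^bsub>L\<^esub> act r m) (s \<otimes>\<^bsub>H\<^esub> h))"
      by (rule ktensor_sw_hom[where f = "\<lambda>x. bb u x (s \<otimes>\<^bsub>H\<^esub> h)" and G = L and G' = BA]) simp_all
    then show "sw K H H BA R (\<lambda>r r'. bb u (act (r' \<otimes>\<^bsub>H\<^esub> s') l \<otimes>\<^bsub>L\<^esub> act r m) (s \<otimes>\<^bsub>H\<^esub> h)) =
       bb u (sw K H H L R (\<lambda>r r'. act r' (act s' l) \<otimes>\<^bsub>L\<^esub> act r m)) (s \<otimes>\<^bsub>H\<^esub> h)"
      by (simp add: act_mult cong: ktensor_sw_cong)
  qed simp_all
  also have "\<dots> = sw K H H BA R (\<lambda>r r'. bb u (m \<otimes>\<^bsub>L\<^esub> act r' l) (r \<otimes>\<^bsub>H\<^esub> h))"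
    by (rule ktensor_sw_cong) (simp_all add: H_comm[symmetric])
  finally show ?thesis .
qed

lemma bb_mult_tB:
  assumes [simp]: "l \<in> carrier L" "u \<in> carrier U" "m \<in> carrier L" "h \<in> carrier H"
  shows "bb u m h \<otimes>\<^bsub>BA\<^esub> tB l = sw K H H BA R (\<lambda>r r'. sw K H H BA (comult H h) (\<lambda>a b. bb u (m \<otimes>\<^bsub>L\<^esub> act a (act r' l)) (b \<otimes>\<^bsub>H\<^esub> r)))"
proof -
  have "bb u m h \<otimes>\<^bsub>BA\<^esub> tB l = sw K H H BA R (\<lambda>r r'. bb u m h \<otimes>\<^bsub>BA\<^esub> bb \<one>\<^bsub>U\<^esub> (act r' l) r)"
    unfolding tB_def by (rule ktensor_mult_sw_r) simp_all
  then show ?thesis by (simp add: bb_mult cong: ktensor_sw_cong)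
qed

text \<open>One map multiplies the \<open>L\<close>-leg from the left, the other from the right, so
  nothing is left but associativity.\<close>

lemma sB_tB_commute:
  assumes [simp]: "l \<in> carrier L" "m \<in> carrier L"
  shows "sB l \<otimes>\<^bsub>BA\<^esub> tB m = tB m \<otimes>\<^bsub>BA\<^esub> sB l"
proof -
  have "sB l \<otimes>\<^bsub>BA\<^esub> tB m = sw K H H BA R (\<lambda>r r'. sB l \<otimes>\<^bsub>BA\<^esub> bb \<one>\<^bsub>U\<^esub> (act r' m) r)"
    unfolding tB_def by (rule ktensor_mult_sw_r) (simp_all add: sB_closed)
  also have "\<dots> = tB m \<otimes>\<^bsub>BA\<^esub> bb \<one>\<^bsub>U\<^esub> l \<one>\<^bsub>H\<^esub>"
    by (simp add: sB_mult_bb tB_mult_bb cong: ktensor_sw_cong)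
  finally show ?thesis by (simp add: sB_def)
qed

text \<open>The reversal of factors comes from the order of the two copies in (id \<otimes>
  \<Delta>)(R) = \<open>R13 R12\<close>.\<close>

lemma tB_mult:
  assumes [simp]: "l \<in> carrier L" "m \<in> carrier L"
  shows "tB (l \<otimes>\<^bsub>L\<^esub> m) = tB m \<otimes>\<^bsub>BA\<^esub> tB l"
proof -
  have "tB (l \<otimes>\<^bsub>L\<^esub> m) = sw K H H BA R (\<lambda>r r'. sw K H H BA (comult H r') (\<lambda>a b. bb \<one>\<^bsub>U\<^esub> (act a l \<otimes>\<^bsub>L\<^esub> act b m) r))"
    unfolding tB_def
  proof (rule ktensor_sw_cong)
    fix r r' assume [simp]: "r \<in> carrier H" "r' \<in> carrier H"
    show "bb \<one>\<^bsub>U\<^esub> (act r' (l \<otimes>\<^bsub>L\<^esub> m)) r = sw K H H BA (comult H r') (\<lambda>a b. bb \<one>\<^bsub>U\<^esub> (act a l \<otimes>\<^bsub>L\<^esub> act b m) r)"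
      unfolding act_prod[OF \<open>r' \<in> carrier H\<close> assms]
      by (rule ktensor_sw_hom[where f = "\<lambda>x. bb \<one>\<^bsub>U\<^esub> x r" and G = L and G' = BA]) simp_all
  qed simp_all
  also have "\<dots> = sw K H H BA R (\<lambda>r r'. sw K H H BA R (\<lambda>s s'. bb \<one>\<^bsub>U\<^esub> (act s' l \<otimes>\<^bsub>L\<^esub> act r' m) (r \<otimes>\<^bsub>H\<^esub> s)))"
    by (rule hexagon_right[where \<phi> = "\<lambda>r a b. bb \<one>\<^bsub>U\<^esub> (act a l \<otimes>\<^bsub>L\<^esub> act b m) r"]) (simp_all add: trilin_def)
  also have "\<dots> = sw K H H BA R (\<lambda>s s'. sw K H H BA R (\<lambda>r r'. bb \<one>\<^bsub>U\<^esub> (act s' l \<otimes>\<^bsub>L\<^esub> act r' m) (r \<otimes>\<^bsub>H\<^esub> s)))"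
    by (rule ktensor_sw_swap) simp_all
  also have "\<dots> = sw K H H BA R (\<lambda>s s'. tB m \<otimes>\<^bsub>BA\<^esub> bb \<one>\<^bsub>U\<^esub> (act s' l) s)"
    by (simp add: tB_mult_bb cong: ktensor_sw_cong)
  also have "\<dots> = tB m \<otimes>\<^bsub>BA\<^esub> tB l"
    unfolding tB_def[of l] by (rule ktensor_mult_sw_r[symmetric]) (simp_all add: tB_closed)
  finally show ?thesis .
qed

text \<open>The action on the unit is by \<epsilon>, which turns the claim into (id \<otimes>
  \<epsilon>)(R) = 1.\<close>

lemma tB_one: "tB \<one>\<^bsub>L\<^esub> = \<one>\<^bsub>BA\<^esub>"
proof -
  have "tB \<one>\<^bsub>L\<^esub> = sw K H H BA R (\<lambda>r r'. counit H r' \<odot>\<^bsub>BA\<^esub> bb \<one>\<^bsub>U\<^esub> \<one>\<^bsub>L\<^esub> r)"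
    unfolding tB_def by (simp add: act_unit smult_bb cong: ktensor_sw_cong)
  also have "\<dots> = bb \<one>\<^bsub>U\<^esub> \<one>\<^bsub>L\<^esub> \<one>\<^bsub>H\<^esub>"
    by (rule counit_R_right) simp_all
  finally show ?thesis by (simp add: BA_one)
qed

lemma enveloping_BA: "enveloping K L BA sB tB"
proof
  show "assoc_algebra K L" "assoc_algebra K BA" by simp_all
  have "sB (l \<otimes>\<^bsub>L\<^esub> m) = sB l \<otimes>\<^bsub>BA\<^esub> sB m" if "l \<in> carrier L" "m \<in> carrier L" for l m
    using that by (simp add: sB_def[of m] sB_mult_bb) (simp add: sB_def)
  moreover have "sB \<one>\<^bsub>L\<^esub> = \<one>\<^bsub>BA\<^esub>" by (simp add: sB_def BA_one)
  ultimately show "sB \<in> alg_hom K L BA"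
    using lin_sB by (auto simp: alg_hom_def ring_hom_def lin_def)
  show "tB \<in> alg_antihom K L BA"
    using lin_tB by (auto simp: alg_antihom_def lin_def tB_mult tB_one)
  show "sB l \<otimes>\<^bsub>BA\<^esub> tB m = tB m \<otimes>\<^bsub>BA\<^esub> sB l" if "l \<in> carrier L" "m \<in> carrier L" for l m
    using that by (rule sB_tB_commute)
qed

end

sublocale dynamical_data \<subseteq> E: enveloping K L "ktensor K U LH" sB tB
  by (rule enveloping_BA)

section \<open>The bialgebroid structure\<close>

context dynamical_data
begin

lemmas BB_rules [simp] = E.B2.lin_T_l E.B2.lin_T_r E.B3.lin_T_l E.B3.lin_T_r
lemma BB_closed [simp]: "a \<in> carrier BA \<Longrightarrow> b \<in> carrier BA \<Longrightarrow> tens E.BB a b \<in> carrier E.BBk"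
  and BBB_closed [simp]: "a \<in> carrier BA \<Longrightarrow> z \<in> carrier E.BBk \<Longrightarrow> tens E.BBB a z \<in> carrier E.BBBk"
  by (simp_all add: E.B2.Tk_simps E.B3.Tk_simps E.B2.T_closed E.B3.T_closed)

text \<open>The \<open>L\<close>-component of the second factor can always be carried to the first.
  Tensors with second \<open>L\<close>-component 1, the shape in which the comultiplication is
  given, are thus a normal form for pure tensors.\<close>

lemma BB_shift:
  assumes [simp]: "x \<in> carrier BA" "u \<in> carrier U" "l \<in> carrier L" "h \<in> carrier H"
  shows "tens E.BB x (bb u l h) = tens E.BB (tB l \<otimes>\<^bsub>BA\<^esub> x) (bb u \<one>\<^bsub>L\<^esub> h)"
  using E.B2.T_balance[of x l "bb u \<one>\<^bsub>L\<^esub> h"] by (simp add: E.lm_simps sB_mult_bb)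

definition Delta where
  "Delta b = bsw E.BBk b (\<lambda>u l h. sw K U U E.BBk (comult U u) (\<lambda>u1 u2. sw K H H E.BBk (comult H h) (\<lambda>h1 h2.
     tens E.BB (bb u1 l h1) (bb u2 \<one>\<^bsub>L\<^esub> h2))))"

lemma trilin_Delta: "trilin K U L H E.BBk (\<lambda>u l h. sw K U U E.BBk (comult U u) (\<lambda>u1 u2. sw K H H E.BBk (comult H h) (\<lambda>h1 h2.
     tens E.BB (bb u1 l h1) (bb u2 \<one>\<^bsub>L\<^esub> h2))))"
  by (simp add: trilin_def)

lemma lin_Delta: "lin K BA E.BBk Delta"
  unfolding Delta_def[abs_def] by (rule lin_bsw[OF _ trilin_Delta]) simp

lemma Delta_bb: "u \<in> carrier U \<Longrightarrow> l \<in> carrier L \<Longrightarrow> h \<in> carrier H \<Longrightarrow> Delta (bb u l h) =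
   sw K U U E.BBk (comult U u) (\<lambda>u1 u2. sw K H H E.BBk (comult H h) (\<lambda>h1 h2. tens E.BB (bb u1 l h1) (bb u2 \<one>\<^bsub>L\<^esub> h2)))"
  unfolding Delta_def by (rule bsw_bb[OF _ trilin_Delta]) simp_all

lemma Delta_closed: "b \<in> carrier BA \<Longrightarrow> Delta b \<in> carrier E.BB"
  using linD(1)[OF lin_Delta, of b] by (simp add: E.B2.Tk_simps)

lemma Delta_bb_hom:
  assumes [simp]: "u \<in> carrier U" "l \<in> carrier L" "h \<in> carrier H" and [simp]: "module K G" and f: "lin K E.BBk G f"
  shows "f (Delta (bb u l h)) = sw K U U G (comult U u) (\<lambda>u1 u2. sw K H H G (comult H h) (\<lambda>h1 h2. f (tens E.BB (bb u1 l h1) (bb u2 \<one>\<^bsub>L\<^esub> h2))))"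
  by (simp add: Delta_bb ktensor_sw_hom[where f = f and G = E.BBk and G' = G] f cong: ktensor_sw_cong)

lemma Delta_sB:
  assumes [simp]: "l \<in> carrier L" and b: "b \<in> carrier BA"
  shows "Delta (sB l \<otimes>\<^bsub>BA\<^esub> b) = l \<odot>\<^bsub>E.BB\<^esub> Delta b"
proof (rule bb_ext[where z = b and G = E.BBk])
  fix u m h assume [simp]: "u \<in> carrier U" "m \<in> carrier L" "h \<in> carrier H"
  show "Delta (sB l \<otimes>\<^bsub>BA\<^esub> bb u m h) = l \<odot>\<^bsub>E.BB\<^esub> Delta (bb u m h)"
    by (simp add: sB_mult_bb Delta_bb_hom[where f = "\<lambda>z. l \<odot>\<^bsub>E.BB\<^esub> z" and G = E.BBk] E.B2.lin_smult_T
       E.B2.smult_T_tens cong: ktensor_sw_cong) (simp add: Delta_bb)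
qed (simp_all add: b lin_comp[OF lin_Delta] lin_comp[OF E.B2.lin_smult_T])

text \<open>Two copies of \<open>R\<close> appear on both sides: on the left the first leg of t(l)
  is split by the comultiplication, on the right the \<open>L\<close>-component of the second factor
  is carried back to the first by a further target map. The first hexagon identity makes them
  agree.\<close>

lemma Delta_tB:
  assumes [simp]: "l \<in> carrier L" and b: "b \<in> carrier BA"
  shows "Delta (tB l \<otimes>\<^bsub>BA\<^esub> b) = E.tmul l (Delta b)"
proof (rule bb_ext[where z = b and G = E.BBk])
  fix u m h assume [simp]: "u \<in> carrier U" "m \<in> carrier L" "h \<in> carrier H"
  have "Delta (tB l \<otimes>\<^bsub>BA\<^esub> bb u m h) = sw K H H E.BBk R (\<lambda>r r'. Delta (bb u (m \<otimes>\<^bsub>L\<^esub> act r' l) (r \<otimes>\<^bsub>H\<^esub> h)))"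
    unfolding tB_mult_bb[OF assms(1) \<open>u \<in> carrier U\<close> \<open>m \<in> carrier L\<close> \<open>h \<in> carrier H\<close>]
    by (rule ktensor_sw_hom[where f = Delta and G = BA and G' = E.BBk]) (simp_all add: lin_Delta)
  also have "\<dots> = sw K H H E.BBk R (\<lambda>r r'. sw K U U E.BBk (comult U u) (\<lambda>u1 u2. sw K H H E.BBk (comult H r) (\<lambda>r1 r2. sw K H H E.BBk (comult H h) (\<lambda>h1 h2.
      tens E.BB (bb u1 (m \<otimes>\<^bsub>L\<^esub> act r' l) (r1 \<otimes>\<^bsub>H\<^esub> h1)) (bb u2 \<one>\<^bsub>L\<^esub> (r2 \<otimes>\<^bsub>H\<^esub> h2))))))"
    by (simp add: Delta_bb comult_mult cong: ktensor_sw_cong)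
  also have "\<dots> = sw K U U E.BBk (comult U u) (\<lambda>u1 u2. sw K H H E.BBk R (\<lambda>r r'. sw K H H E.BBk (comult H r) (\<lambda>r1 r2. sw K H H E.BBk (comult H h) (\<lambda>h1 h2.
      tens E.BB (bb u1 (m \<otimes>\<^bsub>L\<^esub> act r' l) (r1 \<otimes>\<^bsub>H\<^esub> h1)) (bb u2 \<one>\<^bsub>L\<^esub> (r2 \<otimes>\<^bsub>H\<^esub> h2))))))"
    by (rule ktensor_sw_swap) simp_all
  also have "\<dots> = sw K U U E.BBk (comult U u) (\<lambda>u1 u2. sw K H H E.BBk R (\<lambda>r r'. sw K H H E.BBk R (\<lambda>s s'. sw K H H E.BBk (comult H h) (\<lambda>h1 h2.
      tens E.BB (bb u1 (m \<otimes>\<^bsub>L\<^esub> act (r' \<otimes>\<^bsub>H\<^esub> s') l) (r \<otimes>\<^bsub>H\<^esub> h1)) (bb u2 \<one>\<^bsub>L\<^esub> (s \<otimes>\<^bsub>H\<^esub> h2))))))"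
    by (intro ktensor_sw_cong hexagon_left[where \<phi> = "\<lambda>r1 r2 r'. sw K H H E.BBk (comult H h) (\<lambda>h1 h2.
      tens E.BB (bb u1 (m \<otimes>\<^bsub>L\<^esub> act r' l) (r1 \<otimes>\<^bsub>H\<^esub> h1)) (bb u2 \<one>\<^bsub>L\<^esub> (r2 \<otimes>\<^bsub>H\<^esub> h2)))" for u1 u2]) (simp_all add: trilin_def)
  also have "\<dots> = sw K U U E.BBk (comult U u) (\<lambda>u1 u2. sw K H H E.BBk (comult H h) (\<lambda>h1 h2. sw K H H E.BBk R (\<lambda>s s'. sw K H H E.BBk R (\<lambda>r r'.
      tens E.BB (bb u1 (m \<otimes>\<^bsub>L\<^esub> act (r' \<otimes>\<^bsub>H\<^esub> s') l) (r \<otimes>\<^bsub>H\<^esub> h1)) (bb u2 \<one>\<^bsub>L\<^esub> (s \<otimes>\<^bsub>H\<^esub> h2))))))"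
  proof (rule ktensor_sw_cong)
    fix u1 u2 assume [simp]: "u1 \<in> carrier U" "u2 \<in> carrier U"
    let ?x = "\<lambda>r r' s s' h1 h2. tens E.BB (bb u1 (m \<otimes>\<^bsub>L\<^esub> act (r' \<otimes>\<^bsub>H\<^esub> s') l) (r \<otimes>\<^bsub>H\<^esub> h1)) (bb u2 \<one>\<^bsub>L\<^esub> (s \<otimes>\<^bsub>H\<^esub> h2))"
    have "sw K H H E.BBk R (\<lambda>r r'. sw K H H E.BBk R (\<lambda>s s'. sw K H H E.BBk (comult H h) (\<lambda>h1 h2. ?x r r' s s' h1 h2))) =
      sw K H H E.BBk R (\<lambda>s s'. sw K H H E.BBk R (\<lambda>r r'. sw K H H E.BBk (comult H h) (\<lambda>h1 h2. ?x r r' s s' h1 h2)))"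
      by (rule ktensor_sw_swap) simp_all
    also have "\<dots> = sw K H H E.BBk R (\<lambda>s s'. sw K H H E.BBk (comult H h) (\<lambda>h1 h2. sw K H H E.BBk R (\<lambda>r r'. ?x r r' s s' h1 h2)))"
      by (intro ktensor_sw_cong ktensor_sw_swap) simp_all
    also have "\<dots> = sw K H H E.BBk (comult H h) (\<lambda>h1 h2. sw K H H E.BBk R (\<lambda>s s'. sw K H H E.BBk R (\<lambda>r r'. ?x r r' s s' h1 h2)))"
      by (rule ktensor_sw_swap) simp_all
    finally show "sw K H H E.BBk R (\<lambda>r r'. sw K H H E.BBk R (\<lambda>s s'. sw K H H E.BBk (comult H h) (\<lambda>h1 h2. ?x r r' s s' h1 h2))) =
      sw K H H E.BBk (comult H h) (\<lambda>h1 h2. sw K H H E.BBk R (\<lambda>s s'. sw K H H E.BBk R (\<lambda>r r'. ?x r r' s s' h1 h2)))" .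
  qed simp_all
  also have "\<dots> = sw K U U E.BBk (comult U u) (\<lambda>u1 u2. sw K H H E.BBk (comult H h) (\<lambda>h1 h2. tens E.BB (bb u1 m h1) (tB l \<otimes>\<^bsub>BA\<^esub> bb u2 \<one>\<^bsub>L\<^esub> h2)))"
  proof -
    have "tens E.BB (bb u1 m h1) (tB l \<otimes>\<^bsub>BA\<^esub> bb u2 \<one>\<^bsub>L\<^esub> h2) = sw K H H E.BBk R (\<lambda>s s'. sw K H H E.BBk R (\<lambda>r r'.
      tens E.BB (bb u1 (m \<otimes>\<^bsub>L\<^esub> act (r' \<otimes>\<^bsub>H\<^esub> s') l) (r \<otimes>\<^bsub>H\<^esub> h1)) (bb u2 \<one>\<^bsub>L\<^esub> (s \<otimes>\<^bsub>H\<^esub> h2))))"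
      if [simp]: "u1 \<in> carrier U" "u2 \<in> carrier U" "h1 \<in> carrier H" "h2 \<in> carrier H" for u1 u2 h1 h2
    proof -
      have "tens E.BB (bb u1 m h1) (tB l \<otimes>\<^bsub>BA\<^esub> bb u2 \<one>\<^bsub>L\<^esub> h2) = sw K H H E.BBk R (\<lambda>s s'. tens E.BB (bb u1 m h1) (bb u2 (\<one>\<^bsub>L\<^esub> \<otimes>\<^bsub>L\<^esub> act s' l) (s \<otimes>\<^bsub>H\<^esub> h2)))"
        unfolding tB_mult_bb[OF assms(1) \<open>u2 \<in> carrier U\<close> alg_closed(2)[OF algL] \<open>h2 \<in> carrier H\<close>]
        by (rule ktensor_sw_hom[where f = "\<lambda>z. tens E.BB (bb u1 m h1) z" and G = BA and G' = E.BBk]) simp_all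
      also have "\<dots> = sw K H H E.BBk R (\<lambda>s s'. tens E.BB (tB (act s' l) \<otimes>\<^bsub>BA\<^esub> bb u1 m h1) (bb u2 \<one>\<^bsub>L\<^esub> (s \<otimes>\<^bsub>H\<^esub> h2)))"
        by (rule ktensor_sw_cong) (simp_all add: BB_shift[of _ u2 "act s' l" for s'])
      also have "\<dots> = sw K H H E.BBk R (\<lambda>s s'. sw K H H E.BBk R (\<lambda>r r'.
         tens E.BB (bb u1 (m \<otimes>\<^bsub>L\<^esub> act (r' \<otimes>\<^bsub>H\<^esub> s') l) (r \<otimes>\<^bsub>H\<^esub> h1)) (bb u2 \<one>\<^bsub>L\<^esub> (s \<otimes>\<^bsub>H\<^esub> h2))))"
      proof (rule ktensor_sw_cong)
        fix s s' assume [simp]: "s \<in> carrier H" "s' \<in> carrier H"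
        have "tens E.BB (tB (act s' l) \<otimes>\<^bsub>BA\<^esub> bb u1 m h1) (bb u2 \<one>\<^bsub>L\<^esub> (s \<otimes>\<^bsub>H\<^esub> h2)) = sw K H H E.BBk R (\<lambda>r r'.
         tens E.BB (bb u1 (m \<otimes>\<^bsub>L\<^esub> act r' (act s' l)) (r \<otimes>\<^bsub>H\<^esub> h1)) (bb u2 \<one>\<^bsub>L\<^esub> (s \<otimes>\<^bsub>H\<^esub> h2)))"
          unfolding tB_mult_bb[OF act_closed[OF \<open>s' \<in> carrier H\<close> assms(1)] \<open>u1 \<in> carrier U\<close> \<open>m \<in> carrier L\<close> \<open>h1 \<in> carrier H\<close>]
          by (rule ktensor_sw_hom[where f = "\<lambda>z. tens E.BB z (bb u2 \<one>\<^bsub>L\<^esub> (s \<otimes>\<^bsub>H\<^esub> h2))" and G = BA and G' = E.BBk]) simp_all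
        then show "tens E.BB (tB (act s' l) \<otimes>\<^bsub>BA\<^esub> bb u1 m h1) (bb u2 \<one>\<^bsub>L\<^esub> (s \<otimes>\<^bsub>H\<^esub> h2)) = sw K H H E.BBk R (\<lambda>r r'.
         tens E.BB (bb u1 (m \<otimes>\<^bsub>L\<^esub> act (r' \<otimes>\<^bsub>H\<^esub> s') l) (r \<otimes>\<^bsub>H\<^esub> h1)) (bb u2 \<one>\<^bsub>L\<^esub> (s \<otimes>\<^bsub>H\<^esub> h2)))"
          by (simp add: act_mult cong: ktensor_sw_cong)
      qed simp_all
      finally show ?thesis .
    qed
    then show ?thesis by (simp cong: ktensor_sw_cong)
  qed
  also have "\<dots> = E.tmul l (Delta (bb u m h))"
    by (simp add: Delta_bb_hom[where f = "E.tmul l" and G = E.BBk] E.lin_tmul E.tmul_tens cong: ktensor_sw_cong)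
  finally show "Delta (tB l \<otimes>\<^bsub>BA\<^esub> bb u m h) = E.tmul l (Delta (bb u m h))" .
qed (simp_all add: b lin_comp[OF lin_Delta] lin_comp[OF E.lin_tmul lin_Delta])

end

section \<open>Takeuchi condition, multiplicativity and coassociativity\<close>

context dynamical_data
begin

text \<open>Multiplying the first factor by t(l) produces
  \<open>\<Delta>\<^sup>o\<^sup>p(x) R\<close>. Multiplying the second by s(l) and carrying the
  result to the first factor produces R \<Delta>(x), where \<open>x\<close> is the part of
  \<open>h\<close> obtained by rebracketing. Quasi-cocommutativity identifies the two.\<close>

lemma takeuchi_Delta:
  assumes b: "b \<in> carrier BA"
  shows "E.takeuchi (Delta b)"
proof -
  have "E.rmul (tB l) \<one>\<^bsub>BA\<^esub> (Delta b) = E.rmul \<one>\<^bsub>BA\<^esub> (sB l) (Delta b)" if l [simp]: "l \<in> carrier L" for l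
  proof (rule bb_ext[where z = b and G = E.BBk])
    fix u m h assume [simp]: "u \<in> carrier U" "m \<in> carrier L" "h \<in> carrier H"
    let ?\<phi> = "\<lambda>u1 u2 k p q. tens E.BB (bb u1 (m \<otimes>\<^bsub>L\<^esub> act q l) p) (bb u2 \<one>\<^bsub>L\<^esub> k)"
    have left: "E.rmul (tB l) \<one>\<^bsub>BA\<^esub> (tens E.BB (bb u1 m x) (bb u2 \<one>\<^bsub>L\<^esub> k)) =
       sw K H H E.BBk R (\<lambda>r r'. sw K H H E.BBk (comult H x) (\<lambda>h1 h2. ?\<phi> u1 u2 k (h2 \<otimes>\<^bsub>H\<^esub> r) (h1 \<otimes>\<^bsub>H\<^esub> r')))"
      if [simp]: "u1 \<in> carrier U" "u2 \<in> carrier U" "x \<in> carrier H" "k \<in> carrier H" for u1 u2 x k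
    proof -
      have "E.rmul (tB l) \<one>\<^bsub>BA\<^esub> (tens E.BB (bb u1 m x) (bb u2 \<one>\<^bsub>L\<^esub> k)) = tens E.BB (bb u1 m x \<otimes>\<^bsub>BA\<^esub> tB l) (bb u2 \<one>\<^bsub>L\<^esub> k)"
        by (simp add: E.rmul_tens)
      also have "\<dots> = sw K H H E.BBk R (\<lambda>r r'. sw K H H E.BBk (comult H x) (\<lambda>a b.
          tens E.BB (bb u1 (m \<otimes>\<^bsub>L\<^esub> act a (act r' l)) (b \<otimes>\<^bsub>H\<^esub> r)) (bb u2 \<one>\<^bsub>L\<^esub> k)))"
        unfolding bb_mult_tB[OF l \<open>u1 \<in> carrier U\<close> \<open>m \<in> carrier L\<close> \<open>x \<in> carrier H\<close>]
        by (simp add: ktensor_sw_hom[where f = "\<lambda>z. tens E.BB z (bb u2 \<one>\<^bsub>L\<^esub> k)" and G = BA and G' = E.BBk] cong: ktensor_sw_cong)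
      finally show ?thesis by (simp add: act_mult cong: ktensor_sw_cong)
    qed
    have right: "E.rmul \<one>\<^bsub>BA\<^esub> (sB l) (tens E.BB (bb u1 m h1) (bb u2 \<one>\<^bsub>L\<^esub> x)) =
       sw K H H E.BBk (comult H x) (\<lambda>h2 k. sw K H H E.BBk R (\<lambda>r r'. ?\<phi> u1 u2 k (r \<otimes>\<^bsub>H\<^esub> h1) (r' \<otimes>\<^bsub>H\<^esub> h2)))"
      if [simp]: "u1 \<in> carrier U" "u2 \<in> carrier U" "x \<in> carrier H" "h1 \<in> carrier H" for u1 u2 x h1
    proof -
      have "E.rmul \<one>\<^bsub>BA\<^esub> (sB l) (tens E.BB (bb u1 m h1) (bb u2 \<one>\<^bsub>L\<^esub> x)) = tens E.BB (bb u1 m h1) (bb u2 \<one>\<^bsub>L\<^esub> x \<otimes>\<^bsub>BA\<^esub> sB l)"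
        by (simp add: E.rmul_tens)
      also have "\<dots> = sw K H H E.BBk (comult H x) (\<lambda>h2 k. tens E.BB (bb u1 m h1) (bb u2 (\<one>\<^bsub>L\<^esub> \<otimes>\<^bsub>L\<^esub> act h2 l) k))"
        unfolding bb_mult_sB[OF l \<open>u2 \<in> carrier U\<close> alg_closed(2)[OF algL] \<open>x \<in> carrier H\<close>]
        by (rule ktensor_sw_hom[where f = "\<lambda>z. tens E.BB (bb u1 m h1) z" and G = BA and G' = E.BBk]) simp_all
      also have "\<dots> = sw K H H E.BBk (comult H x) (\<lambda>h2 k. tens E.BB (tB (act h2 l) \<otimes>\<^bsub>BA\<^esub> bb u1 m h1) (bb u2 \<one>\<^bsub>L\<^esub> k))"
        by (rule ktensor_sw_cong) (simp_all add: BB_shift[of _ u2 "act h2 l" for h2])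
      also have "\<dots> = sw K H H E.BBk (comult H x) (\<lambda>h2 k. sw K H H E.BBk R (\<lambda>r r'. ?\<phi> u1 u2 k (r \<otimes>\<^bsub>H\<^esub> h1) (r' \<otimes>\<^bsub>H\<^esub> h2)))"
      proof (rule ktensor_sw_cong)
        fix h2 k assume [simp]: "h2 \<in> carrier H" "k \<in> carrier H"
        have "tens E.BB (tB (act h2 l) \<otimes>\<^bsub>BA\<^esub> bb u1 m h1) (bb u2 \<one>\<^bsub>L\<^esub> k) = sw K H H E.BBk R (\<lambda>r r'.
           tens E.BB (bb u1 (m \<otimes>\<^bsub>L\<^esub> act r' (act h2 l)) (r \<otimes>\<^bsub>H\<^esub> h1)) (bb u2 \<one>\<^bsub>L\<^esub> k))"
          unfolding tB_mult_bb[OF act_closed[OF \<open>h2 \<in> carrier H\<close> l] \<open>u1 \<in> carrier U\<close> \<open>m \<in> carrier L\<close> \<open>h1 \<in> carrier H\<close>]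
          by (rule ktensor_sw_hom[where f = "\<lambda>z. tens E.BB z (bb u2 \<one>\<^bsub>L\<^esub> k)" and G = BA and G' = E.BBk]) simp_all
        then show "tens E.BB (tB (act h2 l) \<otimes>\<^bsub>BA\<^esub> bb u1 m h1) (bb u2 \<one>\<^bsub>L\<^esub> k) =
           sw K H H E.BBk R (\<lambda>r r'. ?\<phi> u1 u2 k (r \<otimes>\<^bsub>H\<^esub> h1) (r' \<otimes>\<^bsub>H\<^esub> h2))"
          by (simp add: act_mult cong: ktensor_sw_cong)
      qed simp_all
      finally show ?thesis .
    qed
    have "E.rmul \<one>\<^bsub>BA\<^esub> (sB l) (Delta (bb u m h)) = sw K U U E.BBk (comult U u) (\<lambda>u1 u2. sw K H H E.BBk (comult H h) (\<lambda>h1 x.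
        sw K H H E.BBk (comult H x) (\<lambda>h2 k. sw K H H E.BBk R (\<lambda>r r'. ?\<phi> u1 u2 k (r \<otimes>\<^bsub>H\<^esub> h1) (r' \<otimes>\<^bsub>H\<^esub> h2)))))"
      by (simp add: Delta_bb_hom[where f = "E.rmul \<one>\<^bsub>BA\<^esub> (sB l)" and G = E.BBk] E.lin_rmul right cong: ktensor_sw_cong)
    also have "\<dots> = sw K U U E.BBk (comult U u) (\<lambda>u1 u2. sw K H H E.BBk (comult H h) (\<lambda>x k.
        sw K H H E.BBk (comult H x) (\<lambda>h1 h2. sw K H H E.BBk R (\<lambda>r r'. ?\<phi> u1 u2 k (r \<otimes>\<^bsub>H\<^esub> h1) (r' \<otimes>\<^bsub>H\<^esub> h2)))))"
      by (intro ktensor_sw_cong coassoc[where \<phi> = "\<lambda>h1 h2 k. sw K H H E.BBk R (\<lambda>r r'. ?\<phi> u1 u2 k (r \<otimes>\<^bsub>H\<^esub> h1) (r' \<otimes>\<^bsub>H\<^esub> h2))" for u1 u2, symmetric])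
         (simp_all add: trilin_def)
    also have "\<dots> = sw K U U E.BBk (comult U u) (\<lambda>u1 u2. sw K H H E.BBk (comult H h) (\<lambda>x k.
        sw K H H E.BBk R (\<lambda>r r'. sw K H H E.BBk (comult H x) (\<lambda>h1 h2. ?\<phi> u1 u2 k (r \<otimes>\<^bsub>H\<^esub> h1) (r' \<otimes>\<^bsub>H\<^esub> h2)))))"
      by (intro ktensor_sw_cong ktensor_sw_swap) simp_all
    also have "\<dots> = sw K U U E.BBk (comult U u) (\<lambda>u1 u2. sw K H H E.BBk (comult H h) (\<lambda>x k.
        sw K H H E.BBk R (\<lambda>r r'. sw K H H E.BBk (comult H x) (\<lambda>h1 h2. ?\<phi> u1 u2 k (h2 \<otimes>\<^bsub>H\<^esub> r) (h1 \<otimes>\<^bsub>H\<^esub> r')))))"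
      by (intro ktensor_sw_cong R_comult[where \<phi> = "?\<phi> u1 u2 k" for u1 u2 k]) simp_all
    also have "\<dots> = E.rmul (tB l) \<one>\<^bsub>BA\<^esub> (Delta (bb u m h))"
      by (simp add: Delta_bb_hom[where f = "E.rmul (tB l) \<one>\<^bsub>BA\<^esub>" and G = E.BBk] E.lin_rmul left cong: ktensor_sw_cong)
    finally show "E.rmul (tB l) \<one>\<^bsub>BA\<^esub> (Delta (bb u m h)) = E.rmul \<one>\<^bsub>BA\<^esub> (sB l) (Delta (bb u m h))" by (rule sym)
  qed (simp_all add: b lin_comp[OF E.lin_rmul lin_Delta])
  then show ?thesis using Delta_closed[OF b] by (simp add: E.takeuchi_def)
qed

text \<open>On elements with trivial \<open>L\<close>-component the smash product is the plain
  tensor product, since \<open>H\<close> acts on the unit through \<epsilon>. This covers every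
  product of second factors of coproducts.\<close>

lemma bb_mult_one:
  assumes [simp]: "u \<in> carrier U" "f \<in> carrier H" "v \<in> carrier U" "g \<in> carrier H"
  shows "bb u \<one>\<^bsub>L\<^esub> f \<otimes>\<^bsub>BA\<^esub> bb v \<one>\<^bsub>L\<^esub> g = bb (u \<otimes>\<^bsub>U\<^esub> v) \<one>\<^bsub>L\<^esub> (f \<otimes>\<^bsub>H\<^esub> g)"
proof -
  have "bb u \<one>\<^bsub>L\<^esub> f \<otimes>\<^bsub>BA\<^esub> bb v \<one>\<^bsub>L\<^esub> g = sw K H H BA (comult H f) (\<lambda>f1 f2. counit H f1 \<odot>\<^bsub>BA\<^esub> bb (u \<otimes>\<^bsub>U\<^esub> v) \<one>\<^bsub>L\<^esub> (f2 \<otimes>\<^bsub>H\<^esub> g))"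
    by (simp add: bb_mult act_unit smult_bb cong: ktensor_sw_cong)
  also have "\<dots> = bb (u \<otimes>\<^bsub>U\<^esub> v) \<one>\<^bsub>L\<^esub> (f \<otimes>\<^bsub>H\<^esub> g)"
    by (rule counit_left) simp_all
  finally show ?thesis .
qed

text \<open>The second factors multiply without any action, so only the first factor sees the smash
  product. The remainder is a rearrangement of independent sums and one use of
  coassociativity.\<close>

lemma Delta_mult_bb:
  assumes [simp]: "u \<in> carrier U" "l \<in> carrier L" "f \<in> carrier H" "v \<in> carrier U" "m \<in> carrier L" "g \<in> carrier H"
  shows "Delta (bb u l f \<otimes>\<^bsub>BA\<^esub> bb v m g) = sw K U U E.BBk (comult U v) (\<lambda>v1 v2. sw K H H E.BBk (comult H g) (\<lambda>g1 g2.
     E.rmul (bb v1 m g1) (bb v2 \<one>\<^bsub>L\<^esub> g2) (Delta (bb u l f))))"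
proof -
  let ?X = "\<lambda>u1 u2 v1 v2 p q g1 k g2. tens E.BB (bb (u1 \<otimes>\<^bsub>U\<^esub> v1) (l \<otimes>\<^bsub>L\<^esub> act p m) (q \<otimes>\<^bsub>H\<^esub> g1)) (bb (u2 \<otimes>\<^bsub>U\<^esub> v2) \<one>\<^bsub>L\<^esub> (k \<otimes>\<^bsub>H\<^esub> g2))"
  have "Delta (bb u l f \<otimes>\<^bsub>BA\<^esub> bb v m g) = sw K H H E.BBk (comult H f) (\<lambda>f1 f2. Delta (bb (u \<otimes>\<^bsub>U\<^esub> v) (l \<otimes>\<^bsub>L\<^esub> act f1 m) (f2 \<otimes>\<^bsub>H\<^esub> g)))"
    unfolding bb_mult[OF assms] by (rule ktensor_sw_hom[where f = Delta and G = BA and G' = E.BBk]) (simp_all add: lin_Delta)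
  also have "\<dots> = sw K H H E.BBk (comult H f) (\<lambda>f1 f2. sw K U U E.BBk (comult U u) (\<lambda>u1 u2. sw K U U E.BBk (comult U v) (\<lambda>v1 v2.
      sw K H H E.BBk (comult H f2) (\<lambda>c d. sw K H H E.BBk (comult H g) (\<lambda>g1 g2. ?X u1 u2 v1 v2 f1 c g1 d g2)))))"
    by (simp add: Delta_bb comult_mult Uh.comult_mult cong: ktensor_sw_cong)
  also have "\<dots> = sw K H H E.BBk (comult H f) (\<lambda>f1 f2. sw K U U E.BBk (comult U u) (\<lambda>u1 u2. sw K U U E.BBk (comult U v) (\<lambda>v1 v2.
      sw K H H E.BBk (comult H g) (\<lambda>g1 g2. sw K H H E.BBk (comult H f2) (\<lambda>c d. ?X u1 u2 v1 v2 f1 c g1 d g2)))))"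
    by (rule ktensor_sw_cong[OF mod mod], rule ktensor_sw_cong[OF Uh.mod Uh.mod], rule ktensor_sw_cong[OF Uh.mod Uh.mod], rule ktensor_sw_swap) simp_all
  also have "\<dots> = sw K U U E.BBk (comult U u) (\<lambda>u1 u2. sw K H H E.BBk (comult H f) (\<lambda>f1 f2. sw K U U E.BBk (comult U v) (\<lambda>v1 v2.
      sw K H H E.BBk (comult H g) (\<lambda>g1 g2. sw K H H E.BBk (comult H f2) (\<lambda>c d. ?X u1 u2 v1 v2 f1 c g1 d g2)))))"
    by (rule ktensor_sw_swap) simp_all
  also have "\<dots> = sw K U U E.BBk (comult U u) (\<lambda>u1 u2. sw K U U E.BBk (comult U v) (\<lambda>v1 v2. sw K H H E.BBk (comult H f) (\<lambda>f1 f2.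
      sw K H H E.BBk (comult H g) (\<lambda>g1 g2. sw K H H E.BBk (comult H f2) (\<lambda>c d. ?X u1 u2 v1 v2 f1 c g1 d g2)))))"
    by (rule ktensor_sw_cong[OF Uh.mod Uh.mod], rule ktensor_sw_swap) simp_all
  also have "\<dots> = sw K U U E.BBk (comult U v) (\<lambda>v1 v2. sw K U U E.BBk (comult U u) (\<lambda>u1 u2. sw K H H E.BBk (comult H f) (\<lambda>f1 f2.
      sw K H H E.BBk (comult H g) (\<lambda>g1 g2. sw K H H E.BBk (comult H f2) (\<lambda>c d. ?X u1 u2 v1 v2 f1 c g1 d g2)))))"
    by (rule ktensor_sw_swap) simp_all
  also have "\<dots> = sw K U U E.BBk (comult U v) (\<lambda>v1 v2. sw K U U E.BBk (comult U u) (\<lambda>u1 u2. sw K H H E.BBk (comult H g) (\<lambda>g1 g2.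
      sw K H H E.BBk (comult H f) (\<lambda>f1 f2. sw K H H E.BBk (comult H f2) (\<lambda>c d. ?X u1 u2 v1 v2 f1 c g1 d g2)))))"
    by (rule ktensor_sw_cong[OF Uh.mod Uh.mod], rule ktensor_sw_cong[OF Uh.mod Uh.mod], rule ktensor_sw_swap) simp_all
  \<comment> \<open>On the right-hand side \<open>f\<close> is first distributed over the two tensor
    factors, and only the part in the first factor is split again by the smash product; hence the
    rebracketing.\<close>
  also have "\<dots> = sw K U U E.BBk (comult U v) (\<lambda>v1 v2. sw K U U E.BBk (comult U u) (\<lambda>u1 u2. sw K H H E.BBk (comult H g) (\<lambda>g1 g2.
      sw K H H E.BBk (comult H f) (\<lambda>f1 f2. sw K H H E.BBk (comult H f1) (\<lambda>c d. ?X u1 u2 v1 v2 c d g1 f2 g2)))))"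
    by (rule ktensor_sw_cong[OF Uh.mod Uh.mod], rule ktensor_sw_cong[OF Uh.mod Uh.mod], rule ktensor_sw_cong[OF mod mod],
        rule coassoc[where \<phi> = "\<lambda>a b c. ?X u1 u2 v1 v2 a b g1 c g2" for u1 u2 v1 v2 g1 g2, symmetric]) (simp_all add: trilin_def)
  also have "\<dots> = sw K U U E.BBk (comult U v) (\<lambda>v1 v2. sw K H H E.BBk (comult H g) (\<lambda>g1 g2. sw K U U E.BBk (comult U u) (\<lambda>u1 u2.
      sw K H H E.BBk (comult H f) (\<lambda>f1 f2. sw K H H E.BBk (comult H f1) (\<lambda>c d. ?X u1 u2 v1 v2 c d g1 f2 g2)))))"
    by (rule ktensor_sw_cong[OF Uh.mod Uh.mod], rule ktensor_sw_swap) simp_all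
  also have "\<dots> = sw K U U E.BBk (comult U v) (\<lambda>v1 v2. sw K H H E.BBk (comult H g) (\<lambda>g1 g2.
     E.rmul (bb v1 m g1) (bb v2 \<one>\<^bsub>L\<^esub> g2) (Delta (bb u l f))))"
  proof (intro ktensor_sw_cong)
    fix v1 v2 g1 g2 assume [simp]: "v1 \<in> carrier U" "v2 \<in> carrier U" "g1 \<in> carrier H" "g2 \<in> carrier H"
    have "E.rmul (bb v1 m g1) (bb v2 \<one>\<^bsub>L\<^esub> g2) (tens E.BB (bb u1 l f1) (bb u2 \<one>\<^bsub>L\<^esub> f2)) = sw K H H E.BBk (comult H f1) (\<lambda>c d. ?X u1 u2 v1 v2 c d g1 f2 g2)"
      if [simp]: "u1 \<in> carrier U" "u2 \<in> carrier U" "f1 \<in> carrier H" "f2 \<in> carrier H" for u1 u2 f1 f2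
    proof -
      have "E.rmul (bb v1 m g1) (bb v2 \<one>\<^bsub>L\<^esub> g2) (tens E.BB (bb u1 l f1) (bb u2 \<one>\<^bsub>L\<^esub> f2)) =
        tens E.BB (bb u1 l f1 \<otimes>\<^bsub>BA\<^esub> bb v1 m g1) (bb (u2 \<otimes>\<^bsub>U\<^esub> v2) \<one>\<^bsub>L\<^esub> (f2 \<otimes>\<^bsub>H\<^esub> g2))"
        by (simp add: E.rmul_tens bb_mult_one)
      also have "\<dots> = sw K H H E.BBk (comult H f1) (\<lambda>c d. ?X u1 u2 v1 v2 c d g1 f2 g2)"
        unfolding bb_mult[OF \<open>u1 \<in> carrier U\<close> assms(2) \<open>f1 \<in> carrier H\<close> \<open>v1 \<in> carrier U\<close> assms(5) \<open>g1 \<in> carrier H\<close>]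
        by (rule ktensor_sw_hom[where f = "\<lambda>z. tens E.BB z (bb (u2 \<otimes>\<^bsub>U\<^esub> v2) \<one>\<^bsub>L\<^esub> (f2 \<otimes>\<^bsub>H\<^esub> g2))" and G = BA and G' = E.BBk]) simp_all
      finally show ?thesis .
    qed
    then show "sw K U U E.BBk (comult U u) (\<lambda>u1 u2. sw K H H E.BBk (comult H f) (\<lambda>f1 f2. sw K H H E.BBk (comult H f1) (\<lambda>c d. ?X u1 u2 v1 v2 c d g1 f2 g2))) =
       E.rmul (bb v1 m g1) (bb v2 \<one>\<^bsub>L\<^esub> g2) (Delta (bb u l f))"
      by (simp add: Delta_bb_hom[where f = "E.rmul (bb v1 m g1) (bb v2 \<one>\<^bsub>L\<^esub> g2)" and G = E.BBk] E.lin_rmul cong: ktensor_sw_cong)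
  qed simp_all
  finally show ?thesis .
qed

text \<open>Extending linearly from generators in the second argument is legitimate because
  coproducts lie in the Takeuchi product, which makes the right-hand side linear in
  \<open>Delta y\<close>.\<close>

lemma Delta_mult:
  assumes x: "x \<in> carrier BA" and y: "y \<in> carrier BA"
  shows "Delta (x \<otimes>\<^bsub>BA\<^esub> y) = Delta x \<otimes>\<^bsub>E.BB\<^esub> Delta y"
proof (rule bb_ext[where z = y and G = E.BBk])
  fix v m g assume [simp]: "v \<in> carrier U" "m \<in> carrier L" "g \<in> carrier H"
  have "Delta x \<otimes>\<^bsub>E.BB\<^esub> Delta (bb v m g) = sw K U U E.BBk (comult U v) (\<lambda>v1 v2. sw K H H E.BBk (comult H g) (\<lambda>g1 g2.
     E.rmul (bb v1 m g1) (bb v2 \<one>\<^bsub>L\<^esub> g2) (Delta x)))"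
    by (simp add: Delta_bb_hom[where f = "\<lambda>y. Delta x \<otimes>\<^bsub>E.BB\<^esub> y" and G = E.BBk] E.lin_mult_BB takeuchi_Delta x E.mult_BB_tens cong: ktensor_sw_cong)
  moreover have "Delta (x \<otimes>\<^bsub>BA\<^esub> bb v m g) = sw K U U E.BBk (comult U v) (\<lambda>v1 v2. sw K H H E.BBk (comult H g) (\<lambda>g1 g2.
     E.rmul (bb v1 m g1) (bb v2 \<one>\<^bsub>L\<^esub> g2) (Delta x)))"
    by (rule bb_ext[where z = x and G = E.BBk]) (simp_all add: x Delta_mult_bb lin_comp[OF lin_Delta] lin_comp[OF E.lin_rmul lin_Delta])
  ultimately show "Delta (x \<otimes>\<^bsub>BA\<^esub> bb v m g) = Delta x \<otimes>\<^bsub>E.BB\<^esub> Delta (bb v m g)" by simp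
qed (simp_all add: x y lin_comp[OF lin_Delta] lin_comp[OF E.lin_mult_BB lin_Delta] takeuchi_Delta)

lemma Delta_one: "Delta \<one>\<^bsub>BA\<^esub> = \<one>\<^bsub>E.BB\<^esub>"
proof -
  have "Delta \<one>\<^bsub>BA\<^esub> = sw K U U E.BBk (comult U \<one>\<^bsub>U\<^esub>) (\<lambda>u1 u2. sw K H H E.BBk (comult H \<one>\<^bsub>H\<^esub>) (\<lambda>h1 h2. tens E.BB (bb u1 \<one>\<^bsub>L\<^esub> h1) (bb u2 \<one>\<^bsub>L\<^esub> h2)))"
    by (simp add: BA_one Delta_bb)
  also have "\<dots> = sw K H H E.BBk (comult H \<one>\<^bsub>H\<^esub>) (\<lambda>h1 h2. tens E.BB (bb \<one>\<^bsub>U\<^esub> \<one>\<^bsub>L\<^esub> h1) (bb \<one>\<^bsub>U\<^esub> \<one>\<^bsub>L\<^esub> h2))"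
    by (rule Uh.comult_one) simp_all
  also have "\<dots> = tens E.BB (bb \<one>\<^bsub>U\<^esub> \<one>\<^bsub>L\<^esub> \<one>\<^bsub>H\<^esub>) (bb \<one>\<^bsub>U\<^esub> \<one>\<^bsub>L\<^esub> \<one>\<^bsub>H\<^esub>)"
    by (rule comult_one) simp_all
  finally show ?thesis
    by (simp only: BA_one tensor_product_one[of "carrier L" _ E.lm E.lm] E.lm_simps)
qed

text \<open>Balancing is the compatibility of \<open>Delta\<close> with the target map: t(l) lands
  on the second leg of the coproduct and moves on to the third factor. The companion below rests in
  the same way on the source map.\<close>

lemma lbal_reassoc_Delta: "E.B2.lbal E.BBBk (\<lambda>a1 a2. E.reassoc a2 (Delta a1))"
proof -
  have "E.reassoc a2 (Delta (tB l \<otimes>\<^bsub>BA\<^esub> a1)) = E.reassoc (sB l \<otimes>\<^bsub>BA\<^esub> a2) (Delta a1)"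
    if "l \<in> carrier L" "a1 \<in> carrier BA" "a2 \<in> carrier BA" for l a1 a2
    using that by (simp add: Delta_tB E.reassoc_tmul Delta_closed)
  moreover have "bilin K BA BA E.BBBk (\<lambda>a1 a2. E.reassoc a2 (Delta a1))"
    using E.bilin_reassoc Delta_closed
    by (intro bilinI bilin_comp_l[OF E.bilin_reassoc lin_ident] bilin_comp_r[OF E.bilin_reassoc lin_Delta])
       (simp_all add: E.B2.Tk_simps)
  ultimately show ?thesis unfolding E.B2.lbal_def E.lm_simps by blast
qed

lemma lbal_tens_Delta: "E.B2.lbal E.BBBk (\<lambda>a1 a2. tens E.BBB a1 (Delta a2))"
proof -
  have "tens E.BBB (tB l \<otimes>\<^bsub>BA\<^esub> a1) (Delta a2) = tens E.BBB a1 (Delta (sB l \<otimes>\<^bsub>BA\<^esub> a2))"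
    if "l \<in> carrier L" "a1 \<in> carrier BA" "a2 \<in> carrier BA" for l a1 a2
    using that by (simp add: Delta_sB E.B3.T_balance Delta_closed E.B2.Tk_simps)
  moreover have "bilin K BA BA E.BBBk (\<lambda>a1 a2. tens E.BBB a1 (Delta a2))"
    using Delta_closed by (intro bilinI) (simp_all add: E.B2.Tk_simps lin_Delta)
  ultimately show ?thesis unfolding E.B2.lbal_def E.lm_simps by blast
qed

text \<open>On generators the component in \<open>L\<close> stays in the first factor throughout, so
  coassociativity in \<open>U\<close> and in \<open>H\<close> can be used independently.\<close>

lemma Delta_coassoc:
  assumes a: "a \<in> carrier BA"
  shows "tlift E.BBBk (Delta a) (\<lambda>a1 a2. E.reassoc a2 (Delta a1)) = tlift E.BBBk (Delta a) (\<lambda>a1 a2. tens E.BBB a1 (Delta a2))"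
proof (rule bb_ext[where z = a and G = E.BBBk])
  note l1 = E.B2.lin_tlift_T[OF E.B3.mod_Tk lbal_reassoc_Delta] and l2 = E.B2.lin_tlift_T[OF E.B3.mod_Tk lbal_tens_Delta]
  fix u l h assume [simp]: "u \<in> carrier U" "l \<in> carrier L" "h \<in> carrier H"
  let ?t = "\<lambda>x y z p q r. tens E.BBB (bb x l p) (tens E.BB (bb y \<one>\<^bsub>L\<^esub> q) (bb z \<one>\<^bsub>L\<^esub> r))"
  have "tlift E.BBBk (Delta (bb u l h)) (\<lambda>a1 a2. E.reassoc a2 (Delta a1)) =
    sw K U U E.BBBk (comult U u) (\<lambda>u1 u2. sw K H H E.BBBk (comult H h) (\<lambda>h1 h2. E.reassoc (bb u2 \<one>\<^bsub>L\<^esub> h2) (Delta (bb u1 l h1))))"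
    by (simp add: Delta_bb_hom[where f = "\<lambda>z. tlift E.BBBk z (\<lambda>a1 a2. E.reassoc a2 (Delta a1))" and G = E.BBBk] l1
       E.B2.tlift_T_tens lbal_reassoc_Delta cong: ktensor_sw_cong)
  also have "\<dots> = sw K U U E.BBBk (comult U u) (\<lambda>u1 u2. sw K H H E.BBBk (comult H h) (\<lambda>h1 h2.
      sw K U U E.BBBk (comult U u1) (\<lambda>x y. sw K H H E.BBBk (comult H h1) (\<lambda>p q. ?t x y u2 p q h2))))"
    by (simp add: Delta_bb_hom[where f = "E.reassoc c" and G = E.BBBk for c] E.lin_reassoc E.reassoc_tens cong: ktensor_sw_cong)
  also have "\<dots> = sw K U U E.BBBk (comult U u) (\<lambda>u1 u2. sw K U U E.BBBk (comult U u1) (\<lambda>x y. sw K H H E.BBBk (comult H h) (\<lambda>h1 h2.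
      sw K H H E.BBBk (comult H h1) (\<lambda>p q. ?t x y u2 p q h2))))"
    by (rule ktensor_sw_cong[OF Uh.mod Uh.mod], rule ktensor_sw_swap) simp_all
  also have "\<dots> = sw K U U E.BBBk (comult U u) (\<lambda>u1 u2. sw K U U E.BBBk (comult U u1) (\<lambda>x y. sw K H H E.BBBk (comult H h) (\<lambda>h1 h2.
      sw K H H E.BBBk (comult H h2) (\<lambda>p q. ?t x y u2 h1 p q))))"
    by (rule ktensor_sw_cong[OF Uh.mod Uh.mod], rule ktensor_sw_cong[OF Uh.mod Uh.mod],
        rule coassoc[where \<phi> = "?t x y z" for x y z]) (simp_all add: trilin_def)
  also have "\<dots> = sw K U U E.BBBk (comult U u) (\<lambda>u1 u2. sw K U U E.BBBk (comult U u2) (\<lambda>y z. sw K H H E.BBBk (comult H h) (\<lambda>h1 h2.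
      sw K H H E.BBBk (comult H h2) (\<lambda>p q. ?t u1 y z h1 p q))))"
    by (rule Uh.coassoc[where \<phi> = "\<lambda>x y z. sw K H H E.BBBk (comult H h) (\<lambda>h1 h2.
      sw K H H E.BBBk (comult H h2) (\<lambda>p q. ?t x y z h1 p q))"]) (simp_all add: trilin_def)
  also have "\<dots> = sw K U U E.BBBk (comult U u) (\<lambda>u1 u2. sw K H H E.BBBk (comult H h) (\<lambda>h1 h2. sw K U U E.BBBk (comult U u2) (\<lambda>y z.
      sw K H H E.BBBk (comult H h2) (\<lambda>p q. ?t u1 y z h1 p q))))"
    by (rule ktensor_sw_cong[OF Uh.mod Uh.mod], rule ktensor_sw_swap) simp_all
  also have "\<dots> = sw K U U E.BBBk (comult U u) (\<lambda>u1 u2. sw K H H E.BBBk (comult H h) (\<lambda>h1 h2. tens E.BBB (bb u1 l h1) (Delta (bb u2 \<one>\<^bsub>L\<^esub> h2))))"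
    by (simp add: Delta_bb_hom[where f = "\<lambda>z. tens E.BBB c z" and G = E.BBBk for c] cong: ktensor_sw_cong)
  also have "\<dots> = tlift E.BBBk (Delta (bb u l h)) (\<lambda>a1 a2. tens E.BBB a1 (Delta a2))"
    by (simp add: Delta_bb_hom[where f = "\<lambda>z. tlift E.BBBk z (\<lambda>a1 a2. tens E.BBB a1 (Delta a2))" and G = E.BBBk] l2
       E.B2.tlift_T_tens lbal_tens_Delta cong: ktensor_sw_cong)
  finally show "tlift E.BBBk (Delta (bb u l h)) (\<lambda>a1 a2. E.reassoc a2 (Delta a1)) = tlift E.BBBk (Delta (bb u l h)) (\<lambda>a1 a2. tens E.BBB a1 (Delta a2))" .
qed (simp_all add: a lin_comp[OF E.B2.lin_tlift_T[OF E.B3.mod_Tk lbal_reassoc_Delta] lin_Delta]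
      lin_comp[OF E.B2.lin_tlift_T[OF E.B3.mod_Tk lbal_tens_Delta] lin_Delta])

section \<open>The counit\<close>

definition eps where "eps b = bsw L b (\<lambda>u l h. counit U u \<odot>\<^bsub>L\<^esub> (counit H h \<odot>\<^bsub>L\<^esub> l))"

lemma smult_comm:
  assumes "module K G" "c \<in> carrier K" "d \<in> carrier K" "x \<in> carrier G"
  shows "c \<odot>\<^bsub>G\<^esub> (d \<odot>\<^bsub>G\<^esub> x) = d \<odot>\<^bsub>G\<^esub> (c \<odot>\<^bsub>G\<^esub> x)"
  using linD(3)[OF lin_smult[OF assms(1) lin_ident assms(2)] assms(3,4)] .

lemma trilin_eps: "trilin K U L H L (\<lambda>u l h. counit U u \<odot>\<^bsub>L\<^esub> (counit H h \<odot>\<^bsub>L\<^esub> l))"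
  by (simp add: trilin_def)

lemma lin_eps: "lin K BA L eps"
  unfolding eps_def[abs_def] by (rule lin_bsw[OF _ trilin_eps]) simp

lemma eps_bb: "u \<in> carrier U \<Longrightarrow> l \<in> carrier L \<Longrightarrow> h \<in> carrier H \<Longrightarrow> eps (bb u l h) = counit U u \<odot>\<^bsub>L\<^esub> (counit H h \<odot>\<^bsub>L\<^esub> l)"
  unfolding eps_def by (rule bsw_bb[OF _ trilin_eps]) simp_all

lemma eps_closed [simp]: "b \<in> carrier BA \<Longrightarrow> eps b \<in> carrier L"
  by (rule linD(1)[OF lin_eps])

lemma eps_one: "eps \<one>\<^bsub>BA\<^esub> = \<one>\<^bsub>L\<^esub>"
  using module.smult_one[OF modL] by (simp add: BA_one eps_bb Uh.counit_one counit_one)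

lemma eps_sB:
  assumes [simp]: "l \<in> carrier L" and a: "a \<in> carrier BA"
  shows "eps (sB l \<otimes>\<^bsub>BA\<^esub> a) = l \<otimes>\<^bsub>L\<^esub> eps a"
  by (rule bb_ext[where z = a and G = L])
     (simp_all add: a sB_mult_bb eps_bb alg_smult[where K = K] lin_comp[OF lin_eps] lin_mult_r[OF algL lin_eps])

text \<open>The counit of the bialgebroid reduces the first leg of \<open>R\<close> to \<epsilon>,
  and (\<epsilon> \<otimes> id)(R) = 1 leaves right multiplication by \<open>l\<close>.\<close>

lemma eps_tB:
  assumes [simp]: "l \<in> carrier L" and a: "a \<in> carrier BA"
  shows "eps (tB l \<otimes>\<^bsub>BA\<^esub> a) = eps a \<otimes>\<^bsub>L\<^esub> l"
proof (rule bb_ext[where z = a and G = L])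
  fix u m h assume [simp]: "u \<in> carrier U" "m \<in> carrier L" "h \<in> carrier H"
  interpret module K L by simp
  have "eps (tB l \<otimes>\<^bsub>BA\<^esub> bb u m h) = sw K H H L R (\<lambda>r r'. eps (bb u (m \<otimes>\<^bsub>L\<^esub> act r' l) (r \<otimes>\<^bsub>H\<^esub> h)))"
    unfolding tB_mult_bb[OF assms(1) \<open>u \<in> carrier U\<close> \<open>m \<in> carrier L\<close> \<open>h \<in> carrier H\<close>]
    by (rule ktensor_sw_hom[where f = eps and G = BA and G' = L]) (simp_all add: lin_eps)
  also have "\<dots> = sw K H H L R (\<lambda>r r'. counit H r \<odot>\<^bsub>L\<^esub> (eps (bb u m h) \<otimes>\<^bsub>L\<^esub> act r' l))"
    by (rule ktensor_sw_cong)
       (simp_all add: eps_bb counit_mult smult_assoc1 alg_smult[where K = K] smult_comm[of L "counit U u" "counit H r" for r])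
  also have "\<dots> = eps (bb u m h) \<otimes>\<^bsub>L\<^esub> act \<one>\<^bsub>H\<^esub> l"
    by (rule counit_R_left) simp_all
  finally show "eps (tB l \<otimes>\<^bsub>BA\<^esub> bb u m h) = eps (bb u m h) \<otimes>\<^bsub>L\<^esub> l" by (simp add: act_one)
qed (simp_all add: a tB_closed lin_comp[OF lin_eps] lin_mult_l[OF algL lin_eps])

text \<open>For a = u \<otimes> l \<otimes> f, all three expressions have the value \<epsilon>(u) l
  (f \<triangleright> \<open>eps b\<close>): they depend on \<open>b\<close> only through its
  counit.\<close>

lemma eps_mult_sB:
  assumes a: "a \<in> carrier BA" and b: "b \<in> carrier BA"
  shows "eps (a \<otimes>\<^bsub>BA\<^esub> sB (eps b)) = eps (a \<otimes>\<^bsub>BA\<^esub> b)" "eps (a \<otimes>\<^bsub>BA\<^esub> tB (eps b)) = eps (a \<otimes>\<^bsub>BA\<^esub> b)"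
proof -
  interpret module K L by simp
  have pure: "eps (bb u l f \<otimes>\<^bsub>BA\<^esub> bb v m g) = counit U u \<odot>\<^bsub>L\<^esub> (counit U v \<odot>\<^bsub>L\<^esub> (counit H g \<odot>\<^bsub>L\<^esub> (l \<otimes>\<^bsub>L\<^esub> act f m)))"
    if [simp]: "u \<in> carrier U" "l \<in> carrier L" "f \<in> carrier H" "v \<in> carrier U" "m \<in> carrier L" "g \<in> carrier H" for u l f v m g
  proof -
    have "eps (bb u l f \<otimes>\<^bsub>BA\<^esub> bb v m g) = sw K H H L (comult H f) (\<lambda>f1 f2. eps (bb (u \<otimes>\<^bsub>U\<^esub> v) (l \<otimes>\<^bsub>L\<^esub> act f1 m) (f2 \<otimes>\<^bsub>H\<^esub> g)))"
      unfolding bb_mult[OF that] by (rule ktensor_sw_hom[where f = eps and G = BA and G' = L]) (simp_all add: lin_eps)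
    also have "\<dots> = sw K H H L (comult H f) (\<lambda>f1 f2. counit H f2 \<odot>\<^bsub>L\<^esub> (counit U u \<odot>\<^bsub>L\<^esub> (counit U v \<odot>\<^bsub>L\<^esub> (counit H g \<odot>\<^bsub>L\<^esub> (l \<otimes>\<^bsub>L\<^esub> act f1 m)))))"
      by (rule ktensor_sw_cong)
         (simp_all add: eps_bb counit_mult Uh.counit_mult smult_assoc1 smult_comm[of L "counit U v" "counit H r" for r] smult_comm[of L "counit U u" "counit H r" for r])
    also have "\<dots> = counit U u \<odot>\<^bsub>L\<^esub> (counit U v \<odot>\<^bsub>L\<^esub> (counit H g \<odot>\<^bsub>L\<^esub> (l \<otimes>\<^bsub>L\<^esub> act f m)))"
      by (rule counit_right) simp_all
    finally show ?thesis .
  qed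
  have s: "eps (bb u l f \<otimes>\<^bsub>BA\<^esub> sB m) = counit U u \<odot>\<^bsub>L\<^esub> (l \<otimes>\<^bsub>L\<^esub> act f m)"
    if [simp]: "u \<in> carrier U" "l \<in> carrier L" "f \<in> carrier H" "m \<in> carrier L" for u l f m
    by (simp add: sB_def pure Uh.counit_one counit_one)
  have t: "eps (bb u l f \<otimes>\<^bsub>BA\<^esub> tB m) = counit U u \<odot>\<^bsub>L\<^esub> (l \<otimes>\<^bsub>L\<^esub> act f m)"
    if [simp]: "u \<in> carrier U" "l \<in> carrier L" "f \<in> carrier H" "m \<in> carrier L" for u l f m
  proof -
    have "eps (bb u l f \<otimes>\<^bsub>BA\<^esub> tB m) = sw K H H L R (\<lambda>r r'. eps (bb u l f \<otimes>\<^bsub>BA\<^esub> bb \<one>\<^bsub>U\<^esub> (act r' m) r))"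
      unfolding tB_def
      by (rule ktensor_sw_hom[where f = "\<lambda>x. eps (bb u l f \<otimes>\<^bsub>BA\<^esub> x)" and G = BA and G' = L]) (simp_all add: lin_comp[OF lin_eps])
    also have "\<dots> = sw K H H L R (\<lambda>r r'. counit H r \<odot>\<^bsub>L\<^esub> (counit U u \<odot>\<^bsub>L\<^esub> (l \<otimes>\<^bsub>L\<^esub> act f (act r' m))))"
      by (rule ktensor_sw_cong) (simp_all add: pure Uh.counit_one smult_comm[of L "counit U u" "counit H r" for r])
    also have "\<dots> = counit U u \<odot>\<^bsub>L\<^esub> (l \<otimes>\<^bsub>L\<^esub> act f (act \<one>\<^bsub>H\<^esub> m))"
      by (rule counit_R_left) simp_all
    finally show ?thesis by (simp add: act_one)
  qed
  have e: "eps (bb u l f \<otimes>\<^bsub>BA\<^esub> b) = counit U u \<odot>\<^bsub>L\<^esub> (l \<otimes>\<^bsub>L\<^esub> act f (eps b))"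
    if [simp]: "u \<in> carrier U" "l \<in> carrier L" "f \<in> carrier H" for u l f
    by (rule bb_ext[where z = b and G = L])
       (simp_all add: b lin_comp[OF lin_eps] lin_eps pure eps_bb linD(3)[OF lin_act(2)[OF lin_ident]] alg_smult[where K = K])
  show "eps (a \<otimes>\<^bsub>BA\<^esub> sB (eps b)) = eps (a \<otimes>\<^bsub>BA\<^esub> b)"
    by (rule bb_ext[where z = a and G = L]) (simp_all add: a b sB_closed lin_comp[OF lin_eps] s e)
  show "eps (a \<otimes>\<^bsub>BA\<^esub> tB (eps b)) = eps (a \<otimes>\<^bsub>BA\<^esub> b)"
    by (rule bb_ext[where z = a and G = L]) (simp_all add: a b tB_closed lin_comp[OF lin_eps] t e)
qed

lemma lin_sB_eps [simp]: "lin K BA BA (\<lambda>x. sB (eps x))" "lin K BA BA (\<lambda>x. tB (eps x))"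
  by (rule lin_comp[OF lin_sB lin_eps], rule lin_comp[OF lin_tB lin_eps])

lemma sB_eps_closed [simp]: "a \<in> carrier BA \<Longrightarrow> sB (eps a) \<in> carrier BA" "a \<in> carrier BA \<Longrightarrow> tB (eps a) \<in> carrier BA"
  by (simp_all add: sB_closed tB_closed)

lemma lbal_counit_left: "E.B2.lbal BA (\<lambda>a1 a2. sB (eps a1) \<otimes>\<^bsub>BA\<^esub> a2)"
proof -
  have "sB (eps (tB l \<otimes>\<^bsub>BA\<^esub> a1)) \<otimes>\<^bsub>BA\<^esub> a2 = sB (eps a1) \<otimes>\<^bsub>BA\<^esub> (sB l \<otimes>\<^bsub>BA\<^esub> a2)"
    if [simp]: "l \<in> carrier L" "a1 \<in> carrier BA" "a2 \<in> carrier BA" for l a1 a2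
    by (simp add: eps_tB E.s_mult alg_closed(5)[where K = K] sB_closed)
  then show ?thesis by (simp add: E.B2.lbal_def E.lm_simps)
qed

lemma lbal_counit_right: "E.B2.lbal BA (\<lambda>a1 a2. tB (eps a2) \<otimes>\<^bsub>BA\<^esub> a1)"
proof -
  have "tB (eps a2) \<otimes>\<^bsub>BA\<^esub> (tB l \<otimes>\<^bsub>BA\<^esub> a1) = tB (eps (sB l \<otimes>\<^bsub>BA\<^esub> a2)) \<otimes>\<^bsub>BA\<^esub> a1"
    if [simp]: "l \<in> carrier L" "a1 \<in> carrier BA" "a2 \<in> carrier BA" for l a1 a2
    by (simp add: eps_sB E.t_mult alg_closed(5)[where K = K] tB_closed)
  then show ?thesis by (simp add: E.B2.lbal_def E.lm_simps)
qed

lemma Delta_counit_left: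
  assumes a: "a \<in> carrier BA"
  shows "tlift BA (Delta a) (\<lambda>a1 a2. sB (eps a1) \<otimes>\<^bsub>BA\<^esub> a2) = a"
proof (rule bb_ext[where z = a and G = BA])
  have BA: "module K BA" by simp
  note l1 = E.B2.lin_tlift_T[OF BA lbal_counit_left]
  show "lin K BA BA (\<lambda>a. tlift BA (Delta a) (\<lambda>a1 a2. sB (eps a1) \<otimes>\<^bsub>BA\<^esub> a2))" by (rule lin_comp[OF l1 lin_Delta])
  fix u l h assume [simp]: "u \<in> carrier U" "l \<in> carrier L" "h \<in> carrier H"
  have "tlift BA (Delta (bb u l h)) (\<lambda>a1 a2. sB (eps a1) \<otimes>\<^bsub>BA\<^esub> a2) =
    sw K U U BA (comult U u) (\<lambda>u1 u2. sw K H H BA (comult H h) (\<lambda>h1 h2. sB (eps (bb u1 l h1)) \<otimes>\<^bsub>BA\<^esub> bb u2 \<one>\<^bsub>L\<^esub> h2))"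
    by (simp add: Delta_bb_hom[where f = "\<lambda>z. tlift BA z (\<lambda>a1 a2. sB (eps a1) \<otimes>\<^bsub>BA\<^esub> a2)" and G = BA] l1
       E.B2.tlift_T_tens lbal_counit_left cong: ktensor_sw_cong)
  also have "\<dots> = sw K U U BA (comult U u) (\<lambda>u1 u2. sw K H H BA (comult H h) (\<lambda>h1 h2. counit H h1 \<odot>\<^bsub>BA\<^esub> (counit U u1 \<odot>\<^bsub>BA\<^esub> bb u2 l h2)))"
    by (simp add: sB_mult_bb eps_bb smult_bb smult_comm[of L "counit U r" "counit H r'" for r r'] cong: ktensor_sw_cong)
  also have "\<dots> = sw K U U BA (comult U u) (\<lambda>u1 u2. counit U u1 \<odot>\<^bsub>BA\<^esub> bb u2 l h)"
    by (rule ktensor_sw_cong[OF Uh.mod Uh.mod], rule counit_left) simp_all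
  also have "\<dots> = bb u l h"
    by (rule Uh.counit_left) simp_all
  finally show "tlift BA (Delta (bb u l h)) (\<lambda>a1 a2. sB (eps a1) \<otimes>\<^bsub>BA\<^esub> a2) = bb u l h" .
qed (simp_all add: a)

lemma Delta_counit_right:
  assumes a: "a \<in> carrier BA"
  shows "tlift BA (Delta a) (\<lambda>a1 a2. tB (eps a2) \<otimes>\<^bsub>BA\<^esub> a1) = a"
proof (rule bb_ext[where z = a and G = BA])
  have BA: "module K BA" by simp
  note l1 = E.B2.lin_tlift_T[OF BA lbal_counit_right]
  show "lin K BA BA (\<lambda>a. tlift BA (Delta a) (\<lambda>a1 a2. tB (eps a2) \<otimes>\<^bsub>BA\<^esub> a1))" by (rule lin_comp[OF l1 lin_Delta])
  fix u l h assume [simp]: "u \<in> carrier U" "l \<in> carrier L" "h \<in> carrier H"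
  have "tlift BA (Delta (bb u l h)) (\<lambda>a1 a2. tB (eps a2) \<otimes>\<^bsub>BA\<^esub> a1) =
    sw K U U BA (comult U u) (\<lambda>u1 u2. sw K H H BA (comult H h) (\<lambda>h1 h2. tB (eps (bb u2 \<one>\<^bsub>L\<^esub> h2)) \<otimes>\<^bsub>BA\<^esub> bb u1 l h1))"
    by (simp add: Delta_bb_hom[where f = "\<lambda>z. tlift BA z (\<lambda>a1 a2. tB (eps a2) \<otimes>\<^bsub>BA\<^esub> a1)" and G = BA] l1
       E.B2.tlift_T_tens lbal_counit_right cong: ktensor_sw_cong)
  also have "\<dots> = sw K U U BA (comult U u) (\<lambda>u1 u2. sw K H H BA (comult H h) (\<lambda>h1 h2. counit H h2 \<odot>\<^bsub>BA\<^esub> (counit U u2 \<odot>\<^bsub>BA\<^esub> bb u1 l h1)))"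
    by (simp add: eps_bb linD(3)[OF lin_tB] tB_one alg_smult[where K = K] smult_bb smult_comm[of L "counit U r" "counit H r'" for r r'] cong: ktensor_sw_cong)
  also have "\<dots> = sw K U U BA (comult U u) (\<lambda>u1 u2. counit U u2 \<odot>\<^bsub>BA\<^esub> bb u1 l h)"
    by (rule ktensor_sw_cong[OF Uh.mod Uh.mod], rule counit_right) simp_all
  also have "\<dots> = bb u l h"
    by (rule Uh.counit_right) simp_all
  finally show "tlift BA (Delta (bb u l h)) (\<lambda>a1 a2. tB (eps a2) \<otimes>\<^bsub>BA\<^esub> a1) = bb u l h" .
qed (simp_all add: a)

end

text \<open>The target map of the bialgebroid record agrees with \<open>tB\<close> on the carrier of
  \<open>L\<close> only. The relations evaluate the action just there, so the two tensor products
  coincide as sets.\<close>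

lemma tensor_product_action_cong:
  assumes "\<And>a s. a \<in> carrier A \<Longrightarrow> s \<in> S \<Longrightarrow> ra a s = ra' a s"
  shows "tensor_product S ra A B = tensor_product S ra' A B"
proof -
  have "tensor_rels S ra A B = tensor_rels S ra' A B"
    unfolding tensor_rels_def
    by (intro arg_cong2[where f = "(\<union>)"] refl Collect_cong) (metis assms)
  then have "tensor_group S ra A B = tensor_group S ra' A B"
    by (simp add: tensor_group_def)
  then show ?thesis by (simp add: tensor_product_def)
qed

text \<open>A representative of a tensor may be any integer combination, but two balanced maps equal
  on the carriers induce linear maps that agree on pure tensors, hence everywhere. Balancing has to
  be known for one of them only.\<close>

lemma (in base_tensor) tlift_T_cong:
  assumes G: "module K G" and \<psi>: "lbal G \<psi>" and z: "z \<in> carrier T"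
    and e: "\<And>a m. a \<in> carrier A \<Longrightarrow> m \<in> carrier Mk \<Longrightarrow> \<phi> a m = \<psi> a m"
  shows "tlift G z \<phi> = tlift G z \<psi>"
proof -
  have "bilin K A Mk G \<phi> = bilin K A Mk G \<psi>" by (rule bilin_cong[OF mod_A mod_Mk e])
  then have \<phi>: "lbal G \<phi>" using \<psi> unfolding lbal_def by (simp add: e smult_M_closed del: bilin_def)
  show ?thesis
    by (rule T_ext[OF lin_tlift_T[OF G \<phi>] lin_tlift_T[OF G \<psi>] _ z])
       (simp add: tlift_T_tens[OF G \<phi>] tlift_T_tens[OF G \<psi>] e)
qed

context enveloping
begin

text \<open>Right multiplication commutes with the left action of the base; together with the
  companion for the right action this lets multiplication by \<Psi> preserve balancing.\<close>

lemma rmul_smult: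
  assumes [simp]: "a' \<in> carrier A" "b' \<in> carrier A" "l \<in> carrier L" and z: "z \<in> carrier BB"
  shows "rmul a' b' (l \<odot>\<^bsub>BB\<^esub> z) = l \<odot>\<^bsub>BB\<^esub> rmul a' b' z"
  by (rule B2.T_ext[OF _ _ _ z, where G = BBk])
     (simp_all add: lin_comp[OF lin_rmul B2.lin_smult_T] lin_comp[OF B2.lin_smult_T lin_rmul] B2.smult_T_tens rmul_tens
       alg_closed(5)[where K = K])

lemma rmul_tmul:
  assumes [simp]: "a' \<in> carrier A" "b' \<in> carrier A" "l \<in> carrier L" and z: "z \<in> carrier BB"
  shows "rmul a' b' (tmul l z) = tmul l (rmul a' b' z)"
  by (rule B2.T_ext[OF _ _ _ z, where G = BBk])
     (simp_all add: lin_comp[OF lin_rmul lin_tmul] lin_comp[OF lin_tmul lin_rmul] tmul_tens rmul_tens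
       alg_closed(5)[where K = K])

end

section \<open>The twisting cocycle\<close>

context dynamical_data
begin

definition Psi where
  "Psi = sw3 K U U L E.BBk F (\<lambda>f1 f2 f3. sw K H H E.BBk R (\<lambda>r r'.
     tens E.BB (bb f1 f3 r) (bb (f2 \<otimes>\<^bsub>U\<^esub> r') \<one>\<^bsub>L\<^esub> \<one>\<^bsub>H\<^esub>)))"

lemma Psi_closed: "Psi \<in> carrier E.BBk"
  unfolding Psi_def by simp

lemma Psi_hom:
  assumes [simp]: "module K G" and f: "lin K E.BBk G f"
  shows "f Psi = sw3 K U U L G F (\<lambda>f1 f2 f3. sw K H H G R (\<lambda>r r'.
     f (tens E.BB (bb f1 f3 r) (bb (f2 \<otimes>\<^bsub>U\<^esub> r') \<one>\<^bsub>L\<^esub> \<one>\<^bsub>H\<^esub>))))"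
  unfolding Psi_def
  by (simp add: sw3_hom[where f = f and G = E.BBk and G' = G] ktensor_sw_hom[where f = f and G = E.BBk and G' = G] f
      cong: sw3_cong ktensor_sw_cong)

text \<open>\<open>mulPsi x\<close> is \<open>x \<Psi>\<close> for \<open>x\<close> in the Takeuchi product, but is linear on all of \<open>B \<otimes>\<^sub>L B\<close>.\<close>

definition mulPsi where
  "mulPsi x = sw3 K U U L E.BBk F (\<lambda>g1 g2 g3. sw K H H E.BBk R (\<lambda>s s'.
     E.rmul (bb g1 g3 s) (bb (g2 \<otimes>\<^bsub>U\<^esub> s') \<one>\<^bsub>L\<^esub> \<one>\<^bsub>H\<^esub>) x))"

lemma mult_Psi: "E.takeuchi x \<Longrightarrow> x \<otimes>\<^bsub>E.BB\<^esub> Psi = mulPsi x"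
  unfolding mulPsi_def
  by (subst Psi_hom[where f = "\<lambda>y. x \<otimes>\<^bsub>E.BB\<^esub> y" and G = E.BBk])
     (simp_all add: E.lin_mult_BB E.mult_BB_tens cong: sw3_cong ktensor_sw_cong)

lemma lin_mulPsi: "lin K E.BBk E.BBk mulPsi"
  unfolding mulPsi_def[abs_def] by (simp add: E.lin_rmul)

lemma rmul_closed [simp]:
  "a \<in> carrier BA \<Longrightarrow> b \<in> carrier BA \<Longrightarrow> z \<in> carrier E.BBk \<Longrightarrow> E.rmul a b z \<in> carrier E.BBk"
  by (rule linD(1)[OF E.lin_rmul])

text \<open>Every term of \<open>mulPsi\<close> is a right multiplication, while the base acts by
  left multiplication through \<open>s\<close>; the Takeuchi condition does not enter.\<close>

lemma mulPsi_smult: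
  assumes [simp]: "l \<in> carrier L" and z: "z \<in> carrier E.BBk"
  shows "mulPsi (l \<odot>\<^bsub>E.BB\<^esub> z) = l \<odot>\<^bsub>E.BB\<^esub> mulPsi z"
proof -
  have z': "z \<in> carrier E.BB" using z by (simp add: E.B2.Tk_simps)
  show ?thesis unfolding mulPsi_def
    by (simp add: sw3_hom[where f = "\<lambda>z. l \<odot>\<^bsub>E.BB\<^esub> z" and G = E.BBk and G' = E.BBk]
        ktensor_sw_hom[where f = "\<lambda>z. l \<odot>\<^bsub>E.BB\<^esub> z" and G = E.BBk and G' = E.BBk] E.B2.lin_smult_T E.rmul_smult z z'
      cong: sw3_cong ktensor_sw_cong)
qed

lemma mulPsi_tmul:
  assumes [simp]: "l \<in> carrier L" and z: "z \<in> carrier E.BBk"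
  shows "mulPsi (E.tmul l z) = E.tmul l (mulPsi z)"
proof -
  have z': "z \<in> carrier E.BB" using z by (simp add: E.B2.Tk_simps)
  show ?thesis unfolding mulPsi_def
    by (simp add: sw3_hom[where f = "E.tmul l" and G = E.BBk and G' = E.BBk]
        ktensor_sw_hom[where f = "E.tmul l" and G = E.BBk and G' = E.BBk] E.lin_tmul E.rmul_tmul z z'
      cong: sw3_cong ktensor_sw_cong)
qed

lemma Delta_closed' [simp]: "b \<in> carrier BA \<Longrightarrow> Delta b \<in> carrier E.BBk"
  by (rule linD(1)[OF lin_Delta])

lemma mulPsi_closed [simp]: "z \<in> carrier E.BBk \<Longrightarrow> mulPsi z \<in> carrier E.BBk"
  by (rule linD(1)[OF lin_mulPsi])

text \<open>Well-definedness of the left-hand side of the cocycle equation: t(l) on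
  \<open>p1\<close> appears on the second leg of its coproduct, survives multiplication by \<Psi>
  from the right, and is handed to \<open>p2\<close> by the reassociation.\<close>

lemma lbal_left: "E.B2.lbal E.BBBk (\<lambda>p1 p2. E.reassoc p2 (mulPsi (Delta p1)))"
proof -
  have "E.reassoc p2 (mulPsi (Delta (tB l \<otimes>\<^bsub>BA\<^esub> p1))) = E.reassoc (sB l \<otimes>\<^bsub>BA\<^esub> p2) (mulPsi (Delta p1))"
    if [simp]: "l \<in> carrier L" "p1 \<in> carrier BA" "p2 \<in> carrier BA" for l p1 p2
    using mulPsi_closed[of "Delta p1"] by (simp add: Delta_tB mulPsi_tmul E.reassoc_tmul E.B2.Tk_simps[symmetric] del: mulPsi_closed)
  moreover have "bilin K BA BA E.BBBk (\<lambda>p1 p2. E.reassoc p2 (mulPsi (Delta p1)))"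
    by (intro bilinI bilin_comp_l[OF E.bilin_reassoc lin_ident] bilin_comp_r[OF E.bilin_reassoc lin_comp[OF lin_mulPsi lin_Delta]])
       simp_all
  ultimately show ?thesis unfolding E.B2.lbal_def E.lm_simps by blast
qed

lemma lbal_right: "E.B2.lbal E.BBBk (\<lambda>p1 p2. tens E.BBB p1 (mulPsi (Delta p2)))"
proof -
  have "tens E.BBB (tB l \<otimes>\<^bsub>BA\<^esub> p1) (mulPsi (Delta p2)) = tens E.BBB p1 (mulPsi (Delta (sB l \<otimes>\<^bsub>BA\<^esub> p2)))"
    if [simp]: "l \<in> carrier L" "p1 \<in> carrier BA" "p2 \<in> carrier BA" for l p1 p2
    by (simp add: Delta_sB mulPsi_smult E.B3.T_balance)
  moreover have "bilin K BA BA E.BBBk (\<lambda>p1 p2. tens E.BBB p1 (mulPsi (Delta p2)))"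
    by (intro bilinI) (simp_all add: lin_comp[OF lin_mulPsi lin_Delta])
  ultimately show ?thesis unfolding E.B2.lbal_def E.lm_simps by blast
qed

definition W3 where
  "W3 x y z l p q = tens E.BBB (bb x l p) (tens E.BB (bb y \<one>\<^bsub>L\<^esub> q) (bb z \<one>\<^bsub>L\<^esub> \<one>\<^bsub>H\<^esub>))"

lemma hexlin_W3: "hexlin K U L H E.BBBk W3"
  unfolding hexlin_def W3_def by simp

lemma mulPsi_tens:
  assumes [simp]: "a \<in> carrier BA" "b \<in> carrier BA" and [simp]: "module K G" and f: "lin K E.BBk G f"
  shows "f (mulPsi (tens E.BB a b)) = sw3 K U U L G F (\<lambda>g1 g2 g3. sw K H H G R (\<lambda>s s'.
     f (tens E.BB (a \<otimes>\<^bsub>BA\<^esub> bb g1 g3 s) (b \<otimes>\<^bsub>BA\<^esub> bb (g2 \<otimes>\<^bsub>U\<^esub> s') \<one>\<^bsub>L\<^esub> \<one>\<^bsub>H\<^esub>))))"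
  unfolding mulPsi_def
  by (simp add: sw3_hom[where f = f and G = E.BBk and G' = G] ktensor_sw_hom[where f = f and G = E.BBk and G' = G] f
      E.rmul_tens cong: sw3_cong ktensor_sw_cong)

text \<open>Of the two products with the inner \<Psi>, the one in the second factor involves only
  trivial \<open>L\<close>-components. The smash product therefore splits just \<open>h1\<close>,
  the part of \<open>r\<close> in the first factor.\<close>

lemma cocycle_left_term:
  assumes [simp]: "f1 \<in> carrier U" "f2 \<in> carrier U" "f3 \<in> carrier L" "r \<in> carrier H" "r' \<in> carrier H"
  shows "E.reassoc (bb (f2 \<otimes>\<^bsub>U\<^esub> r') \<one>\<^bsub>L\<^esub> \<one>\<^bsub>H\<^esub>) (mulPsi (Delta (bb f1 f3 r))) =
    sw K U U E.BBBk (comult U f1) (\<lambda>u1 u2. sw K H H E.BBBk (comult H r) (\<lambda>h1 h2.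
     sw3 K U U L E.BBBk F (\<lambda>g1 g2 g3. sw K H H E.BBBk R (\<lambda>s s'. sw K H H E.BBBk (comult H h1) (\<lambda>k1 k2.
       W3 (u1 \<otimes>\<^bsub>U\<^esub> g1) (u2 \<otimes>\<^bsub>U\<^esub> (g2 \<otimes>\<^bsub>U\<^esub> s')) (f2 \<otimes>\<^bsub>U\<^esub> r') (f3 \<otimes>\<^bsub>L\<^esub> act k1 g3) (k2 \<otimes>\<^bsub>H\<^esub> s) h2)))))"
proof -
  let ?c = "bb (f2 \<otimes>\<^bsub>U\<^esub> r') \<one>\<^bsub>L\<^esub> \<one>\<^bsub>H\<^esub>"
  have re: "lin K E.BBk E.BBBk (E.reassoc ?c)" by (rule E.lin_reassoc) simp
  have "E.reassoc ?c (mulPsi (Delta (bb f1 f3 r))) = sw K U U E.BBBk (comult U f1) (\<lambda>u1 u2. sw K H H E.BBBk (comult H r) (\<lambda>h1 h2.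
     E.reassoc ?c (mulPsi (tens E.BB (bb u1 f3 h1) (bb u2 \<one>\<^bsub>L\<^esub> h2)))))"
    by (rule Delta_bb_hom[where f = "\<lambda>x. E.reassoc ?c (mulPsi x)"]) (simp_all add: lin_comp[OF re lin_mulPsi])
  also have "\<dots> = sw K U U E.BBBk (comult U f1) (\<lambda>u1 u2. sw K H H E.BBBk (comult H r) (\<lambda>h1 h2.
     sw3 K U U L E.BBBk F (\<lambda>g1 g2 g3. sw K H H E.BBBk R (\<lambda>s s'. sw K H H E.BBBk (comult H h1) (\<lambda>k1 k2.
       W3 (u1 \<otimes>\<^bsub>U\<^esub> g1) (u2 \<otimes>\<^bsub>U\<^esub> (g2 \<otimes>\<^bsub>U\<^esub> s')) (f2 \<otimes>\<^bsub>U\<^esub> r') (f3 \<otimes>\<^bsub>L\<^esub> act k1 g3) (k2 \<otimes>\<^bsub>H\<^esub> s) h2)))))"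
  proof (intro ktensor_sw_cong)
    fix u1 u2 h1 h2 assume [simp]: "u1 \<in> carrier U" "u2 \<in> carrier U" "h1 \<in> carrier H" "h2 \<in> carrier H"
    have "E.reassoc ?c (mulPsi (tens E.BB (bb u1 f3 h1) (bb u2 \<one>\<^bsub>L\<^esub> h2))) =
      sw3 K U U L E.BBBk F (\<lambda>g1 g2 g3. sw K H H E.BBBk R (\<lambda>s s'.
        E.reassoc ?c (tens E.BB (bb u1 f3 h1 \<otimes>\<^bsub>BA\<^esub> bb g1 g3 s) (bb u2 \<one>\<^bsub>L\<^esub> h2 \<otimes>\<^bsub>BA\<^esub> bb (g2 \<otimes>\<^bsub>U\<^esub> s') \<one>\<^bsub>L\<^esub> \<one>\<^bsub>H\<^esub>))))"
      by (rule mulPsi_tens[where f = "E.reassoc ?c"]) (simp_all add: re)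
    also have "\<dots> = sw3 K U U L E.BBBk F (\<lambda>g1 g2 g3. sw K H H E.BBBk R (\<lambda>s s'. sw K H H E.BBBk (comult H h1) (\<lambda>k1 k2.
       W3 (u1 \<otimes>\<^bsub>U\<^esub> g1) (u2 \<otimes>\<^bsub>U\<^esub> (g2 \<otimes>\<^bsub>U\<^esub> s')) (f2 \<otimes>\<^bsub>U\<^esub> r') (f3 \<otimes>\<^bsub>L\<^esub> act k1 g3) (k2 \<otimes>\<^bsub>H\<^esub> s) h2)))"
    proof (rule sw3_cong[OF Uh.mod Uh.mod modL E.B3.mod_Tk], rule ktensor_sw_cong[OF mod mod])
      fix g1 g2 g3 s s' assume [simp]: "g1 \<in> carrier U" "g2 \<in> carrier U" "g3 \<in> carrier L" "s \<in> carrier H" "s' \<in> carrier H"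
      have "E.reassoc ?c (tens E.BB (bb u1 f3 h1 \<otimes>\<^bsub>BA\<^esub> bb g1 g3 s) (bb u2 \<one>\<^bsub>L\<^esub> h2 \<otimes>\<^bsub>BA\<^esub> bb (g2 \<otimes>\<^bsub>U\<^esub> s') \<one>\<^bsub>L\<^esub> \<one>\<^bsub>H\<^esub>)) =
        tens E.BBB (bb u1 f3 h1 \<otimes>\<^bsub>BA\<^esub> bb g1 g3 s) (tens E.BB (bb (u2 \<otimes>\<^bsub>U\<^esub> (g2 \<otimes>\<^bsub>U\<^esub> s')) \<one>\<^bsub>L\<^esub> h2) ?c)"
        by (simp add: E.reassoc_tens bb_mult_one)
      also have "\<dots> = sw K H H E.BBBk (comult H h1) (\<lambda>k1 k2.
         W3 (u1 \<otimes>\<^bsub>U\<^esub> g1) (u2 \<otimes>\<^bsub>U\<^esub> (g2 \<otimes>\<^bsub>U\<^esub> s')) (f2 \<otimes>\<^bsub>U\<^esub> r') (f3 \<otimes>\<^bsub>L\<^esub> act k1 g3) (k2 \<otimes>\<^bsub>H\<^esub> s) h2)"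
        unfolding bb_mult[OF \<open>u1 \<in> carrier U\<close> assms(3) \<open>h1 \<in> carrier H\<close> \<open>g1 \<in> carrier U\<close> \<open>g3 \<in> carrier L\<close> \<open>s \<in> carrier H\<close>] W3_def
        by (rule ktensor_sw_hom[where f = "\<lambda>z. tens E.BBB z (tens E.BB (bb (u2 \<otimes>\<^bsub>U\<^esub> (g2 \<otimes>\<^bsub>U\<^esub> s')) \<one>\<^bsub>L\<^esub> h2) ?c)" and G = BA and G' = E.BBBk]) simp_all
      finally show "E.reassoc ?c (tens E.BB (bb u1 f3 h1 \<otimes>\<^bsub>BA\<^esub> bb g1 g3 s) (bb u2 \<one>\<^bsub>L\<^esub> h2 \<otimes>\<^bsub>BA\<^esub> bb (g2 \<otimes>\<^bsub>U\<^esub> s') \<one>\<^bsub>L\<^esub> \<one>\<^bsub>H\<^esub>)) =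
        sw K H H E.BBBk (comult H h1) (\<lambda>k1 k2.
         W3 (u1 \<otimes>\<^bsub>U\<^esub> g1) (u2 \<otimes>\<^bsub>U\<^esub> (g2 \<otimes>\<^bsub>U\<^esub> s')) (f2 \<otimes>\<^bsub>U\<^esub> r') (f3 \<otimes>\<^bsub>L\<^esub> act k1 g3) (k2 \<otimes>\<^bsub>H\<^esub> s) h2)" .
    qed
    finally show "E.reassoc ?c (mulPsi (tens E.BB (bb u1 f3 h1) (bb u2 \<one>\<^bsub>L\<^esub> h2))) =
      sw3 K U U L E.BBBk F (\<lambda>g1 g2 g3. sw K H H E.BBBk R (\<lambda>s s'. sw K H H E.BBBk (comult H h1) (\<lambda>k1 k2.
       W3 (u1 \<otimes>\<^bsub>U\<^esub> g1) (u2 \<otimes>\<^bsub>U\<^esub> (g2 \<otimes>\<^bsub>U\<^esub> s')) (f2 \<otimes>\<^bsub>U\<^esub> r') (f3 \<otimes>\<^bsub>L\<^esub> act k1 g3) (k2 \<otimes>\<^bsub>H\<^esub> s) h2)))" .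
  qed simp_all
  finally show ?thesis .
qed

lemma bb_unit_mult:
  assumes [simp]: "v \<in> carrier U" "u \<in> carrier U" "l \<in> carrier L" "h \<in> carrier H"
  shows "bb v \<one>\<^bsub>L\<^esub> \<one>\<^bsub>H\<^esub> \<otimes>\<^bsub>BA\<^esub> bb u l h = bb (v \<otimes>\<^bsub>U\<^esub> u) l h"
proof -
  have "bb v \<one>\<^bsub>L\<^esub> \<one>\<^bsub>H\<^esub> \<otimes>\<^bsub>BA\<^esub> bb u l h = bb (v \<otimes>\<^bsub>U\<^esub> u) (\<one>\<^bsub>L\<^esub> \<otimes>\<^bsub>L\<^esub> act \<one>\<^bsub>H\<^esub> l) (\<one>\<^bsub>H\<^esub> \<otimes>\<^bsub>H\<^esub> h)"
    unfolding bb_mult[OF assms(1) alg_closed(2)[OF algL] alg_closed(2)[OF alg] assms(2-4)]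
    by (rule comult_one) simp_all
  then show ?thesis by (simp add: act_one)
qed

text \<open>The \<open>L\<close>-component of the middle factor is first read as a left scalar on
  the pair of the last two factors; as such it can be balanced against the first factor, where it
  acts through the target map.\<close>

lemma BBB_shift:
  assumes [simp]: "f1 \<in> carrier U" "f3 \<in> carrier L" "r \<in> carrier H" "y \<in> carrier U" "z \<in> carrier U" "l \<in> carrier L" "s \<in> carrier H"
  shows "tens E.BBB (bb f1 f3 r) (tens E.BB (bb y l s) (bb z \<one>\<^bsub>L\<^esub> \<one>\<^bsub>H\<^esub>)) =
    sw K H H E.BBBk R (\<lambda>p p'. W3 f1 y z (f3 \<otimes>\<^bsub>L\<^esub> act p' l) (p \<otimes>\<^bsub>H\<^esub> r) s)"
proof -
  let ?w = "tens E.BB (bb y \<one>\<^bsub>L\<^esub> s) (bb z \<one>\<^bsub>L\<^esub> \<one>\<^bsub>H\<^esub>)"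
  have "tens E.BB (bb y l s) (bb z \<one>\<^bsub>L\<^esub> \<one>\<^bsub>H\<^esub>) = l \<odot>\<^bsub>E.BB\<^esub> ?w"
    by (simp add: E.B2.smult_T_tens sB_mult_bb)
  then have "tens E.BBB (bb f1 f3 r) (tens E.BB (bb y l s) (bb z \<one>\<^bsub>L\<^esub> \<one>\<^bsub>H\<^esub>)) = tens E.BBB (tB l \<otimes>\<^bsub>BA\<^esub> bb f1 f3 r) ?w"
    by (simp add: E.B3.T_balance)
  also have "\<dots> = sw K H H E.BBBk R (\<lambda>p p'. W3 f1 y z (f3 \<otimes>\<^bsub>L\<^esub> act p' l) (p \<otimes>\<^bsub>H\<^esub> r) s)"
    unfolding tB_mult_bb[OF assms(6,1-3)] W3_def
    by (rule ktensor_sw_hom[where f = "\<lambda>x. tens E.BBB x ?w" and G = BA and G' = E.BBBk]) simp_all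
  finally show ?thesis .
qed

text \<open>The second factor of \<Psi> has trivial components in \<open>L\<close> and
  \<open>H\<close>, so its coproduct splits only \<open>v\<close>; the smash legs on this side come
  from the inner \<Psi> and from the shift across the base.\<close>

lemma cocycle_right_term:
  assumes [simp]: "f1 \<in> carrier U" "v \<in> carrier U" "f3 \<in> carrier L" "r \<in> carrier H"
  shows "tens E.BBB (bb f1 f3 r) (mulPsi (Delta (bb v \<one>\<^bsub>L\<^esub> \<one>\<^bsub>H\<^esub>))) =
    sw K U U E.BBBk (comult U v) (\<lambda>v1 v2. sw3 K U U L E.BBBk F (\<lambda>g1 g2 g3. sw K H H E.BBBk R (\<lambda>s s'. sw K H H E.BBBk R (\<lambda>p p'.
       W3 f1 (v1 \<otimes>\<^bsub>U\<^esub> g1) (v2 \<otimes>\<^bsub>U\<^esub> (g2 \<otimes>\<^bsub>U\<^esub> s')) (f3 \<otimes>\<^bsub>L\<^esub> act p' g3) (p \<otimes>\<^bsub>H\<^esub> r) s))))"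
proof -
  let ?f = "\<lambda>z. tens E.BBB (bb f1 f3 r) z"
  have f: "lin K E.BBk E.BBBk ?f" by simp
  have "?f (mulPsi (Delta (bb v \<one>\<^bsub>L\<^esub> \<one>\<^bsub>H\<^esub>))) = sw K U U E.BBBk (comult U v) (\<lambda>v1 v2. sw K H H E.BBBk (comult H \<one>\<^bsub>H\<^esub>) (\<lambda>h1 h2.
     ?f (mulPsi (tens E.BB (bb v1 \<one>\<^bsub>L\<^esub> h1) (bb v2 \<one>\<^bsub>L\<^esub> h2)))))"
    by (rule Delta_bb_hom[where f = "\<lambda>x. ?f (mulPsi x)"]) (simp_all add: lin_comp[OF f lin_mulPsi])
  also have "\<dots> = sw K U U E.BBBk (comult U v) (\<lambda>v1 v2. ?f (mulPsi (tens E.BB (bb v1 \<one>\<^bsub>L\<^esub> \<one>\<^bsub>H\<^esub>) (bb v2 \<one>\<^bsub>L\<^esub> \<one>\<^bsub>H\<^esub>))))"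
    by (rule ktensor_sw_cong[OF Uh.mod Uh.mod], rule comult_one) (simp_all add: lin_comp[OF lin_mulPsi])
  also have "\<dots> = sw K U U E.BBBk (comult U v) (\<lambda>v1 v2. sw3 K U U L E.BBBk F (\<lambda>g1 g2 g3. sw K H H E.BBBk R (\<lambda>s s'. sw K H H E.BBBk R (\<lambda>p p'.
       W3 f1 (v1 \<otimes>\<^bsub>U\<^esub> g1) (v2 \<otimes>\<^bsub>U\<^esub> (g2 \<otimes>\<^bsub>U\<^esub> s')) (f3 \<otimes>\<^bsub>L\<^esub> act p' g3) (p \<otimes>\<^bsub>H\<^esub> r) s))))"
    by (rule ktensor_sw_cong)
       (simp_all add: mulPsi_tens[where f = ?f and G = E.BBBk] bb_unit_mult BBB_shift cong: sw3_cong ktensor_sw_cong)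
  finally show ?thesis .
qed

theorem Psi_cocycle:
  "tlift E.BBBk Psi (\<lambda>p1 p2. E.reassoc p2 (mulPsi (Delta p1))) = tlift E.BBBk Psi (\<lambda>p1 p2. tens E.BBB p1 (mulPsi (Delta p2)))"
proof -
  note l1 = E.B2.lin_tlift_T[OF E.B3.mod_Tk lbal_left] and l2 = E.B2.lin_tlift_T[OF E.B3.mod_Tk lbal_right]
  note t1 = E.B2.tlift_T_tens[OF E.B3.mod_Tk lbal_left] and t2 = E.B2.tlift_T_tens[OF E.B3.mod_Tk lbal_right]
  have "tlift E.BBBk Psi (\<lambda>p1 p2. E.reassoc p2 (mulPsi (Delta p1))) =
    sw3 K U U L E.BBBk F (\<lambda>f1 f2 f3. sw K H H E.BBBk R (\<lambda>r r'. E.reassoc (bb (f2 \<otimes>\<^bsub>U\<^esub> r') \<one>\<^bsub>L\<^esub> \<one>\<^bsub>H\<^esub>) (mulPsi (Delta (bb f1 f3 r)))))"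
    unfolding Psi_hom[where f = "\<lambda>z. tlift E.BBBk z (\<lambda>p1 p2. E.reassoc p2 (mulPsi (Delta p1)))", OF E.B3.mod_Tk l1]
    by (intro sw3_cong ktensor_sw_cong t1) simp_all
  also have "\<dots> = sw3 K U U L E.BBBk F (\<lambda>f1 f2 f3. sw K H H E.BBBk R (\<lambda>r r'. tens E.BBB (bb f1 f3 r) (mulPsi (Delta (bb (f2 \<otimes>\<^bsub>U\<^esub> r') \<one>\<^bsub>L\<^esub> \<one>\<^bsub>H\<^esub>)))))"
    using twist_identity[OF E.B3.mod_Tk hexlin_W3]
    by (simp add: cocycle_left_term cocycle_right_term cong: sw3_cong ktensor_sw_cong)
  also have "\<dots> = tlift E.BBBk Psi (\<lambda>p1 p2. tens E.BBB p1 (mulPsi (Delta p2)))"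
    unfolding Psi_hom[where f = "\<lambda>z. tlift E.BBBk z (\<lambda>p1 p2. tens E.BBB p1 (mulPsi (Delta p2)))", OF E.B3.mod_Tk l2]
    by (intro sw3_cong ktensor_sw_cong t2[symmetric]) simp_all
  finally show ?thesis .
qed

lemma Psi_counit_left: "tlift BA Psi (\<lambda>p1 p2. sB (eps p1) \<otimes>\<^bsub>BA\<^esub> p2) = \<one>\<^bsub>BA\<^esub>"
proof -
  have BA: "module K BA" by simp
  note l = E.B2.lin_tlift_T[OF BA lbal_counit_left] and t = E.B2.tlift_T_tens[OF BA lbal_counit_left]
  have "tlift BA Psi (\<lambda>p1 p2. sB (eps p1) \<otimes>\<^bsub>BA\<^esub> p2) =
    sw3 K U U L BA F (\<lambda>f1 f2 f3. sw K H H BA R (\<lambda>r r'. sB (eps (bb f1 f3 r)) \<otimes>\<^bsub>BA\<^esub> bb (f2 \<otimes>\<^bsub>U\<^esub> r') \<one>\<^bsub>L\<^esub> \<one>\<^bsub>H\<^esub>))"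
    unfolding Psi_hom[where f = "\<lambda>z. tlift BA z (\<lambda>p1 p2. sB (eps p1) \<otimes>\<^bsub>BA\<^esub> p2)", OF BA l]
    by (intro sw3_cong ktensor_sw_cong t) simp_all
  also have "\<dots> = sw3 K U U L BA F (\<lambda>f1 f2 f3. sw K H H BA R (\<lambda>r r'. counit H r \<odot>\<^bsub>BA\<^esub> (counit U f1 \<odot>\<^bsub>BA\<^esub> bb (f2 \<otimes>\<^bsub>U\<^esub> r') f3 \<one>\<^bsub>H\<^esub>)))"
    by (simp add: sB_mult_bb eps_bb smult_bb smult_comm[of L "counit U c" "counit H c'" for c c'] cong: sw3_cong ktensor_sw_cong)
  also have "\<dots> = sw3 K U U L BA F (\<lambda>f1 f2 f3. counit U f1 \<odot>\<^bsub>BA\<^esub> bb (f2 \<otimes>\<^bsub>U\<^esub> \<one>\<^bsub>H\<^esub>) f3 \<one>\<^bsub>H\<^esub>)"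
    by (intro sw3_cong counit_R_left[where \<phi> = "\<lambda>r'. counit U f1 \<odot>\<^bsub>BA\<^esub> bb (f2 \<otimes>\<^bsub>U\<^esub> r') f3 \<one>\<^bsub>H\<^esub>" for f1 f2 f3]) simp_all
  also have "\<dots> = bb (\<one>\<^bsub>U\<^esub> \<otimes>\<^bsub>U\<^esub> \<one>\<^bsub>H\<^esub>) \<one>\<^bsub>L\<^esub> \<one>\<^bsub>H\<^esub>"
    by (rule F_counit_left[where \<phi> = "\<lambda>f2 f3. bb (f2 \<otimes>\<^bsub>U\<^esub> \<one>\<^bsub>H\<^esub>) f3 \<one>\<^bsub>H\<^esub>"]) simp_all
  finally show ?thesis by (simp add: one_H_U BA_one)
qed

lemma Psi_counit_right: "tlift BA Psi (\<lambda>p1 p2. tB (eps p2) \<otimes>\<^bsub>BA\<^esub> p1) = \<one>\<^bsub>BA\<^esub>"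
proof -
  have BA: "module K BA" by simp
  interpret L: module K L by simp
  note l = E.B2.lin_tlift_T[OF BA lbal_counit_right] and t = E.B2.tlift_T_tens[OF BA lbal_counit_right]
  have "tlift BA Psi (\<lambda>p1 p2. tB (eps p2) \<otimes>\<^bsub>BA\<^esub> p1) =
    sw3 K U U L BA F (\<lambda>f1 f2 f3. sw K H H BA R (\<lambda>r r'. tB (eps (bb (f2 \<otimes>\<^bsub>U\<^esub> r') \<one>\<^bsub>L\<^esub> \<one>\<^bsub>H\<^esub>)) \<otimes>\<^bsub>BA\<^esub> bb f1 f3 r))"
    unfolding Psi_hom[where f = "\<lambda>z. tlift BA z (\<lambda>p1 p2. tB (eps p2) \<otimes>\<^bsub>BA\<^esub> p1)", OF BA l]
    by (intro sw3_cong ktensor_sw_cong t) simp_all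
  also have "\<dots> = sw3 K U U L BA F (\<lambda>f1 f2 f3. sw K H H BA R (\<lambda>r r'. counit H r' \<odot>\<^bsub>BA\<^esub> bb f1 (counit U f2 \<odot>\<^bsub>L\<^esub> f3) r))"
  proof -
    \<comment> \<open>The counit of an element with trivial \<open>L\<close>-component is a scalar
      multiple of the unit, on which the target map is the scalar itself; so no further copy of
      \<open>R\<close> arises.\<close>
    have "tB (eps (bb (f2 \<otimes>\<^bsub>U\<^esub> r') \<one>\<^bsub>L\<^esub> \<one>\<^bsub>H\<^esub>)) \<otimes>\<^bsub>BA\<^esub> bb f1 f3 r = counit H r' \<odot>\<^bsub>BA\<^esub> bb f1 (counit U f2 \<odot>\<^bsub>L\<^esub> f3) r"
      if [simp]: "f1 \<in> carrier U" "f2 \<in> carrier U" "f3 \<in> carrier L" "r \<in> carrier H" "r' \<in> carrier H" for f1 f2 f3 r r'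
      by (simp add: eps_bb Uh.counit_mult counit_H_U counit_one L.smult_assoc1 linD(3)[OF lin_tB] tB_one alg_smult[where K = K]
          smult_bb smult_comm[of L "counit U f2" "counit H r'"])
    then show ?thesis by (simp cong: sw3_cong ktensor_sw_cong)
  qed
  also have "\<dots> = sw3 K U U L BA F (\<lambda>f1 f2 f3. bb f1 (counit U f2 \<odot>\<^bsub>L\<^esub> f3) \<one>\<^bsub>H\<^esub>)"
    by (intro sw3_cong counit_R_right[where \<phi> = "\<lambda>r. bb f1 (counit U f2 \<odot>\<^bsub>L\<^esub> f3) r" for f1 f2 f3]) simp_all
  also have "\<dots> = bb \<one>\<^bsub>U\<^esub> \<one>\<^bsub>L\<^esub> \<one>\<^bsub>H\<^esub>"
    by (rule F_counit_right[where \<phi> = "\<lambda>f1 m. bb f1 m \<one>\<^bsub>H\<^esub>"]) simp_all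
  finally show ?thesis by (simp add: BA_one)
qed

end

section \<open>Transfer to the bialgebroid record\<close>

context dynamical_data
begin

definition Bg where "Bg = tensor_smash_bialgebroid K H R U act L"

lemmas Bg_unfold = Bg_def tensor_smash_bialgebroid_def Let_def module.extend_def LH_def[symmetric]

lemma Bg_ops: "carrier Bg = carrier BA" "monoid.mult Bg = monoid.mult BA" "\<one>\<^bsub>Bg\<^esub> = \<one>\<^bsub>BA\<^esub>"
  "\<zero>\<^bsub>Bg\<^esub> = \<zero>\<^bsub>BA\<^esub>" "add Bg = add BA" "smult Bg = smult BA"
  by (simp_all add: Bg_unfold)

lemma src_Bg: "src Bg = sB"
  by (rule ext) (simp add: Bg_unfold sB_def bb_def)

lemma tgt_Bg: "l \<in> carrier L \<Longrightarrow> tgt Bg l = tB l"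
  by (simp add: Bg_unfold tB_def bb_def tlift_R)

lemma left_mod_Bg: "left_mod Bg = E.lm"
  by (simp add: left_mod_def E.lm_def Bg_ops src_Bg)

lemma ltensor_Bg: "ltensor L Bg M = tensor_product (carrier L) (\<lambda>a l. tB l \<otimes>\<^bsub>BA\<^esub> a) E.lm M"
  unfolding ltensor_def left_mod_Bg by (rule tensor_product_action_cong) (simp add: tgt_Bg Bg_ops)

lemma ltensor2_Bg: "ltensor2 L Bg = E.BB" and ltensor3_Bg: "ltensor L Bg E.BB = E.BBB"
  by (simp_all only: ltensor_Bg left_mod_Bg)

lemma tlift_BB: "tlift E.BB = tlift E.BBk"
  by (rule tlift_same) (simp_all add: E.B2.Tk_simps)

lemma tlift_BBB: "tlift E.BBB = tlift E.BBBk"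
  by (rule tlift_same) (simp_all add: E.B3.Tk_simps)

lemma tlift_Bg: "tlift Bg = tlift BA"
  by (rule tlift_same) (simp_all add: Bg_ops)

lemma tens_Bg: "tens Bg = tens BA"
  by (rule tens_same) (simp add: Bg_ops)

lemma bcomult_Bg:
  assumes b: "b \<in> carrier BA"
  shows "bcomult Bg b = Delta b"
proof -
  \<comment> \<open>The record takes its tensor square from a preliminary version with undefined
    comultiplication and counit. Only the algebra, the source and the target enter that
    construction, so it is also the tensor square of the finished record.\<close>
  have "bcomult Bg b = tlift (ltensor2 L Bg) b (\<lambda>u x. tlift (ltensor2 L Bg) x (\<lambda>l h.
      tlift (ltensor2 L Bg) (comult U u) (\<lambda>u1 u2. tlift (ltensor2 L Bg) (comult H h) (\<lambda>h1 h2.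
        tens (ltensor2 L Bg) (tens BA u1 (tens LH l h1)) (tens BA u2 (tens LH \<one>\<^bsub>L\<^esub> h2))))))"
    by (simp add: Bg_unfold ltensor_def left_mod_def)
  also have "\<dots> = tlift E.BBk b (\<lambda>u x. tlift E.BBk x (\<lambda>l h.
      tlift E.BBk (comult U u) (\<lambda>u1 u2. tlift E.BBk (comult H h) (\<lambda>h1 h2.
        tens E.BB (bb u1 l h1) (bb u2 \<one>\<^bsub>L\<^esub> h2)))))"
    unfolding ltensor2_Bg tlift_BB bb_def ..
  also have "\<dots> = Delta b"
    unfolding Delta_def
  proof (rule tlift_bsw[OF _ trilin_Delta b])
    fix u l h assume [simp]: "u \<in> carrier U" "l \<in> carrier L" "h \<in> carrier H"
    show "tlift E.BBk (comult U u) (\<lambda>u1 u2. tlift E.BBk (comult H h) (\<lambda>h1 h2. tens E.BB (bb u1 l h1) (bb u2 \<one>\<^bsub>L\<^esub> h2))) =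
      sw K U U E.BBk (comult U u) (\<lambda>u1 u2. sw K H H E.BBk (comult H h) (\<lambda>h1 h2. tens E.BB (bb u1 l h1) (bb u2 \<one>\<^bsub>L\<^esub> h2)))"
      by (intro tlift_sw_cong) simp_all
  qed simp
  finally show ?thesis .
qed

lemma bcounit_Bg:
  assumes b: "b \<in> carrier BA"
  shows "bcounit Bg b = eps b"
proof -
  have "bcounit Bg b = tlift L b (\<lambda>u x. tlift L x (\<lambda>l h. counit U u \<odot>\<^bsub>L\<^esub> (counit H h \<odot>\<^bsub>L\<^esub> l)))"
    by (simp add: Bg_unfold)
  also have "\<dots> = eps b"
    unfolding eps_def by (rule tlift_bsw[OF _ trilin_eps b]) simp_all
  finally show ?thesis .
qed

text \<open>The axioms are known for \<open>Delta\<close>, \<open>eps\<close>, \<open>sB\<close> and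
  \<open>tB\<close>. The record's comultiplication, counit and target agree with these on carriers
  only, so sums with such a field in the body are rewritten as balanced sums and not by plain
  substitution.\<close>

lemma bialgebroid_Bg: "bialgebroid K L Bg"
proof -
  interpret L: module K L by simp
  interpret BA: module K BA by simp
  have coassoc: "tlift E.BBB (Delta a) (\<lambda>a1 a2. tlift E.BBB (bcomult Bg a1) (\<lambda>a11 a12. tens E.BBB a11 (tens E.BB a12 a2))) =
      tlift E.BBB (Delta a) (\<lambda>a1 a2. tens E.BBB a1 (bcomult Bg a2))" if a: "a \<in> carrier BA" for a
  proof -
    have "tlift E.BBBk (Delta a) (\<lambda>a1 a2. tlift E.BBBk (bcomult Bg a1) (\<lambda>a11 a12. tens E.BBB a11 (tens E.BB a12 a2))) =
       tlift E.BBBk (Delta a) (\<lambda>a1 a2. E.reassoc a2 (Delta a1))"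
      by (rule E.B2.tlift_T_cong[OF E.B3.mod_Tk lbal_reassoc_Delta Delta_closed[OF a]]) (simp add: bcomult_Bg E.reassoc_def)
    also have "\<dots> = tlift E.BBBk (Delta a) (\<lambda>a1 a2. tens E.BBB a1 (Delta a2))"
      by (rule Delta_coassoc[OF a])
    also have "\<dots> = tlift E.BBBk (Delta a) (\<lambda>a1 a2. tens E.BBB a1 (bcomult Bg a2))"
      by (rule E.B2.tlift_T_cong[OF E.B3.mod_Tk lbal_tens_Delta Delta_closed[OF a], symmetric]) (simp add: bcomult_Bg)
    finally show ?thesis unfolding tlift_BBB .
  qed
  have tak: "tlift E.BB (Delta a) (\<lambda>a1 a2. tens E.BB (a1 \<otimes>\<^bsub>BA\<^esub> tB l) a2) = tlift E.BB (Delta a) (\<lambda>a1 a2. tens E.BB a1 (a2 \<otimes>\<^bsub>BA\<^esub> sB l))"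
    if a: "a \<in> carrier BA" and l [simp]: "l \<in> carrier L" for a l
  proof -
    have "tlift E.BBk (Delta a) (\<lambda>a1 a2. tens E.BB (a1 \<otimes>\<^bsub>BA\<^esub> tB l) a2) = E.rmul (tB l) \<one>\<^bsub>BA\<^esub> (Delta a)"
      unfolding E.rmul_def
      by (rule E.B2.tlift_T_cong[OF E.B2.mod_Tk E.rmul_lbal Delta_closed[OF a]]) simp_all
    also have "\<dots> = E.rmul \<one>\<^bsub>BA\<^esub> (sB l) (Delta a)"
      using takeuchi_Delta[OF a] l by (simp only: E.takeuchi_def)
    also have "\<dots> = tlift E.BBk (Delta a) (\<lambda>a1 a2. tens E.BB a1 (a2 \<otimes>\<^bsub>BA\<^esub> sB l))"
      unfolding E.rmul_def
      by (rule E.B2.tlift_T_cong[OF E.B2.mod_Tk E.rmul_lbal Delta_closed[OF a], symmetric]) simp_all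
    finally show ?thesis unfolding tlift_BB .
  qed
  have counit_l: "tlift BA (Delta a) (\<lambda>a1 a2. sB (bcounit Bg a1) \<otimes>\<^bsub>BA\<^esub> a2) = a" if a: "a \<in> carrier BA" for a
  proof -
    have "tlift BA (Delta a) (\<lambda>a1 a2. sB (bcounit Bg a1) \<otimes>\<^bsub>BA\<^esub> a2) = tlift BA (Delta a) (\<lambda>a1 a2. sB (eps a1) \<otimes>\<^bsub>BA\<^esub> a2)"
      by (rule E.B2.tlift_T_cong[OF _ lbal_counit_left Delta_closed[OF a]]) (simp_all add: bcounit_Bg)
    then show ?thesis using Delta_counit_left[OF a] by (rule trans)
  qed
  have counit_r: "tlift BA (Delta a) (\<lambda>a1 a2. tgt Bg (bcounit Bg a2) \<otimes>\<^bsub>BA\<^esub> a1) = a" if a: "a \<in> carrier BA" for a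
  proof -
    have "tlift BA (Delta a) (\<lambda>a1 a2. tgt Bg (bcounit Bg a2) \<otimes>\<^bsub>BA\<^esub> a1) = tlift BA (Delta a) (\<lambda>a1 a2. tB (eps a2) \<otimes>\<^bsub>BA\<^esub> a1)"
      by (rule E.B2.tlift_T_cong[OF _ lbal_counit_right Delta_closed[OF a]]) (simp_all add: bcounit_Bg tgt_Bg)
    then show ?thesis using Delta_counit_right[OF a] by (rule trans)
  qed
  have s_comult: "tlift E.BB (Delta a) (\<lambda>a1 a2. tens E.BB (sB l \<otimes>\<^bsub>BA\<^esub> a1) a2) = Delta (sB l \<otimes>\<^bsub>BA\<^esub> a)"
    if "l \<in> carrier L" "a \<in> carrier BA" for l a
    using that by (simp add: Delta_sB tensor_product_smult[where c = l] E.lm_simps)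
  have t_comult: "tlift E.BB (Delta a) (\<lambda>a1 a2. tens E.BB a1 (tB l \<otimes>\<^bsub>BA\<^esub> a2)) = Delta (tB l \<otimes>\<^bsub>BA\<^esub> a)"
    if "l \<in> carrier L" "a \<in> carrier BA" for l a
    using that by (simp add: Delta_tB E.tmul_def tlift_BB)
  have add: "Delta (a \<oplus>\<^bsub>BA\<^esub> b) = Delta a \<oplus>\<^bsub>E.BB\<^esub> Delta b" "eps (a \<oplus>\<^bsub>BA\<^esub> b) = eps a \<oplus>\<^bsub>L\<^esub> eps b"
    if "a \<in> carrier BA" "b \<in> carrier BA" for a b
    using linD(2)[OF lin_Delta that] linD(2)[OF lin_eps that] by (simp_all add: E.B2.Tk_simps)
  have alg_Bg: "assoc_algebra K Bg"
    by (rule assoc_algebra_same[of K BA]) (simp_all add: Bg_ops)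
  have s_Bg: "sB \<in> alg_hom K L Bg"
    using E.s_hom by (simp add: alg_hom_def ring_hom_def Bg_ops)
  have t_Bg: "tgt Bg \<in> alg_antihom K L Bg"
    using E.t_anti by (auto simp: alg_antihom_def Bg_ops tgt_Bg)
  show ?thesis
    unfolding bialgebroid_def Let_def ltensor2_Bg ltensor3_Bg src_Bg tlift_Bg Bg_ops
    by (intro conjI ballI funcsetI alg_Bg s_Bg t_Bg algL)
       (simp_all add: bcomult_Bg bcounit_Bg tgt_Bg Delta_closed add s_comult t_comult coassoc tak Delta_one Delta_mult
         sB_closed tB_closed sB_tB_commute eps_sB eps_tB eps_one eps_mult_sB counit_l counit_r)
qed

lemma twisting_cocycle_Psi: "twisting_cocycle K L Bg Psi"
proof -
  have Psi_in: "Psi \<in> carrier E.BB"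
    using Psi_closed by (simp add: E.B2.Tk_simps)
  \<comment> \<open>Here the product of the definition meets its everywhere linear substitute: the
    two agree because the coproduct of \<open>p\<close> lies in the Takeuchi product.\<close>
  have m: "bcomult Bg p \<otimes>\<^bsub>E.BB\<^esub> Psi = mulPsi (Delta p)" if "p \<in> carrier BA" for p
    using that by (simp only: bcomult_Bg mult_Psi takeuchi_Delta)
  have "tlift E.BBBk Psi (\<lambda>p1 p2. tlift E.BBBk (bcomult Bg p1 \<otimes>\<^bsub>E.BB\<^esub> Psi) (\<lambda>q1 q2. tens E.BBB q1 (tens E.BB q2 p2))) =
     tlift E.BBBk Psi (\<lambda>p1 p2. E.reassoc p2 (mulPsi (Delta p1)))"
    by (rule E.B2.tlift_T_cong[OF E.B3.mod_Tk lbal_left Psi_in]) (simp only: m E.reassoc_def)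
  also have "\<dots> = tlift E.BBBk Psi (\<lambda>p1 p2. tens E.BBB p1 (mulPsi (Delta p2)))"
    by (rule Psi_cocycle)
  also have "\<dots> = tlift E.BBBk Psi (\<lambda>p1 p2. tens E.BBB p1 (bcomult Bg p2 \<otimes>\<^bsub>E.BB\<^esub> Psi))"
    by (rule E.B2.tlift_T_cong[OF E.B3.mod_Tk lbal_right Psi_in, symmetric]) (simp only: m)
  finally have coc: "tlift E.BBB Psi (\<lambda>p1 p2. tlift E.BBB (bcomult Bg p1 \<otimes>\<^bsub>E.BB\<^esub> Psi) (\<lambda>q1 q2. tens E.BBB q1 (tens E.BB q2 p2))) =
     tlift E.BBB Psi (\<lambda>p1 p2. tens E.BBB p1 (bcomult Bg p2 \<otimes>\<^bsub>E.BB\<^esub> Psi))"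
    unfolding tlift_BBB .
  have cl: "tlift BA Psi (\<lambda>p1 p2. sB (bcounit Bg p1) \<otimes>\<^bsub>BA\<^esub> p2) = \<one>\<^bsub>BA\<^esub>"
  proof -
    have "tlift BA Psi (\<lambda>p1 p2. sB (bcounit Bg p1) \<otimes>\<^bsub>BA\<^esub> p2) = tlift BA Psi (\<lambda>p1 p2. sB (eps p1) \<otimes>\<^bsub>BA\<^esub> p2)"
      by (rule E.B2.tlift_T_cong[OF _ lbal_counit_left Psi_in]) (simp_all add: bcounit_Bg)
    then show ?thesis using Psi_counit_left by (rule trans)
  qed
  have cr: "tlift BA Psi (\<lambda>p1 p2. tgt Bg (bcounit Bg p2) \<otimes>\<^bsub>BA\<^esub> p1) = \<one>\<^bsub>BA\<^esub>"
  proof -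
    have "tlift BA Psi (\<lambda>p1 p2. tgt Bg (bcounit Bg p2) \<otimes>\<^bsub>BA\<^esub> p1) = tlift BA Psi (\<lambda>p1 p2. tB (eps p2) \<otimes>\<^bsub>BA\<^esub> p1)"
      by (rule E.B2.tlift_T_cong[OF _ lbal_counit_right Psi_in]) (simp_all add: bcounit_Bg tgt_Bg)
    then show ?thesis using Psi_counit_right by (rule trans)
  qed
  show ?thesis
    unfolding twisting_cocycle_def Let_def ltensor2_Bg ltensor3_Bg src_Bg tlift_Bg Bg_ops
    using bialgebroid_Bg Psi_in coc cl cr by blast
qed

lemma Psi_eq: "Psi = tlift E.BB F (\<lambda>f1 g. tlift E.BB g (\<lambda>f2 f3. tlift E.BB R (\<lambda>r1 r2.
                   tens E.BB (tens Bg f1 (tens LH f3 r1))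
                           (tens Bg (f2 \<otimes>\<^bsub>U\<^esub> r2) (tens LH \<one>\<^bsub>L\<^esub> \<one>\<^bsub>H\<^esub>)))))"
proof -
  have "tlift E.BBk F (\<lambda>f1 g. tlift E.BBk g (\<lambda>f2 f3. tlift E.BBk R (\<lambda>r1 r2.
      tens E.BB (bb f1 f3 r1) (bb (f2 \<otimes>\<^bsub>U\<^esub> r2) \<one>\<^bsub>L\<^esub> \<one>\<^bsub>H\<^esub>)))) = Psi"
    unfolding Psi_def sw3_def by (intro tlift_sw_cong Uh.mod modL mod) simp_all
  then show ?thesis unfolding tlift_BB tens_Bg bb_def by (rule sym)
qed

end

theorem proposition6p1:
  fixes K :: "'k ring"
    and H U :: "('k, 'u) hopf"
    and R :: "('u, 'u) tensor"
    and L :: "('k, 'l) module"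
    and act :: "'u \<Rightarrow> 'l \<Rightarrow> 'l"
    and F :: "('u, ('u, 'l) tensor) tensor"
  assumes "base_ring K"
    and "quasitriangular K H R"
    and "hopf_algebra K U"
    and "hopf_subalgebra K H U"
    and "module_algebra K H act L"
    and "H_commutative R act L"
    and "universal_dynamical_cocycle K H U act L (coaction_minus K H R act L) F"
  shows "let LH = smash_product K H act L;
             B = tensor_smash_bialgebroid K H R U act L;
             BB = ltensor2 L B;
             \<Psi> = tlift BB F (\<lambda>f1 g. tlift BB g (\<lambda>f2 f3. tlift BB R (\<lambda>r1 r2.
                   tens BB (tens B f1 (tens LH f3 r1))
                           (tens B (f2 \<otimes>\<^bsub>U\<^esub> r2) (tens LH \<one>\<^bsub>L\<^esub> \<one>\<^bsub>H\<^esub>)))))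
         in twisting_cocycle K L B \<Psi>"
proof -
  have "hopf_algebra K H"
    using assms(2) by (simp add: quasitriangular_def Let_def)
  then interpret dynamical_data K H U R L act F
    by unfold_locales (use assms in simp_all)
  show ?thesis
    using twisting_cocycle_Psi
    unfolding Let_def Psi_eq ltensor2_Bg[symmetric] unfolding Bg_def LH_def .
qed

end
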